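(* Let $\Omega\subset\mathbb{R}^2$ be a convex centered symmetric body, let $\eta>0$, and let $$A^\eta=\{(\eta\theta\cos 2\pi\theta,\eta\theta\sin 2\pi\theta):\theta\geq 0\},\qquad O^\eta=\{(x,y)\in\mathbb{R}^2: x^2+y^2=\eta^2k^2 \text{ for some } k\in\{1,2,3,\dots\}\}.$$ (i) If $\operatorname{diam}(\Omega)\,\eta<1$, then $A^\eta$ and $O^\eta$ are both sampling trajectories for $PW^2(\Omega)$. (ii) If $\operatorname{diam}(\Omega)\,\eta>1$, then neither $A^\eta$ nor $O^\eta$ is a sampling trajectory for $PW^2(\Omega)$.
   Context: A convex body is a convex compact subset of $\mathbb{R}^d$ with non-empty interior; it is centered if $0$ is an interior point, and symmetric if $\Omega=-\Omega$. The Fourier transform is $\hat f(\xi)=\int e^{-2\pi i\xi\cdot x}f(x)\,dx$. $PW^2(\Omega)$ is the space of Fourier transforms $\hat f$ of functions $f\in L^2(\mathbb{R}^2)$ vanishing a.e. outside $\Omega$ (identified with their continuous representatives). $\mathcal{H}^1$ denotes the one-dimensional Hausdorff measure. A set $\Gamma\subset\mathbb{R}^2$ is a sampling trajectory for $PW^2(\Omega)$ if there are constants $A,B>0$ with $$A\|F\|_2^2\leq\int_\Gamma|F(\xi)|^2\,d\mathcal{H}^1(\xi)\leq B\|F\|_2^2\quad\text{for all }F\in PW^2(\Omega).$$ $\operatorname{diam}(\Omega)$ is the Euclidean diameter. *)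

theory Defs
  imports "HOL-Analysis.Analysis"
begin

definition convex_body :: "'a::euclidean_space set \<Rightarrow> bool" where
  "convex_body \<Omega> \<longleftrightarrow> convex \<Omega> \<and> compact \<Omega> \<and> interior \<Omega> \<noteq> {}"

definition centered :: "'a::euclidean_space set \<Rightarrow> bool" where
  "centered \<Omega> \<longleftrightarrow> 0 \<in> interior \<Omega>"

definition symmetric :: "'a::euclidean_space set \<Rightarrow> bool" where
  "symmetric \<Omega> \<longleftrightarrow> \<Omega> = uminus ` \<Omega>"

text \<open>
  One-dimensional Hausdorff measure. The library function \<^const>\<open>diameter\<close> has an unspecified
  value on unbounded sets, hence the explicit boundedness condition on the covering sets.
\<close>

definition hausdorff1_pre :: "real \<Rightarrow> 'a::metric_space set \<Rightarrow> ennreal" where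
  "hausdorff1_pre \<delta> X =
     (INF E \<in> {E :: nat \<Rightarrow> 'a set. X \<subseteq> (\<Union>i. E i) \<and> (\<forall>i. bounded (E i) \<and> diameter (E i) \<le> \<delta>)}.
        \<Sum>i. ennreal (diameter (E i)))"

definition hausdorff1_outer :: "'a::metric_space set \<Rightarrow> ennreal" where
  "hausdorff1_outer X = (SUP \<delta> \<in> {0<..}. hausdorff1_pre \<delta> X)"

text \<open>The \<open>\<sigma>\<close>-algebra consists of the Caratheodory-measurable sets.\<close>

definition hausdorff1 :: "'a::metric_space measure" where
  "hausdorff1 = measure_of UNIV (lambda_system UNIV UNIV hausdorff1_outer) hausdorff1_outer"

lemma hausdorff1_pre_mono:
  "X \<subseteq> Y \<Longrightarrow> hausdorff1_pre \<delta> X \<le> hausdorff1_pre \<delta> Y"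
  unfolding hausdorff1_pre_def by (intro INF_superset_mono) auto

lemma hausdorff1_pre_countably_subadditive:
  "hausdorff1_pre \<delta> (\<Union>n. X n) \<le> (\<Sum>n. hausdorff1_pre \<delta> (X n))"
proof (rule ennreal_le_epsilon)
  fix e :: real
  assume "0 < e" and fin: "(\<Sum>n. hausdorff1_pre \<delta> (X n)) < top"
  have "\<exists>E. X n \<subseteq> (\<Union>i. E i) \<and> (\<forall>i. bounded (E i) \<and> diameter (E i) \<le> \<delta>) \<and>
      (\<Sum>i. ennreal (diameter (E i))) \<le> hausdorff1_pre \<delta> (X n) + e * (1/2) ^ Suc n" for n
  proof -
    have "hausdorff1_pre \<delta> (X n) < hausdorff1_pre \<delta> (X n) + e * (1/2) ^ Suc n"
      using \<open>0 < e\<close> fin by (auto simp add: less_top dest!: ennreal_suminf_lessD)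
    then show ?thesis
      unfolding hausdorff1_pre_def[of \<delta> "X n"] INF_less_iff by (auto intro: less_imp_le)
  qed
  then obtain E where cover: "\<And>n. X n \<subseteq> (\<Union>i. E n i)"
    and small: "\<And>n i. bounded (E n i) \<and> diameter (E n i) \<le> \<delta>"
    and le: "\<And>n. (\<Sum>i. ennreal (diameter (E n i))) \<le> hausdorff1_pre \<delta> (X n) + e * (1/2) ^ Suc n"
    by metis
  define C where "C = case_prod E \<circ> prod_decode"
  have "(\<Union>n. X n) \<subseteq> (\<Union>i. C i)"
    using cover by (auto simp add: C_def subset_eq) (metis prod.case prod_encode_inverse)
  moreover have "bounded (C i) \<and> diameter (C i) \<le> \<delta>" for i
    using small by (simp add: C_def split_def)
  ultimately have "hausdorff1_pre \<delta> (\<Union>n. X n) \<le> (\<Sum>i. ennreal (diameter (C i)))"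
    unfolding hausdorff1_pre_def by (intro INF_lower) auto
  also have "\<dots> = (\<Sum>n. \<Sum>i. ennreal (diameter (E n i)))"
    unfolding C_def comp_def
    by (intro suminf_ennreal_2dimen[where f = "\<lambda>p. ennreal (diameter (case_prod E p))"]) auto
  also have "\<dots> \<le> (\<Sum>n. hausdorff1_pre \<delta> (X n) + e * (1/2) ^ Suc n)"
    by (intro suminf_le allI le) auto
  also have "\<dots> = (\<Sum>n. hausdorff1_pre \<delta> (X n)) + (\<Sum>n. ennreal e * ennreal ((1/2) ^ Suc n))"
    using \<open>0 < e\<close> by (subst suminf_add[symmetric])
      (auto simp del: ennreal_suminf_cmult simp add: ennreal_mult[symmetric])
  also have "\<dots> = (\<Sum>n. hausdorff1_pre \<delta> (X n)) + e"
    unfolding ennreal_suminf_cmult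
    by (subst suminf_ennreal_eq[OF zero_le_power power_half_series]) auto
  finally show "hausdorff1_pre \<delta> (\<Union>n. X n) \<le> (\<Sum>n. hausdorff1_pre \<delta> (X n)) + e" .
qed

lemma outer_measure_space_hausdorff1: "outer_measure_space UNIV hausdorff1_outer"
  unfolding outer_measure_space_def
proof (intro conjI)
  have "hausdorff1_pre \<delta> ({} :: 'a set) = 0" if "0 < \<delta>" for \<delta>
  proof -
    have "hausdorff1_pre \<delta> ({} :: 'a set) \<le> (\<Sum>i::nat. ennreal (diameter ({} :: 'a set)))"
      unfolding hausdorff1_pre_def using that by (intro INF_lower) auto
    then show ?thesis by simp
  qed
  then show "positive UNIV (hausdorff1_outer :: 'a set \<Rightarrow> ennreal)"
    by (auto simp: positive_def hausdorff1_outer_def)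
  show "increasing UNIV (hausdorff1_outer :: 'a set \<Rightarrow> ennreal)"
    unfolding increasing_def hausdorff1_outer_def
    by (auto intro!: SUP_mono hausdorff1_pre_mono)
  show "countably_subadditive UNIV (hausdorff1_outer :: 'a set \<Rightarrow> ennreal)"
    unfolding countably_subadditive_def
  proof (intro allI impI)
    fix X :: "nat \<Rightarrow> 'a set"
    have "hausdorff1_pre \<delta> (\<Union>n. X n) \<le> (\<Sum>n. hausdorff1_outer (X n))" if "0 < \<delta>" for \<delta>
    proof -
      have "hausdorff1_pre \<delta> (X n) \<le> hausdorff1_outer (X n)" for n
        unfolding hausdorff1_outer_def using that by (intro SUP_upper) auto
      then show ?thesis
        by (intro order_trans[OF hausdorff1_pre_countably_subadditive] suminf_le) auto
    qed
    then show "hausdorff1_outer (\<Union>n. X n) \<le> (\<Sum>n. hausdorff1_outer (X n))"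
      unfolding hausdorff1_outer_def[of "\<Union>n. X n"] by (intro SUP_least) auto
  qed
qed

lemma measure_space_hausdorff1:
  "measure_space UNIV (lambda_system UNIV UNIV hausdorff1_outer) hausdorff1_outer"
proof -
  have "sigma_algebra UNIV (UNIV :: 'a set set)"
    using sigma_algebra_Pow[of UNIV] by simp
  then show ?thesis
    by (rule sigma_algebra.caratheodory_lemma) (rule outer_measure_space_hausdorff1)
qed

lemma space_hausdorff1 [simp]: "space hausdorff1 = UNIV"
  by (simp add: hausdorff1_def space_measure_of_conv)

lemma sets_hausdorff1:
  "sets (hausdorff1 :: 'a::metric_space measure) = lambda_system UNIV UNIV hausdorff1_outer"
proof -
  have "sigma_algebra UNIV (lambda_system UNIV UNIV (hausdorff1_outer :: 'a set \<Rightarrow> ennreal))"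
    by (rule measure_space_hausdorff1[unfolded measure_space_def, THEN conjunct1])
  from sigma_algebra.sets_measure_of_eq[OF this] show ?thesis
    unfolding hausdorff1_def .
qed

lemma emeasure_hausdorff1:
  "X \<in> sets hausdorff1 \<Longrightarrow> emeasure hausdorff1 X = hausdorff1_outer X"
  unfolding sets_hausdorff1 unfolding hausdorff1_def
  using measure_space_hausdorff1[unfolded measure_space_def]
  by (intro emeasure_measure_of_sigma) blast+

definition fourier_transform :: "('a::euclidean_space \<Rightarrow> complex) \<Rightarrow> 'a \<Rightarrow> complex" where
  "fourier_transform f \<xi> = (LINT x|lborel. exp (- (2 * of_real pi * \<i> * of_real (\<xi> \<bullet> x))) * f x)"

text \<open>
  For bounded \<open>\<Omega>\<close> every \<open>f\<close> below is integrable, so \<^term>\<open>fourier_transform f\<close> is given by an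
  absolutely convergent integral and is the continuous representative of the Fourier transform
  of \<open>f\<close>. For \<open>\<Omega>\<close> of infinite measure this would not be the Paley--Wiener space.
\<close>

definition PW2 :: "(real ^ 2) set \<Rightarrow> (real ^ 2 \<Rightarrow> complex) set" where
  "PW2 \<Omega> = {fourier_transform f | f.
     f \<in> borel_measurable lborel \<and>
     integrable lborel (\<lambda>x. (norm (f x))\<^sup>2) \<and>
     (AE x in lborel. x \<notin> \<Omega> \<longrightarrow> f x = 0)}"

definition sampling_trajectory :: "(real ^ 2) set \<Rightarrow> (real ^ 2) set \<Rightarrow> bool" where
  "sampling_trajectory \<Omega> \<Gamma> \<longleftrightarrow>
     (\<exists>A B :: real. A > 0 \<and> B > 0 \<and>
        (\<forall>F \<in> PW2 \<Omega>.
           ennreal A * (\<integral>\<^sup>+ \<xi>. ennreal ((norm (F \<xi>))\<^sup>2) \<partial>lborel)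
             \<le> (\<integral>\<^sup>+ \<xi> \<in> \<Gamma>. ennreal ((norm (F \<xi>))\<^sup>2) \<partial>hausdorff1) \<and>
           (\<integral>\<^sup>+ \<xi> \<in> \<Gamma>. ennreal ((norm (F \<xi>))\<^sup>2) \<partial>hausdorff1)
             \<le> ennreal B * (\<integral>\<^sup>+ \<xi>. ennreal ((norm (F \<xi>))\<^sup>2) \<partial>lborel)))"

definition spiral :: "real \<Rightarrow> (real ^ 2) set" where
  "spiral \<eta> = {vector [\<eta> * \<theta> * cos (2 * pi * \<theta>), \<eta> * \<theta> * sin (2 * pi * \<theta>)] | \<theta>. \<theta> \<ge> 0}"

definition concentric_circles :: "real \<Rightarrow> (real ^ 2) set" where
  "concentric_circles \<eta> =
     {p. \<exists>k::nat. k \<ge> 1 \<and> (p $ 1)\<^sup>2 + (p $ 2)\<^sup>2 = \<eta>\<^sup>2 * (real k)\<^sup>2}"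

end

(*
  Write F for the Fourier transform of f, with f in L^2 supported in the disc of radius D/2, D the
  diameter of the body.  Both sets meet every ray from the origin in points at distance eta from
  each other, and on each turn the Hausdorff measure is comparable to r dtheta.  So everything is a
  statement about F on rays, with the weight r of polar coordinates.

  Lower bound for D eta < 1.  If kappa < pi / eta, a cotangent weight gives, on an interval of length
  eta, kappa^2 int |u|^2 <= int |u'|^2 + C (|u|^2 at the two end points).  Far from the origin the
  factor r is harmless.  Summing over the intervals, integrating over the angle and using Bernstein's
  inequality ||grad F|| <= pi D ||F|| (Plancherel), one controls (kappa^2 - (pi D)^2) ||F||^2 by the
  samples and the mass of F in a fixed disc; kappa can be taken larger than pi D since pi D < pi / eta.
  The mass in the disc is small plus samples: on an arc of length less than 2 pi every exponential is
  a uniform limit of exponential sums with positive frequencies (Runge), hence F at a point of a ray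
  is, up to a small error, a combination of the values of F at finitely many nodes of that ray.

  Failure for D eta > 1.  Let D/2 be attained in direction u.  Then the frequencies +- u / (2 eta) are
  interior to the body.  A wave packet with these two frequencies, located at n eta u and vanishing on
  lines orthogonal to u, is of size O(1/n) on the set times a fixed packet of the space; the upper
  sampling inequality for the latter contradicts the lower one for the former.
*)
theory Submission
  imports Defs "HOL-Probability.Probability"
begin

subsection \<open>One-dimensional Hausdorff measure\<close>

text \<open>Two obstacles shape the sufficiency half. The weight r vanishes at the origin, and the
  term it adds to the cotangent identity can be absorbed only for r bounded below; hence the
  separate disc. For that disc the nodes of a ray lie on one side: the turn of index 0 carries no
  useful weight (for the circles it is a point), so F must be predicted from nodes further out.
  Hence the positive frequencies, and hence an arc that does not close up: on the full circle the
  function 1 has distance at least 1 from all such sums. The bound D \<eta> < 1 keeps the arc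
  shorter than the circle, just as it gives pi D < pi / \<eta>.

  In the failure half no estimate of Hausdorff measure enters: the packet is dominated pointwise on
  the set by another member of the space, and the assumed sampling inequalities do the rest. The
  error of the phase is of order (1 + |\<xi> - n \<eta> u|^2) / n; the growing factor corresponds to
  a differential operator on the spectrum, which does not enlarge the support.\<close>

lemma hausdorff1_pre_antimono:
  assumes "\<delta> \<le> \<epsilon>"
  shows "hausdorff1_pre \<epsilon> X \<le> hausdorff1_pre \<delta> X"
  unfolding hausdorff1_pre_def
  by (intro INF_superset_mono) (auto intro: order_trans[OF _ assms])

lemma hausdorff1_pre_le_outer: "0 < \<delta> \<Longrightarrow> hausdorff1_pre \<delta> X \<le> hausdorff1_outer X"
  unfolding hausdorff1_outer_def by (intro SUP_upper) auto

lemma hausdorff1_outer_mono: "X \<subseteq> Y \<Longrightarrow> hausdorff1_outer X \<le> hausdorff1_outer Y"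
  unfolding hausdorff1_outer_def by (intro SUP_mono) (auto intro: hausdorff1_pre_mono)

lemma hausdorff1_outer_countably_subadditive:
  "hausdorff1_outer (\<Union>n::nat. X n) \<le> (\<Sum>n. hausdorff1_outer (X n))"
  unfolding hausdorff1_outer_def[of "\<Union>n. X n"]
proof (rule SUP_least, clarify)
  fix \<delta> :: real assume "0 < \<delta>"
  then show "hausdorff1_pre \<delta> (\<Union>n. X n) \<le> (\<Sum>n. hausdorff1_outer (X n))"
    by (intro order_trans[OF hausdorff1_pre_countably_subadditive] suminf_le hausdorff1_pre_le_outer) auto
qed

lemma hausdorff1_outer_empty [simp]: "hausdorff1_outer {} = 0"
  using outer_measure_space_hausdorff1[unfolded outer_measure_space_def, THEN conjunct1]
  by (simp add: positive_def)

lemma hausdorff1_outer_Un: "hausdorff1_outer (A \<union> B) \<le> hausdorff1_outer A + hausdorff1_outer B"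
proof -
  define X where "X n = (if n = 0 then A else if n = Suc 0 then B else {})" for n :: nat
  have "A \<union> B = (\<Union>n. X n)" by (auto simp: X_def split: if_splits)
  then have "hausdorff1_outer (A \<union> B) \<le> (\<Sum>n. hausdorff1_outer (X n))"
    using hausdorff1_outer_countably_subadditive[of X] by simp
  also have "\<dots> = (\<Sum>n<2. hausdorff1_outer (X n))"
    by (rule suminf_finite) (auto simp: X_def)
  also have "\<dots> = hausdorff1_outer A + hausdorff1_outer B"
    by (simp add: X_def numeral_2_eq_2)
  finally show ?thesis .
qed

section \<open>Caratheodory's criterion: Borel sets are measurable for Hausdorff measure\<close>

text \<open>A covering set of diameter less than \<open>d\<close> cannot meet both \<open>A\<close>
  and \<open>B\<close>, so every fine covering of the union splits into a covering of
  \<open>A\<close> and one of \<open>B\<close>.\<close>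

lemma hausdorff1_outer_separated:
  assumes d: "0 < d" and sep: "\<And>x y. x \<in> A \<Longrightarrow> y \<in> B \<Longrightarrow> d \<le> dist x y"
  shows "hausdorff1_outer A + hausdorff1_outer B \<le> hausdorff1_outer (A \<union> B)"
proof -
  have small: "hausdorff1_pre \<delta> A + hausdorff1_pre \<delta> B \<le> hausdorff1_pre \<delta> (A \<union> B)"
    if "0 < \<delta>" "\<delta> < d" for \<delta>
    unfolding hausdorff1_pre_def[of \<delta> "A \<union> B"]
  proof (rule INF_greatest, clarify)
    fix E :: "nat \<Rightarrow> 'a set"
    assume cov: "A \<union> B \<subseteq> (\<Union>i. E i)" and E: "\<forall>i. bounded (E i) \<and> diameter (E i) \<le> \<delta>"
    \<comment> \<open>Sets that are sorted out are replaced by the empty set, of diameter 0, so that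
      the two sums add up termwise to the original one.\<close>
    define P where "P i = (if E i \<inter> A \<noteq> {} then E i else {})" for i
    define Q where "Q i = (if E i \<inter> A \<noteq> {} then {} else E i)" for i
    have "A \<subseteq> (\<Union>i. P i)" using cov by (fastforce simp: P_def)
    then have PA: "hausdorff1_pre \<delta> A \<le> (\<Sum>i. ennreal (diameter (P i)))"
      unfolding hausdorff1_pre_def using E that by (intro INF_lower) (auto simp: P_def)
    have "B \<subseteq> (\<Union>i. Q i)"
    proof
      fix y assume y: "y \<in> B"
      then obtain i where i: "y \<in> E i" using cov by blast
      have "E i \<inter> A = {}"
      proof (rule ccontr)
        assume "E i \<inter> A \<noteq> {}"
        then obtain x where x: "x \<in> E i" "x \<in> A" by blast
        have "dist x y \<le> diameter (E i)" using E x i by (intro diameter_bounded_bound) auto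
        with sep[OF x(2) y] E that show False by (meson leD order_trans)
      qed
      with i show "y \<in> (\<Union>i. Q i)" by (auto simp: Q_def)
    qed
    then have QB: "hausdorff1_pre \<delta> B \<le> (\<Sum>i. ennreal (diameter (Q i)))"
      unfolding hausdorff1_pre_def using E that by (intro INF_lower) (auto simp: Q_def)
    have "(\<Sum>i. ennreal (diameter (P i))) + (\<Sum>i. ennreal (diameter (Q i)))
        = (\<Sum>i. ennreal (diameter (P i)) + ennreal (diameter (Q i)))"
      by (rule suminf_add) auto
    also have "\<dots> = (\<Sum>i. ennreal (diameter (E i)))"
      by (intro suminf_cong) (auto simp: P_def Q_def)
    finally show "hausdorff1_pre \<delta> A + hausdorff1_pre \<delta> B \<le> (\<Sum>i. ennreal (diameter (E i)))"
      using add_mono[OF PA QB] by simp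
  qed
  \<comment> \<open>Independent scales for \<open>A\<close> and \<open>B\<close> allow the two
    suprema to be taken one after the other.\<close>
  have two: "hausdorff1_pre \<delta> A + hausdorff1_pre \<epsilon> B \<le> hausdorff1_outer (A \<union> B)"
    if "0 < \<delta>" "0 < \<epsilon>" for \<delta> \<epsilon>
  proof -
    define m where "m = min (min \<delta> \<epsilon>) (d/2)"
    have m: "0 < m" "m < d" "m \<le> \<delta>" "m \<le> \<epsilon>" using that d by (auto simp: m_def)
    have "hausdorff1_pre \<delta> A + hausdorff1_pre \<epsilon> B \<le> hausdorff1_pre m A + hausdorff1_pre m B"
      using m by (intro add_mono hausdorff1_pre_antimono) auto
    also have "\<dots> \<le> hausdorff1_pre m (A \<union> B)" using m by (intro small)
    also have "\<dots> \<le> hausdorff1_outer (A \<union> B)" using m by (intro hausdorff1_pre_le_outer)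
    finally show ?thesis .
  qed
  have "hausdorff1_outer A + hausdorff1_pre \<epsilon> B \<le> hausdorff1_outer (A \<union> B)" if "0 < \<epsilon>" for \<epsilon>
    unfolding hausdorff1_outer_def[of A] using two that
    by (subst ennreal_SUP_add_left[symmetric]) (auto intro!: SUP_least)
  then have "(SUP \<epsilon>\<in>{0<..}. hausdorff1_pre \<epsilon> B + hausdorff1_outer A) \<le> hausdorff1_outer (A \<union> B)"
    by (intro SUP_least) (auto simp: add.commute)
  then show ?thesis
    unfolding hausdorff1_outer_def[of B]
    by (subst add.commute, subst ennreal_SUP_add_left[symmetric]) auto
qed

lemma hausdorff1_outer_finite_separated:
  fixes R :: "nat \<Rightarrow> 'a::metric_space set"
  assumes "\<And>i j. i < j \<Longrightarrow> \<exists>d>0. \<forall>x\<in>R i. \<forall>y\<in>R j. d \<le> dist x y"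
  shows "(\<Sum>i<n. hausdorff1_outer (R i)) \<le> hausdorff1_outer (\<Union>i<n. R i)"
proof (induction n)
  case (Suc n)
  have "\<forall>i. \<exists>d. i < n \<longrightarrow> 0 < d \<and> (\<forall>x\<in>R i. \<forall>y\<in>R n. d \<le> dist x y)"
    using assms by blast
  then obtain d :: "nat \<Rightarrow> real" where d: "\<And>i. i < n \<Longrightarrow> 0 < d i"
    "\<And>i x y. i < n \<Longrightarrow> x \<in> R i \<Longrightarrow> y \<in> R n \<Longrightarrow> d i \<le> dist x y" by metis
  define e where "e = Min (insert 1 (d ` {..<n}))"
  have e: "0 < e" "\<And>i. i < n \<Longrightarrow> e \<le> d i" using d by (auto simp: e_def)
  have "(\<Sum>i<Suc n. hausdorff1_outer (R i)) \<le> hausdorff1_outer (\<Union>i<n. R i) + hausdorff1_outer (R n)"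
    using Suc by (auto intro: add_right_mono)
  also have "\<dots> \<le> hausdorff1_outer ((\<Union>i<n. R i) \<union> R n)"
    using e(1) order_trans[OF e(2) d(2)] by (intro hausdorff1_outer_separated[of e]) blast+
  also have "(\<Union>i<n. R i) \<union> R n = (\<Union>i<Suc n. R i)" by (auto simp: less_Suc_eq)
  finally show ?case .
qed auto

text \<open>The set \<open>X - C\<close> is exhausted by the sets \<open>A n\<close>, which keep a
  positive distance from \<open>C\<close>. What \<open>A n\<close> misses consists of the shells
  \<open>R i\<close> with \<open>i >= n\<close>; shells of equal parity are separated from each
  other, so their measures have a finite sum, and the tail of the series tends to 0.\<close>

lemma hausdorff1_outer_closed_add:
  fixes C :: "'a::metric_space set"
  assumes C: "closed C"
  shows "hausdorff1_outer (C \<inter> X) + hausdorff1_outer (X - C) \<le> hausdorff1_outer X"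
proof (cases "hausdorff1_outer X = top \<or> C = {}")
  case True
  then show ?thesis by auto
next
  case False
  then have fin: "hausdorff1_outer X < top" and ne: "C \<noteq> {}" by (auto simp: top.not_eq_extremum)
  define A where "A n = {x \<in> X. 1 / real (Suc n) \<le> infdist x C}" for n
  define R where "R n = A (Suc n) - A n" for n
  have RX: "R n \<subseteq> X" for n by (auto simp: R_def A_def)
  have sepR: "\<exists>d>0. \<forall>x\<in>R i. \<forall>y\<in>R j. d \<le> dist x y" if "i + 2 \<le> j" for i j
  proof (intro exI conjI ballI)
    show "0 < 1 / real (i+2) - 1 / real (i+3)" by (simp add: frac_less2)
    fix x y assume x: "x \<in> R i" and y: "y \<in> R j"
    have "1 / real (i+2) \<le> infdist x C" using x by (auto simp: R_def A_def)
    moreover have "infdist y C < 1 / real (Suc j)" using y by (auto simp: R_def A_def)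
    moreover have "1 / real (Suc j) \<le> 1 / real (i+3)" using that by (intro divide_left_mono) auto
    moreover have "infdist x C \<le> infdist y C + dist x y" by (rule infdist_triangle)
    ultimately show "1 / real (i+2) - 1 / real (i+3) \<le> dist x y" by linarith
  qed
  \<comment> \<open>The shift \<open>p\<close> selects the parity; two different indices of this
    form differ by at least 2, as \<open>sepR\<close> demands.\<close>
  have half: "(\<Sum>i<n. hausdorff1_outer (R (2*i+p))) \<le> hausdorff1_outer X" for n p
  proof -
    have "(\<Sum>i<n. hausdorff1_outer (R (2*i+p))) \<le> hausdorff1_outer (\<Union>i<n. R (2*i+p))"
      by (intro hausdorff1_outer_finite_separated sepR) auto
    also have "\<dots> \<le> hausdorff1_outer X" using RX by (intro hausdorff1_outer_mono) auto
    finally show ?thesis .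
  qed
  have sumR: "(\<Sum>i<2*n. hausdorff1_outer (R i)) \<le> 2 * hausdorff1_outer X" for n
  proof -
    have "(\<Sum>i<2*n. hausdorff1_outer (R i)) = (\<Sum>i<n. hausdorff1_outer (R (2*i+0))) + (\<Sum>i<n. hausdorff1_outer (R (2*i+1)))"
      by (induction n) (auto simp: algebra_simps)
    also have "\<dots> \<le> hausdorff1_outer X + hausdorff1_outer X" by (intro add_mono half)
    finally show ?thesis by (simp add: mult_2)
  qed
  have "(\<Sum>i. hausdorff1_outer (R i)) \<le> 2 * hausdorff1_outer X"
  proof (intro suminf_le_const)
    fix n
    have "(\<Sum>i<n. hausdorff1_outer (R i)) \<le> (\<Sum>i<2*n. hausdorff1_outer (R i))"
      by (intro sum_mono2) auto
    then show "(\<Sum>i<n. hausdorff1_outer (R i)) \<le> 2 * hausdorff1_outer X"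
      using sumR order_trans by blast
  qed auto
  then have Rfin: "(\<Sum>i. hausdorff1_outer (R i)) < top" (is "?S < top")
    using fin by (auto simp: ennreal_mult_less_top intro: le_less_trans)
  have cover: "X - C \<subseteq> A n \<union> (\<Union>i. R (i + n))" for n
  proof
    fix x assume x: "x \<in> X - C"
    then have pos: "0 < infdist x C"
      using C ne by (simp add: infdist_pos_not_in_closed)
    then obtain m where m: "1 / real (Suc m) < infdist x C"
      using nat_approx_posE by blast
    show "x \<in> A n \<union> (\<Union>i. R (i + n))"
    proof (cases "x \<in> A n")
      case False
      have xm: "x \<in> A m" using m x by (auto simp: A_def)
      define k where "k = (LEAST k. x \<in> A k)"
      have k: "x \<in> A k" "\<And>l. l < k \<Longrightarrow> x \<notin> A l"
        unfolding k_def by (rule LeastI[of "\<lambda>k. x \<in> A k", OF xm]) (rule not_less_Least)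
      have mono: "A a \<subseteq> A b" if "a \<le> b" for a b
      proof -
        have "1 / real (Suc b) \<le> 1 / real (Suc a)" using that by (intro divide_left_mono) auto
        then show ?thesis by (auto simp: A_def)
      qed
      have "n < k" using False k(1) mono by (meson leI subsetD)
      then obtain i where i: "k = Suc (i + n)" using less_iff_Suc_add[of n k] by (auto simp: add.commute)
      have "x \<in> R (i + n)" using k i by (auto simp: R_def)
      then show ?thesis by blast
    qed auto
  qed
  show ?thesis
  proof (rule ennreal_le_epsilon)
    fix e :: real assume e: "0 < e"
    \<comment> \<open>Convergence of the tails is a statement about real series, hence the passage
      to \<open>enn2real\<close>, which loses nothing because the sum is finite.\<close>
    obtain n where n: "(\<Sum>i. hausdorff1_outer (R (i + n))) \<le> e"
    proof -
      define a where "a i = enn2real (hausdorff1_outer (R i))" for i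
      have a: "hausdorff1_outer (R i) = ennreal (a i)" for i
      proof -
        have "hausdorff1_outer (R i) \<le> ?S" using sum_le_suminf[of "\<lambda>i. hausdorff1_outer (R i)" "{i}"] by simp
        then show ?thesis using Rfin by (simp add: a_def less_top)
      qed
      have a0: "a i \<ge> 0" for i by (simp add: a_def)
      have sa: "summable a"
        using Rfin a a0 by (intro summable_suminf_not_top) auto
      have "(\<lambda>n. \<Sum>i. a (i + n)) \<longlonglongrightarrow> 0"
        by (rule suminf_exist_split2[OF sa])
      then have "\<forall>\<^sub>F n in sequentially. (\<Sum>i. a (i + n)) < e"
        using e by (rule order_tendstoD(2))
      then obtain n where "(\<Sum>i. a (i + n)) < e"
        by (meson eventually_happens trivial_limit_sequentially)
      moreover have "(\<Sum>i. hausdorff1_outer (R (i + n))) = ennreal (\<Sum>i. a (i + n))"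
        unfolding a using a0 sa by (intro suminf_ennreal2) (auto simp: summable_iff_shift)
      ultimately show ?thesis using that[of n] by (simp add: ennreal_leI)
    qed
    have sep: "hausdorff1_outer (C \<inter> X) + hausdorff1_outer (A n) \<le> hausdorff1_outer ((C \<inter> X) \<union> A n)"
    proof (rule hausdorff1_outer_separated[where d = "1 / real (Suc n)"])
      fix x y assume "x \<in> C \<inter> X" "y \<in> A n"
      then have "1 / real (Suc n) \<le> infdist y C" "infdist y C \<le> dist y x"
        by (auto simp: A_def intro: infdist_le)
      then show "1 / real (Suc n) \<le> dist x y" by (simp add: dist_commute)
    qed auto
    have "hausdorff1_outer (X - C) \<le> hausdorff1_outer (A n) + hausdorff1_outer (\<Union>i. R (i + n))"
      using hausdorff1_outer_mono[OF cover[of n]] hausdorff1_outer_Un order_trans by blast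
    also have "\<dots> \<le> hausdorff1_outer (A n) + e"
      using order_trans[OF hausdorff1_outer_countably_subadditive n] by (intro add_left_mono)
    finally have "hausdorff1_outer (C \<inter> X) + hausdorff1_outer (X - C)
        \<le> (hausdorff1_outer (C \<inter> X) + hausdorff1_outer (A n)) + e"
      by (simp add: add.assoc add_left_mono)
    also have "\<dots> \<le> hausdorff1_outer X + e"
      using sep by (intro add_right_mono) (auto elim!: order_trans intro!: hausdorff1_outer_mono simp: A_def)
    finally show "hausdorff1_outer (C \<inter> X) + hausdorff1_outer (X - C) \<le> hausdorff1_outer X + e" .
  qed
qed

text \<open>Integrals against \<open>hausdorff1\<close> are additive and monotone-convergent only
  for measurable integrands; this makes every continuous function on a Borel set admissible.\<close>

lemma sets_borel_subset_hausdorff1: "sets borel \<subseteq> sets (hausdorff1 :: 'a::metric_space measure)"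
proof -
  have "C \<in> sets (hausdorff1 :: 'a measure)" if "closed C" for C
    unfolding sets_hausdorff1 lambda_system_def
  proof (clarify, intro conjI allI impI ballI)
    fix X :: "'a set"
    have "hausdorff1_outer X \<le> hausdorff1_outer (C \<inter> X) + hausdorff1_outer (X - C)"
      using hausdorff1_outer_Un[of "C \<inter> X" "X - C"] by (metis Int_Diff_Un Int_commute)
    then show "hausdorff1_outer (C \<inter> X) + hausdorff1_outer ((UNIV - C) \<inter> X) = hausdorff1_outer X"
      using hausdorff1_outer_closed_add[OF that, of X] by (simp add: Diff_eq Int_commute antisym)
  qed simp
  then have "sigma_sets UNIV (Collect closed) \<subseteq> sets (hausdorff1 :: 'a measure)"
    using sets.sigma_sets_subset[of "Collect closed" "hausdorff1 :: 'a measure"] by auto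
  then show ?thesis by (simp add: borel_eq_closed)
qed

lemma measurable_hausdorff1_borel:
  fixes f :: "'a::metric_space \<Rightarrow> 'b::topological_space"
  shows "f \<in> borel_measurable borel \<Longrightarrow> f \<in> borel_measurable hausdorff1"
proof (rule measurableI)
  fix A :: "'b set" assume "f \<in> borel_measurable borel" "A \<in> sets borel"
  then have "f -` A \<inter> UNIV \<in> sets borel" using measurable_sets[of f borel borel A] by simp
  then show "f -` A \<inter> space hausdorff1 \<in> sets hausdorff1"
    using sets_borel_subset_hausdorff1 by auto
qed simp

text \<open>A covering set of diameter \<open>d\<close> meets the curve in parameters of an interval of length \<open>d / c\<close>.\<close>

lemma hausdorff1_outer_image_ge:
  fixes \<gamma> :: "real \<Rightarrow> 'a::metric_space"
  assumes E: "E \<in> sets borel" and c: "0 < c"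
    and exp: "\<And>s t. s \<in> E \<Longrightarrow> t \<in> E \<Longrightarrow> c * \<bar>s - t\<bar> \<le> dist (\<gamma> s) (\<gamma> t)"
  shows "ennreal c * emeasure lborel E \<le> hausdorff1_outer (\<gamma> ` E)"
proof -
  \<comment> \<open>The scale 1 is arbitrary: the estimate holds for every covering by bounded sets,
    however coarse.\<close>
  have "ennreal c * emeasure lborel E \<le> hausdorff1_pre 1 (\<gamma> ` E)"
    unfolding hausdorff1_pre_def
  proof (rule INF_greatest, clarify)
    fix V :: "nat \<Rightarrow> 'a set"
    assume cov: "\<gamma> ` E \<subseteq> (\<Union>i. V i)" and V: "\<forall>i. bounded (V i) \<and> diameter (V i) \<le> 1"
    define W where "W i = {t\<in>E. \<gamma> t \<in> V i}" for i
    have len: "\<bar>s - t\<bar> \<le> diameter (V i) / c" if "s \<in> W i" "t \<in> W i" for s t i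
    proof -
      have "c * \<bar>s - t\<bar> \<le> dist (\<gamma> s) (\<gamma> t)" using that by (intro exp) (auto simp: W_def)
      also have "\<dots> \<le> diameter (V i)" using that V by (intro diameter_bounded_bound) (auto simp: W_def)
      finally show ?thesis using c by (simp add: field_simps)
    qed
    define J where "J i = (if W i = {} then {} else {Inf (W i)..Sup (W i)})" for i
    have Wb: "bdd_below (W i)" "bdd_above (W i)" for i
    proof -
      have "bdd_below (W i) \<and> bdd_above (W i)"
      proof (cases "W i = {}")
        case False
        then obtain s where s: "s \<in> W i" by blast
        have "s - diameter (V i) / c \<le> t \<and> t \<le> s + diameter (V i) / c" if "t \<in> W i" for t
          using len[OF s that] by linarith
        then show ?thesis unfolding bdd_below_def bdd_above_def by blast
      qed auto
      then show "bdd_below (W i)" "bdd_above (W i)" by auto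
    qed
    have WJ: "W i \<subseteq> J i" for i
      using Wb by (auto simp: J_def intro!: cInf_lower cSup_upper)
    have EJ: "E \<subseteq> (\<Union>i. J i)"
    proof
      fix t assume t: "t \<in> E"
      then obtain i where "\<gamma> t \<in> V i" using cov by blast
      then have "t \<in> W i" using t by (simp add: W_def)
      then show "t \<in> (\<Union>i. J i)" using WJ by blast
    qed
    have Jm: "ennreal c * emeasure lborel (J i) \<le> ennreal (diameter (V i))" for i
    proof (cases "W i = {}")
      case False
      have d0: "0 \<le> diameter (V i)" using V diameter_ge_0 by blast
      have "Sup (W i) \<le> Inf (W i) + diameter (V i) / c"
      proof (rule cSup_least[OF False])
        fix t assume t: "t \<in> W i"
        have "t - diameter (V i) / c \<le> Inf (W i)"
          using len[OF t] by (intro cInf_greatest[OF False]) (smt (verit))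
        then show "t \<le> Inf (W i) + diameter (V i) / c" by simp
      qed
      moreover have "Inf (W i) \<le> Sup (W i)"
        using False Wb cInf_le_cSup by blast
      ultimately have "c * (Sup (W i) - Inf (W i)) \<le> diameter (V i)" "Inf (W i) \<le> Sup (W i)"
        using c by (auto simp: field_simps)
      then show ?thesis using False c
        by (simp add: J_def ennreal_mult[symmetric] ennreal_leI)
    qed (simp add: J_def)
    have "emeasure lborel E \<le> emeasure lborel (\<Union>i. J i)"
      using EJ by (intro emeasure_mono) (auto simp: J_def)
    also have "\<dots> \<le> (\<Sum>i. emeasure lborel (J i))"
      by (intro emeasure_subadditive_countably) (auto simp: J_def)
    finally have "ennreal c * emeasure lborel E \<le> (\<Sum>i. ennreal c * emeasure lborel (J i))"
      by (subst ennreal_suminf_cmult) (rule mult_left_mono, auto)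
    also have "\<dots> \<le> (\<Sum>i. ennreal (diameter (V i)))"
      by (intro suminf_le allI Jm) auto
    finally show "ennreal c * emeasure lborel E \<le> (\<Sum>i. ennreal (diameter (V i)))" .
  qed
  also have "\<dots> \<le> hausdorff1_outer (\<gamma> ` E)" by (rule hausdorff1_pre_le_outer) simp
  finally show ?thesis .
qed

text \<open>Cut the interval into \<open>n\<close> equal pieces; the images have diameter at most
  \<open>L * h\<close>, and \<open>n\<close> is chosen to bring this below the scale.\<close>

lemma hausdorff1_outer_interval_le:
  fixes \<gamma> :: "real \<Rightarrow> 'a::metric_space"
  assumes L: "0 < L" and lip: "\<And>s t. s \<in> {a..b} \<Longrightarrow> t \<in> {a..b} \<Longrightarrow> dist (\<gamma> s) (\<gamma> t) \<le> L * \<bar>s - t\<bar>"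
    and ab: "a \<le> b"
  shows "hausdorff1_outer (\<gamma> ` {a..b}) \<le> ennreal (L * (b - a))"
  unfolding hausdorff1_outer_def
proof (rule SUP_least, clarify)
  fix \<delta> :: real assume \<delta>: "0 < \<delta>"
  obtain n :: nat where n: "L * (b - a) / \<delta> < real n" using reals_Archimedean2 by blast
  have n0: "0 < n" using n L ab \<delta> by (metis divide_nonneg_pos leD diff_ge_0_iff_ge less_imp_le mult_nonneg_nonneg not_gr_zero of_nat_0)
  define h where "h = (b - a) / real n"
  have h0: "0 \<le> h" using ab by (simp add: h_def)
  have Lh: "L * h \<le> \<delta>" using n n0 \<delta> by (simp add: h_def field_simps)
  define V where "V i = (if i < n then \<gamma> ` {a + real i * h..a + real (Suc i) * h} else {})" for i
  have sub: "{a + real i * h..a + real (Suc i) * h} \<subseteq> {a..b}" if "i < n" for i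
  proof -
    have "real (Suc i) * h \<le> real n * h" using that h0 by (intro mult_right_mono) auto
    also have "\<dots> = b - a" using n0 by (simp add: h_def)
    finally show ?thesis using h0 by auto
  qed
  have dV: "dist x y \<le> L * h" if "x \<in> V i" "y \<in> V i" for x y i
  proof -
    from that obtain s t where st: "x = \<gamma> s" "y = \<gamma> t" "i < n" "s \<in> {a + real i * h..a + real (Suc i) * h}"
       "t \<in> {a + real i * h..a + real (Suc i) * h}" by (auto simp: V_def split: if_splits)
    then have "dist x y \<le> L * \<bar>s - t\<bar>" using lip sub[of i] by blast
    also have "\<dots> \<le> L * h" using st L by (intro mult_left_mono) (auto simp: algebra_simps)
    finally show ?thesis .
  qed
  have bV: "bounded (V i)" for i
    using dV unfolding bounded_def by (metis empty_iff equals0I)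
  have diam: "diameter (V i) \<le> L * h" for i
  proof (cases "V i = {}")
    case False
    then show ?thesis unfolding diameter_def using dV by (auto intro!: cSUP_least)
  qed (use L h0 in auto)
  have cov: "\<gamma> ` {a..b} \<subseteq> (\<Union>i. V i)"
  proof clarify
    fix t assume t: "t \<in> {a..b}"
    show "\<gamma> t \<in> (\<Union>i. V i)"
    \<comment> \<open>At the right end point the floor formula would give the index
      \<open>n\<close>, one too many, so \<open>b\<close> is put into the last piece by
      hand.\<close>
    proof (cases "t = b")
      case True
      have "b \<in> {a + real (n-1) * h..a + real (Suc (n-1)) * h}"
        using n0 ab by (auto simp: h_def field_simps of_nat_diff)
      then have "\<gamma> t \<in> V (n-1)" using True n0 by (auto simp: V_def)
      then show ?thesis by blast
    next
      case False
      then have "a < b" using t by auto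
      then have hp: "0 < h" using n0 by (simp add: h_def)
      define i where "i = nat \<lfloor>(t - a) / h\<rfloor>"
      have q: "0 \<le> (t - a) / h" using t hp by simp
      have i: "real i \<le> (t - a) / h" "(t - a)/h < real (Suc i)"
        using q by (auto simp: i_def) linarith
      have "(t - a) / h < real n" using t False n0 \<open>a < b\<close> by (simp add: h_def field_simps)
      then have "i < n" using i by linarith
      moreover have "t \<in> {a + real i * h..a + real (Suc i) * h}"
        using i hp by (simp add: field_simps)
      ultimately have "\<gamma> t \<in> V i" by (simp add: V_def)
      then show ?thesis by blast
    qed
  qed
  have "hausdorff1_pre \<delta> (\<gamma> ` {a..b}) \<le> (\<Sum>i. ennreal (diameter (V i)))"
    unfolding hausdorff1_pre_def using cov bV order_trans[OF diam Lh] by (intro INF_lower) auto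
  also have "\<dots> = (\<Sum>i<n. ennreal (diameter (V i)))"
    by (rule suminf_finite) (auto simp: V_def)
  also have "\<dots> \<le> (\<Sum>i<n. ennreal (L * h))" by (intro sum_mono ennreal_leI diam)
  also have "\<dots> = ennreal (\<Sum>i<n. L * h)" using L h0 by (subst sum_ennreal) auto
  also have "(\<Sum>i<n. L * h) = L * (b - a)" using n0 by (simp add: h_def)
  finally show "hausdorff1_pre \<delta> (\<gamma> ` {a..b}) \<le> ennreal (L * (b - a))" .
qed

text \<open>Cover \<open>E\<close> by countably many non-overlapping closed intervals of total
  length at most the measure of \<open>E\<close> plus \<open>e / L\<close>, and use the Lipschitz
  bound on each of them.\<close>

lemma hausdorff1_outer_image_le:
  fixes \<gamma> :: "real \<Rightarrow> 'a::metric_space"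
  assumes E: "E \<in> sets borel" "E \<subseteq> {a..b}" and L: "0 < L"
    and lip: "\<And>s t. s \<in> {a..b} \<Longrightarrow> t \<in> {a..b} \<Longrightarrow> dist (\<gamma> s) (\<gamma> t) \<le> L * \<bar>s - t\<bar>"
  shows "hausdorff1_outer (\<gamma> ` E) \<le> ennreal L * emeasure lborel E"
proof (rule ennreal_le_epsilon)
  fix e :: real assume e: "0 < e"
  have lE: "E \<in> lmeasurable"
    using E by (intro bounded_set_imp_lmeasurable) (auto intro: bounded_subset[OF bounded_closed_interval])
  have Ecb: "E \<subseteq> cbox a b" and eL: "0 < e / L" using E e L by auto
  obtain \<D> where D: "countable \<D>"
        "\<And>K. K \<in> \<D> \<Longrightarrow> K \<subseteq> cbox a b \<and> K \<noteq> {} \<and> (\<exists>c d. K = cbox c d)"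
        "pairwise (\<lambda>A B. interior A \<inter> interior B = {}) \<D>"
        "\<And>u v. cbox u v \<in> \<D> \<Longrightarrow> \<exists>n. \<forall>i \<in> Basis. v \<bullet> i - u \<bullet> i = (b \<bullet> i - a \<bullet> i)/2^n"
        "\<And>K. \<lbrakk>K \<in> \<D>; box a b \<noteq> {}\<rbrakk> \<Longrightarrow> interior K \<noteq> {}"
        "E \<subseteq> \<Union>\<D>" "\<Union>\<D> \<in> lmeasurable" "measure lebesgue (\<Union>\<D>) \<le> measure lebesgue E + e / L"
    by (rule measurable_outer_intervals_bounded[OF lE Ecb eL], rule that) auto
  have D2: "\<exists>c d. c \<le> d \<and> K = {c..d}" if "K \<in> \<D>" for K
    using D(2)[OF that] by (metis atLeastatMost_empty cbox_interval not_le)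
  have HK: "hausdorff1_outer (\<gamma> ` K) \<le> ennreal L * emeasure lborel K" if K: "K \<in> \<D>" for K
  proof -
    obtain c d where cd: "K = {c..d}" "c \<le> d" using D2[OF K] by blast
    have "hausdorff1_outer (\<gamma> ` {c..d}) \<le> ennreal (L * (d - c))"
      using D(2)[OF K] cd by (intro hausdorff1_outer_interval_le lip L) auto
    then show ?thesis using cd L by (simp add: ennreal_mult)
  qed
  have "hausdorff1_outer (\<gamma> ` E) \<le> ennreal L * emeasure lborel (\<Union>\<D>)"
  proof (cases "\<D> = {}")
    case True
    then show ?thesis using D(6) by auto
  next
    case False
    define f where "f = from_nat_into \<D>"
    \<comment> \<open>An enumeration of the family may repeat intervals; \<open>g\<close> keeps the
      first occurrence and replaces later ones by the empty set, so that different indices have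
      disjoint interiors.\<close>
    define g where "g n = (if f n \<in> f ` {..<n} then {} else f n)" for n
    have fr: "range f = \<D>" using D(1) False by (simp add: f_def)
    have gU: "(\<Union>n. g n) = \<Union>\<D>"
    proof -
      have "\<exists>m. g m = f n" for n
      proof -
        define m where "m = (LEAST m. f m = f n)"
        have "f m = f n" unfolding m_def by (rule LeastI) simp
        moreover have "f l \<noteq> f n" if "l < m" for l using that not_less_Least m_def by blast
        ultimately have "g m = f n" by (auto simp: g_def)
        then show ?thesis by blast
      qed
      moreover have "g n \<subseteq> f n" for n by (auto simp: g_def)
      ultimately show ?thesis unfolding fr[symmetric] by (intro equalityI subsetI; clarsimp; metis subsetD)
    qed
    have gD: "g n = {} \<or> g n \<in> \<D>" for n using fr by (auto simp: g_def)
    have gI: "interior (g m) \<inter> interior (g n) = {}" if "m < n" for m n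
    proof (cases "g n = {} \<or> g m = {}")
      case False
      then have "g n = f n" "g m = f m" "f n \<noteq> f m" using that by (auto simp: g_def split: if_splits)
      moreover have "f n \<in> \<D>" "f m \<in> \<D>" using fr by auto
      ultimately show ?thesis using D(3) unfolding pairwise_def by metis
    qed auto
    have gm: "g n \<in> sets lborel" for n
    proof (cases "g n = {}")
      case False
      then obtain c d where "g n = {c..d}" using gD[of n] D2[of "g n"] by blast
      then show ?thesis by simp
    qed simp
    have gN: "emeasure lborel (g n - interior (g n)) = 0" for n
    proof -
      have "emeasure lborel ({c..d} - {c<..<d}) = 0" for c d :: real
      proof -
        have "{c..d} - {c<..<d} \<subseteq> {c, d}" by auto
        moreover have "emeasure lborel {c,d} = 0"
          by (intro emeasure_lborel_countable) auto
        ultimately show ?thesis by (metis emeasure_eq_0 insert_iff borel_closed closed_insert closed_empty sets_lborel)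
      qed
      moreover obtain c d where "g n = {c..d}"
        using gD[of n] D2[of "g n"] atLeastatMost_empty[of 0 "1::real"] by (metis atLeastatMost_empty zero_less_one)
      ultimately show ?thesis by (simp add: interior_atLeastAtMost_real)
    qed
    have "hausdorff1_outer (\<gamma> ` E) \<le> hausdorff1_outer (\<Union>n. \<gamma> ` g n)"
      using D(6) unfolding gU[symmetric] by (intro hausdorff1_outer_mono) blast
    also have "\<dots> \<le> (\<Sum>n. hausdorff1_outer (\<gamma> ` g n))"
      by (rule hausdorff1_outer_countably_subadditive)
    also have "\<dots> \<le> (\<Sum>n. ennreal L * emeasure lborel (g n))"
      using gD HK by (intro suminf_le allI) (metis emeasure_empty hausdorff1_outer_empty image_empty mult_zero_right order_refl, auto)
    also have "\<dots> = ennreal L * (\<Sum>n. emeasure lborel (g n))" by (rule ennreal_suminf_cmult)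
    \<comment> \<open>The closed intervals may share end points. Their interiors are truly disjoint
      and have the same measure, so countable additivity applies to them.\<close>
    also have "(\<Sum>n. emeasure lborel (g n)) = (\<Sum>n. emeasure lborel (interior (g n)))"
    proof (rule suminf_cong)
      fix n
      have "emeasure lborel (g n) = emeasure lborel (interior (g n)) + emeasure lborel (g n - interior (g n))"
        using gm[of n] by (subst plus_emeasure) (auto simp: interior_subset Un_absorb1)
      then show "emeasure lborel (g n) = emeasure lborel (interior (g n))" using gN by simp
    qed
    also have "\<dots> = emeasure lborel (\<Union>n. interior (g n))"
      using gI by (intro suminf_emeasure) (auto simp: disjoint_family_on_def, metis Int_commute disjoint_iff linorder_neqE_nat)
    also have "\<dots> \<le> emeasure lborel (\<Union>\<D>)"
      unfolding gU[symmetric] using interior_subset gm by (intro emeasure_mono) fastforce+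
    finally show ?thesis by (simp add: mult_left_mono)
  qed
  also have "\<dots> \<le> ennreal L * (emeasure lborel E + ennreal (e / L))"
  proof (intro mult_left_mono)
    have Dm: "\<Union>\<D> \<in> sets borel" using D(1) D2 by (intro sets.countable_Union) force+
    have "emeasure lborel (\<Union>\<D>) = ennreal (measure lebesgue (\<Union>\<D>))"
      using emeasure_eq_measure2[OF D(7)] Dm by simp
    also have "\<dots> \<le> ennreal (measure lebesgue E + e / L)" using D by (intro ennreal_leI)
    also have "\<dots> = ennreal (measure lebesgue E) + ennreal (e / L)" using e L by (intro ennreal_plus) auto
    also have "ennreal (measure lebesgue E) = emeasure lborel E"
      using emeasure_eq_measure2[OF lE] E by simp
    finally show "emeasure lborel (\<Union>\<D>) \<le> emeasure lborel E + ennreal (e / L)" .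
  qed auto
  also have "\<dots> = ennreal L * emeasure lborel E + ennreal e"
    using L e by (simp add: distrib_left ennreal_mult[symmetric])
  finally show "hausdorff1_outer (\<gamma> ` E) \<le> ennreal L * emeasure lborel E + ennreal e" .
qed

subsection \<open>Lebesgue measure on the plane\<close>

lemma Basis_real2: "(Basis :: (real^2) set) = {axis 1 1, axis 2 1}"
  by (auto simp: Basis_vec_def exhaust_2) (metis exhaust_2)

lemma inner_real2: "x \<bullet> y = x$1 * y$1 + x$2 * (y$2 :: real)" for x y :: "real^2"
  by (simp add: inner_vec_def sum_2)

lemma norm_real2: "(norm x)\<^sup>2 = (x$1)\<^sup>2 + (x$2 :: real)\<^sup>2" for x :: "real^2"
  unfolding power2_norm_eq_inner inner_real2 by (simp add: power2_eq_square)

lemma vector2_eta [simp]: "vector [x$1, x$2] = (x :: real^2)"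
  by (simp add: vec_eq_iff forall_2)

lemma vector2_eq: "(vector [a, b] :: real^2) = a *\<^sub>R axis 1 1 + b *\<^sub>R axis 2 1"
  by (simp add: vec_eq_iff forall_2 axis_def)

lemma measurable_vector2 [measurable (raw)]:
  assumes "f \<in> borel_measurable M" "g \<in> borel_measurable M"
  shows "(\<lambda>x. vector [f x, g x] :: real^2) \<in> borel_measurable M"
  unfolding vector2_eq using assms by measurable

lemma continuous_vector2 [continuous_intros]:
  assumes "continuous_on S f" "continuous_on S g"
  shows "continuous_on S (\<lambda>x. vector [f x, g x] :: real^2)"
  unfolding vector2_eq using assms by (intro continuous_intros)

lemma measurable_vec_nth_real2 [measurable]: "(\<lambda>x :: real^2. x $ i) \<in> borel_measurable borel"
  by (intro borel_measurable_continuous_onI continuous_intros)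

lemma measurable_cnj [measurable (raw)]:
  assumes "f \<in> borel_measurable M"
  shows "(\<lambda>x. cnj (f x)) \<in> borel_measurable M"
proof -
  have "cnj \<in> borel_measurable borel"
    by (intro borel_measurable_continuous_onI continuous_intros)
  from measurable_compose[OF assms this] show ?thesis .
qed

text \<open>A measure that agrees with volume on open boxes is \<open>lborel\<close>; this makes
  Fubini's theorem available on \<open>real ^ 2\<close>.\<close>

lemma lborel_real2: "(lborel :: (real^2) measure) = distr (lborel \<Otimes>\<^sub>M lborel) borel (\<lambda>(a, b). vector [a, b])"
proof (rule lborel_eqI)
  fix l u :: "real^2" assume lu: "\<And>b. b \<in> Basis \<Longrightarrow> l \<bullet> b \<le> u \<bullet> b"
  have m: "(\<lambda>(a, b). vector [a, b] :: real^2) \<in> borel_measurable (lborel \<Otimes>\<^sub>M lborel)"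
    by measurable
  have "(\<lambda>(a, b). vector [a, b] :: real^2) -` box l u \<inter> space (lborel \<Otimes>\<^sub>M lborel)
      = {l$1<..<u$1} \<times> {l$2<..<u$2}"
    by (auto simp: box_def Basis_real2 inner_axis' space_pair_measure inner_axis)
  then have "emeasure (distr (lborel \<Otimes>\<^sub>M lborel) borel (\<lambda>(a, b). vector [a, b])) (box l u)
     = emeasure (lborel \<Otimes>\<^sub>M lborel) ({l$1<..<u$1} \<times> {l$2<..<u$2})"
    by (subst emeasure_distr[OF m]) auto
  also have "\<dots> = emeasure lborel {l$1<..<u$1} * emeasure lborel {l$2<..<u$2}"
    by (rule lborel.emeasure_pair_measure_Times) auto
  also have "\<dots> = ennreal ((u$1 - l$1) * (u$2 - l$2))"
    using lu[of "axis 1 1"] lu[of "axis 2 1"] by (simp add: Basis_real2 inner_axis ennreal_mult[symmetric])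
  also have "(u$1 - l$1) * (u$2 - l$2) = (\<Prod>b\<in>Basis. (u - l) \<bullet> b)"
    by (simp add: Basis_real2 axis_eq_axis inner_axis)
  finally show "emeasure (distr (lborel \<Otimes>\<^sub>M lborel) borel (\<lambda>(a, b). vector [a, b])) (box l u)
      = (\<Prod>b\<in>Basis. (u - l) \<bullet> b)" .
qed simp

lemma nn_integral_real2:
  fixes f :: "real^2 \<Rightarrow> ennreal"
  assumes [measurable]: "f \<in> borel_measurable borel"
  shows "(\<integral>\<^sup>+x. f x \<partial>lborel) = (\<integral>\<^sup>+a. \<integral>\<^sup>+b. f (vector [a, b]) \<partial>lborel \<partial>lborel)"
proof -
  have "(\<integral>\<^sup>+x. f x \<partial>lborel) = (\<integral>\<^sup>+z. f (case z of (a, b) \<Rightarrow> vector [a, b]) \<partial>(lborel \<Otimes>\<^sub>M lborel))"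
    by (subst lborel_real2, subst nn_integral_distr) (auto simp: split_def)
  also have "\<dots> = (\<integral>\<^sup>+a. \<integral>\<^sup>+b. f (vector [a, b]) \<partial>lborel \<partial>lborel)"
    by (subst lborel.nn_integral_fst[symmetric]) auto
  finally show ?thesis .
qed

lemma integrable_pair_mult:
  fixes f :: "'a::euclidean_space \<Rightarrow> complex" and g :: "'b::euclidean_space \<Rightarrow> complex"
  assumes f: "integrable lborel f" and g: "integrable lborel g"
  shows "integrable (lborel \<Otimes>\<^sub>M lborel) (\<lambda>(x, y). f x * g y)"
proof (rule lborel_pair.Fubini_integrable)
  have [measurable]: "f \<in> borel_measurable borel" "g \<in> borel_measurable borel"
    using f g by (auto dest: borel_measurable_integrable)
  show "(\<lambda>(x, y). f x * g y) \<in> borel_measurable (lborel \<Otimes>\<^sub>M lborel)" by measurable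
  show "integrable lborel (\<lambda>x. \<integral>y. norm (case (x, y) of (x, y) \<Rightarrow> f x * g y) \<partial>lborel)"
    using f by (simp add: norm_mult)
  show "AE x in lborel. integrable lborel (\<lambda>y. case (x, y) of (x, y) \<Rightarrow> f x * g y)"
    using g by simp
qed

lemma real2_integral_prod:
  fixes f g :: "real \<Rightarrow> complex"
  assumes f: "integrable lborel f" and g: "integrable lborel g"
  shows "integrable lborel (\<lambda>x :: real^2. f (x$1) * g (x$2))"
    and "(LINT x|lborel. f ((x :: real^2)$1) * g (x$2)) = (LINT a|lborel. f a) * (LINT b|lborel. g b)"
proof -
  have [measurable]: "f \<in> borel_measurable borel" "g \<in> borel_measurable borel"
    using f g by (auto dest: borel_measurable_integrable)
  note I = integrable_pair_mult[OF f g]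
  show "integrable lborel (\<lambda>x :: real^2. f (x$1) * g (x$2))"
    using I by (subst lborel_real2, subst integrable_distr_eq) (auto simp: split_def)
  have "(LINT x|lborel. f ((x :: real^2)$1) * g (x$2)) = integral\<^sup>L (lborel \<Otimes>\<^sub>M lborel) (\<lambda>(a, b). f a * g b)"
    by (subst lborel_real2, subst integral_distr) (auto simp: split_def)
  also have "\<dots> = (LINT a|lborel. LINT b|lborel. f a * g b)"
    by (rule lborel_pair.integral_fst[OF I, symmetric])
  also have "\<dots> = (LINT a|lborel. f a) * (LINT b|lborel. g b)" by simp
  finally show "(LINT x|lborel. f ((x :: real^2)$1) * g (x$2)) = (LINT a|lborel. f a) * (LINT b|lborel. g b)" .
qed

lemma nn_integral_lborel_affine:
  fixes f :: "'a::euclidean_space \<Rightarrow> ennreal"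
  assumes [measurable]: "f \<in> borel_measurable borel" and c: "c \<noteq> 0"
  shows "(\<integral>\<^sup>+x. f x \<partial>lborel) = ennreal (\<bar>c\<bar> ^ DIM('a)) * (\<integral>\<^sup>+x. f (t + c *\<^sub>R x) \<partial>lborel)"
  by (subst lborel_affine[OF c, of t])
     (simp add: nn_integral_density nn_integral_distr nn_integral_cmult)

lemma integral_lborel_affine:
  fixes f :: "'a::euclidean_space \<Rightarrow> complex"
  assumes [measurable]: "f \<in> borel_measurable borel" and c: "c \<noteq> 0"
  shows "(LINT x|lborel. f x) = (\<bar>c\<bar> ^ DIM('a)) *\<^sub>R (LINT x|lborel. f (t + c *\<^sub>R x))"
  by (subst lborel_affine[OF c, of t])
     (simp add: integral_density integral_distr)

subsection \<open>The Fourier transform of integrable functions\<close>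

definition fchar :: "real \<Rightarrow> complex" where
  "fchar t = exp (- (2 * of_real pi * \<i> * of_real t))"

lemma norm_fchar [simp]: "norm (fchar t) = 1"
  by (simp add: fchar_def norm_exp_eq_Re)

lemma fchar_add: "fchar (s + t) = fchar s * fchar t"
  by (simp add: fchar_def exp_add[symmetric] algebra_simps)

lemma fchar_0 [simp]: "fchar 0 = 1" by (simp add: fchar_def)

lemma fchar_minus: "fchar (- t) = cnj (fchar t)"
  by (simp add: fchar_def exp_cnj)

lemma fchar_diff: "fchar (s - t) = fchar s * cnj (fchar t)"
  using fchar_add[of s "- t"] by (simp add: fchar_minus)

lemma continuous_fchar [continuous_intros]: "continuous_on S f \<Longrightarrow> continuous_on S (\<lambda>x. fchar (f x))"
  unfolding fchar_def by (intro continuous_intros)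

lemma measurable_fchar [measurable]: "fchar \<in> borel_measurable borel"
  by (intro borel_measurable_continuous_onI continuous_intros)

lemma fourier_transform_fchar: "fourier_transform f \<xi> = (LINT x|lborel. fchar (\<xi> \<bullet> x) * f x)"
  by (simp add: fourier_transform_def fchar_def)

lemma integrable_fchar_mult:
  fixes f :: "'a::euclidean_space \<Rightarrow> complex"
  assumes "integrable lborel f"
  shows "integrable lborel (\<lambda>x. fchar (\<xi> \<bullet> x) * f x)"
proof (rule Bochner_Integration.integrable_bound[OF assms])
  have [measurable]: "f \<in> borel_measurable borel" using assms by (auto dest: borel_measurable_integrable)
  show "(\<lambda>x. fchar (\<xi> \<bullet> x) * f x) \<in> borel_measurable lborel" by measurable
qed (simp add: norm_mult)

lemma norm_fourier_transform_le:
  fixes f :: "'a::euclidean_space \<Rightarrow> complex"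
  shows "norm (fourier_transform f \<xi>) \<le> (LINT x|lborel. norm (f x))"
proof -
  have "norm (fourier_transform f \<xi>) \<le> (LINT x|lborel. norm (fchar (\<xi> \<bullet> x) * f x))"
    unfolding fourier_transform_fchar by (rule integral_norm_bound)
  then show ?thesis by (simp add: norm_mult)
qed

lemma continuous_fourier_transform:
  fixes f :: "'a::euclidean_space \<Rightarrow> complex"
  assumes f: "integrable lborel f"
  shows "continuous_on UNIV (fourier_transform f)"
proof -
  have [measurable]: "f \<in> borel_measurable borel" using f by (auto dest: borel_measurable_integrable)
  have "isCont (fourier_transform f) \<xi>" for \<xi>
  proof (rule continuous_at_sequentiallyI)
    fix u assume u: "u \<longlonglongrightarrow> \<xi>"
    show "(\<lambda>n. fourier_transform f (u n)) \<longlonglongrightarrow> fourier_transform f \<xi>"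
      unfolding fourier_transform_fchar
    proof (rule integral_dominated_convergence[where w = "\<lambda>x. norm (f x)"])
      show "AE x in lborel. (\<lambda>n. fchar (u n \<bullet> x) * f x) \<longlonglongrightarrow> fchar (\<xi> \<bullet> x) * f x"
        unfolding fchar_def by (intro AE_I2 tendsto_intros u)
    qed (use f in \<open>auto simp: norm_mult\<close>)
  qed
  then show ?thesis by (simp add: continuous_at_imp_continuous_on)
qed

lemma fourier_transform_diff:
  fixes f g :: "'a::euclidean_space \<Rightarrow> complex"
  assumes "integrable lborel f" "integrable lborel g"
  shows "fourier_transform (\<lambda>x. f x - g x) \<xi> = fourier_transform f \<xi> - fourier_transform g \<xi>"
  unfolding fourier_transform_fchar right_diff_distrib
  by (rule Bochner_Integration.integral_diff) (intro integrable_fchar_mult assms)+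

lemma fourier_transform_add:
  fixes f g :: "'a::euclidean_space \<Rightarrow> complex"
  assumes "integrable lborel f" "integrable lborel g"
  shows "fourier_transform (\<lambda>x. f x + g x) \<xi> = fourier_transform f \<xi> + fourier_transform g \<xi>"
  unfolding fourier_transform_fchar distrib_left
  by (rule Bochner_Integration.integral_add) (intro integrable_fchar_mult assms)+

lemma fourier_transform_cmult:
  fixes f :: "'a::euclidean_space \<Rightarrow> complex"
  shows "fourier_transform (\<lambda>x. c * f x) \<xi> = c * fourier_transform f \<xi>"
  by (simp add: fourier_transform_fchar mult.left_commute)

subsection \<open>Plancherel's theorem\<close>

text \<open>After the scaling \<open>u = \<sigma> t\<close> this is the characteristic function of
  the standard normal distribution at \<open>- 2 pi s / \<sigma>\<close>.\<close>

lemma gauss_transform_1: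
  assumes \<sigma>: "0 < \<sigma>"
  shows "integrable lborel (\<lambda>t. fchar (s * t) * of_real (exp (- (\<sigma> * t)\<^sup>2 / 2)))"
    and "(LINT t|lborel. fchar (s * t) * of_real (exp (- (\<sigma> * t)\<^sup>2 / 2)))
         = of_real (sqrt (2 * pi) / \<sigma> * exp (- 2 * pi\<^sup>2 * (s / \<sigma>)\<^sup>2))"
proof -
  define h where "h u = std_normal_density u *\<^sub>R iexp ((- 2 * pi * s / \<sigma>) * u)" for u
  have hm: "h \<in> borel_measurable borel" unfolding h_def by measurable
  have hint: "integrable lborel h"
    by (rule Bochner_Integration.integrable_bound[OF integrable_normal_density[of 1 0]]) (use hm in \<open>auto simp: h_def\<close>)
  have "char std_normal_distribution (- 2 * pi * s / \<sigma>) = (LINT u|lborel. h u)"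
    unfolding char_def h_def by (subst integral_density) auto
  then have hval: "(LINT u|lborel. h u) = of_real (exp (- ((- 2 * pi * s / \<sigma>)\<^sup>2) / 2))"
    by (simp add: char_std_normal_distribution)
  have eq: "fchar (s * t) * of_real (exp (- (\<sigma> * t)\<^sup>2 / 2)) = of_real (sqrt (2 * pi)) * h (0 + \<sigma> * t)" for t
    using \<sigma> by (simp add: h_def std_normal_density_def fchar_def scaleR_conv_of_real field_simps)
  show "integrable lborel (\<lambda>t. fchar (s * t) * of_real (exp (- (\<sigma> * t)\<^sup>2 / 2)))"
    unfolding eq using \<sigma> by (intro integrable_mult_right lborel_integrable_real_affine[OF hint]) auto
  have "(LINT u|lborel. h u) = \<sigma> *\<^sub>R (LINT t|lborel. h (0 + \<sigma> * t))"
    using \<sigma> lborel_integral_real_affine[of \<sigma> h 0] by simp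
  then have "(LINT t|lborel. h (0 + \<sigma> * t)) = of_real (exp (- ((- 2 * pi * s / \<sigma>)\<^sup>2) / 2)) / of_real \<sigma>"
    using \<sigma> by (simp add: hval scaleR_conv_of_real field_simps)
  then show "(LINT t|lborel. fchar (s * t) * of_real (exp (- (\<sigma> * t)\<^sup>2 / 2)))
         = of_real (sqrt (2 * pi) / \<sigma> * exp (- 2 * pi\<^sup>2 * (s / \<sigma>)\<^sup>2))"
    unfolding eq integral_mult_right_zero using \<sigma> by (simp add: power2_eq_square field_simps)
qed

text \<open>The Fourier transform of \<open>exp (- |\<xi>|^2 / 2)\<close> on the plane, and at the
  same time a probability density; its dilates form the approximate identity used for Plancherel's
  theorem.\<close>

definition gauss2 :: "real^2 \<Rightarrow> real" where
  "gauss2 z = 2 * pi * exp (- 2 * pi\<^sup>2 * (norm z)\<^sup>2)"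

lemma gauss2_nonneg [simp]: "0 \<le> gauss2 z" by (simp add: gauss2_def)

lemma measurable_gauss2 [measurable]: "gauss2 \<in> borel_measurable borel"
  unfolding gauss2_def by measurable

lemma gauss2_minus [simp]: "gauss2 (- z) = gauss2 z" by (simp add: gauss2_def)

lemma gauss_transform_2:
  assumes \<sigma>: "0 < \<sigma>"
  shows "integrable lborel (\<lambda>\<xi> :: real^2. fchar (\<xi> \<bullet> x) * of_real (exp (- (\<sigma> * norm \<xi>)\<^sup>2 / 2)))"
    and "(LINT \<xi>|lborel. fchar (\<xi> \<bullet> x) * of_real (exp (- (\<sigma> * norm \<xi>)\<^sup>2 / 2)))
         = of_real (gauss2 (x /\<^sub>R \<sigma>) / \<sigma>\<^sup>2)"
proof -
  have eq: "fchar (\<xi> \<bullet> x) * of_real (exp (- (\<sigma> * norm \<xi>)\<^sup>2 / 2)) =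
     (fchar (x$1 * \<xi>$1) * of_real (exp (- (\<sigma> * \<xi>$1)\<^sup>2 / 2))) * (fchar (x$2 * \<xi>$2) * of_real (exp (- (\<sigma> * \<xi>$2)\<^sup>2 / 2)))"
    for \<xi> :: "real^2"
  proof -
    have "exp (- (\<sigma> * norm \<xi>)\<^sup>2 / 2) = exp (- (\<sigma> * \<xi>$1)\<^sup>2 / 2) * exp (- (\<sigma> * \<xi>$2)\<^sup>2 / 2)"
      by (simp add: power_mult_distrib norm_real2 exp_add[symmetric] field_simps)
    then show ?thesis by (simp add: inner_real2 fchar_add mult_ac)
  qed
  note I = gauss_transform_1[OF \<sigma>]
  show "integrable lborel (\<lambda>\<xi> :: real^2. fchar (\<xi> \<bullet> x) * of_real (exp (- (\<sigma> * norm \<xi>)\<^sup>2 / 2)))"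
    unfolding eq by (rule real2_integral_prod(1)[OF I(1) I(1)])
  have "(LINT \<xi>|lborel. fchar (\<xi> \<bullet> x) * of_real (exp (- (\<sigma> * norm \<xi>)\<^sup>2 / 2)))
      = of_real ((sqrt (2 * pi) / \<sigma> * exp (- 2 * pi\<^sup>2 * (x$1 / \<sigma>)\<^sup>2)) * (sqrt (2 * pi) / \<sigma> * exp (- 2 * pi\<^sup>2 * (x$2 / \<sigma>)\<^sup>2)))"
    unfolding eq real2_integral_prod(2)[OF I(1) I(1)] I(2) by simp
  also have "(sqrt (2 * pi) / \<sigma> * exp (- 2 * pi\<^sup>2 * (x$1 / \<sigma>)\<^sup>2)) * (sqrt (2 * pi) / \<sigma> * exp (- 2 * pi\<^sup>2 * (x$2 / \<sigma>)\<^sup>2))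
     = (2 * pi / \<sigma>\<^sup>2) * (exp (- 2 * pi\<^sup>2 * (x$1 / \<sigma>)\<^sup>2) * exp (- 2 * pi\<^sup>2 * (x$2 / \<sigma>)\<^sup>2))"
    using \<sigma> real_sqrt_mult_self[of "2 * pi"] by (simp add: power2_eq_square)
  also have "exp (- 2 * pi\<^sup>2 * (x$1 / \<sigma>)\<^sup>2) * exp (- 2 * pi\<^sup>2 * (x$2 / \<sigma>)\<^sup>2) = exp (- 2 * pi\<^sup>2 * (norm (x /\<^sub>R \<sigma>))\<^sup>2)"
    unfolding norm_real2 using \<sigma> by (simp add: exp_add[symmetric] field_simps)
  finally show "(LINT \<xi>|lborel. fchar (\<xi> \<bullet> x) * of_real (exp (- (\<sigma> * norm \<xi>)\<^sup>2 / 2)))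
         = of_real (gauss2 (x /\<^sub>R \<sigma>) / \<sigma>\<^sup>2)"
    by (simp add: gauss2_def)
qed

lemma gauss2_integral: "integrable lborel gauss2" "(LINT z|lborel. gauss2 z) = 1"
proof -
  define d where "d t = sqrt (2 * pi) * exp (- 2 * pi\<^sup>2 * t\<^sup>2)" for t
  \<comment> \<open>In each coordinate the density is the centered normal one with standard
    deviation \<open>1 / (2 pi)\<close>.\<close>
  have d: "d = normal_density 0 (1 / (2 * pi))"
  proof
    fix t
    have "sqrt (2 * pi * (1 / (2 * pi))\<^sup>2) = 1 / sqrt (2 * pi)"
      by (simp add: real_sqrt_mult real_sqrt_divide power2_eq_square field_simps)
    then show "d t = normal_density 0 (1 / (2 * pi)) t"
      by (simp add: d_def normal_density_def power2_eq_square field_simps)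
  qed
  have dI: "integrable lborel d" "(LINT t|lborel. d t) = 1"
    unfolding d by (auto intro: integrable_normal_density integral_normal_density)
  have dC: "integrable lborel (\<lambda>t. complex_of_real (d t))" using dI by simp
  have eq: "complex_of_real (gauss2 z) = of_real (d (z$1)) * of_real (d (z$2))" for z
  proof -
    have "d (z$1) * d (z$2) = (sqrt (2*pi) * sqrt (2*pi)) * (exp (- 2 * pi\<^sup>2 * (z$1)\<^sup>2) * exp (- 2 * pi\<^sup>2 * (z$2)\<^sup>2))"
      by (simp add: d_def)
    also have "\<dots> = gauss2 z"
      unfolding gauss2_def norm_real2 by (simp add: exp_add[symmetric] algebra_simps)
    finally show ?thesis by (simp flip: of_real_mult)
  qed
  have "integrable lborel (\<lambda>z. complex_of_real (gauss2 z))"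
    unfolding eq by (rule real2_integral_prod(1)[OF dC dC])
  then show gi: "integrable lborel gauss2" by (simp add: complex_of_real_integrable_eq)
  have "complex_of_real (LINT z|lborel. gauss2 z) = (LINT z|lborel. complex_of_real (gauss2 z))" by simp
  also have "\<dots> = 1"
    unfolding eq real2_integral_prod(2)[OF dC dC] using dI by simp
  finally show "(LINT z|lborel. gauss2 z) = 1" using of_real_eq_1_iff by blast
qed

lemma nn_integral_gauss2_scaled:
  assumes "0 < \<sigma>"
  shows "(\<integral>\<^sup>+y. ennreal (gauss2 ((x - y) /\<^sub>R \<sigma>) / \<sigma>\<^sup>2) \<partial>lborel) = 1"
proof -
  have "(\<integral>\<^sup>+y. ennreal (gauss2 ((x - y) /\<^sub>R \<sigma>) / \<sigma>\<^sup>2) \<partial>lborel)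
    = ennreal (\<bar>- \<sigma>\<bar> ^ DIM(real^2)) * (\<integral>\<^sup>+z. ennreal (gauss2 ((x - (x + (- \<sigma>) *\<^sub>R z)) /\<^sub>R \<sigma>) / \<sigma>\<^sup>2) \<partial>lborel)"
    using assms by (intro nn_integral_lborel_affine) auto
  also have "\<dots> = (\<integral>\<^sup>+z. ennreal (\<sigma>\<^sup>2) * ennreal (gauss2 z / \<sigma>\<^sup>2) \<partial>lborel)"
    using assms by (simp add: nn_integral_cmult)
  also have "\<dots> = (\<integral>\<^sup>+z. ennreal (gauss2 z) \<partial>lborel)"
    using assms by (intro nn_integral_cong) (simp add: ennreal_mult[symmetric])
  also have "\<dots> = 1" using gauss2_integral by (subst nn_integral_eq_integral) auto
  finally show ?thesis .
qed

text \<open>For \<open>f\<close> merely integrable, the square of its transform need not be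
  integrable. The Gaussian factor makes the double integrals absolutely convergent, so Fubini's
  theorem applies twice, once to open the transform and once to open its conjugate; the remaining
  frequency integral is a Gaussian transform at \<open>x - y\<close>.\<close>

lemma gauss_energy:
  fixes f :: "real^2 \<Rightarrow> complex"
  assumes f: "integrable lborel f" and \<sigma>: "0 < \<sigma>"
  shows "(LINT \<xi>|lborel. of_real (exp (- (\<sigma> * norm \<xi>)\<^sup>2 / 2) * (norm (fourier_transform f \<xi>))\<^sup>2))
    = (LINT x|lborel. f x * (LINT y|lborel. cnj (f y) * of_real (gauss2 ((x - y) /\<^sub>R \<sigma>) / \<sigma>\<^sup>2)))"
proof -
  define g where "g \<xi> = complex_of_real (exp (- (\<sigma> * norm \<xi>)\<^sup>2 / 2))" for \<xi> :: "real^2"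
  define F where "F = fourier_transform f"
  have [measurable]: "f \<in> borel_measurable borel" using f by (auto dest: borel_measurable_integrable)
  have [measurable]: "F \<in> borel_measurable borel"
    unfolding F_def using continuous_fourier_transform[OF f] by (rule borel_measurable_continuous_onI)
  have [measurable]: "g \<in> borel_measurable borel" unfolding g_def by measurable
  have g: "integrable lborel g"
    using gauss_transform_2(1)[OF \<sigma>, of 0] unfolding g_def by simp
  have gF: "integrable lborel (\<lambda>\<xi>. g \<xi> * cnj (F \<xi>))"
  proof (rule Bochner_Integration.integrable_bound)
    show "integrable lborel (\<lambda>\<xi>. (LINT x|lborel. norm (f x)) *\<^sub>R g \<xi>)" using g by simp
    show "AE x in lborel. norm (g x * cnj (F x)) \<le> norm ((LINT x|lborel. norm (f x)) *\<^sub>R g x)"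
    proof (rule AE_I2)
      fix \<xi> :: "real^2"
      have "norm (F \<xi>) \<le> \<bar>LINT x|lborel. norm (f x)\<bar>"
        unfolding F_def by (rule order_trans[OF norm_fourier_transform_le]) simp
      then show "norm (g \<xi> * cnj (F \<xi>)) \<le> norm ((LINT x|lborel. norm (f x)) *\<^sub>R g \<xi>)"
        by (simp add: norm_mult mult.commute[of _ "norm (g \<xi>)"] mult_left_mono)
    qed
  qed measurable
  have intA: "integrable (lborel \<Otimes>\<^sub>M lborel) (\<lambda>(x, \<xi>). fchar (\<xi> \<bullet> x) * (f x * (g \<xi> * cnj (F \<xi>))))"
    by (rule Bochner_Integration.integrable_bound[OF integrable_pair_mult[OF f gF]]) (auto simp: norm_mult)
  have intB: "integrable (lborel \<Otimes>\<^sub>M lborel) (\<lambda>(y, \<xi>). fchar (\<xi> \<bullet> (x - y)) * (cnj (f y) * g \<xi>))" for x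
    by (rule Bochner_Integration.integrable_bound[OF integrable_pair_mult[OF f g]]) (auto simp: norm_mult)
  have "(LINT \<xi>|lborel. of_real (exp (- (\<sigma> * norm \<xi>)\<^sup>2 / 2) * (norm (fourier_transform f \<xi>))\<^sup>2))
     = (LINT \<xi>|lborel. F \<xi> * (g \<xi> * cnj (F \<xi>)))"
    by (intro Bochner_Integration.integral_cong refl)
       (simp add: g_def F_def complex_norm_square mult_ac del: of_real_exp flip: of_real_power)
  also have "\<dots> = (LINT \<xi>|lborel. LINT x|lborel. fchar (\<xi> \<bullet> x) * (f x * (g \<xi> * cnj (F \<xi>))))"
    unfolding F_def fourier_transform_fchar[of f]
    by (subst integral_mult_left_zero[symmetric]) (simp add: mult.assoc)
  also have "\<dots> = (LINT x|lborel. LINT \<xi>|lborel. fchar (\<xi> \<bullet> x) * (f x * (g \<xi> * cnj (F \<xi>))))"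
    by (rule lborel_pair.Fubini_integral[OF intA])
  also have "\<dots> = (LINT x|lborel. f x * (LINT y|lborel. cnj (f y) * of_real (gauss2 ((x - y) /\<^sub>R \<sigma>) / \<sigma>\<^sup>2)))"
  proof (intro Bochner_Integration.integral_cong refl)
    fix x :: "real^2"
    have "(LINT \<xi>|lborel. fchar (\<xi> \<bullet> x) * (f x * (g \<xi> * cnj (F \<xi>))))
        = f x * (LINT \<xi>|lborel. fchar (\<xi> \<bullet> x) * g \<xi> * cnj (F \<xi>))"
      by (subst integral_mult_right_zero[symmetric]) (simp add: mult_ac)
    also have "(LINT \<xi>|lborel. fchar (\<xi> \<bullet> x) * g \<xi> * cnj (F \<xi>))
       = (LINT \<xi>|lborel. LINT y|lborel. fchar (\<xi> \<bullet> (x - y)) * (cnj (f y) * g \<xi>))"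
    proof (intro Bochner_Integration.integral_cong refl)
      fix \<xi> :: "real^2"
      have "cnj (F \<xi>) = (LINT y|lborel. cnj (fchar (\<xi> \<bullet> y) * f y))"
        unfolding F_def fourier_transform_fchar by (rule Bochner_Integration.integral_cnj[symmetric])
      then show "fchar (\<xi> \<bullet> x) * g \<xi> * cnj (F \<xi>) = (LINT y|lborel. fchar (\<xi> \<bullet> (x - y)) * (cnj (f y) * g \<xi>))"
        by (simp only: integral_mult_right_zero[symmetric]) (simp add: inner_diff_right fchar_diff mult_ac)
    qed
    also have "\<dots> = (LINT y|lborel. LINT \<xi>|lborel. fchar (\<xi> \<bullet> (x - y)) * (cnj (f y) * g \<xi>))"
      by (rule lborel_pair.Fubini_integral[OF intB])
    also have "\<dots> = (LINT y|lborel. cnj (f y) * (LINT \<xi>|lborel. fchar (\<xi> \<bullet> (x - y)) * g \<xi>))"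
      by (subst integral_mult_right_zero[symmetric]) (simp add: mult_ac)
    also have "\<dots> = (LINT y|lborel. cnj (f y) * of_real (gauss2 ((x - y) /\<^sub>R \<sigma>) / \<sigma>\<^sup>2))"
      unfolding g_def gauss_transform_2(2)[OF \<sigma>] ..
    finally show "(LINT \<xi>|lborel. fchar (\<xi> \<bullet> x) * (f x * (g \<xi> * cnj (F \<xi>))))
       = f x * (LINT y|lborel. cnj (f y) * of_real (gauss2 ((x - y) /\<^sub>R \<sigma>) / \<sigma>\<^sup>2))" .
  qed
  finally show ?thesis .
qed

lemma norm_integral_le_nn_integral:
  fixes f :: "'a \<Rightarrow> 'b::{banach, second_countable_topology}"
  shows "ennreal (norm (integral\<^sup>L M f)) \<le> (\<integral>\<^sup>+x. ennreal (norm (f x)) \<partial>M)"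
  by (cases "integrable M f") (auto intro: integral_norm_bound_ennreal simp: not_integrable_integral_eq)

text \<open>In \<open>gauss_energy\<close> the kernel \<open>K\<close> is symmetric with total mass
  1, so \<open>|f x| |f y| <= (|f x|^2 + |f y|^2) / 2\<close> bounds the regularised energy
  uniformly in \<sigma> (Schur's test). Fatou's lemma for \<sigma> tending to 0 removes the
  Gaussian. The right-hand side is allowed to be infinite.\<close>

lemma plancherel_le:
  fixes f :: "real^2 \<Rightarrow> complex"
  assumes f: "integrable lborel f"
  shows "(\<integral>\<^sup>+\<xi>. ennreal ((norm (fourier_transform f \<xi>))\<^sup>2) \<partial>lborel) \<le> (\<integral>\<^sup>+x. ennreal ((norm (f x))\<^sup>2) \<partial>lborel)"
proof -
  define F where "F = fourier_transform f"
  have [measurable]: "f \<in> borel_measurable borel" using f by (auto dest: borel_measurable_integrable)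
  have [measurable]: "F \<in> borel_measurable borel"
    unfolding F_def using continuous_fourier_transform[OF f] by (rule borel_measurable_continuous_onI)
  define G where "G \<sigma> \<xi> = exp (- (\<sigma> * norm \<xi>)\<^sup>2 / 2) * (norm (F \<xi>))\<^sup>2" for \<sigma> and \<xi> :: "real^2"
  have [measurable]: "G \<sigma> \<in> borel_measurable borel" for \<sigma> unfolding G_def by measurable
  have G0: "0 \<le> G \<sigma> \<xi>" for \<sigma> \<xi> by (simp add: G_def)
  define K where "K \<sigma> x y = gauss2 ((x - y) /\<^sub>R \<sigma>) / \<sigma>\<^sup>2" for \<sigma> x y
  have K0: "0 \<le> K \<sigma> x y" for \<sigma> x y by (simp add: K_def)
  have Kc: "K \<sigma> x y = K \<sigma> y x" for \<sigma> x y
    using gauss2_minus[of "(x - y) /\<^sub>R \<sigma>"] by (simp add: K_def scaleR_right_diff_distrib)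
  have [measurable]: "case_prod (K \<sigma>) \<in> borel_measurable (borel \<Otimes>\<^sub>M borel)" for \<sigma>
    unfolding K_def by measurable
  have K1: "(\<integral>\<^sup>+y. ennreal (K \<sigma> x y) \<partial>lborel) = 1" if "0 < \<sigma>" for \<sigma> x
    unfolding K_def by (rule nn_integral_gauss2_scaled[OF that])
  have bound: "(\<integral>\<^sup>+\<xi>. ennreal (G \<sigma> \<xi>) \<partial>lborel) \<le> (\<integral>\<^sup>+x. ennreal ((norm (f x))\<^sup>2) \<partial>lborel)" if \<sigma>: "0 < \<sigma>" for \<sigma>
  proof -
    have gi: "integrable lborel (\<lambda>\<xi> :: real^2. exp (- (\<sigma> * norm \<xi>)\<^sup>2 / 2))"
      using gauss_transform_2(1)[OF \<sigma>, of 0] by (simp add: complex_of_real_integrable_eq del: of_real_exp)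
    have Gi: "integrable lborel (G \<sigma>)"
    proof (rule Bochner_Integration.integrable_bound)
      show "integrable lborel (\<lambda>\<xi> :: real^2. exp (- (\<sigma> * norm \<xi>)\<^sup>2 / 2) * (LINT x|lborel. norm (f x))\<^sup>2)"
        using gi by simp
      show "AE \<xi> in lborel. norm (G \<sigma> \<xi>) \<le> norm (exp (- (\<sigma> * norm \<xi>)\<^sup>2 / 2) * (LINT x|lborel. norm (f x))\<^sup>2)"
        unfolding G_def F_def using norm_fourier_transform_le[of f]
        by (intro AE_I2) (auto simp: abs_mult intro!: mult_left_mono power_mono)
    qed measurable
    have "(\<integral>\<^sup>+\<xi>. ennreal (G \<sigma> \<xi>) \<partial>lborel) = ennreal (LINT \<xi>|lborel. G \<sigma> \<xi>)"
      by (rule nn_integral_eq_integral[OF Gi]) (simp add: G0)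
    also have "(LINT \<xi>|lborel. G \<sigma> \<xi>) = norm (LINT \<xi>|lborel. complex_of_real (G \<sigma> \<xi>))"
      by (simp add: integral_nonneg_AE G0)
    also have "(LINT \<xi>|lborel. complex_of_real (G \<sigma> \<xi>))
        = (LINT x|lborel. f x * (LINT y|lborel. cnj (f y) * of_real (K \<sigma> x y)))"
      unfolding G_def F_def K_def by (rule gauss_energy[OF f \<sigma>])
    also have "ennreal (norm \<dots>) \<le> (\<integral>\<^sup>+x. ennreal (norm (f x * (LINT y|lborel. cnj (f y) * of_real (K \<sigma> x y)))) \<partial>lborel)"
      by (rule norm_integral_le_nn_integral)
    also have "\<dots> \<le> (\<integral>\<^sup>+x. \<integral>\<^sup>+y. (ennreal ((norm (f x))\<^sup>2 / 2) * ennreal (K \<sigma> x y) + ennreal ((norm (f y))\<^sup>2 / 2) * ennreal (K \<sigma> x y)) \<partial>lborel \<partial>lborel)"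
    proof (rule nn_integral_mono)
      fix x :: "real^2"
      have "ennreal (norm (f x * (LINT y|lborel. cnj (f y) * of_real (K \<sigma> x y))))
         = ennreal (norm (LINT y|lborel. f x * (cnj (f y) * of_real (K \<sigma> x y))))" by simp
      also have "\<dots> \<le> (\<integral>\<^sup>+y. ennreal (norm (f x * (cnj (f y) * of_real (K \<sigma> x y)))) \<partial>lborel)"
        by (rule norm_integral_le_nn_integral)
      also have "\<dots> \<le> (\<integral>\<^sup>+y. (ennreal ((norm (f x))\<^sup>2 / 2) * ennreal (K \<sigma> x y) + ennreal ((norm (f y))\<^sup>2 / 2) * ennreal (K \<sigma> x y)) \<partial>lborel)"
      proof (rule nn_integral_mono)
        fix y :: "real^2"
        have "norm (f x) * norm (f y) \<le> (norm (f x))\<^sup>2 / 2 + (norm (f y))\<^sup>2 / 2"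
          using sum_squares_bound[of "norm (f x)" "norm (f y)"] by simp
        then have "norm (f x) * norm (f y) * K \<sigma> x y \<le> ((norm (f x))\<^sup>2 / 2 + (norm (f y))\<^sup>2 / 2) * K \<sigma> x y"
          by (intro mult_right_mono K0)
        then show "ennreal (norm (f x * (cnj (f y) * of_real (K \<sigma> x y))))
          \<le> ennreal ((norm (f x))\<^sup>2 / 2) * ennreal (K \<sigma> x y) + ennreal ((norm (f y))\<^sup>2 / 2) * ennreal (K \<sigma> x y)"
          using K0 by (simp add: norm_mult ennreal_mult[symmetric] ennreal_plus[symmetric] distrib_right mult.assoc ennreal_leI del: ennreal_plus)
      qed
      finally show "ennreal (norm (f x * (LINT y|lborel. cnj (f y) * of_real (K \<sigma> x y))))
         \<le> (\<integral>\<^sup>+y. (ennreal ((norm (f x))\<^sup>2 / 2) * ennreal (K \<sigma> x y) + ennreal ((norm (f y))\<^sup>2 / 2) * ennreal (K \<sigma> x y)) \<partial>lborel)" .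
    qed
    also have "\<dots> = (\<integral>\<^sup>+x. ennreal ((norm (f x))\<^sup>2 / 2) * (\<integral>\<^sup>+y. ennreal (K \<sigma> x y) \<partial>lborel) \<partial>lborel)
        + (\<integral>\<^sup>+x. \<integral>\<^sup>+y. ennreal ((norm (f y))\<^sup>2 / 2) * ennreal (K \<sigma> x y) \<partial>lborel \<partial>lborel)"
      by (simp add: nn_integral_add nn_integral_cmult)
    also have "(\<integral>\<^sup>+x. \<integral>\<^sup>+y. ennreal ((norm (f y))\<^sup>2 / 2) * ennreal (K \<sigma> x y) \<partial>lborel \<partial>lborel)
       = (\<integral>\<^sup>+y. \<integral>\<^sup>+x. ennreal ((norm (f y))\<^sup>2 / 2) * ennreal (K \<sigma> x y) \<partial>lborel \<partial>lborel)"
      by (rule lborel_pair.Fubini') measurable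
    also have "\<dots> = (\<integral>\<^sup>+y. ennreal ((norm (f y))\<^sup>2 / 2) * (\<integral>\<^sup>+x. ennreal (K \<sigma> y x) \<partial>lborel) \<partial>lborel)"
      by (simp add: nn_integral_cmult Kc[of \<sigma> _ _])
    also have "(\<integral>\<^sup>+x. ennreal ((norm (f x))\<^sup>2 / 2) * (\<integral>\<^sup>+y. ennreal (K \<sigma> x y) \<partial>lborel) \<partial>lborel) + \<dots>
       = (\<integral>\<^sup>+x. ennreal ((norm (f x))\<^sup>2 / 2) \<partial>lborel) + (\<integral>\<^sup>+x. ennreal ((norm (f x))\<^sup>2 / 2) \<partial>lborel)"
      by (simp add: K1[OF \<sigma>])
    also have "\<dots> = (\<integral>\<^sup>+x. ennreal ((norm (f x))\<^sup>2) \<partial>lborel)"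
      by (subst nn_integral_add[symmetric]) (auto simp: ennreal_plus[symmetric] simp del: ennreal_plus)
    finally show ?thesis .
  qed
  have "(\<integral>\<^sup>+\<xi>. ennreal ((norm (F \<xi>))\<^sup>2) \<partial>lborel) = (\<integral>\<^sup>+\<xi>. liminf (\<lambda>n. ennreal (G (1 / real (Suc n)) \<xi>)) \<partial>lborel)"
  proof (rule nn_integral_cong)
    fix \<xi> :: "real^2"
    have l0: "(\<lambda>n. 1 / real (Suc n)) \<longlonglongrightarrow> 0"
      using LIMSEQ_Suc[OF lim_1_over_n] by simp
    have "(\<lambda>n. G (1 / real (Suc n)) \<xi>) \<longlonglongrightarrow> exp (- (0 * norm \<xi>)\<^sup>2 / 2) * (norm (F \<xi>))\<^sup>2"
      unfolding G_def by (intro tendsto_intros l0) auto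
    then have "(\<lambda>n. ennreal (G (1 / real (Suc n)) \<xi>)) \<longlonglongrightarrow> ennreal ((norm (F \<xi>))\<^sup>2)"
      by (intro tendsto_ennrealI) simp
    then show "ennreal ((norm (F \<xi>))\<^sup>2) = liminf (\<lambda>n. ennreal (G (1 / real (Suc n)) \<xi>))"
      by (simp add: lim_imp_Liminf)
  qed
  also have "\<dots> \<le> liminf (\<lambda>n. \<integral>\<^sup>+\<xi>. ennreal (G (1 / real (Suc n)) \<xi>) \<partial>lborel)"
    by (rule nn_integral_liminf) measurable
  also have "\<dots> \<le> liminf (\<lambda>n::nat. \<integral>\<^sup>+x. ennreal ((norm (f x))\<^sup>2) \<partial>lborel)"
    by (intro Liminf_mono always_eventually allI bound) simp
  also have "\<dots> = (\<integral>\<^sup>+x. ennreal ((norm (f x))\<^sup>2) \<partial>lborel)" by (simp add: Liminf_const)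
  finally show ?thesis by (simp add: F_def)
qed

text \<open>For bounded continuous \<open>f\<close> the inner integral in
  \<open>gauss_energy\<close> converges at every point to the conjugate of \<open>f\<close>, by the
  approximate identity, while on the frequency side the Gaussian factor is simply bounded by
  1.\<close>

lemma plancherel_ge_if_continuous:
  fixes f :: "real^2 \<Rightarrow> complex"
  assumes f: "integrable lborel f" and cont: "continuous_on UNIV f" and bdd: "\<And>x. norm (f x) \<le> M"
  shows "(\<integral>\<^sup>+x. ennreal ((norm (f x))\<^sup>2) \<partial>lborel) \<le> (\<integral>\<^sup>+\<xi>. ennreal ((norm (fourier_transform f \<xi>))\<^sup>2) \<partial>lborel)"
proof -
  define F where "F = fourier_transform f"
  have M0: "0 \<le> M" using bdd[of 0] norm_ge_zero order_trans by blast
  have [measurable]: "f \<in> borel_measurable borel" using f by (auto dest: borel_measurable_integrable)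
  have [measurable]: "F \<in> borel_measurable borel"
    unfolding F_def using continuous_fourier_transform[OF f] by (rule borel_measurable_continuous_onI)
  define s where "s n = 1 / real (Suc n)" for n
  have s: "0 < s n" for n by (simp add: s_def)
  have s0: "s \<longlonglongrightarrow> 0" unfolding s_def using LIMSEQ_Suc[OF lim_1_over_n] by simp
  define H where "H n x = (LINT y|lborel. cnj (f y) * of_real (gauss2 ((x - y) /\<^sub>R s n) / (s n)\<^sup>2))" for n x
  \<comment> \<open>The substitution \<open>y = x - s n z\<close> moves the scale from the kernel
    into the argument of \<open>f\<close>, so that one integrable majorant serves for all
    \<open>n\<close>.\<close>
  have H: "H n x = (LINT z|lborel. cnj (f (x - s n *\<^sub>R z)) * of_real (gauss2 z))" for n x
  proof -
    have "H n x = (\<bar>- s n\<bar> ^ DIM(real^2)) *\<^sub>R (LINT z|lborel. cnj (f (x + (- s n) *\<^sub>R z)) * of_real (gauss2 ((x - (x + (- s n) *\<^sub>R z)) /\<^sub>R s n) / (s n)\<^sup>2))"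
      unfolding H_def using s[of n] by (intro integral_lborel_affine) auto
    also have "\<dots> = (LINT z|lborel. (s n)\<^sup>2 *\<^sub>R (cnj (f (x - s n *\<^sub>R z)) * of_real (gauss2 z / (s n)\<^sup>2)))"
      using s[of n] by (subst integral_scaleR_right[symmetric]) simp
    also have "\<dots> = (LINT z|lborel. cnj (f (x - s n *\<^sub>R z)) * of_real (gauss2 z))"
      using s[of n] by (intro Bochner_Integration.integral_cong refl) (simp add: scaleR_conv_of_real)
    finally show ?thesis .
  qed
  have gi: "integrable lborel (\<lambda>z. M * gauss2 z)" using gauss2_integral by simp
  have Hlim: "(\<lambda>n. H n x) \<longlonglongrightarrow> cnj (f x)" for x
  proof -
    have "(\<lambda>n. H n x) \<longlonglongrightarrow> (LINT z|lborel. cnj (f x) * of_real (gauss2 z))"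
      unfolding H
    proof (rule integral_dominated_convergence[OF _ _ gi])
      show "AE z in lborel. (\<lambda>n. cnj (f (x - s n *\<^sub>R z)) * of_real (gauss2 z)) \<longlonglongrightarrow> cnj (f x) * of_real (gauss2 z)"
      proof (rule AE_I2)
        fix z :: "real^2"
        have "(\<lambda>n. x - s n *\<^sub>R z) \<longlonglongrightarrow> x - 0 *\<^sub>R z" by (intro tendsto_intros s0)
        then have "(\<lambda>n. f (x - s n *\<^sub>R z)) \<longlonglongrightarrow> f x"
          using cont by (intro isCont_tendsto_compose[of x f]) (auto simp: continuous_on_eq_continuous_at)
        then show "(\<lambda>n. cnj (f (x - s n *\<^sub>R z)) * of_real (gauss2 z)) \<longlonglongrightarrow> cnj (f x) * of_real (gauss2 z)"
          by (intro tendsto_intros)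
      qed
      show "AE z in lborel. norm (cnj (f (x - s n *\<^sub>R z)) * of_real (gauss2 z)) \<le> M * gauss2 z" for n
        using bdd by (intro AE_I2) (simp add: norm_mult mult_right_mono)
    qed measurable
    also have "(LINT z|lborel. cnj (f x) * of_real (gauss2 z)) = cnj (f x)"
      using gauss2_integral by simp
    finally show ?thesis .
  qed
  have Hb: "norm (H n x) \<le> M" for n x
  proof -
    have "norm (H n x) \<le> (LINT z|lborel. norm (cnj (f (x - s n *\<^sub>R z)) * of_real (gauss2 z)))"
      unfolding H by (rule integral_norm_bound)
    also have "\<dots> \<le> (LINT z|lborel. M * gauss2 z)"
      using bdd by (intro integral_mono' gi) (auto simp: norm_mult M0 intro!: mult_right_mono)
    also have "\<dots> = M" using gauss2_integral by simp
    finally show ?thesis .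
  qed
  have [measurable]: "H n \<in> borel_measurable borel" for n
    unfolding H_def by measurable
  have lim: "(\<lambda>n. LINT x|lborel. f x * H n x) \<longlonglongrightarrow> (LINT x|lborel. f x * cnj (f x))"
  proof (rule integral_dominated_convergence[where w = "\<lambda>x. M * norm (f x)"])
    show "AE x in lborel. (\<lambda>n. f x * H n x) \<longlonglongrightarrow> f x * cnj (f x)"
      by (intro AE_I2 tendsto_intros Hlim)
    show "AE x in lborel. norm (f x * H n x) \<le> M * norm (f x)" for n
      using Hb by (intro AE_I2) (simp add: norm_mult mult.commute[of M] mult_left_mono)
    show "integrable lborel (\<lambda>x. M * norm (f x))" using f by simp
  qed measurable
  have fi: "integrable lborel (\<lambda>x. (norm (f x))\<^sup>2)"
  proof (rule Bochner_Integration.integrable_bound)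
    show "integrable lborel (\<lambda>x. M * norm (f x))" using f by simp
    show "AE x in lborel. norm ((norm (f x))\<^sup>2) \<le> norm (M * norm (f x))"
      using bdd M0 by (intro AE_I2) (simp add: power2_eq_square mult_right_mono)
  qed measurable
  have "ennreal (norm (LINT x|lborel. f x * H n x)) \<le> (\<integral>\<^sup>+\<xi>. ennreal ((norm (F \<xi>))\<^sup>2) \<partial>lborel)" for n
  proof -
    have "(LINT x|lborel. f x * H n x) = (LINT \<xi>|lborel. of_real (exp (- (s n * norm \<xi>)\<^sup>2 / 2) * (norm (F \<xi>))\<^sup>2))"
      unfolding H_def F_def by (rule gauss_energy[OF f s, symmetric])
    then have "ennreal (norm (LINT x|lborel. f x * H n x)) \<le>
       (\<integral>\<^sup>+\<xi>. ennreal (norm (complex_of_real (exp (- (s n * norm \<xi>)\<^sup>2 / 2) * (norm (F \<xi>))\<^sup>2))) \<partial>lborel)"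
      by (simp only:) (rule norm_integral_le_nn_integral)
    also have "\<dots> \<le> (\<integral>\<^sup>+\<xi>. ennreal ((norm (F \<xi>))\<^sup>2) \<partial>lborel)"
      by (intro nn_integral_mono ennreal_leI) (simp add: norm_mult norm_power mult_left_le_one_le)
    finally show ?thesis .
  qed
  then have "ennreal (norm (LINT x|lborel. f x * cnj (f x))) \<le> (\<integral>\<^sup>+\<xi>. ennreal ((norm (F \<xi>))\<^sup>2) \<partial>lborel)"
    by (intro LIMSEQ_le_const2[OF tendsto_ennrealI[OF tendsto_norm[OF lim]]]) auto
  also have "(LINT x|lborel. f x * cnj (f x)) = of_real (LINT x|lborel. (norm (f x))\<^sup>2)"
    by (subst integral_complex_of_real[symmetric]) (simp flip: complex_norm_square)
  finally show ?thesis
    by (subst nn_integral_eq_integral[OF fi]) (auto simp: F_def)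
qed

section \<open>Plancherel's theorem for square-integrable functions of bounded support\<close>

text \<open>A condition on the spectrum \<open>f\<close>, not on its transform. A disc replaces the
  body because the sufficiency half sees the body only through its radius; other discs serve the
  packets of the failure half.\<close>

definition bandlimited :: "real \<Rightarrow> (real^2 \<Rightarrow> complex) \<Rightarrow> bool" where
  "bandlimited R f \<longleftrightarrow> f \<in> borel_measurable borel \<and> integrable lborel (\<lambda>x. (norm (f x))\<^sup>2) \<and>
     (AE x in lborel. R < norm x \<longrightarrow> f x = 0)"

definition energy :: "(real^2 \<Rightarrow> complex) \<Rightarrow> real" where
  "energy f = (LINT x|lborel. (norm (f x))\<^sup>2)"

lemma energy_nonneg [simp]: "0 \<le> energy f"
  by (simp add: energy_def)

lemma nn_integral_energy:
  "bandlimited R f \<Longrightarrow> (\<integral>\<^sup>+x. ennreal ((norm (f x))\<^sup>2) \<partial>lborel) = ennreal (energy f)"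
  unfolding energy_def bandlimited_def by (intro nn_integral_eq_integral) auto

lemma integrable_indicator_cball: "integrable lborel (indicat_real (cball (c :: real^2) r))"
  using emeasure_lborel_cball_finite[of c r] by (intro integrable_real_indicator) auto

text \<open>On the disc \<open>|f| <= 1 + |f|^2\<close>; outside, \<open>f\<close> vanishes almost
  everywhere.\<close>

lemma bandlimited_integrable:
  assumes "bandlimited R f"
  shows "integrable lborel f"
proof (rule Bochner_Integration.integrable_bound)
  have [measurable]: "f \<in> borel_measurable borel" using assms by (simp add: bandlimited_def)
  then show "f \<in> borel_measurable lborel" by simp
  show "integrable lborel (\<lambda>x. indicator (cball 0 R) x + (norm (f x))\<^sup>2)"
    using assms unfolding bandlimited_def
    by (intro Bochner_Integration.integrable_add integrable_indicator_cball) auto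
  have "AE x in lborel. R < norm x \<longrightarrow> f x = 0" using assms by (simp add: bandlimited_def)
  then show "AE x in lborel. norm (f x) \<le> norm (indicator (cball 0 R) x + (norm (f x))\<^sup>2)"
  proof eventually_elim
    case (elim x)
    have "norm (f x) \<le> 1 + (norm (f x))\<^sup>2"
      using sum_squares_bound[of 1 "norm (f x)"] norm_ge_zero[of "f x"] unfolding power_one by linarith
    then show ?case using elim by (auto simp: indicator_def)
  qed
qed

lemma bandlimited_mult:
  assumes f: "bandlimited R f" and p: "p \<in> borel_measurable borel"
    and b: "\<And>x. norm x \<le> R \<Longrightarrow> norm (p x) \<le> C"
  shows "bandlimited R (\<lambda>x. p x * f x)"
  unfolding bandlimited_def
proof (intro conjI)
  have [measurable]: "f \<in> borel_measurable borel" "p \<in> borel_measurable borel"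
    using f p by (auto simp: bandlimited_def)
  show "(\<lambda>x. p x * f x) \<in> borel_measurable borel" by measurable
  have AE: "AE x in lborel. R < norm x \<longrightarrow> f x = 0" using f by (simp add: bandlimited_def)
  then show "AE x in lborel. R < norm x \<longrightarrow> p x * f x = 0" by eventually_elim auto
  show "integrable lborel (\<lambda>x. (norm (p x * f x))\<^sup>2)"
  proof (rule Bochner_Integration.integrable_bound)
    show "integrable lborel (\<lambda>x. C\<^sup>2 * (norm (f x))\<^sup>2)" using f by (simp add: bandlimited_def)
    show "AE x in lborel. norm ((norm (p x * f x))\<^sup>2) \<le> norm (C\<^sup>2 * (norm (f x))\<^sup>2)"
      using AE
    proof eventually_elim
      case (elim x)
      show ?case
      proof (cases "R < norm x")
        case False
        then have "(norm (p x))\<^sup>2 \<le> C\<^sup>2" using b[of x] by (intro power_mono) auto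
        then show ?thesis by (simp add: norm_mult power_mult_distrib mult_right_mono)
      qed (use elim in auto)
    qed
  qed measurable
qed

text \<open>Young's inequality with a free parameter: \<open>t\<close> tends to 0 where the main
  term must keep the constant 1, and \<open>t = 1\<close> where constants do not matter.\<close>

lemma norm_square_le_split:
  fixes a b :: "'a::real_normed_vector"
  assumes t: "0 < t"
  shows "(norm a)\<^sup>2 \<le> (1 + t) * (norm b)\<^sup>2 + (1 + 1 / t) * (norm (a - b))\<^sup>2"
proof -
  define p q where "p = norm b" and "q = norm (a - b)"
  have "norm a \<le> p + q" unfolding p_def q_def using norm_triangle_ineq[of b "a - b"] by simp
  then have "(norm a)\<^sup>2 \<le> (p + q)\<^sup>2" by (intro power_mono) auto
  also have "2 * p * q \<le> t * p\<^sup>2 + q\<^sup>2 / t"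
  proof -
    have "0 \<le> (t * p - q)\<^sup>2 / t" using t by simp
    also have "\<dots> = t * p\<^sup>2 + q\<^sup>2 / t - 2 * p * q" using t by (simp add: power2_eq_square field_simps)
    finally show ?thesis by simp
  qed
  then have "(p + q)\<^sup>2 \<le> (1 + t) * p\<^sup>2 + (1 + 1 / t) * q\<^sup>2"
    by (simp add: power2_sum algebra_simps)
  finally show ?thesis by (simp add: p_def q_def)
qed

lemma nn_integral_square_split:
  fixes a b :: "real^2 \<Rightarrow> complex"
  assumes [measurable]: "a \<in> borel_measurable borel" "b \<in> borel_measurable borel" and t: "0 < t"
  shows "(\<integral>\<^sup>+x. ennreal ((norm (a x))\<^sup>2) \<partial>lborel) \<le>
    ennreal (1 + t) * (\<integral>\<^sup>+x. ennreal ((norm (b x))\<^sup>2) \<partial>lborel) +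
    ennreal (1 + 1 / t) * (\<integral>\<^sup>+x. ennreal ((norm (a x - b x))\<^sup>2) \<partial>lborel)"
proof -
  have "(\<integral>\<^sup>+x. ennreal ((norm (a x))\<^sup>2) \<partial>lborel) \<le>
     (\<integral>\<^sup>+x. (ennreal (1 + t) * ennreal ((norm (b x))\<^sup>2) + ennreal (1 + 1 / t) * ennreal ((norm (a x - b x))\<^sup>2)) \<partial>lborel)"
    using norm_square_le_split[OF t] t
    by (intro nn_integral_mono) (simp add: ennreal_mult[symmetric] ennreal_plus[symmetric] ennreal_leI del: ennreal_plus)
  also have "\<dots> = ennreal (1 + t) * (\<integral>\<^sup>+x. ennreal ((norm (b x))\<^sup>2) \<partial>lborel) +
    ennreal (1 + 1 / t) * (\<integral>\<^sup>+x. ennreal ((norm (a x - b x))\<^sup>2) \<partial>lborel)"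
    by (simp add: nn_integral_add nn_integral_cmult)
  finally show ?thesis .
qed

lemma LIMSEQ_integral_square_0:
  fixes f :: "real^2 \<Rightarrow> complex" and h :: "nat \<Rightarrow> real^2 \<Rightarrow> complex"
  assumes [measurable]: "f \<in> borel_measurable borel" "\<And>n. h n \<in> borel_measurable borel"
    and lim: "AE x in lborel. (\<lambda>n. h n x) \<longlonglongrightarrow> f x"
    and w: "integrable lborel w" and b: "\<And>n. AE x in lborel. (norm (f x - h n x))\<^sup>2 \<le> w x"
    and e: "0 < e"
  shows "\<exists>n. (\<integral>\<^sup>+x. ennreal ((norm (f x - h n x))\<^sup>2) \<partial>lborel) \<le> ennreal e"
proof -
  have "(\<lambda>n. LINT x|lborel. (norm (f x - h n x))\<^sup>2) \<longlonglongrightarrow> (LINT x|(lborel :: (real^2) measure). (0::real))"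
  proof (rule integral_dominated_convergence[OF _ _ w])
    show "AE x in lborel. (\<lambda>n. (norm (f x - h n x))\<^sup>2) \<longlonglongrightarrow> 0"
      using lim
    proof eventually_elim
      case (elim x)
      have "(\<lambda>n. (norm (f x - h n x))\<^sup>2) \<longlonglongrightarrow> (norm (f x - f x))\<^sup>2" by (intro tendsto_intros elim)
      then show ?case by simp
    qed
  qed (use b in auto)
  then have "\<forall>\<^sub>F n in sequentially. (LINT x|lborel. (norm (f x - h n x))\<^sup>2) < e"
    using e by (intro order_tendstoD) auto
  then obtain n where n: "(LINT x|lborel. (norm (f x - h n x))\<^sup>2) < e"
    by (meson eventually_happens trivial_limit_sequentially)
  have "integrable lborel (\<lambda>x. (norm (f x - h n x))\<^sup>2)"
    by (rule Bochner_Integration.integrable_bound[OF w]) (use b[of n] in \<open>auto elim!: eventually_mono\<close>)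
  then show ?thesis using n by (intro exI[of _ n]) (simp add: nn_integral_eq_integral ennreal_leI less_imp_le)
qed

text \<open>For positive \<open>M\<close>, the radial projection of the complex plane onto the
  closed disc of radius \<open>M\<close>: it is continuous and leaves the values of a function
  bounded by \<open>M\<close> alone.\<close>

definition clip :: "real \<Rightarrow> complex \<Rightarrow> complex" where
  "clip M z = of_real (M / max M (norm z)) * z"

lemma clip_bound: "0 < M \<Longrightarrow> norm (clip M z) \<le> M"
  by (simp add: clip_def norm_mult norm_divide abs_of_pos max_def field_simps)

lemma clip_id: "0 < M \<Longrightarrow> norm z \<le> M \<Longrightarrow> clip M z = z"
  by (simp add: clip_def max_def)

lemma continuous_clip: "0 < M \<Longrightarrow> continuous_on UNIV (clip M)"
  unfolding clip_def by (intro continuous_intros) (auto simp: max_def)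

text \<open>A measurable function is almost everywhere a limit of continuous ones. Clipping their
  values and cutting off their supports preserves the limit and provides a majorant, so dominated
  convergence turns this into approximation in the mean square.\<close>

lemma bounded_L2_approx_continuous:
  fixes f :: "real^2 \<Rightarrow> complex"
  assumes f: "f \<in> borel_measurable borel" and M: "0 < M" and fM: "\<And>x. norm (f x) \<le> M"
    and R: "\<And>x. R < norm x \<Longrightarrow> f x = 0" and e: "0 < e"
  obtains g where "continuous_on UNIV g" "\<And>x. norm (g x) \<le> M" "integrable lborel g"
    "(\<integral>\<^sup>+x. ennreal ((norm (f x - g x))\<^sup>2) \<partial>lborel) \<le> ennreal e"
proof -
  have "f measurable_on UNIV"
    using f by (intro lebesgue_measurable_imp_measurable_on) (auto intro: measurable_completion)
  then obtain N g where N: "negligible N" and gc: "\<And>n :: nat. continuous_on UNIV (g n)"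
    and gl: "\<And>x. x \<notin> N \<Longrightarrow> (\<lambda>n. g n x) \<longlonglongrightarrow> f x"
    unfolding measurable_on_def by auto
  \<comment> \<open>Continuous cut-off, equal to 1 on the ball of radius \<open>R\<close> and to 0
    beyond radius \<open>R + 1\<close>.\<close>
  define ch where "ch x = complex_of_real (max 0 (min 1 (R + 1 - norm x)))" for x :: "real^2"
  define h where "h n x = ch x * clip M (g n x)" for n x
  have chc: "continuous_on UNIV ch" unfolding ch_def by (intro continuous_intros)
  have hc: "continuous_on UNIV (h n)" for n
    unfolding h_def
    by (intro continuous_intros chc continuous_on_compose2[OF continuous_clip[OF M] gc]) auto
  have [measurable]: "h n \<in> borel_measurable borel" for n
    using hc by (rule borel_measurable_continuous_onI)
  have [measurable]: "f \<in> borel_measurable borel" by (rule f)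
  have ch1: "norm (ch x) \<le> 1" for x by (simp add: ch_def)
  have hb: "norm (h n x) \<le> M" for n x
    using mult_mono[OF ch1 clip_bound[OF M, of "g n x"]] by (simp add: h_def norm_mult)
  have h0: "h n x = 0" if "R + 1 < norm x" for n x using that by (simp add: h_def ch_def)
  have wi: "integrable lborel (\<lambda>x :: real^2. C * indicator (cball 0 (R+1)) x :: real)" for C
    by (intro integrable_mult_right integrable_indicator_cball)
  have hi: "integrable lborel (h n)" for n
  proof (rule Bochner_Integration.integrable_bound[OF wi[of M]])
    show "AE x in lborel. norm (h n x) \<le> norm (M * indicator (cball 0 (R + 1)) x :: real)"
      using hb h0 M by (intro AE_I2) (auto simp: indicator_def)
  qed measurable
  have ae: "AE x in lborel. (\<lambda>n. h n x) \<longlonglongrightarrow> f x"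
  proof -
    have "AE x in lebesgue. x \<notin> N" using N by (auto simp: negligible_iff_null_sets intro: AE_not_in)
    then have "AE x in lborel. x \<notin> N" by (simp add: AE_completion_iff)
    then show ?thesis
    proof eventually_elim
      case (elim x)
      have "(\<lambda>n. clip M (g n x)) \<longlonglongrightarrow> clip M (f x)"
        using continuous_clip[OF M] gl[OF elim]
        by (intro isCont_tendsto_compose[of _ "clip M"]) (auto simp: continuous_on_eq_continuous_at)
      then have "(\<lambda>n. h n x) \<longlonglongrightarrow> ch x * clip M (f x)" unfolding h_def by (intro tendsto_intros)
      also have "ch x * clip M (f x) = f x"
        using clip_id[OF M fM] R[of x] by (cases "R < norm x") (auto simp: ch_def clip_def)
      finally show ?case .
    qed
  qed
  have "\<exists>n. (\<integral>\<^sup>+x. ennreal ((norm (f x - h n x))\<^sup>2) \<partial>lborel) \<le> ennreal e"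
  proof (rule LIMSEQ_integral_square_0[OF _ _ ae wi[of "(2 * M)\<^sup>2"] _ e])
    show "AE x in lborel. (norm (f x - h n x))\<^sup>2 \<le> (2 * M)\<^sup>2 * indicator (cball 0 (R + 1)) x" for n
    proof (rule AE_I2)
      fix x :: "real^2"
      have "norm (f x - h n x) \<le> 2 * M"
        using norm_triangle_ineq4[of "f x" "h n x"] fM[of x] hb[of n x] by linarith
      then have "(norm (f x - h n x))\<^sup>2 \<le> (2 * M)\<^sup>2" by (intro power_mono) auto
      moreover have "f x - h n x = 0" if "R + 1 < norm x" using that h0 R by simp
      ultimately show "(norm (f x - h n x))\<^sup>2 \<le> (2 * M)\<^sup>2 * indicator (cball 0 (R + 1)) x"
        by (auto simp: indicator_def)
    qed
  qed measurable
  then show thesis using that hc hb hi by blast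
qed

lemma bandlimited_approx_continuous:
  assumes f: "bandlimited R f" and e: "0 < e"
  obtains g M where "continuous_on UNIV g" "\<And>x. norm (g x) \<le> M" "integrable lborel g"
    "(\<integral>\<^sup>+x. ennreal ((norm (f x - g x))\<^sup>2) \<partial>lborel) \<le> ennreal e"
proof -
  have [measurable]: "f \<in> borel_measurable borel" using f by (simp add: bandlimited_def)
  define h where "h n x = (if norm (f x) \<le> real n \<and> norm x \<le> R then f x else 0)" for n :: nat and x
  have [measurable]: "h n \<in> borel_measurable borel" for n unfolding h_def by measurable
  have AE: "AE x in lborel. R < norm x \<longrightarrow> f x = 0" using f by (simp add: bandlimited_def)
  have ae: "AE x in lborel. (\<lambda>n. h n x) \<longlonglongrightarrow> f x"
    using AE
  proof eventually_elim
    case (elim x)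
    obtain m :: nat where m: "norm (f x) \<le> real m" using real_arch_simple by blast
    have "\<forall>\<^sub>F n in sequentially. h n x = f x"
      using eventually_ge_at_top[of m]
    proof eventually_elim
      case (elim n)
      then have "norm (f x) \<le> real n" using m by (meson of_nat_mono order_trans)
      then show ?case using \<open>R < norm x \<longrightarrow> f x = 0\<close> by (auto simp: h_def)
    qed
    then show ?case by (rule tendsto_eventually)
  qed
  \<comment> \<open>Truncation and continuous approximation cost \<open>e / 4\<close> each; the
    splitting with \<open>t = 1\<close> doubles both errors.\<close>
  have "\<exists>n. (\<integral>\<^sup>+x. ennreal ((norm (f x - h n x))\<^sup>2) \<partial>lborel) \<le> ennreal (e / 4)"
  proof (rule LIMSEQ_integral_square_0[OF _ _ ae])
    show "integrable lborel (\<lambda>x. (norm (f x))\<^sup>2)" using f by (simp add: bandlimited_def)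
    show "AE x in lborel. (norm (f x - h n x))\<^sup>2 \<le> (norm (f x))\<^sup>2" for n
      by (intro AE_I2) (simp add: h_def)
  qed (use e in auto)
  then obtain n where n: "(\<integral>\<^sup>+x. ennreal ((norm (f x - h n x))\<^sup>2) \<partial>lborel) \<le> ennreal (e / 4)" by blast
  obtain g where g: "continuous_on UNIV g" "\<And>x. norm (g x) \<le> real (Suc n)" "integrable lborel g"
    "(\<integral>\<^sup>+x. ennreal ((norm (h n x - g x))\<^sup>2) \<partial>lborel) \<le> ennreal (e / 4)"
    by (rule bounded_L2_approx_continuous[of "h n" "real (Suc n)" R "e/4"]) (use e in \<open>auto simp: h_def\<close>)
  have [measurable]: "g \<in> borel_measurable borel" using g(3) by (auto dest: borel_measurable_integrable)
  have "(\<integral>\<^sup>+x. ennreal ((norm (f x - g x))\<^sup>2) \<partial>lborel) \<le>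
      ennreal (1 + 1) * (\<integral>\<^sup>+x. ennreal ((norm (f x - h n x))\<^sup>2) \<partial>lborel) +
      ennreal (1 + 1 / 1) * (\<integral>\<^sup>+x. ennreal ((norm ((f x - g x) - (f x - h n x)))\<^sup>2) \<partial>lborel)"
    by (rule nn_integral_square_split) auto
  also have "\<dots> \<le> ennreal (1 + 1) * ennreal (e / 4) + ennreal (1 + 1 / 1) * ennreal (e / 4)"
    using n g(4) by (intro add_mono mult_left_mono) auto
  also have "\<dots> = ennreal ((1 + 1) * (e / 4) + (1 + 1 / 1) * (e / 4))"
  proof -
    have "0 \<le> (1 + 1 :: real)" "0 \<le> (1 + 1 / 1 :: real)" "0 \<le> e / 4"
      "0 \<le> (1 + 1) * (e / 4)" "0 \<le> (1 + 1 / 1) * (e / 4)" using e by auto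
    then show ?thesis by (metis ennreal_mult ennreal_plus)
  qed
  also have "(1 + 1) * (e / 4) + (1 + 1 / 1) * (e / 4) = e" by simp
  finally show thesis by (rule that[OF g(1,2,3)])
qed

text \<open>The reverse inequality is carried over from a continuous approximant \<open>g\<close>,
  whose transform is close to that of \<open>f\<close> because \<open>plancherel_le\<close> applies
  to the difference.\<close>

theorem plancherel:
  assumes f: "bandlimited R f"
  shows "(\<integral>\<^sup>+\<xi>. ennreal ((norm (fourier_transform f \<xi>))\<^sup>2) \<partial>lborel) = ennreal (energy f)"
proof -
  define F where "F = fourier_transform f"
  note fi = bandlimited_integrable[OF f]
  have [measurable]: "f \<in> borel_measurable borel" using f by (simp add: bandlimited_def)
  have mF: "fourier_transform u \<in> borel_measurable borel" if "integrable lborel u" for u :: "real^2 \<Rightarrow> complex"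
    using continuous_fourier_transform[OF that] by (rule borel_measurable_continuous_onI)
  have le: "(\<integral>\<^sup>+\<xi>. ennreal ((norm (F \<xi>))\<^sup>2) \<partial>lborel) \<le> ennreal (energy f)"
    unfolding F_def nn_integral_energy[OF f, symmetric] by (rule plancherel_le[OF fi])
  define B where "B = enn2real (\<integral>\<^sup>+\<xi>. ennreal ((norm (F \<xi>))\<^sup>2) \<partial>lborel)"
  have B: "(\<integral>\<^sup>+\<xi>. ennreal ((norm (F \<xi>))\<^sup>2) \<partial>lborel) = ennreal B" "0 \<le> B"
    using le by (auto simp: B_def ennreal_enn2real_if top_unique)
  \<comment> \<open>Mean square error \<open>t^2\<close> is prescribed because it gets multiplied by
    \<open>1 + 1 / t\<close>; the product \<open>t^2 + t\<close> still tends to 0.\<close>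
  have est: "energy f \<le> (1 + t) * ((1 + t) * B + (t\<^sup>2 + t)) + (t\<^sup>2 + t)" if t: "0 < t" for t
  proof -
    obtain g M where g: "continuous_on UNIV g" "\<And>x. norm (g x) \<le> M" "integrable lborel g"
      "(\<integral>\<^sup>+x. ennreal ((norm (f x - g x))\<^sup>2) \<partial>lborel) \<le> ennreal (t\<^sup>2)"
      by (rule bandlimited_approx_continuous[OF f, of "t\<^sup>2"], use t in simp, rule that) auto
    have [measurable]: "g \<in> borel_measurable borel" using g(3) by (auto dest: borel_measurable_integrable)
    have tt: "(1 + 1 / t) * t\<^sup>2 = t\<^sup>2 + t" using t by (simp add: power2_eq_square field_simps)
    have G: "(\<integral>\<^sup>+\<xi>. ennreal ((norm (fourier_transform g \<xi>))\<^sup>2) \<partial>lborel) \<le>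
       ennreal (1 + t) * (\<integral>\<^sup>+\<xi>. ennreal ((norm (F \<xi>))\<^sup>2) \<partial>lborel) +
       ennreal (1 + 1 / t) * (\<integral>\<^sup>+\<xi>. ennreal ((norm (fourier_transform g \<xi> - F \<xi>))\<^sup>2) \<partial>lborel)"
      unfolding F_def by (intro nn_integral_square_split mF fi g t)
    have D: "(\<integral>\<^sup>+\<xi>. ennreal ((norm (fourier_transform g \<xi> - F \<xi>))\<^sup>2) \<partial>lborel) \<le> ennreal (t\<^sup>2)"
    proof -
      have "(\<integral>\<^sup>+\<xi>. ennreal ((norm (fourier_transform g \<xi> - F \<xi>))\<^sup>2) \<partial>lborel)
        = (\<integral>\<^sup>+\<xi>. ennreal ((norm (fourier_transform (\<lambda>x. g x - f x) \<xi>))\<^sup>2) \<partial>lborel)"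
        unfolding F_def fourier_transform_diff[OF g(3) fi] ..
      also have "\<dots> \<le> (\<integral>\<^sup>+x. ennreal ((norm (g x - f x))\<^sup>2) \<partial>lborel)"
        by (intro plancherel_le Bochner_Integration.integrable_diff g fi)
      finally show ?thesis using g(4) by (simp add: norm_minus_commute)
    qed
    have "ennreal (energy f) \<le> ennreal (1 + t) * (\<integral>\<^sup>+x. ennreal ((norm (g x))\<^sup>2) \<partial>lborel)
       + ennreal (1 + 1 / t) * (\<integral>\<^sup>+x. ennreal ((norm (f x - g x))\<^sup>2) \<partial>lborel)"
      unfolding nn_integral_energy[OF f, symmetric] by (intro nn_integral_square_split t) auto
    also have "\<dots> \<le> ennreal (1 + t) * (ennreal (1 + t) * ennreal B + ennreal (1 + 1 / t) * ennreal (t\<^sup>2))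
       + ennreal (1 + 1 / t) * ennreal (t\<^sup>2)"
    proof (intro add_mono mult_left_mono)
      have "(\<integral>\<^sup>+x. ennreal ((norm (g x))\<^sup>2) \<partial>lborel) \<le> (\<integral>\<^sup>+\<xi>. ennreal ((norm (fourier_transform g \<xi>))\<^sup>2) \<partial>lborel)"
        by (rule plancherel_ge_if_continuous[OF g(3,1,2)])
      also have "\<dots> \<le> ennreal (1 + t) * ennreal B + ennreal (1 + 1 / t) * ennreal (t\<^sup>2)"
        using G D unfolding B(1) by (meson add_left_mono mult_left_mono order_trans zero_le)
      finally show "(\<integral>\<^sup>+x. ennreal ((norm (g x))\<^sup>2) \<partial>lborel) \<le> ennreal (1 + t) * ennreal B + ennreal (1 + 1 / t) * ennreal (t\<^sup>2)" .
    qed (use g(4) in auto)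
    also have "\<dots> = ennreal ((1 + t) * ((1 + t) * B + (t\<^sup>2 + t)) + (t\<^sup>2 + t))"
      using t B(2) by (simp add: ennreal_mult[symmetric] ennreal_plus[symmetric] tt del: ennreal_plus)
    finally show ?thesis using t B(2) by (subst (asm) ennreal_le_iff) auto
  qed
  have "energy f \<le> B"
  proof (rule LIMSEQ_le_const)
    define s where "s n = 1 / real (Suc n)" for n
    have s0: "s \<longlonglongrightarrow> 0" unfolding s_def using LIMSEQ_Suc[OF lim_1_over_n] by simp
    have "(\<lambda>n. (1 + s n) * ((1 + s n) * B + ((s n)\<^sup>2 + s n)) + ((s n)\<^sup>2 + s n))
      \<longlonglongrightarrow> (1 + 0) * ((1 + 0) * B + (0\<^sup>2 + 0)) + (0\<^sup>2 + 0)"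
      by (intro tendsto_intros s0)
    then show "(\<lambda>n. (1 + s n) * ((1 + s n) * B + ((s n)\<^sup>2 + s n)) + ((s n)\<^sup>2 + s n)) \<longlonglongrightarrow> B" by simp
    show "\<exists>N. \<forall>n\<ge>N. energy f \<le> (1 + s n) * ((1 + s n) * B + ((s n)\<^sup>2 + s n)) + ((s n)\<^sup>2 + s n)"
      by (intro exI[of _ 0] allI impI est) (simp add: s_def)
  qed
  then have "ennreal (energy f) \<le> (\<integral>\<^sup>+\<xi>. ennreal ((norm (F \<xi>))\<^sup>2) \<partial>lborel)"
    unfolding B(1) by (rule ennreal_leI)
  then show ?thesis using le by (simp add: F_def)
qed

lemma plancherel_integral:
  assumes f: "bandlimited R f"
  shows "integrable lborel (\<lambda>\<xi>. (norm (fourier_transform f \<xi>))\<^sup>2)"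
    and "(LINT \<xi>|lborel. (norm (fourier_transform f \<xi>))\<^sup>2) = energy f"
proof -
  have [measurable]: "fourier_transform f \<in> borel_measurable borel"
    using continuous_fourier_transform[OF bandlimited_integrable[OF f]]
    by (rule borel_measurable_continuous_onI)
  show i: "integrable lborel (\<lambda>\<xi>. (norm (fourier_transform f \<xi>))\<^sup>2)"
    using plancherel[OF f] by (intro integrableI_nonneg) auto
  show "(LINT \<xi>|lborel. (norm (fourier_transform f \<xi>))\<^sup>2) = energy f"
    using plancherel[OF f] nn_integral_eq_integral[OF i] by simp
qed

text \<open>The Cauchy-Schwarz inequality on the disc, obtained from
  \<open>2 |f| <= t + |f|^2 / t\<close> with the best weight \<open>t = a / V\<close>.\<close>

lemma norm_L1_le_energy:
  assumes f: "bandlimited R f"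
  shows "(LINT x|lborel. norm (f x))\<^sup>2 \<le> (measure lborel (cball (0::real^2) R) + 1) * energy f"
proof -
  have [measurable]: "f \<in> borel_measurable borel" using f by (simp add: bandlimited_def)
  define a where "a = (LINT x|lborel. norm (f x))"
  \<comment> \<open>The added 1 keeps \<open>V\<close> positive for a disc of measure 0, so that it
    can be divided by.\<close>
  define V where "V = measure lborel (cball (0::real^2) R) + 1"
  have V: "0 < V" by (simp add: V_def add_nonneg_pos)
  have a0: "0 \<le> a" by (simp add: a_def)
  have f2: "integrable lborel (\<lambda>x. (norm (f x))\<^sup>2)" using f by (simp add: bandlimited_def)
  have ci: "integrable lborel (\<lambda>x :: real^2. indicator (cball 0 R) x :: real)"
    by (rule integrable_indicator_cball)
  have est: "2 * a \<le> t * V + energy f / t" if t: "0 < t" for t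
  proof -
    have "a \<le> (LINT x|lborel. (t * indicator (cball 0 R) x + (norm (f x))\<^sup>2 / t) / 2)"
      unfolding a_def
    proof (rule integral_mono_AE)
      show "integrable lborel (\<lambda>x. norm (f x))" using bandlimited_integrable[OF f] by simp
      show "integrable lborel (\<lambda>x. (t * indicator (cball 0 R) x + (norm (f x))\<^sup>2 / t) / 2)"
        using f2 ci by simp
      have "AE x in lborel. R < norm x \<longrightarrow> f x = 0" using f by (simp add: bandlimited_def)
      then show "AE x in lborel. norm (f x) \<le> (t * indicator (cball 0 R) x + (norm (f x))\<^sup>2 / t) / 2"
      proof eventually_elim
        case (elim x)
        have "0 \<le> (t - norm (f x))\<^sup>2 / t" using t by simp
        also have "\<dots> = t + (norm (f x))\<^sup>2 / t - 2 * norm (f x)" using t by (simp add: power2_eq_square field_simps)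
        finally show ?case using elim by (auto simp: indicator_def)
      qed
    qed
    also have "\<dots> = (t * measure lborel (cball (0::real^2) R) + energy f / t) / 2"
      using f2 ci by (simp add: energy_def)
    finally have "2 * a \<le> t * measure lborel (cball (0::real^2) R) + energy f / t" by simp
    also have "\<dots> \<le> t * V + energy f / t" using t by (simp add: V_def)
    finally show ?thesis .
  qed
  have "a\<^sup>2 \<le> V * energy f"
  proof (cases "a = 0")
    case False
    then have ap: "0 < a" using a0 by simp
    have "2 * a \<le> a / V * V + energy f / (a / V)" using ap V by (intro est) simp
    then have "a \<le> energy f * V / a" using V ap by simp
    then show ?thesis using ap by (simp add: power2_eq_square field_simps)
  qed (use V in simp)
  then show ?thesis by (simp add: a_def V_def)
qed

section \<open>Derivatives along rays and Bernstein's inequality\<close>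

lemma norm_fchar_remainder:
  "norm (fchar (t + s) - fchar t + 2 * of_real pi * \<i> * of_real s * fchar t) \<le> (2 * pi * s)\<^sup>2 / 2"
proof -
  define x where "x = - (2 * pi * s)"
  have "norm (iexp x - (\<Sum>k\<le>1. (\<i> * x) ^ k / fact k)) \<le> \<bar>x\<bar> ^ Suc 1 / fact (Suc 1)"
    by (rule iexp_approx1)
  then have "norm (iexp x - 1 - \<i> * x) \<le> x\<^sup>2 / 2"
    by (simp add: numeral_2_eq_2 power2_eq_square algebra_simps)
  moreover have "fchar (t + s) - fchar t + 2 * of_real pi * \<i> * of_real s * fchar t = fchar t * (iexp x - 1 - \<i> * x)"
  proof -
    have "iexp x = fchar s" by (simp add: x_def fchar_def algebra_simps)
    then show ?thesis by (simp add: fchar_add x_def algebra_simps)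
  qed
  ultimately show ?thesis by (simp add: norm_mult x_def)
qed

text \<open>The Taylor remainder of the character is quadratic in \<open>h\<close> with the factor
  \<open>(\<omega> \<bullet> x)^2\<close>. Bounded support makes this moment of \<open>f\<close>
  integrable, so the difference quotient converges with error at most \<open>C |h|\<close>.\<close>

lemma fourier_transform_ray_derivative:
  assumes f: "bandlimited R f"
  shows "((\<lambda>r. fourier_transform f (r *\<^sub>R \<omega>)) has_vector_derivative
     fourier_transform (\<lambda>x. (- (2 * of_real pi * \<i> * of_real (\<omega> \<bullet> x))) * f x) (r *\<^sub>R \<omega>)) (at r)"
proof -
  define p where "p x = - (2 * of_real pi * \<i> * complex_of_real (\<omega> \<bullet> x))" for x
  define q where "q x = complex_of_real ((2 * pi * (\<omega> \<bullet> x))\<^sup>2 / 2)" for x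
  have [measurable]: "f \<in> borel_measurable borel" using f by (simp add: bandlimited_def)
  have wx: "\<bar>\<omega> \<bullet> x\<bar> \<le> norm \<omega> * R" if "norm x \<le> R" for x
    using Cauchy_Schwarz_ineq2[of \<omega> x] mult_left_mono[OF that norm_ge_zero[of \<omega>]] by linarith
  have pb: "bandlimited R (\<lambda>x. p x * f x)"
  proof (rule bandlimited_mult[OF f])
    show "p \<in> borel_measurable borel" unfolding p_def by measurable
    show "norm (p x) \<le> 2 * pi * (norm \<omega> * R)" if "norm x \<le> R" for x
      using wx[OF that] by (simp add: p_def norm_mult)
  qed
  have qb: "bandlimited R (\<lambda>x. q x * f x)"
  proof (rule bandlimited_mult[OF f])
    show "q \<in> borel_measurable borel" unfolding q_def by measurable
    show "norm (q x) \<le> (2 * pi * (norm \<omega> * R))\<^sup>2 / 2" if "norm x \<le> R" for x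
    proof -
      have "(\<bar>2 * pi * (\<omega> \<bullet> x)\<bar>)\<^sup>2 \<le> (2 * pi * (norm \<omega> * R))\<^sup>2"
        using wx[OF that] by (intro power_mono) (auto simp: abs_mult)
      then show ?thesis unfolding q_def norm_of_real by simp
    qed
  qed
  define C where "C = (LINT x|lborel. norm (q x * f x))"
  define u where "u r = fourier_transform f (r *\<^sub>R \<omega>)" for r
  define v where "v = fourier_transform (\<lambda>x. p x * f x) (r *\<^sub>R \<omega>)"
  have est: "norm (u (r + h) - u r - h *\<^sub>R v) \<le> C * h\<^sup>2" for h
  proof -
    note I = integrable_fchar_mult[OF bandlimited_integrable[OF f]] integrable_fchar_mult[OF bandlimited_integrable[OF pb]]
    have "u (r + h) - u r - h *\<^sub>R v =
      (LINT x|lborel. fchar (((r + h) *\<^sub>R \<omega>) \<bullet> x) * f x - fchar ((r *\<^sub>R \<omega>) \<bullet> x) * f x - of_real h * (fchar ((r *\<^sub>R \<omega>) \<bullet> x) * (p x * f x)))"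
      unfolding u_def v_def fourier_transform_fchar scaleR_conv_of_real using I
      by (simp add: Bochner_Integration.integral_diff)
    also have "norm \<dots> \<le> (LINT x|lborel. norm (q x * f x) * h\<^sup>2)"
    proof (rule order_trans[OF integral_norm_bound integral_mono])
      show "integrable lborel (\<lambda>x. norm (q x * f x) * h\<^sup>2)"
        using bandlimited_integrable[OF qb] by (intro integrable_mult_left) simp
      fix x :: "real^2"
      define t where "t = (r *\<^sub>R \<omega>) \<bullet> x"
      define s where "s = h * (\<omega> \<bullet> x)"
      have ts: "((r + h) *\<^sub>R \<omega>) \<bullet> x = t + s" by (simp add: t_def s_def algebra_simps)
      have "fchar (((r + h) *\<^sub>R \<omega>) \<bullet> x) * f x - fchar ((r *\<^sub>R \<omega>) \<bullet> x) * f x - of_real h * (fchar ((r *\<^sub>R \<omega>) \<bullet> x) * (p x * f x))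
        = (fchar (t + s) - fchar t + 2 * of_real pi * \<i> * of_real s * fchar t) * f x"
        unfolding ts t_def[symmetric] by (simp add: p_def s_def algebra_simps)
      also have "norm \<dots> \<le> (2 * pi * s)\<^sup>2 / 2 * norm (f x)"
        unfolding norm_mult by (intro mult_right_mono norm_fchar_remainder) simp
      also have "\<dots> = norm (q x * f x) * h\<^sup>2"
        unfolding norm_mult q_def norm_of_real by (simp add: s_def power_mult_distrib)
      finally show "norm (fchar (((r + h) *\<^sub>R \<omega>) \<bullet> x) * f x - fchar ((r *\<^sub>R \<omega>) \<bullet> x) * f x - of_real h * (fchar ((r *\<^sub>R \<omega>) \<bullet> x) * (p x * f x))) \<le> norm (q x * f x) * h\<^sup>2" .
    qed (intro integrable_norm Bochner_Integration.integrable_diff I integrable_mult_right)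
    also have "\<dots> = C * h\<^sup>2" by (simp add: C_def)
    finally show ?thesis .
  qed
  have "(u has_vector_derivative v) (at r)"
    unfolding has_vector_derivative_def has_derivative_at
  proof (intro conjI)
    show "bounded_linear (\<lambda>h. h *\<^sub>R v)" by (rule bounded_linear_scaleR_left)
    show "(\<lambda>h. norm (u (r + h) - u r - h *\<^sub>R v) / norm h) \<midarrow>0\<rightarrow> 0"
    proof (rule Lim_null_comparison)
      show "\<forall>\<^sub>F h in at 0. norm (norm (u (r + h) - u r - h *\<^sub>R v) / norm h) \<le> C * \<bar>h\<bar>"
        unfolding eventually_at_filter
      proof (intro always_eventually allI impI)
        fix h :: real assume "h \<noteq> 0"
        then show "norm (norm (u (r + h) - u r - h *\<^sub>R v) / norm h) \<le> C * \<bar>h\<bar>"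
          using est[of h] by (simp add: field_simps power2_eq_square flip: abs_mult)
      qed
      have "((\<lambda>h. C * \<bar>h\<bar>) \<longlongrightarrow> C * \<bar>0::real\<bar>) (at 0)" by (intro tendsto_intros)
      then show "((\<lambda>h. C * \<bar>h\<bar>) \<longlongrightarrow> 0) (at (0::real))" by simp
    qed
  qed
  then show ?thesis unfolding u_def v_def p_def .
qed

text \<open>The partial derivative of the transform, defined on the spectral side: there
  Plancherel's theorem applies to it at once, since the multiplied spectrum is band-limited with the
  same radius.\<close>

definition coordinate_derivative :: "2 \<Rightarrow> (real^2 \<Rightarrow> complex) \<Rightarrow> real^2 \<Rightarrow> complex" where
  "coordinate_derivative j f = fourier_transform (\<lambda>x. - (2 * of_real pi * \<i> * of_real (x $ j)) * f x)"

definition grad_square :: "(real^2 \<Rightarrow> complex) \<Rightarrow> real^2 \<Rightarrow> real" where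
  "grad_square f \<xi> = (norm (coordinate_derivative 1 f \<xi>))\<^sup>2 + (norm (coordinate_derivative 2 f \<xi>))\<^sup>2"

lemma bandlimited_coordinate:
  assumes f: "bandlimited R f"
  shows "bandlimited R (\<lambda>x. - (2 * of_real pi * \<i> * of_real (x $ j)) * f x)"
proof (rule bandlimited_mult[OF f])
  show "(\<lambda>x::real^2. - (2 * of_real pi * \<i> * of_real (x $ j)) :: complex) \<in> borel_measurable borel"
    by measurable
  show "norm (- (2 * of_real pi * \<i> * of_real (x $ j)) :: complex) \<le> 2 * pi * R" if "norm x \<le> R" for x :: "real^2"
    using component_le_norm_cart[of x j] that by (simp add: norm_mult)
qed

lemma continuous_coordinate_derivative:
  "bandlimited R f \<Longrightarrow> continuous_on UNIV (coordinate_derivative j f)"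
  unfolding coordinate_derivative_def
  by (rule continuous_fourier_transform[OF bandlimited_integrable[OF bandlimited_coordinate]])

lemma continuous_grad_square: "bandlimited R f \<Longrightarrow> continuous_on UNIV (grad_square f)"
  unfolding grad_square_def by (intro continuous_intros continuous_coordinate_derivative)

lemma ray_derivative:
  assumes f: "bandlimited R f"
  shows "((\<lambda>r. fourier_transform f (r *\<^sub>R \<omega>)) has_vector_derivative
     of_real (\<omega>$1) * coordinate_derivative 1 f (r *\<^sub>R \<omega>) + of_real (\<omega>$2) * coordinate_derivative 2 f (r *\<^sub>R \<omega>)) (at r)"
proof -
  note I = bandlimited_integrable[OF bandlimited_coordinate[OF f]]
  have "of_real (\<omega>$1) * coordinate_derivative 1 f (r *\<^sub>R \<omega>) + of_real (\<omega>$2) * coordinate_derivative 2 f (r *\<^sub>R \<omega>)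
    = fourier_transform (\<lambda>x. (- (2 * of_real pi * \<i> * of_real (\<omega> \<bullet> x))) * f x) (r *\<^sub>R \<omega>)"
    unfolding coordinate_derivative_def fourier_transform_cmult[symmetric]
    by (subst fourier_transform_add[symmetric])
      (rule integrable_mult_right I | (rule arg_cong[where f = "\<lambda>g. fourier_transform g _"], simp add: inner_real2 algebra_simps))+
  then show ?thesis using fourier_transform_ray_derivative[OF f] by simp
qed

text \<open>Cauchy-Schwarz in the plane. It replaces the radial derivative by a function on the
  whole plane, to which polar integration and Plancherel's theorem apply.\<close>

lemma ray_derivative_bound:
  fixes \<omega> :: "real^2"
  assumes "norm \<omega> = 1"
  shows "(norm (of_real (\<omega>$1) * coordinate_derivative 1 f \<xi> + of_real (\<omega>$2) * coordinate_derivative 2 f \<xi>))\<^sup>2 \<le> grad_square f \<xi>"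
proof -
  define a b where "a = norm (coordinate_derivative 1 f \<xi>)" and "b = norm (coordinate_derivative 2 f \<xi>)"
  have w: "(\<omega>$1)\<^sup>2 + (\<omega>$2)\<^sup>2 = 1" using assms norm_real2[of \<omega>] by simp
  have "norm (of_real (\<omega>$1) * coordinate_derivative 1 f \<xi> + of_real (\<omega>$2) * coordinate_derivative 2 f \<xi>)
    \<le> \<bar>\<omega>$1\<bar> * a + \<bar>\<omega>$2\<bar> * b"
    unfolding a_def b_def by (rule order_trans[OF norm_triangle_ineq]) (simp add: norm_mult)
  then have "(norm (of_real (\<omega>$1) * coordinate_derivative 1 f \<xi> + of_real (\<omega>$2) * coordinate_derivative 2 f \<xi>))\<^sup>2
    \<le> (\<bar>\<omega>$1\<bar> * a + \<bar>\<omega>$2\<bar> * b)\<^sup>2" by (intro power_mono) auto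
  also have "\<dots> \<le> ((\<omega>$1)\<^sup>2 + (\<omega>$2)\<^sup>2) * (a\<^sup>2 + b\<^sup>2)"
  proof -
    have "((\<omega>$1)\<^sup>2 + (\<omega>$2)\<^sup>2) * (a\<^sup>2 + b\<^sup>2) - (\<bar>\<omega>$1\<bar> * a + \<bar>\<omega>$2\<bar> * b)\<^sup>2 = (\<bar>\<omega>$1\<bar> * b - \<bar>\<omega>$2\<bar> * a)\<^sup>2"
      by (simp add: power2_eq_square algebra_simps)
    then show ?thesis by (smt (verit) zero_le_power2)
  qed
  finally show ?thesis by (simp add: w grad_square_def a_def b_def)
qed

text \<open>Bernstein's inequality with its sharp constant: the multipliers of both coordinates are
  added before they are estimated, which gives \<open>(2 pi |x|)^2 <= (2 pi R)^2\<close> without a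
  factor 2.\<close>

lemma grad_square_energy:
  assumes f: "bandlimited R f" and R: "0 \<le> R"
  shows "integrable lborel (grad_square f)"
    and "(LINT \<xi>|lborel. grad_square f \<xi>) \<le> (2 * pi * R)\<^sup>2 * energy f"
proof -
  note B = bandlimited_coordinate[OF f]
  note P = plancherel_integral[OF B]
  show "integrable lborel (grad_square f)"
    unfolding grad_square_def coordinate_derivative_def by (intro Bochner_Integration.integrable_add P)
  have "(LINT \<xi>|lborel. grad_square f \<xi>) = energy (\<lambda>x. - (2 * of_real pi * \<i> * of_real (x $ 1)) * f x) + energy (\<lambda>x. - (2 * of_real pi * \<i> * of_real (x $ 2)) * f x)"
    unfolding grad_square_def coordinate_derivative_def
    by (subst Bochner_Integration.integral_add) (simp_all only: P)
  also have "\<dots> = (LINT x|lborel. (norm (- (2 * of_real pi * \<i> * of_real (x $ 1)) * f x))\<^sup>2 + (norm (- (2 * of_real pi * \<i> * of_real (x $ 2)) * f x))\<^sup>2)"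
    unfolding energy_def
    by (rule Bochner_Integration.integral_add[symmetric]) (use B in \<open>auto simp only: bandlimited_def\<close>)
  also have "\<dots> \<le> (LINT x|lborel. (2 * pi * R)\<^sup>2 * (norm (f x))\<^sup>2)"
  proof (rule integral_mono_AE)
    show "integrable lborel (\<lambda>x. (norm (- (2 * of_real pi * \<i> * of_real (x $ 1)) * f x))\<^sup>2 + (norm (- (2 * of_real pi * \<i> * of_real (x $ 2)) * f x))\<^sup>2)"
      by (rule Bochner_Integration.integrable_add) (use B in \<open>auto simp only: bandlimited_def\<close>)
    show "integrable lborel (\<lambda>x. (2 * pi * R)\<^sup>2 * (norm (f x))\<^sup>2)" using f by (simp add: bandlimited_def)
    have "AE x in lborel. R < norm x \<longrightarrow> f x = 0" using f by (simp add: bandlimited_def)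
    then show "AE x in lborel. (norm (- (2 * of_real pi * \<i> * of_real (x $ 1)) * f x))\<^sup>2 + (norm (- (2 * of_real pi * \<i> * of_real (x $ 2)) * f x))\<^sup>2
       \<le> (2 * pi * R)\<^sup>2 * (norm (f x))\<^sup>2"
    proof eventually_elim
      case (elim x)
      have "(norm (- (2 * of_real pi * \<i> * of_real (x $ 1)) * f x))\<^sup>2 + (norm (- (2 * of_real pi * \<i> * of_real (x $ 2)) * f x))\<^sup>2
        = (2 * pi * norm x)\<^sup>2 * (norm (f x))\<^sup>2"
        by (simp add: norm_mult power_mult_distrib norm_real2 algebra_simps)
      moreover have "(2 * pi * norm x)\<^sup>2 * (norm (f x))\<^sup>2 \<le> (2 * pi * R)\<^sup>2 * (norm (f x))\<^sup>2"
      proof (cases "R < norm x")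
        case False
        then show ?thesis using R by (intro mult_right_mono power_mono mult_left_mono) auto
      qed (use elim in auto)
      ultimately show ?case by simp
    qed
  qed
  also have "\<dots> = (2 * pi * R)\<^sup>2 * energy f" by (simp add: energy_def)
  finally show "(LINT \<xi>|lborel. grad_square f \<xi>) \<le> (2 * pi * R)\<^sup>2 * energy f" .
qed

subsection \<open>Polar coordinates\<close>

text \<open>Angles are measured in full turns, as in the parametrisation of the spiral; the price is
  the factor \<open>2 pi\<close> in the Jacobian.\<close>

definition dirv :: "real \<Rightarrow> real^2" where
  "dirv \<theta> = vector [cos (2 * pi * \<theta>), sin (2 * pi * \<theta>)]"

lemma norm_dirv [simp]: "norm (dirv \<theta>) = 1"
proof -
  have "(norm (dirv \<theta>))\<^sup>2 = 1" by (simp add: norm_real2 dirv_def)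
  then show ?thesis by (simp add: power2_eq_1_iff) (smt (verit) norm_ge_zero)
qed

lemma dirv_add_nat [simp]: "dirv (\<theta> + real k) = dirv \<theta>"
  using cos.plus_of_nat[of "2 * pi * \<theta>" k] sin.plus_of_nat[of "2 * pi * \<theta>" k]
  by (simp add: dirv_def algebra_simps)

lemma continuous_dirv [continuous_intros]:
  fixes f :: "'a::t2_space \<Rightarrow> real"
  assumes "continuous_on S f"
  shows "continuous_on S (\<lambda>x. dirv (f x))"
  unfolding dirv_def using assms
  by (intro continuous_vector2 continuous_on_cos continuous_on_sin continuous_on_mult_left)

lemma measurable_dirv [measurable]: "dirv \<in> borel_measurable borel"
  by (intro borel_measurable_continuous_onI continuous_intros)

lemma polar_exists: "\<exists>\<theta>. 0 \<le> \<theta> \<and> \<theta> < 1 \<and> x = norm x *\<^sub>R dirv \<theta>"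
proof (cases "x = 0")
  case False
  define c s where "c = x$1 / norm x" and "s = x$2 / norm x"
  have "c\<^sup>2 + s\<^sup>2 = 1"
    using False norm_real2[of x] by (simp add: c_def s_def power_divide flip: add_divide_distrib) auto
  then obtain t where t: "0 \<le> t" "t < 2 * pi" "c = cos t" "s = sin t" by (rule sincos_total_2pi)
  have "x = norm x *\<^sub>R dirv (t / (2 * pi))"
  proof -
    have "x$1 = norm x * c" "x$2 = norm x * s" using False by (auto simp: c_def s_def)
    moreover have "2 * pi * (t / (2 * pi)) = t" by simp
    ultimately show ?thesis using t(3,4) by (simp only: vec_eq_iff forall_2 dirv_def vector_scaleR_component vector_2) simp
  qed
  then show ?thesis using t by (intro exI[of _ "t / (2 * pi)"]) (auto simp: field_simps)
qed (auto intro: exI[of _ 0])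

lemma dirv_inj:
  assumes "dirv a = dirv b" "\<bar>a - b\<bar> < 1"
  shows "a = b"
proof -
  have "cos (2 * pi * a) = cos (2 * pi * b) \<and> sin (2 * pi * a) = sin (2 * pi * b)"
    using assms(1) by (simp add: vec_eq_iff forall_2 dirv_def)
  then obtain n :: int where n: "2 * pi * a = 2 * pi * b + 2 * pi * n"
    using sin_cos_eq_iff[of "2 * pi * a" "2 * pi * b"] by (auto simp: mult.commute)
  then have "a - b = of_int n"
  proof -
    have "2 * pi * (a - b) = 2 * pi * of_int n" using n by (simp add: algebra_simps)
    then show ?thesis by simp
  qed
  then have "\<bar>real_of_int n\<bar> < 1" using assms(2) by simp
  then have "n = 0" by linarith
  then show ?thesis using \<open>a - b = of_int n\<close> by simp
qed

text \<open>Change of variables on the strip \<open>S\<close>, whose image fills the plane up to a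
  null set. Integrability over the image makes the pulled-back function integrable, after which
  Tonelli's theorem separates radius and angle.\<close>

lemma polar_integral:
  fixes h :: "real^2 \<Rightarrow> real"
  assumes hm: "h \<in> borel_measurable borel" and hi: "integrable lborel h" and h0: "\<And>x. 0 \<le> h x"
  shows "(\<integral>\<^sup>+x. ennreal (h x) \<partial>lborel) =
    (\<integral>\<^sup>+\<theta>\<in>{0<..<1}. (\<integral>\<^sup>+r\<in>{0<..}. ennreal (2 * pi * r * h (r *\<^sub>R dirv \<theta>)) \<partial>lborel) \<partial>lborel)"
proof -
  note [measurable] = hm
  define g where "g z = z$1 *\<^sub>R dirv (z$2)" for z :: "real^2"
  define g' where "g' z w = w$1 *\<^sub>R dirv (z$2) + (z$1 * (2 * pi * w$2)) *\<^sub>R vector [- sin (2 * pi * z$2), cos (2 * pi * z$2)]"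
    for z w :: "real^2"
  define S where "S = {z :: real^2. 0 < z$1 \<and> 0 < z$2 \<and> z$2 < 1}"
  define T where "T = g ` S"
  have [measurable]: "S \<in> sets borel" unfolding S_def by measurable
  have SL: "S \<in> sets lebesgue" by simp
  have der: "(g has_derivative g' z) (at z within S)" for z
  proof -
    have bl: "bounded_linear (\<lambda>x :: real^2. x $ i)" for i by (rule bounded_linear_vec_nth)
    have d: "((\<lambda>x :: real^2. x $ i) has_derivative (\<lambda>w. w $ i)) (at z within S)" for i
      by (rule bounded_linear_imp_has_derivative[OF bl])
    have "((\<lambda>z. (z$1 * cos (2 * pi * z$2)) *\<^sub>R axis 1 1 + (z$1 * sin (2 * pi * z$2)) *\<^sub>R axis 2 1) has_derivative g' z) (at z within S)"
      unfolding g'_def dirv_def vector2_eq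
      by (rule derivative_eq_intros d refl)+ (auto simp: fun_eq_iff vec_eq_iff forall_2 axis_def algebra_simps)
    moreover have "g = (\<lambda>z. (z$1 * cos (2 * pi * z$2)) *\<^sub>R axis 1 1 + (z$1 * sin (2 * pi * z$2)) *\<^sub>R axis 2 1)"
      unfolding g_def dirv_def vector2_eq by (auto simp: algebra_simps)
    ultimately show ?thesis by simp
  qed
  have det: "det (matrix (g' z)) = 2 * pi * z$1" for z
    unfolding det_2 matrix_def g'_def dirv_def
    by (simp add: axis_def algebra_simps) (simp add: sin_squared_eq power2_eq_square flip: distrib_left)
  have inj: "inj_on g S"
  proof (rule inj_onI)
    fix x y assume x: "x \<in> S" and y: "y \<in> S" and e: "g x = g y"
    have "norm (g x) = x$1" "norm (g y) = y$1" using x y by (auto simp: g_def S_def)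
    then have e1: "x$1 = y$1" using e by simp
    then have "dirv (x$2) = dirv (y$2)" using e x by (auto simp: g_def S_def)
    then have "x$2 = y$2" by (rule dirv_inj) (use x y in \<open>auto simp: S_def\<close>)
    with e1 show "x = y" by (simp add: vec_eq_iff forall_2)
  qed
  \<comment> \<open>The points that are missed have angle 0, hence lie on the horizontal
    axis.\<close>
  have neg: "negligible (UNIV - T)"
  proof (rule negligible_subset[OF negligible_standard_hyperplane_cart])
    show "UNIV - T \<subseteq> {x. x $ 2 = 0}"
    proof (clarsimp, rule ccontr)
      fix x :: "real^2" assume x: "x \<notin> T" "x $ 2 \<noteq> 0"
      obtain \<theta> where t: "0 \<le> \<theta>" "\<theta> < 1" "x = norm x *\<^sub>R dirv \<theta>" using polar_exists by blast
      have n: "0 < norm x" using x(2) by auto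
      have "\<theta> \<noteq> 0"
      proof
        assume "\<theta> = 0"
        then have "x = norm x *\<^sub>R dirv 0" using t by simp
        then have "x$2 = (norm x *\<^sub>R dirv 0)$2" by simp
        then show False using x(2) by (simp add: dirv_def)
      qed
      then have "vector [norm x, \<theta>] \<in> S" using t n by (simp add: S_def)
      moreover have "g (vector [norm x, \<theta>]) = x" using t(3) by (simp add: g_def)
      ultimately show False using x(1) unfolding T_def by (metis imageI)
    qed
  qed
  have TL: "T \<in> sets lebesgue"
  proof -
    have "UNIV - T \<in> sets lebesgue" using neg by (simp add: negligible_imp_sets)
    then have "UNIV - (UNIV - T) \<in> sets lebesgue" using sets.compl_sets[of "UNIV - T" lebesgue] by simp
    then show ?thesis by (simp add: Diff_Diff_Int)
  qed
  have hU: "h absolutely_integrable_on UNIV"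
    using hi by (simp add: set_integrable_def integrable_completion)
  have hT: "h absolutely_integrable_on T"
    using set_integrable_subset[OF hU TL] by simp
  have intT: "integral T h = (LINT x|lborel. h x)"
  proof -
    have "integral T h = integral UNIV h"
      by (rule integral_spike_set) (auto intro: negligible_subset[OF neg])
    also have "\<dots> = (LINT x|lborel. h x)" using hi by (rule integral_lborel)
    finally show ?thesis .
  qed
  define k where "k z = indicator S z * (2 * pi * z$1 * h (g z))" for z
  have [measurable]: "g \<in> borel_measurable borel" unfolding g_def by measurable
  have [measurable]: "k \<in> borel_measurable borel" unfolding k_def by measurable
  have k0: "0 \<le> k z" for z using h0 by (auto simp: k_def indicator_def S_def)
  \<comment> \<open>The change of variables formula is applied to a vector-valued function, so
    \<open>h\<close> makes a detour through \<open>real ^ 1\<close>.\<close>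
  have cv: "(\<lambda>x. \<bar>det (matrix (g' x))\<bar> *\<^sub>R vec (h (g x)) :: real^1) absolutely_integrable_on S \<and>
      integral S (\<lambda>x. \<bar>det (matrix (g' x))\<bar> *\<^sub>R vec (h (g x)) :: real^1) = vec (LINT x|lborel. h x)"
    by (rule has_absolute_integral_change_of_variables[OF SL der inj, THEN iffD2])
       (use hT intT in \<open>simp add: T_def[symmetric] absolutely_integrable_on_1_iff integral_on_1_eq\<close>)
  have kS: "(\<lambda>x. 2 * pi * x$1 * h (g x)) absolutely_integrable_on S"
    and kI: "integral S (\<lambda>x. 2 * pi * x$1 * h (g x)) = (LINT x|lborel. h x)"
  proof -
    have *: "\<bar>2 * pi * x$1\<bar> = 2 * pi * x$1" if "x \<in> S" for x :: "real^2" using that by (simp add: S_def abs_mult)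
    have "(\<lambda>x. \<bar>2 * pi * x$1\<bar> * h (g x)) absolutely_integrable_on S"
      using cv by (simp add: det absolutely_integrable_on_1_iff)
    moreover have "(\<lambda>x. \<bar>2 * pi * x$1\<bar> * h (g x)) absolutely_integrable_on S \<longleftrightarrow>
        (\<lambda>x. 2 * pi * x$1 * h (g x)) absolutely_integrable_on S"
      by (intro set_integrable_cong refl) (simp add: *)
    ultimately show "(\<lambda>x. 2 * pi * x$1 * h (g x)) absolutely_integrable_on S" by simp
    have "integral S (\<lambda>x. \<bar>2 * pi * x$1\<bar> * h (g x)) = (LINT x|lborel. h x)"
      using cv by (simp add: det integral_on_1_eq vec_eq_iff)
    moreover have "integral S (\<lambda>x. \<bar>2 * pi * x$1\<bar> * h (g x)) = integral S (\<lambda>x. 2 * pi * x$1 * h (g x))"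
      by (rule integral_cong) (simp add: *)
    ultimately show "integral S (\<lambda>x. 2 * pi * x$1 * h (g x)) = (LINT x|lborel. h x)" by simp
  qed
  have kil: "integrable lebesgue k"
    using kS by (simp add: set_integrable_def k_def[abs_def])
  have kint: "integrable lborel k"
    using kil by (simp add: integrable_completion)
  have "(LINT z|lborel. k z) = (LINT z|lebesgue. k z)" by (rule integral_completion[symmetric]) simp
  also have "\<dots> = (LINT z:S|lebesgue. 2 * pi * z$1 * h (g z))"
    by (simp add: set_lebesgue_integral_def k_def[abs_def])
  also have "\<dots> = (LINT x|lborel. h x)"
    using set_lebesgue_integral_eq_integral(2)[OF kS] kI by simp
  finally have kh: "(LINT z|lborel. k z) = (LINT x|lborel. h x)" .
  have "(\<integral>\<^sup>+x. ennreal (h x) \<partial>lborel) = (\<integral>\<^sup>+z. ennreal (k z) \<partial>lborel)"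
    using kh hi kint h0 k0 by (simp add: nn_integral_eq_integral)
  also have "\<dots> = (\<integral>\<^sup>+a. \<integral>\<^sup>+b. ennreal (k (vector [a, b])) \<partial>lborel \<partial>lborel)"
    by (rule nn_integral_real2) measurable
  also have "\<dots> = (\<integral>\<^sup>+b. \<integral>\<^sup>+a. ennreal (k (vector [a, b])) \<partial>lborel \<partial>lborel)"
    by (rule lborel_pair.Fubini'[symmetric]) measurable
  also have "\<dots> = (\<integral>\<^sup>+\<theta>\<in>{0<..<1}. (\<integral>\<^sup>+r\<in>{0<..}. ennreal (2 * pi * r * h (r *\<^sub>R dirv \<theta>)) \<partial>lborel) \<partial>lborel)"
  proof (rule nn_integral_cong)
    fix b :: real
    show "(\<integral>\<^sup>+a. ennreal (k (vector [a, b])) \<partial>lborel) =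
      (\<integral>\<^sup>+r\<in>{0<..}. ennreal (2 * pi * r * h (r *\<^sub>R dirv b)) \<partial>lborel) * indicator {0<..<1} b"
    proof (cases "b \<in> {0<..<1}")
      case True
      then show ?thesis
        by (simp, intro nn_integral_cong) (auto simp: k_def g_def S_def indicator_def)
    next
      case False
      then have "k (vector [a, b]) = 0" for a by (auto simp: k_def S_def)
      then show ?thesis using False by simp
    qed
  qed
  finally show ?thesis .
qed

subsection \<open>Inequalities on an interval\<close>

lemma nn_integral_interval:
  fixes v :: "real \<Rightarrow> real"
  assumes c: "continuous_on UNIV v" and v0: "\<And>r. r \<in> {a..b} \<Longrightarrow> 0 \<le> v r"
  shows "(\<integral>\<^sup>+r\<in>{a..b}. ennreal (v r) \<partial>lborel) = ennreal (integral {a..b} v)"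
proof -
  have [measurable]: "v \<in> borel_measurable borel" using c by (rule borel_measurable_continuous_onI)
  have "v integrable_on {a..b}"
    by (rule integrable_continuous_interval) (rule continuous_on_subset[OF c], simp)
  then have "(v has_integral integral {a..b} v) {a..b}" by (rule integrable_integral)
  then have hi: "((\<lambda>r. if r \<in> {a..b} then v r else 0) has_integral integral {a..b} v) UNIV"
    by (simp only: has_integral_restrict_UNIV)
  have "(\<integral>\<^sup>+r. ennreal (if r \<in> {a..b} then v r else 0) \<partial>lborel) = ennreal (integral {a..b} v)"
    by (rule nn_integral_has_integral_lborel[OF _ _ hi]) (use v0 in auto)
  also have "(\<integral>\<^sup>+r. ennreal (if r \<in> {a..b} then v r else 0) \<partial>lborel) = (\<integral>\<^sup>+r\<in>{a..b}. ennreal (v r) \<partial>lborel)"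
    by (intro nn_integral_cong) (auto simp: indicator_def)
  finally show ?thesis .
qed

lemma norm_square_has_derivative:
  fixes u :: "real \<Rightarrow> complex"
  assumes "(u has_vector_derivative u') (at r)"
  shows "((\<lambda>r. (norm (u r))\<^sup>2) has_real_derivative 2 * (u r \<bullet> u')) (at r)"
proof -
  have d: "(u has_derivative (\<lambda>h. h *\<^sub>R u')) (at r)" using assms by (simp add: has_vector_derivative_def)
  have "((\<lambda>r. u r \<bullet> u r) has_derivative (\<lambda>h. u r \<bullet> (h *\<^sub>R u') + (h *\<^sub>R u') \<bullet> u r)) (at r)"
    by (rule has_derivative_inner[OF d d])
  also have "(\<lambda>h. u r \<bullet> (h *\<^sub>R u') + (h *\<^sub>R u') \<bullet> u r) = (*) (2 * (u r \<bullet> u'))"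
    by (auto simp: inner_commute)
  finally show ?thesis
    by (simp add: has_field_derivative_def power2_norm_eq_inner)
qed

lemma abs_cot_le:
  assumes e: "0 < e" "e \<le> x" "x \<le> pi - e"
  shows "\<bar>cot x\<bar> \<le> cot e"
proof -
  have s: "0 < sin x" "0 < sin e" using e by (auto intro!: sin_gt_zero)
  have "cot e - cot x = sin (x - e) / (sin e * sin x)"
    using s by (simp add: cot_def sin_diff field_simps)
  moreover have "0 \<le> sin (x - e)" using e by (intro sin_ge_zero) auto
  ultimately have 1: "cot x \<le> cot e" using s by (smt (verit) divide_nonneg_pos mult_pos_pos)
  have "cot e + cot x = sin (x + e) / (sin e * sin x)"
    using s by (simp add: cot_def sin_add field_simps)
  moreover have "0 \<le> sin (x + e)" using e by (intro sin_ge_zero) auto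
  ultimately have "- cot x \<le> cot e" using s by (smt (verit) divide_nonneg_pos mult_pos_pos)
  with 1 show ?thesis by simp
qed

text \<open>The weight \<open>w = \<kappa> cot (\<kappa> (r - a) + e)\<close> solves the Riccati equation \<open>w' = - \<kappa>\<^sup>2 - w\<^sup>2\<close>, so that
  \<open>|u'|\<^sup>2 - \<kappa>\<^sup>2 |u|\<^sup>2 = |u' - w u|\<^sup>2 + (w |u|\<^sup>2)'\<close>; the factor \<open>r\<close> costs the extra term \<open>w |u|\<^sup>2\<close>.\<close>

lemma wirtinger_interval:
  fixes u u' :: "real \<Rightarrow> complex" and Q :: "real \<Rightarrow> real"
  assumes \<eta>: "0 < \<eta>" and e: "0 < e" "e < pi / 2" and \<kappa>: "\<kappa> = (pi - 2 * e) / \<eta>"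
    and der: "\<And>r. (u has_vector_derivative u' r) (at r)"
    and Qc: "continuous_on UNIV Q" and Q: "\<And>r. (norm (u' r))\<^sup>2 \<le> Q r"
    and a: "0 \<le> a" and low: "\<And>r. a \<le> r \<Longrightarrow> \<mu> * r \<le> \<kappa>\<^sup>2 * r - \<kappa> * cot e" and \<mu>: "0 \<le> \<mu>"
  shows "ennreal \<mu> * (\<integral>\<^sup>+r\<in>{a..a+\<eta>}. ennreal (r * (norm (u r))\<^sup>2) \<partial>lborel) \<le>
     (\<integral>\<^sup>+r\<in>{a..a+\<eta>}. ennreal (r * Q r) \<partial>lborel)
      + ennreal (\<kappa> * cot e * ((a + \<eta>) * (norm (u (a + \<eta>)))\<^sup>2 + a * (norm (u a))\<^sup>2))"
proof -
  define b where "b = a + \<eta>"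
  define W where "W = \<kappa> * cot e"
  have \<kappa>0: "0 < \<kappa>" using \<eta> e by (simp add: \<kappa>)
  have k\<eta>: "\<kappa> * \<eta> = pi - 2 * e" using \<eta> by (simp add: \<kappa>)
  define x where "x r = \<kappa> * (r - a) + e" for r
  have xb: "e \<le> x r" "x r \<le> pi - e" if "r \<in> {a..b}" for r
  proof -
    show "e \<le> x r" using that \<kappa>0 by (simp add: x_def)
    have "\<kappa> * (r - a) \<le> \<kappa> * \<eta>" using that \<kappa>0 by (intro mult_left_mono) (auto simp: b_def)
    then show "x r \<le> pi - e" using k\<eta> by (simp add: x_def)
  qed
  define w where "w r = \<kappa> * cot (x r)" for r
  define d where "d r = (norm (u r))\<^sup>2" for r
  define \<Phi> where "\<Phi> r = r * w r * d r" for r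
  define \<Phi>' where "\<Phi>' r = (w r + r * (- \<kappa>\<^sup>2 - (w r)\<^sup>2)) * d r + r * w r * (2 * (u r \<bullet> u' r))" for r
  have dd: "(d has_real_derivative 2 * (u r \<bullet> u' r)) (at r)" for r
    unfolding d_def by (rule norm_square_has_derivative[OF der])
  have dw: "(w has_real_derivative - \<kappa>\<^sup>2 - (w r)\<^sup>2) (at r)" if "r \<in> {a..b}" for r
  proof -
    have s: "sin (x r) \<noteq> 0" using xb[OF that] e sin_gt_zero[of "x r"] by force
    have dx: "(x has_real_derivative \<kappa>) (at r)" unfolding x_def by (auto intro!: derivative_eq_intros)
    have "(w has_real_derivative \<kappa> * (- inverse ((sin (x r))\<^sup>2) * \<kappa>)) (at r)"
      unfolding w_def by (intro DERIV_cmult DERIV_chain2[OF DERIV_cot dx] s)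
    also have "\<kappa> * (- inverse ((sin (x r))\<^sup>2) * \<kappa>) = - \<kappa>\<^sup>2 - (w r)\<^sup>2"
    proof -
      have "1 + (cot (x r))\<^sup>2 = ((sin (x r))\<^sup>2 + (cos (x r))\<^sup>2) / (sin (x r))\<^sup>2"
        using s by (simp add: cot_def power_divide add_divide_distrib del: sin_cos_squared_add)
      then have i: "inverse ((sin (x r))\<^sup>2) = 1 + (cot (x r))\<^sup>2" by (simp add: inverse_eq_divide)
      show ?thesis unfolding i w_def by (simp add: power2_eq_square algebra_simps)
    qed
    finally show ?thesis .
  qed
  have d\<Phi>: "(\<Phi> has_vector_derivative \<Phi>' r) (at r within {a..b})" if "r \<in> {a..b}" for r
  proof -
    have "(\<Phi> has_real_derivative \<Phi>' r) (at r)"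
      unfolding \<Phi>_def \<Phi>'_def
      by (rule derivative_eq_intros dw[OF that] dd refl)+ (simp add: algebra_simps)
    then show ?thesis
      by (simp add: has_real_derivative_iff_has_vector_derivative has_vector_derivative_at_within)
  qed
  have ab: "a \<le> b" using \<eta> by (simp add: b_def)
  have hi: "(\<Phi>' has_integral (\<Phi> b - \<Phi> a)) {a..b}"
    by (rule fundamental_theorem_of_calculus[OF ab d\<Phi>])
  have uc: "continuous_on UNIV u"
    using der by (auto intro!: continuous_at_imp_continuous_on has_vector_derivative_continuous)
  have dc: "continuous_on UNIV d" unfolding d_def by (intro continuous_intros uc)
  have iQ: "(\<lambda>r. r * Q r) integrable_on {a..b}"
    by (rule integrable_continuous_interval, rule continuous_on_subset[of UNIV]) (intro continuous_intros Qc, simp)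
  have iD: "(\<lambda>r. r * d r) integrable_on {a..b}"
    by (rule integrable_continuous_interval, rule continuous_on_subset[of UNIV]) (intro continuous_intros dc, simp)
  define p where "p r = r * Q r - (\<mu> * r) * d r" for r
  have pc: "continuous_on UNIV p" unfolding p_def by (intro continuous_intros Qc dc)
  have pi': "(p has_integral integral {a..b} p) {a..b}"
    by (intro integrable_integral integrable_continuous_interval continuous_on_subset[OF pc]) simp
  have wW: "\<bar>w r\<bar> \<le> W" if "r \<in> {a..b}" for r
    using abs_cot_le[OF e(1) xb[OF that]] \<kappa>0 by (simp add: w_def W_def abs_mult)
  have "\<Phi>' r \<le> p r" if r: "r \<in> {a..b}" for r
  proof -
    have r0: "0 \<le> r" using r a by simp
    have "(norm (u' r - w r *\<^sub>R u r))\<^sup>2 = (norm (u' r))\<^sup>2 - 2 * w r * (u r \<bullet> u' r) + (w r)\<^sup>2 * d r"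
      unfolding d_def power2_norm_eq_inner by (simp add: inner_diff_left inner_diff_right inner_commute power2_eq_square algebra_simps)
    then have "2 * w r * (u r \<bullet> u' r) - (w r)\<^sup>2 * d r \<le> Q r"
      using Q[of r] zero_le_power2[of "norm (u' r - w r *\<^sub>R u r)"] by linarith
    then have "r * (2 * w r * (u r \<bullet> u' r) - (w r)\<^sup>2 * d r) \<le> r * Q r" using r0 by (rule mult_left_mono)
    \<comment> \<open>Here \<open>low\<close> absorbs the extra term: \<open>w r\<close> is at most
      \<open>W\<close>, and \<open>\<kappa>^2 r - W\<close> is still at least
      \<open>\<mu> r\<close>.\<close>
    moreover have "(w r - \<kappa>\<^sup>2 * r) * d r \<le> - (\<mu> * r) * d r"
      using low[of r] wW[OF r] r by (intro mult_right_mono) (auto simp: W_def d_def)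
    ultimately show ?thesis by (simp add: \<Phi>'_def p_def algebra_simps)
  qed
  then have "\<Phi> b - \<Phi> a \<le> integral {a..b} p" by (rule has_integral_le[OF hi pi'])
  also have "integral {a..b} p = integral {a..b} (\<lambda>r. r * Q r) - \<mu> * integral {a..b} (\<lambda>r. r * d r)"
  proof -
    note i1 = iQ and i2 = iD
    have "integral {a..b} p = integral {a..b} (\<lambda>r. r * Q r - \<mu> * (r * d r))"
      by (rule integral_cong) (simp add: p_def algebra_simps)
    also have "\<dots> = integral {a..b} (\<lambda>r. r * Q r) - integral {a..b} (\<lambda>r. \<mu> * (r * d r))"
      by (rule Henstock_Kurzweil_Integration.integral_diff[OF i1 integrable_on_mult_right[OF i2]])
    finally show ?thesis by simp
  qed
  \<comment> \<open>The argument of the cotangent runs from \<open>e\<close> to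
    \<open>pi - e\<close>, so \<open>w\<close> takes opposite values at the two ends and both
    boundary terms appear with the same sign and the same weight \<open>W\<close>.\<close>
  also have "\<Phi> b = - (W * (b * d b))"
  proof -
    have "cot (pi - e) = - cot e" by (simp add: cot_def)
    then have "w b = - W" using k\<eta> by (simp add: w_def W_def x_def b_def)
    then show ?thesis by (simp add: \<Phi>_def)
  qed
  also have "\<Phi> a = W * (a * d a)" by (simp add: \<Phi>_def w_def W_def x_def)
  finally have main: "\<mu> * integral {a..b} (\<lambda>r. r * d r) \<le> integral {a..b} (\<lambda>r. r * Q r) + W * (b * d b + a * d a)"
    by (simp add: algebra_simps)
  have Q0: "0 \<le> Q r" for r using Q[of r] zero_le_power2 order_trans by blast
  have W0: "0 \<le> W" using wW[of a] ab by (auto intro: order_trans[OF abs_ge_zero])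
  have D: "(\<integral>\<^sup>+r\<in>{a..b}. ennreal (r * d r) \<partial>lborel) = ennreal (integral {a..b} (\<lambda>r. r * d r))"
    using a by (intro nn_integral_interval continuous_intros dc) (auto simp: d_def)
  have QQ: "(\<integral>\<^sup>+r\<in>{a..b}. ennreal (r * Q r) \<partial>lborel) = ennreal (integral {a..b} (\<lambda>r. r * Q r))"
    using a Q0 by (intro nn_integral_interval continuous_intros Qc) auto
  have D0: "0 \<le> integral {a..b} (\<lambda>r. r * d r)"
    using a by (intro integral_nonneg iD) (auto simp: d_def)
  have Qi0: "0 \<le> integral {a..b} (\<lambda>r. r * Q r)"
    using a Q0 by (intro integral_nonneg iQ) auto
  have B0: "0 \<le> W * (b * d b + a * d a)" using W0 a ab by (simp add: d_def)
  have "ennreal \<mu> * ennreal (integral {a..b} (\<lambda>r. r * d r)) \<le> ennreal (integral {a..b} (\<lambda>r. r * Q r)) + ennreal (W * (b * d b + a * d a))"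
    using main \<mu> D0 Qi0 B0 by (simp add: ennreal_mult[symmetric] ennreal_plus[symmetric] ennreal_leI del: ennreal_plus)
  then show ?thesis unfolding D[symmetric] QQ[symmetric] by (simp add: d_def b_def W_def)
qed

text \<open>Integrate the derivative of \<open>- a \<phi> |u|^2\<close>, where \<phi> falls linearly
  from 1 at \<open>a\<close> to 0 at \<open>a + \<eta>\<close>, so that only the value at
  \<open>a\<close> survives. The constant factor \<open>a\<close> is replaced by
  \<open>r >= a\<close> at the end.\<close>

lemma trace_interval:
  fixes u u' :: "real \<Rightarrow> complex" and Q :: "real \<Rightarrow> real"
  assumes \<eta>: "0 < \<eta>" and der: "\<And>r. (u has_vector_derivative u' r) (at r)"
    and Qc: "continuous_on UNIV Q" and Q: "\<And>r. (norm (u' r))\<^sup>2 \<le> Q r" and a: "0 \<le> a"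
  shows "ennreal (a * (norm (u a))\<^sup>2) \<le>
    (\<integral>\<^sup>+r\<in>{a..a+\<eta>}. ennreal (r * ((1 + 1 / \<eta>) * (norm (u r))\<^sup>2 + Q r)) \<partial>lborel)"
proof -
  define b where "b = a + \<eta>"
  define d where "d r = (norm (u r))\<^sup>2" for r
  define \<phi> where "\<phi> r = 1 - (r - a) / \<eta>" for r
  have \<phi>: "0 \<le> \<phi> r" "\<phi> r \<le> 1" if "r \<in> {a..b}" for r
    using that \<eta> by (auto simp: \<phi>_def b_def field_simps)
  define \<Psi> where "\<Psi> r = - a * \<phi> r * d r" for r
  define \<Psi>' where "\<Psi>' r = a / \<eta> * d r - a * \<phi> r * (2 * (u r \<bullet> u' r))" for r
  have dd: "(d has_real_derivative 2 * (u r \<bullet> u' r)) (at r)" for r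
    unfolding d_def by (rule norm_square_has_derivative[OF der])
  have d\<phi>: "(\<phi> has_real_derivative - (1 / \<eta>)) (at r)" for r
    unfolding \<phi>_def using \<eta> by (auto intro!: derivative_eq_intros)
  have d\<Psi>: "(\<Psi> has_vector_derivative \<Psi>' r) (at r within {a..b})" for r
  proof -
    have "(\<Psi> has_real_derivative \<Psi>' r) (at r)"
      unfolding \<Psi>_def \<Psi>'_def
      by (rule derivative_eq_intros d\<phi> dd refl)+ (simp add: algebra_simps)
    then show ?thesis
      by (simp add: has_real_derivative_iff_has_vector_derivative has_vector_derivative_at_within)
  qed
  have ab: "a \<le> b" using \<eta> by (simp add: b_def)
  have hi: "(\<Psi>' has_integral (\<Psi> b - \<Psi> a)) {a..b}"
    by (rule fundamental_theorem_of_calculus[OF ab d\<Psi>])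
  have uc: "continuous_on UNIV u"
    using der by (auto intro!: continuous_at_imp_continuous_on has_vector_derivative_continuous)
  define p where "p r = r * ((1 + 1 / \<eta>) * d r + Q r)" for r
  have pc: "continuous_on UNIV p" unfolding p_def d_def by (intro continuous_intros Qc uc)
  have pi': "(p has_integral integral {a..b} p) {a..b}"
    by (intro integrable_integral integrable_continuous_interval continuous_on_subset[OF pc]) simp
  have Q0: "0 \<le> Q r" for r using Q[of r] zero_le_power2 order_trans by blast
  have p0: "0 \<le> p r" if "r \<in> {a..b}" for r using that a Q0[of r] \<eta> by (simp add: p_def d_def)
  have "\<Psi>' r \<le> p r" if r: "r \<in> {a..b}" for r
  proof -
    have "- (2 * (u r \<bullet> u' r)) \<le> d r + Q r"
    proof -
      have "0 \<le> (norm (u r + u' r))\<^sup>2" by simp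
      also have "\<dots> = d r + 2 * (u r \<bullet> u' r) + (norm (u' r))\<^sup>2"
        unfolding d_def power2_norm_eq_inner by (simp add: inner_add_left inner_add_right inner_commute)
      finally show ?thesis using Q[of r] by linarith
    qed
    then have "\<phi> r * (- (2 * (u r \<bullet> u' r))) \<le> \<phi> r * (d r + Q r)" using \<phi>[OF r] by (intro mult_left_mono)
    also have "\<dots> \<le> d r + Q r" using \<phi>[OF r] Q0[of r] by (intro mult_left_le_one_le) (auto simp: d_def)
    finally have "1 / \<eta> * d r - \<phi> r * (2 * (u r \<bullet> u' r)) \<le> (1 + 1 / \<eta>) * d r + Q r" by (simp add: algebra_simps)
    then have "a * (1 / \<eta> * d r - \<phi> r * (2 * (u r \<bullet> u' r))) \<le> a * ((1 + 1 / \<eta>) * d r + Q r)"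
      using a by (rule mult_left_mono)
    also have "\<dots> \<le> p r" unfolding p_def using r a \<eta> Q0[of r] by (intro mult_right_mono) (auto simp: d_def)
    finally show ?thesis by (simp add: \<Psi>'_def algebra_simps)
  qed
  then have "\<Psi> b - \<Psi> a \<le> integral {a..b} p" by (rule has_integral_le[OF hi pi'])
  moreover have "\<Psi> b = 0" "\<Psi> a = - (a * d a)" using \<eta> by (auto simp: \<Psi>_def \<phi>_def b_def)
  ultimately have "a * d a \<le> integral {a..b} p" by simp
  then have "ennreal (a * d a) \<le> ennreal (integral {a..b} p)" by (rule ennreal_leI)
  also have "\<dots> = (\<integral>\<^sup>+r\<in>{a..b}. ennreal (p r) \<partial>lborel)"
    by (rule nn_integral_interval[OF pc p0, symmetric])
  finally show ?thesis by (simp add: d_def b_def p_def)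
qed

subsection \<open>Approximation by one-sided exponential sums\<close>

lemma fchar_lipschitz: "norm (fchar a - fchar b) \<le> 2 * pi * \<bar>a - b\<bar>"
proof -
  define x where "x = - (2 * pi * (a - b))"
  have "norm (iexp x - (\<Sum>k\<le>0. (\<i> * x) ^ k / fact k)) \<le> \<bar>x\<bar> ^ Suc 0 / fact (Suc 0)" by (rule iexp_approx1)
  then have "norm (iexp x - 1) \<le> \<bar>x\<bar>" by simp
  moreover have "fchar a - fchar b = fchar b * (iexp x - 1)"
  proof -
    have "iexp x = fchar (a - b)" by (simp add: x_def fchar_def algebra_simps)
    then show ?thesis using fchar_add[of b "a - b"] by (simp add: algebra_simps)
  qed
  ultimately show ?thesis by (simp add: norm_mult x_def abs_mult)
qed

lemma fchar_power: "fchar t ^ k = fchar (real k * t)"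
proof (induction k)
  case (Suc k)
  have "real (Suc k) * t = t + real k * t" by (simp add: distrib_right)
  then show ?case by (simp only: power_Suc Suc fchar_add)
qed simp

lemma fchar_cis: "fchar t = of_real (cos (2 * pi * t)) - \<i> * of_real (sin (2 * pi * t))"
proof -
  have "fchar t = cis (- (2 * pi * t))" by (simp add: fchar_def cis_conv_exp mult_ac)
  then show ?thesis by (simp add: complex_eq_iff)
qed

lemma cnj_fchar_mult [simp]: "cnj (fchar t) * fchar t = 1" "fchar t * cnj (fchar t) = 1"
  by (metis fchar_diff diff_self fchar_0 mult.commute) (metis fchar_diff diff_self fchar_0)

lemma fchar_inj:
  assumes "fchar a = fchar b" "\<bar>a - b\<bar> < 1"
  shows "a = b"
proof -
  have "cos (2 * pi * a) = cos (2 * pi * b) \<and> sin (2 * pi * a) = sin (2 * pi * b)"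
    using assms(1) by (simp add: fchar_cis complex_eq_iff)
  then obtain n :: int where n: "2 * pi * a = 2 * pi * b + 2 * pi * n"
    using sin_cos_eq_iff[of "2 * pi * a" "2 * pi * b"] by (auto simp: mult.commute)
  then have "2 * pi * (a - b) = 2 * pi * of_int n" by (simp add: algebra_simps)
  then have ab: "a - b = of_int n" by simp
  then have "\<bar>real_of_int n\<bar> < 1" using assms(2) by simp
  then have "n = 0" by linarith
  then show ?thesis using ab by simp
qed

text \<open>\<open>h z = - \<rho> z / (1 + \<rho> z)\<close> has negative real part on the arc as soon as \<open>\<rho> > - cos \<alpha>\<close>; the
  polynomial is \<open>1 + t h\<close> for small \<open>t > 0\<close>, with the geometric series of \<open>h\<close> truncated.\<close>

lemma small_polynomial_on_arc:
  assumes W: "0 \<le> W" and \<eta>: "0 < \<eta>" and W\<eta>: "2 * W * \<eta> < 1"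
  obtains P :: "complex poly" and q where "poly P 0 = 1" "0 \<le> q" "q < 1"
    "\<And>s. \<bar>s\<bar> \<le> W \<Longrightarrow> norm (poly P (fchar (\<eta> * s))) \<le> q"
proof -
  define \<alpha> where "\<alpha> = 2 * pi * (\<eta> * W)"
  have \<alpha>: "0 \<le> \<alpha>" "\<alpha> < pi"
  proof -
    show "0 \<le> \<alpha>" using W \<eta> by (simp add: \<alpha>_def)
    have "pi * (2 * W * \<eta>) < pi * 1" using W\<eta> by (intro mult_strict_left_mono) auto
    then show "\<alpha> < pi" by (simp add: \<alpha>_def mult_ac)
  qed
  have ca: "- 1 < cos \<alpha>" using cos_monotone_0_pi[of \<alpha> pi] \<alpha> by simp
  \<comment> \<open>The midpoint between 1 and \<open>max 0 (- cos \<alpha>)\<close>: below 1, so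
    that the geometric series converges, and above \<open>- cos \<alpha>\<close>.\<close>
  define \<rho> where "\<rho> = (1 + max 0 (- cos \<alpha>)) / 2"
  have \<rho>: "0 < \<rho>" "\<rho> < 1" "- cos \<alpha> < \<rho>" using ca by (auto simp: \<rho>_def max_def)
  \<comment> \<open>With \<delta> the real part of \<open>h\<close> is at most
    \<open>- \<delta>\<close> (the 4 comes from \<open>|1 + \<rho> z| <= 2\<close>), and
    \<open>H\<close> bounds \<open>|h|\<close>. Then \<open>t = \<delta> / H^2\<close> minimises the
    bound \<open>1 - 2 t \<delta> + t^2 H^2\<close> for \<open>|1 + t h|^2\<close>.\<close>
  define \<delta> where "\<delta> = \<rho> * (\<rho> + cos \<alpha>) / 4"
  define H where "H = 1 / (1 - \<rho>)"
  define t where "t = \<delta> / H\<^sup>2"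
  have \<delta>: "0 < \<delta>" using \<rho> by (simp add: \<delta>_def)
  have H: "0 < H" using \<rho> by (simp add: H_def)
  have t: "0 < t" using \<delta> H by (simp add: t_def)
  have cosb: "cos \<alpha> \<le> cos (2 * pi * (\<eta> * s))" if "\<bar>s\<bar> \<le> W" for s
  proof -
    have "2 * pi * (\<eta> * \<bar>s\<bar>) \<le> \<alpha>" unfolding \<alpha>_def using that \<eta> by (intro mult_left_mono) auto
    then have "cos \<alpha> \<le> cos (2 * pi * (\<eta> * \<bar>s\<bar>))" using \<alpha> \<eta> by (intro cos_monotone_0_pi_le) auto
    also have "cos (2 * pi * (\<eta> * \<bar>s\<bar>)) = cos (2 * pi * (\<eta> * s))"
      by (cases "0 \<le> s") (auto simp: abs_if)
    finally show ?thesis .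
  qed
  have main: "norm (1 + of_real t * (- of_real \<rho> * z / (1 + of_real \<rho> * z))) \<le> sqrt (1 - \<delta>\<^sup>2 / H\<^sup>2)"
    and den: "1 - \<rho> \<le> norm (1 + of_real \<rho> * z)"
    if z: "norm z = 1" "cos \<alpha> \<le> Re z" for z
  proof -
    define D where "D = 1 + of_real \<rho> * z"
    have "norm (1::complex) - norm (of_real \<rho> * z) \<le> norm D" unfolding D_def by (rule norm_diff_ineq)
    then show dl: "1 - \<rho> \<le> norm (1 + of_real \<rho> * z)" using z \<rho> by (simp add: norm_mult D_def)
    have D0: "0 < norm D" unfolding D_def using dl \<rho> by linarith
    have du: "norm D \<le> 2" unfolding D_def
      using norm_triangle_ineq[of 1 "of_real \<rho> * z"] z \<rho> by (simp add: norm_mult)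
    define h where "h = - of_real \<rho> * z / D"
    have hH: "norm h \<le> H"
    proof -
      have "norm h = \<rho> / norm D" using z \<rho> by (simp add: h_def norm_mult norm_divide)
      also have "\<dots> \<le> 1 / (1 - \<rho>)" using \<rho> dl D0 by (intro frac_le) (auto simp: D_def)
      finally show ?thesis by (simp add: H_def)
    qed
    have "h = - of_real \<rho> * (z * cnj D) / of_real ((norm D)\<^sup>2)"
      using D0 by (simp add: h_def complex_norm_square del: of_real_power)
    also have "z * cnj D = z + of_real \<rho>"
    proof -
      have "z * cnj z = 1" using z by (metis complex_norm_square of_real_1 one_power2)
      then show ?thesis by (simp add: D_def algebra_simps)
    qed
    finally have "h = of_real (- \<rho> / (norm D)\<^sup>2) * (z + of_real \<rho>)" by simp
    then have Reh: "Re h = - \<rho> / (norm D)\<^sup>2 * (Re z + \<rho>)" by (simp only: times_complex.sel plus_complex.sel Re_complex_of_real Im_complex_of_real)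
    have "\<delta> \<le> \<rho> * (Re z + \<rho>) / (norm D)\<^sup>2"
    proof -
      have "(norm D)\<^sup>2 \<le> 2\<^sup>2" using du by (intro power_mono) auto
      then show ?thesis unfolding \<delta>_def using \<rho> z D0 by (intro frac_le mult_left_mono mult_nonneg_nonneg) auto
    qed
    then have Reh': "Re h \<le> - \<delta>" using Reh by (simp add: field_simps)
    have "(norm (1 + of_real t * h))\<^sup>2 = 1 + 2 * t * Re h + t\<^sup>2 * (norm h)\<^sup>2"
      unfolding cmod_power2 by (simp add: power2_eq_square algebra_simps)
    also have "\<dots> \<le> 1 + 2 * t * (- \<delta>) + t\<^sup>2 * H\<^sup>2"
      using t Reh' hH by (intro add_mono mult_left_mono power_mono) auto
    also have "\<dots> = 1 - \<delta>\<^sup>2 / H\<^sup>2" using H by (simp add: t_def power2_eq_square field_simps)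
    finally show "norm (1 + of_real t * (- of_real \<rho> * z / (1 + of_real \<rho> * z))) \<le> sqrt (1 - \<delta>\<^sup>2 / H\<^sup>2)"
      by (intro real_le_rsqrt) (simp add: h_def D_def)
  qed
  define q0 where "q0 = sqrt (1 - \<delta>\<^sup>2 / H\<^sup>2)"
  have q01: "q0 < 1" unfolding q0_def using \<delta> H by simp
  \<comment> \<open>The second summand is the error of cutting the geometric series after
    \<open>N\<close> terms; it must fit into the gap between \<open>q0\<close> and 1.\<close>
  have "(\<lambda>N. q0 + t * (\<rho> ^ Suc N / (1 - \<rho>))) \<longlonglongrightarrow> q0 + t * (0 / (1 - \<rho>))"
    using \<rho> by (intro tendsto_intros LIMSEQ_Suc LIMSEQ_realpow_zero) auto
  then have "\<forall>\<^sub>F N in sequentially. q0 + t * (\<rho> ^ Suc N / (1 - \<rho>)) < 1"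
    using q01 by (intro order_tendstoD(2)) auto
  then obtain N where N: "q0 + t * (\<rho> ^ Suc N / (1 - \<rho>)) < 1"
    by (meson eventually_happens trivial_limit_sequentially)
  \<comment> \<open>The series of \<open>h\<close> starts at exponent 1, which gives the
    normalisation \<open>P(0) = 1\<close>.\<close>
  define P :: "complex poly" where "P = 1 + smult (of_real t) (\<Sum>j=1..N. monom ((- of_real \<rho>) ^ j) j)"
  have Pz: "poly P z = 1 + of_real t * (\<Sum>j=1..N. (- of_real \<rho> * z) ^ j)" for z
    by (simp only: power_mult_distrib) (simp add: P_def poly_sum poly_monom)
  have bound: "norm (poly P z) \<le> q0 + t * (\<rho> ^ Suc N / (1 - \<rho>))"
    if z: "norm z = 1" "cos \<alpha> \<le> Re z" for z
  proof -
    define y where "y = - of_real \<rho> * z"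
    have ny: "norm y = \<rho>" using z \<rho> by (simp add: y_def norm_mult)
    have y1: "1 - y \<noteq> 0" using ny \<rho> by auto
    have "(\<Sum>j=1..N. y ^ j) = y * (\<Sum>j<N. y ^ j)"
      unfolding sum_distrib_left by (rule sum.reindex_bij_witness[of _ Suc "\<lambda>j. j - 1"]) (auto simp: power_eq_if)
    also have "\<dots> = y * ((1 - y ^ N) / (1 - y))" using y1 by (simp add: sum_gp_strict)
    also have "\<dots> = y / (1 - y) - y ^ Suc N / (1 - y)"
      by (simp add: diff_divide_distrib right_diff_distrib)
    finally have S: "(\<Sum>j=1..N. y ^ j) = y / (1 - y) - y ^ Suc N / (1 - y)" .
    have "poly P z = (1 + of_real t * (y / (1 - y))) - of_real t * (y ^ Suc N / (1 - y))"
      unfolding Pz y_def[symmetric] S right_diff_distrib by (simp only: add_diff_eq)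
    also have "norm \<dots> \<le> norm (1 + of_real t * (y / (1 - y))) + norm (of_real t * (y ^ Suc N / (1 - y)))"
      by (rule norm_triangle_ineq4)
    also have "\<dots> \<le> q0 + t * (\<rho> ^ Suc N / (1 - \<rho>))"
    proof (intro add_mono)
      show "norm (1 + of_real t * (y / (1 - y))) \<le> q0"
        using main[OF z] by (simp add: q0_def y_def)
      have "norm (of_real t * (y ^ Suc N / (1 - y))) = t * (\<rho> ^ Suc N / norm (1 - y))"
        using t by (simp add: norm_mult norm_divide norm_power ny)
      also have "\<dots> \<le> t * (\<rho> ^ Suc N / (1 - \<rho>))"
        using t \<rho> den[OF z] by (intro mult_left_mono divide_left_mono) (auto simp: y_def intro!: mult_pos_pos)
      finally show "norm (of_real t * (y ^ Suc N / (1 - y))) \<le> t * (\<rho> ^ Suc N / (1 - \<rho>))" .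
    qed
    finally show ?thesis .
  qed
  show thesis
  proof (rule that[of P "max 0 (q0 + t * (\<rho> ^ Suc N / (1 - \<rho>)))"])
    show "poly P 0 = 1" unfolding Pz by (simp add: power_0_left)
    show "norm (poly P (fchar (\<eta> * s))) \<le> max 0 (q0 + t * (\<rho> ^ Suc N / (1 - \<rho>)))" if "\<bar>s\<bar> \<le> W" for s
    proof -
      have "Re (fchar (\<eta> * s)) = cos (2 * pi * (\<eta> * s))" by (simp add: fchar_cis)
      then show ?thesis using bound[of "fchar (\<eta> * s)"] cosb[OF that] by simp
    qed
  qed (use N in auto)
qed

text \<open>A high power of the polynomial \<open>P\<close> is small on the arc and still equals 1
  at 0, so \<open>1 - P^n\<close> is divisible by \<open>z\<close>; the quotient is
  \<open>Q\<close>.\<close>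

lemma one_approx_on_arc:
  assumes W: "0 \<le> W" and \<eta>: "0 < \<eta>" and W\<eta>: "2 * W * \<eta> < 1" and e: "0 < e"
  shows "\<exists>Q :: complex poly. \<forall>s. \<bar>s\<bar> \<le> W \<longrightarrow> norm (1 - fchar (\<eta> * s) * poly Q (fchar (\<eta> * s))) \<le> e"
proof -
  obtain P :: "complex poly" and q where P: "poly P 0 = 1" "0 \<le> q" "q < 1"
    "\<And>s. \<bar>s\<bar> \<le> W \<Longrightarrow> norm (poly P (fchar (\<eta> * s))) \<le> q"
    by (rule small_polynomial_on_arc[OF W \<eta> W\<eta>], rule that) auto
  obtain n where n: "q ^ n < e" using real_arch_pow_inv[OF e P(3)] by blast
  have "poly (1 - P ^ n) 0 = 0" using P(1) by simp
  then obtain Q where Q: "1 - P ^ n = [:0, 1:] * Q"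
    using poly_eq_0_iff_dvd[of "1 - P ^ n" 0] by (auto simp: dvd_def)
  have "poly (1 - P ^ n) z = z * poly Q z" for z unfolding Q by simp
  then have "1 - z * poly Q z = poly P z ^ n" for z by (simp add: poly_power algebra_simps)
  moreover have "norm (poly P (fchar (\<eta> * s)) ^ n) \<le> e" if "\<bar>s\<bar> \<le> W" for s
    using power_mono[OF P(4)[OF that] norm_ge_zero, of n] n by (simp add: norm_power)
  ultimately show ?thesis by metis
qed

lemma poly_bounded_unit_circle:
  fixes P :: "complex poly"
  obtains C where "0 < C" "\<And>t. norm (poly P (fchar t)) \<le> C"
proof -
  have "norm (poly P (fchar t)) \<le> (\<Sum>i\<le>degree P. norm (coeff P i))" for t
    unfolding poly_altdef by (rule order_trans[OF norm_sum]) (simp add: norm_mult norm_power)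
  then show thesis using that[of "(\<Sum>i\<le>degree P. norm (coeff P i)) + 1"]
    by (smt (verit) sum_nonneg norm_ge_zero)
qed

text \<open>Negative powers are removed one at a time. If \<open>z Q1\<close> approximates the
  function with one factor \<open>1 / z\<close> less, then multiplication by \<open>1 / z\<close>
  leaves \<open>Q1\<close>, and \<open>Q1\<close> is close to \<open>z Q Q1\<close> because
  \<open>z Q\<close> is close to 1.\<close>

lemma laurent_approx_on_arc:
  assumes W: "0 \<le> W" and \<eta>: "0 < \<eta>" and W\<eta>: "2 * W * \<eta> < 1" and e: "0 < e"
  shows "\<exists>Q :: complex poly. \<forall>s. \<bar>s\<bar> \<le> W \<longrightarrow>
    norm (cnj (fchar (\<eta> * s)) ^ m * poly P (fchar (\<eta> * s)) - fchar (\<eta> * s) * poly Q (fchar (\<eta> * s))) \<le> e"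
  using e
proof (induction m arbitrary: P e)
  case 0
  obtain C where C: "0 < C" "\<And>t. norm (poly P (fchar t)) \<le> C"
    by (rule poly_bounded_unit_circle[of P], rule that) auto
  obtain Q :: "complex poly" where Q: "\<And>s. \<bar>s\<bar> \<le> W \<Longrightarrow> norm (1 - fchar (\<eta> * s) * poly Q (fchar (\<eta> * s))) \<le> e / C"
    using one_approx_on_arc[OF W \<eta> W\<eta>, of "e / C"] 0 C by auto
  show ?case
  proof (intro exI[of _ "P * Q"] allI impI)
    fix s assume s: "\<bar>s\<bar> \<le> W"
    define z where "z = fchar (\<eta> * s)"
    have "norm (poly P z * (1 - z * poly Q z)) \<le> C * (e / C)"
      unfolding norm_mult z_def using C Q[OF s] by (intro mult_mono) auto
    then have "norm (poly P z * (1 - z * poly Q z)) \<le> e" using C by simp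
    then show "norm (cnj (fchar (\<eta> * s)) ^ 0 * poly P (fchar (\<eta> * s)) - fchar (\<eta> * s) * poly (P * Q) (fchar (\<eta> * s))) \<le> e"
      by (simp add: z_def algebra_simps)
  qed
next
  case (Suc m)
  obtain Q1 :: "complex poly" where Q1: "\<And>s. \<bar>s\<bar> \<le> W \<Longrightarrow>
      norm (cnj (fchar (\<eta> * s)) ^ m * poly P (fchar (\<eta> * s)) - fchar (\<eta> * s) * poly Q1 (fchar (\<eta> * s))) \<le> e / 2"
    using Suc.IH[of "e / 2" P] Suc.prems by auto
  obtain C where C: "0 < C" "\<And>t. norm (poly Q1 (fchar t)) \<le> C"
    by (rule poly_bounded_unit_circle[of Q1], rule that) auto
  obtain Q :: "complex poly" where Q: "\<And>s. \<bar>s\<bar> \<le> W \<Longrightarrow> norm (1 - fchar (\<eta> * s) * poly Q (fchar (\<eta> * s))) \<le> e / 2 / C"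
    using one_approx_on_arc[OF W \<eta> W\<eta>, of "e / 2 / C"] Suc.prems C by auto
  show ?case
  proof (intro exI[of _ "Q1 * Q"] allI impI)
    fix s assume s: "\<bar>s\<bar> \<le> W"
    define z where "z = fchar (\<eta> * s)"
    have z: "cnj z * z = 1" "norm z = 1" by (auto simp: z_def)
    have "norm (poly Q1 z * (1 - z * poly Q z)) \<le> C * (e / 2 / C)"
      unfolding norm_mult z_def using C Q[OF s] by (intro mult_mono) auto
    then have 1: "norm (poly Q1 z * (1 - z * poly Q z)) \<le> e / 2" using C by simp
    have 2: "norm (cnj z * (cnj z ^ m * poly P z - z * poly Q1 z)) \<le> e / 2"
      unfolding norm_mult using Q1[OF s] by (simp add: z_def)
    have "cnj z ^ Suc m * poly P z - z * poly (Q1 * Q) z =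
       cnj z * (cnj z ^ m * poly P z - z * poly Q1 z) + ((cnj z * z) * poly Q1 z - z * (poly Q1 z * poly Q z))"
      by (simp add: algebra_simps)
    also have "(cnj z * z) * poly Q1 z - z * (poly Q1 z * poly Q z) = poly Q1 z * (1 - z * poly Q z)"
      unfolding z by (simp add: algebra_simps)
    also have "norm (cnj z * (cnj z ^ m * poly P z - z * poly Q1 z) + poly Q1 z * (1 - z * poly Q z)) \<le> e / 2 + e / 2"
      by (rule order_trans[OF norm_triangle_ineq add_mono[OF 2 1]])
    finally show "norm (cnj (fchar (\<eta> * s)) ^ Suc m * poly P (fchar (\<eta> * s)) - fchar (\<eta> * s) * poly (Q1 * Q) (fchar (\<eta> * s))) \<le> e"
      by (simp add: z_def)
  qed
qed

text \<open>Stone-Weierstrass for the ring of real functions that are Laurent polynomials in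
  \<open>z = fchar (\<eta> s)\<close>, negative powers being written as conjugates. It contains the
  cosine and the sine of the angle, which separate points since the arc is shorter than the
  circle.\<close>

lemma real_laurent_approx:
  fixes g :: "real \<Rightarrow> real"
  assumes W: "0 \<le> W" and \<eta>: "0 < \<eta>" and W\<eta>: "2 * W * \<eta> < 1" and e: "0 < e"
    and g: "continuous_on {- W..W} g"
  shows "\<exists>m. \<exists>P :: complex poly. \<forall>s. \<bar>s\<bar> \<le> W \<longrightarrow>
    norm (of_real (g s) - cnj (fchar (\<eta> * s)) ^ m * poly P (fchar (\<eta> * s))) \<le> e"
proof -
  define R where "R = {g :: real \<Rightarrow> real. \<exists>m. \<exists>P :: complex poly. \<forall>s.
    complex_of_real (g s) = cnj (fchar (\<eta> * s)) ^ m * poly P (fchar (\<eta> * s))}"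
  have cosR: "(\<lambda>s. cos (2 * pi * (\<eta> * s))) \<in> R" and sinR: "(\<lambda>s. sin (2 * pi * (\<eta> * s))) \<in> R"
  proof -
    have "complex_of_real (cos (2 * pi * t)) = cnj (fchar t) ^ 1 * poly [:1/2, 0, 1/2:] (fchar t)" for t
    proof -
      have "cnj (fchar t) ^ 1 * poly [:1/2, 0, 1/2:] (fchar t) = (cnj (fchar t) + (cnj (fchar t) * fchar t) * fchar t) / 2"
        by (simp add: algebra_simps del: cnj_fchar_mult)
      also have "\<dots> = (cnj (fchar t) + fchar t) / 2" by simp
      also have "\<dots> = of_real (cos (2 * pi * t))" by (simp add: fchar_cis)
      finally show ?thesis by simp
    qed
    then show "(\<lambda>s. cos (2 * pi * (\<eta> * s))) \<in> R" unfolding R_def by blast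
    have "complex_of_real (sin (2 * pi * t)) = cnj (fchar t) ^ 1 * poly [:- \<i>/2, 0, \<i>/2:] (fchar t)" for t
    proof -
      have "cnj (fchar t) ^ 1 * poly [:- \<i>/2, 0, \<i>/2:] (fchar t) = \<i> * (- cnj (fchar t) + (cnj (fchar t) * fchar t) * fchar t) / 2"
        by (simp add: algebra_simps del: cnj_fchar_mult)
      also have "\<dots> = \<i> * (fchar t - cnj (fchar t)) / 2" by simp
      also have "\<dots> = of_real (sin (2 * pi * t))" by (simp add: fchar_cis algebra_simps)
      finally show ?thesis by simp
    qed
    then show "(\<lambda>s. sin (2 * pi * (\<eta> * s))) \<in> R" unfolding R_def by blast
  qed
  interpret function_ring_on R "{- W..W}"
  proof
    show "compact {- W..W}" by simp
    show "continuous_on {- W..W} f" if "f \<in> R" for f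
    proof -
      from that obtain m and P :: "complex poly" where
        f: "\<And>s. complex_of_real (f s) = cnj (fchar (\<eta> * s)) ^ m * poly P (fchar (\<eta> * s))" unfolding R_def by blast
      have eq: "f = (\<lambda>s. Re (cnj (fchar (\<eta> * s)) ^ m * poly P (fchar (\<eta> * s))))"
        unfolding f[symmetric] by simp
      show ?thesis by (subst eq) (intro continuous_intros)
    qed
    show "(\<lambda>x. f x + h x) \<in> R" if "f \<in> R" "h \<in> R" for f h
    proof -
      from that obtain m P n Q where
        f: "\<And>s. complex_of_real (f s) = cnj (fchar (\<eta> * s)) ^ m * poly P (fchar (\<eta> * s))" and
        h: "\<And>s. complex_of_real (h s) = cnj (fchar (\<eta> * s)) ^ n * poly Q (fchar (\<eta> * s))" unfolding R_def by blast
      have "complex_of_real (f s + h s) = cnj (fchar (\<eta> * s)) ^ (m + n) * poly (monom 1 n * P + monom 1 m * Q) (fchar (\<eta> * s))" for s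
      proof -
        define z where "z = fchar (\<eta> * s)"
        have z: "cnj z ^ k * z ^ k = 1" for k unfolding power_mult_distrib[symmetric] z_def by simp
        have "cnj z ^ (m + n) * poly (monom 1 n * P + monom 1 m * Q) z
           = cnj z ^ m * poly P z * (cnj z ^ n * z ^ n) + cnj z ^ n * poly Q z * (cnj z ^ m * z ^ m)"
          by (simp add: poly_monom power_add algebra_simps)
        then show ?thesis unfolding z by (simp add: f h z_def)
      qed
      then show ?thesis unfolding R_def by blast
    qed
    show "(\<lambda>x. f x * h x) \<in> R" if "f \<in> R" "h \<in> R" for f h
    proof -
      from that obtain m P n Q where
        f: "\<And>s. complex_of_real (f s) = cnj (fchar (\<eta> * s)) ^ m * poly P (fchar (\<eta> * s))" and
        h: "\<And>s. complex_of_real (h s) = cnj (fchar (\<eta> * s)) ^ n * poly Q (fchar (\<eta> * s))" unfolding R_def by blast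
      have "complex_of_real (f s * h s) = cnj (fchar (\<eta> * s)) ^ (m + n) * poly (P * Q) (fchar (\<eta> * s))" for s
        by (simp add: f h power_add)
      then show ?thesis unfolding R_def by blast
    qed
    show "(\<lambda>_. c) \<in> R" for c
    proof -
      have "\<forall>s. complex_of_real c = cnj (fchar (\<eta> * s)) ^ 0 * poly [:of_real c:] (fchar (\<eta> * s))" by simp
      then show ?thesis unfolding R_def by blast
    qed
    show "\<exists>f\<in>R. f x \<noteq> f y" if x: "x \<in> {- W..W}" and y: "y \<in> {- W..W}" and ne: "x \<noteq> y" for x y
    proof (rule ccontr)
      assume "\<not> (\<exists>f\<in>R. f x \<noteq> f y)"
      then have "cos (2 * pi * (\<eta> * x)) = cos (2 * pi * (\<eta> * y))" "sin (2 * pi * (\<eta> * x)) = sin (2 * pi * (\<eta> * y))"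
        using cosR sinR by auto
      then have "fchar (\<eta> * x) = fchar (\<eta> * y)" by (simp add: fchar_cis)
      moreover have "\<bar>\<eta> * x - \<eta> * y\<bar> < 1"
      proof -
        have "\<bar>\<eta> * x - \<eta> * y\<bar> = \<eta> * \<bar>x - y\<bar>" using \<eta> by (simp add: abs_mult flip: right_diff_distrib)
        also have "\<dots> \<le> \<eta> * (2 * W)" using x y \<eta> by (intro mult_left_mono) auto
        also have "\<dots> < 1" using W\<eta> by (simp add: mult_ac)
        finally show ?thesis .
      qed
      ultimately have "\<eta> * x = \<eta> * y" by (rule fchar_inj)
      then show False using ne \<eta> by simp
    qed
  qed
  obtain f where f: "f \<in> R" "\<forall>x\<in>{- W..W}. \<bar>g x - f x\<bar> < e"
    using Stone_Weierstrass_basic[OF g e] by blast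
  then obtain m and P :: "complex poly" where
    fP: "\<And>s. complex_of_real (f s) = cnj (fchar (\<eta> * s)) ^ m * poly P (fchar (\<eta> * s))" unfolding R_def by blast
  have "norm (of_real (g s) - cnj (fchar (\<eta> * s)) ^ m * poly P (fchar (\<eta> * s))) \<le> e" if "\<bar>s\<bar> \<le> W" for s
  proof -
    have "norm (complex_of_real (g s) - complex_of_real (f s)) = \<bar>g s - f s\<bar>"
      by (simp flip: of_real_diff)
    then show ?thesis using f(2) that unfolding fP[symmetric] by (smt (verit) atLeastAtMost_iff)
  qed
  then show ?thesis by blast
qed

text \<open>Real and imaginary parts are treated separately. The frequency \<open>c\<close> is an
  arbitrary real number: on an arc that does not close up, the function to be approximated need not
  be periodic.\<close>

lemma fchar_approx_one_sided:
  assumes W: "0 \<le> W" and \<eta>: "0 < \<eta>" and W\<eta>: "2 * W * \<eta> < 1" and e: "0 < e"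
  shows "\<exists>Q :: complex poly. \<forall>s. \<bar>s\<bar> \<le> W \<longrightarrow> norm (fchar (c * s) - fchar (\<eta> * s) * poly Q (fchar (\<eta> * s))) \<le> e"
proof -
  have one: "\<exists>Q :: complex poly. \<forall>s. \<bar>s\<bar> \<le> W \<longrightarrow> norm (of_real (g s) - fchar (\<eta> * s) * poly Q (fchar (\<eta> * s))) \<le> e / 2"
    if g: "continuous_on {- W..W} g" for g :: "real \<Rightarrow> real"
  proof -
    obtain m and P :: "complex poly" where P: "\<And>s. \<bar>s\<bar> \<le> W \<Longrightarrow>
      norm (of_real (g s) - cnj (fchar (\<eta> * s)) ^ m * poly P (fchar (\<eta> * s))) \<le> e / 4"
      using real_laurent_approx[OF W \<eta> W\<eta> _ g, of "e / 4"] e by auto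
    obtain Q :: "complex poly" where Q: "\<And>s. \<bar>s\<bar> \<le> W \<Longrightarrow>
      norm (cnj (fchar (\<eta> * s)) ^ m * poly P (fchar (\<eta> * s)) - fchar (\<eta> * s) * poly Q (fchar (\<eta> * s))) \<le> e / 4"
      using laurent_approx_on_arc[OF W \<eta> W\<eta>, of "e / 4" m P] e by auto
    show ?thesis
    proof (intro exI[of _ Q] allI impI)
      fix s assume "\<bar>s\<bar> \<le> W"
      from norm_diff_triangle_le[OF P[OF this] Q[OF this]]
      show "norm (of_real (g s) - fchar (\<eta> * s) * poly Q (fchar (\<eta> * s))) \<le> e / 2" by simp
    qed
  qed
  have cc: "continuous_on {- W..W} (\<lambda>s. cos (2 * pi * (c * s)))"
    and cs: "continuous_on {- W..W} (\<lambda>s. sin (2 * pi * (c * s)))" by (intro continuous_intros)+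
  obtain Q1 :: "complex poly" where Q1: "\<And>s. \<bar>s\<bar> \<le> W \<Longrightarrow> norm (of_real (cos (2 * pi * (c * s))) - fchar (\<eta> * s) * poly Q1 (fchar (\<eta> * s))) \<le> e / 2"
    using one[OF cc] by blast
  obtain Q2 :: "complex poly" where Q2: "\<And>s. \<bar>s\<bar> \<le> W \<Longrightarrow> norm (of_real (sin (2 * pi * (c * s))) - fchar (\<eta> * s) * poly Q2 (fchar (\<eta> * s))) \<le> e / 2"
    using one[OF cs] by blast
  show ?thesis
  proof (intro exI[of _ "Q1 - smult \<i> Q2"] allI impI)
    fix s assume s: "\<bar>s\<bar> \<le> W"
    define z where "z = fchar (\<eta> * s)"
    have "fchar (c * s) - z * poly (Q1 - smult \<i> Q2) z =
      (of_real (cos (2 * pi * (c * s))) - z * poly Q1 z) - \<i> * (of_real (sin (2 * pi * (c * s))) - z * poly Q2 z)"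
      by (simp add: fchar_cis[of "c * s"] algebra_simps)
    also have "norm \<dots> \<le> norm (of_real (cos (2 * pi * (c * s))) - z * poly Q1 z) + norm (\<i> * (of_real (sin (2 * pi * (c * s))) - z * poly Q2 z))"
      by (rule norm_triangle_ineq4)
    also have "\<dots> \<le> e / 2 + e / 2" using Q1[OF s] Q2[OF s] by (intro add_mono) (auto simp: z_def norm_mult)
    finally show "norm (fchar (c * s) - fchar (\<eta> * s) * poly (Q1 - smult \<i> Q2) (fchar (\<eta> * s))) \<le> e" by (simp add: z_def)
  qed
qed

text \<open>In the application \<open>c\<close> is the offset of a point from the nodes of its ray,
  which changes with point and direction; so the number of terms and the size of the coefficients
  must be uniform in \<open>c\<close>. A finite net of frequencies and the Lipschitz bound for
  characters provide this.\<close>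

lemma fchar_approx_uniform:
  assumes W: "0 \<le> W" and \<eta>: "0 < \<eta>" and W\<eta>: "2 * W * \<eta> < 1" and e: "0 < e"
  shows "\<exists>K C. 0 \<le> C \<and> (\<forall>c. \<bar>c\<bar> \<le> L \<longrightarrow> (\<exists>p :: nat \<Rightarrow> complex. (\<forall>k. norm (p k) \<le> C) \<and>
    (\<forall>s. \<bar>s\<bar> \<le> W \<longrightarrow> norm (fchar (c * s) - (\<Sum>k=1..K. p k * fchar (\<eta> * real k * s))) \<le> e)))"
proof -
  have "\<forall>c. \<exists>Q :: complex poly. \<forall>s. \<bar>s\<bar> \<le> W \<longrightarrow> norm (fchar (c * s) - fchar (\<eta> * s) * poly Q (fchar (\<eta> * s))) \<le> e / 2"
    using fchar_approx_one_sided[OF W \<eta> W\<eta>, of "e / 2"] e by simp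
  then obtain Q :: "real \<Rightarrow> complex poly" where
    Q: "\<And>c s. \<bar>s\<bar> \<le> W \<Longrightarrow> norm (fchar (c * s) - fchar (\<eta> * s) * poly (Q c) (fchar (\<eta> * s))) \<le> e / 2" by metis
  \<comment> \<open>The mesh makes \<open>2 pi d (W + 1)\<close> equal to \<open>e / 2\<close>;
    \<open>W + 1\<close> instead of \<open>W\<close> avoids division by 0.\<close>
  define d where "d = e / 2 / (2 * pi * (W + 1))"
  have d: "0 < d" using e W by (simp add: d_def)
  have "\<exists>D. finite D \<and> {- L..L} \<subseteq> (\<Union>x\<in>D. ball x d)"
    using compact_Icc[of "- L" L] d unfolding compact_eq_totally_bounded by blast
  then obtain D where D: "finite D" "{- L..L} \<subseteq> (\<Union>x\<in>D. ball x d)" by blast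
  define K where "K = Max (insert 0 ((\<lambda>c. Suc (degree (Q c))) ` D))"
  define C where "C = Max (insert 0 ((\<lambda>c. \<Sum>i\<le>degree (Q c). norm (coeff (Q c) i)) ` D))"
  have K: "Suc (degree (Q c)) \<le> K" if "c \<in> D" for c
    unfolding K_def using D that by (intro Max_ge) auto
  have C: "(\<Sum>i\<le>degree (Q c). norm (coeff (Q c) i)) \<le> C" if "c \<in> D" for c
    unfolding C_def using D that by (intro Max_ge) auto
  have C0: "0 \<le> C" unfolding C_def using D by (intro Max_ge) auto
  have "\<exists>p :: nat \<Rightarrow> complex. (\<forall>k. norm (p k) \<le> C) \<and>
    (\<forall>s. \<bar>s\<bar> \<le> W \<longrightarrow> norm (fchar (c * s) - (\<Sum>k=1..K. p k * fchar (\<eta> * real k * s))) \<le> e)" if c: "\<bar>c\<bar> \<le> L" for c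
  proof -
    have "c \<in> {- L..L}" using c by auto
    then obtain c' where c': "c' \<in> D" "c \<in> ball c' d" using D(2) by blast
    \<comment> \<open>The index is shifted because the polynomial is multiplied by \<open>z\<close>.
      At \<open>k = 0\<close> the subtraction truncates, and the bound on the coefficients holds
      there too.\<close>
    define p where "p k = coeff (Q c') (k - 1)" for k
    have "norm (p k) \<le> C" for k
    proof (cases "k - 1 \<le> degree (Q c')")
      case True
      then have "norm (p k) \<le> (\<Sum>i\<le>degree (Q c'). norm (coeff (Q c') i))"
        unfolding p_def by (intro member_le_sum) auto
      then show ?thesis using C[OF c'(1)] by simp
    qed (simp add: p_def coeff_eq_0 C0)
    moreover have "norm (fchar (c * s) - (\<Sum>k=1..K. p k * fchar (\<eta> * real k * s))) \<le> e" if s: "\<bar>s\<bar> \<le> W" for s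
    proof -
      define z where "z = fchar (\<eta> * s)"
      have "(\<Sum>k=1..K. p k * fchar (\<eta> * real k * s)) = (\<Sum>k=1..K. p k * z ^ k)"
        by (simp add: z_def fchar_power mult_ac)
      also have "\<dots> = (\<Sum>i<K. coeff (Q c') i * z ^ Suc i)"
        unfolding p_def by (rule sum.reindex_bij_witness[of _ Suc "\<lambda>j. j - 1"]) auto
      also have "\<dots> = (\<Sum>i\<le>degree (Q c'). coeff (Q c') i * z ^ Suc i)"
        using K[OF c'(1)] by (intro sum.mono_neutral_right) (auto simp: coeff_eq_0 not_le)
      also have "\<dots> = z * poly (Q c') z"
        unfolding poly_altdef sum_distrib_left by (intro sum.cong) (auto simp: mult_ac)
      finally have eq: "(\<Sum>k=1..K. p k * fchar (\<eta> * real k * s)) = z * poly (Q c') z" .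
      have "norm (fchar (c * s) - fchar (c' * s)) \<le> 2 * pi * \<bar>c * s - c' * s\<bar>" by (rule fchar_lipschitz)
      also have "\<dots> = 2 * pi * (\<bar>c - c'\<bar> * \<bar>s\<bar>)" by (simp add: abs_mult flip: left_diff_distrib)
      also have "\<dots> \<le> 2 * pi * (d * (W + 1))"
        using c' s d by (intro mult_left_mono mult_mono) (auto simp: dist_real_def abs_minus_commute)
      also have "\<dots> = e / 2" using W by (simp add: d_def)
      finally have "norm (fchar (c * s) - fchar (c' * s)) \<le> e / 2" .
      from norm_diff_triangle_le[OF this Q[OF s, of c']] show ?thesis unfolding eq by (simp add: z_def)
    qed
    ultimately show ?thesis by blast
  qed
  then show ?thesis using C0 by blast
qed

text \<open>Multiplying the approximation of the character of frequency \<open>r - \<beta>\<close>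
  by that of frequency \<beta> expresses the kernel at \<open>r\<close> through the kernels at the
  nodes. Integrated against \<open>f\<close>, the error is at most \<open>d\<close> times the
  integral of \<open>|f|\<close>, which the energy controls.\<close>

lemma fourier_transform_near_bound:
  assumes R: "0 \<le> R" and \<eta>: "0 < \<eta>" and R\<eta>: "2 * R * \<eta> < 1" and e: "0 < e"
  shows "\<exists>K C. 0 \<le> C \<and> (\<forall>f \<omega> \<beta> r. bandlimited R f \<longrightarrow> norm \<omega> = 1 \<longrightarrow> 0 \<le> \<beta> \<longrightarrow> \<beta> \<le> \<eta> \<longrightarrow> 0 \<le> r \<longrightarrow> r \<le> \<rho> \<longrightarrow>
     (norm (fourier_transform f (r *\<^sub>R \<omega>)))\<^sup>2 \<le> e * energy f +
       C * (\<Sum>k=1..K. (norm (fourier_transform f ((\<beta> + \<eta> * real k) *\<^sub>R \<omega>)))\<^sup>2))"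
proof -
  define V where "V = measure lborel (cball (0::real^2) R) + 1"
  have V: "0 < V" by (simp add: V_def add_nonneg_pos)
  \<comment> \<open>Chosen so that the squared error \<open>d^2 V\<close> times the energy, doubled
    by the splitting with \<open>t = 1\<close>, is exactly \<open>e\<close> times the
    energy.\<close>
  define d where "d = sqrt (e / (2 * V))"
  have d: "0 < d" using e V by (simp add: d_def)
  have d2: "2 * (d\<^sup>2 * V) = e" using e V by (simp add: d_def)
  obtain K C where C: "0 \<le> C" and KC: "\<And>c. \<bar>c\<bar> \<le> \<bar>\<rho>\<bar> + \<eta> \<Longrightarrow> \<exists>p :: nat \<Rightarrow> complex. (\<forall>k. norm (p k) \<le> C) \<and>
    (\<forall>s. \<bar>s\<bar> \<le> R \<longrightarrow> norm (fchar (c * s) - (\<Sum>k=1..K. p k * fchar (\<eta> * real k * s))) \<le> d)"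
    using fchar_approx_uniform[OF R \<eta> R\<eta> d, of "\<bar>\<rho>\<bar> + \<eta>"] by blast
  have "(norm (fourier_transform f (r *\<^sub>R \<omega>)))\<^sup>2 \<le> e * energy f +
       (2 * C\<^sup>2 * real K) * (\<Sum>k=1..K. (norm (fourier_transform f ((\<beta> + \<eta> * real k) *\<^sub>R \<omega>)))\<^sup>2)"
    if f: "bandlimited R f" and \<omega>: "norm \<omega> = 1" and \<beta>: "0 \<le> \<beta>" "\<beta> \<le> \<eta>" and r: "0 \<le> r" "r \<le> \<rho>" for f \<omega> \<beta> r
  proof -
    define F where "F = fourier_transform f"
    have "\<bar>r - \<beta>\<bar> \<le> \<bar>\<rho>\<bar> + \<eta>" using \<beta> r by linarith
    then obtain p :: "nat \<Rightarrow> complex" where p: "\<And>k. norm (p k) \<le> C"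
      "\<And>s. \<bar>s\<bar> \<le> R \<Longrightarrow> norm (fchar ((r - \<beta>) * s) - (\<Sum>k=1..K. p k * fchar (\<eta> * real k * s))) \<le> d"
      using KC by blast
    define G where "G = (\<Sum>k=1..K. p k * F ((\<beta> + \<eta> * real k) *\<^sub>R \<omega>))"
    note I = integrable_fchar_mult[OF bandlimited_integrable[OF f]]
    have "F (r *\<^sub>R \<omega>) - G = (LINT x|lborel. fchar ((r *\<^sub>R \<omega>) \<bullet> x) * f x - (\<Sum>k=1..K. p k * (fchar (((\<beta> + \<eta> * real k) *\<^sub>R \<omega>) \<bullet> x) * f x)))"
      unfolding G_def F_def fourier_transform_fchar
      by (subst Bochner_Integration.integral_diff, rule I, rule Bochner_Integration.integrable_sum, rule integrable_mult_right, rule I,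
          subst Bochner_Integration.integral_sum) (auto intro!: I integrable_mult_right simp del: inner_scaleR_left)
    also have "norm \<dots> \<le> (LINT x|lborel. norm (fchar ((r *\<^sub>R \<omega>) \<bullet> x) * f x - (\<Sum>k=1..K. p k * (fchar (((\<beta> + \<eta> * real k) *\<^sub>R \<omega>) \<bullet> x) * f x))))"
      by (rule integral_norm_bound)
    also have "\<dots> \<le> (LINT x|lborel. d * norm (f x))"
    proof (rule integral_mono_AE)
      show "integrable lborel (\<lambda>x. norm (fchar ((r *\<^sub>R \<omega>) \<bullet> x) * f x - (\<Sum>k=1..K. p k * (fchar (((\<beta> + \<eta> * real k) *\<^sub>R \<omega>) \<bullet> x) * f x))))"
        by (intro integrable_norm Bochner_Integration.integrable_diff I Bochner_Integration.integrable_sum integrable_mult_right)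
      show "integrable lborel (\<lambda>x. d * norm (f x))" using bandlimited_integrable[OF f] by simp
      have "AE x in lborel. R < norm x \<longrightarrow> f x = 0" using f by (simp add: bandlimited_def)
      then show "AE x in lborel. norm (fchar ((r *\<^sub>R \<omega>) \<bullet> x) * f x - (\<Sum>k=1..K. p k * (fchar (((\<beta> + \<eta> * real k) *\<^sub>R \<omega>) \<bullet> x) * f x))) \<le> d * norm (f x)"
      proof eventually_elim
        case (elim x)
        show ?case
        proof (cases "R < norm x")
          case False
          define s where "s = \<omega> \<bullet> x"
          have s: "\<bar>s\<bar> \<le> R" using Cauchy_Schwarz_ineq2[of \<omega> x] \<omega> False by (simp add: s_def)
          have "fchar (r * s) = fchar (\<beta> * s) * fchar ((r - \<beta>) * s)"
            by (simp add: fchar_add[symmetric] algebra_simps)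
          moreover have "fchar ((\<beta> + \<eta> * real k) * s) = fchar (\<beta> * s) * fchar (\<eta> * real k * s)" for k
            by (simp add: fchar_add[symmetric] algebra_simps)
          ultimately have "fchar ((r *\<^sub>R \<omega>) \<bullet> x) * f x - (\<Sum>k=1..K. p k * (fchar (((\<beta> + \<eta> * real k) *\<^sub>R \<omega>) \<bullet> x) * f x))
             = fchar (\<beta> * s) * (fchar ((r - \<beta>) * s) - (\<Sum>k=1..K. p k * fchar (\<eta> * real k * s))) * f x"
            by (simp add: s_def[symmetric] right_diff_distrib left_diff_distrib sum_distrib_left sum_distrib_right mult_ac)
          then have "norm (fchar ((r *\<^sub>R \<omega>) \<bullet> x) * f x - (\<Sum>k=1..K. p k * (fchar (((\<beta> + \<eta> * real k) *\<^sub>R \<omega>) \<bullet> x) * f x)))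
             = norm (fchar ((r - \<beta>) * s) - (\<Sum>k=1..K. p k * fchar (\<eta> * real k * s))) * norm (f x)"
            by (simp only: norm_mult norm_fchar mult_1)
          also have "\<dots> \<le> d * norm (f x)" using p(2)[OF s] by (intro mult_right_mono) auto
          finally show ?thesis .
        qed (use elim in simp)
      qed
    qed
    also have "\<dots> = d * (LINT x|lborel. norm (f x))" by simp
    finally have "(norm (F (r *\<^sub>R \<omega>) - G))\<^sup>2 \<le> (d * (LINT x|lborel. norm (f x)))\<^sup>2"
      by (intro power_mono) auto
    also have "\<dots> \<le> d\<^sup>2 * (V * energy f)"
      unfolding power_mult_distrib V_def by (intro mult_left_mono norm_L1_le_energy f) simp
    finally have 1: "(norm (F (r *\<^sub>R \<omega>) - G))\<^sup>2 \<le> d\<^sup>2 * V * energy f" by simp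
    have "norm G \<le> (\<Sum>k=1..K. C * norm (F ((\<beta> + \<eta> * real k) *\<^sub>R \<omega>)))"
      unfolding G_def by (rule order_trans[OF norm_sum]) (auto simp: norm_mult intro!: sum_mono mult_right_mono p)
    then have "(norm G)\<^sup>2 \<le> (\<Sum>k=1..K. C * norm (F ((\<beta> + \<eta> * real k) *\<^sub>R \<omega>)))\<^sup>2" by (intro power_mono) auto
    also have "\<dots> \<le> real K * (\<Sum>k=1..K. (C * norm (F ((\<beta> + \<eta> * real k) *\<^sub>R \<omega>)))\<^sup>2)"
      using sum_squared_le_sum_of_squares[of "\<lambda>k. C * norm (F ((\<beta> + \<eta> * real k) *\<^sub>R \<omega>))" "{1..K}"]
      by (simp add: mult.commute)
    also have "\<dots> = C\<^sup>2 * real K * (\<Sum>k=1..K. (norm (F ((\<beta> + \<eta> * real k) *\<^sub>R \<omega>)))\<^sup>2)"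
      by (simp add: power_mult_distrib sum_distrib_left mult_ac)
    finally have 2: "(norm G)\<^sup>2 \<le> C\<^sup>2 * real K * (\<Sum>k=1..K. (norm (F ((\<beta> + \<eta> * real k) *\<^sub>R \<omega>)))\<^sup>2)" .
    have "(norm (F (r *\<^sub>R \<omega>)))\<^sup>2 \<le> (1 + 1) * (norm G)\<^sup>2 + (1 + 1 / 1) * (norm (F (r *\<^sub>R \<omega>) - G))\<^sup>2"
      by (rule norm_square_le_split) simp
    also have "\<dots> \<le> 2 * (C\<^sup>2 * real K * (\<Sum>k=1..K. (norm (F ((\<beta> + \<eta> * real k) *\<^sub>R \<omega>)))\<^sup>2)) + 2 * (d\<^sup>2 * V * energy f)"
      using 1 2 by simp
    also have "2 * (d\<^sup>2 * V * energy f) = e * energy f" by (simp flip: d2)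
    finally show ?thesis by (simp add: F_def algebra_simps)
  qed
  then show ?thesis using C by (intro exI[of _ K] exI[of _ "2 * C\<^sup>2 * real K"]) auto
qed

subsection \<open>Sampling along the turns, in polar coordinates\<close>

text \<open>The turns of the spiral are \<open>\<sigma> = 1\<close>, the concentric circles are \<open>\<sigma> = 0\<close>.\<close>

definition node :: "real \<Rightarrow> real \<Rightarrow> nat \<Rightarrow> real \<Rightarrow> real" where
  "node \<eta> \<sigma> k \<theta> = \<eta> * (\<sigma> * \<theta> + real k)"

definition samp :: "real \<Rightarrow> real \<Rightarrow> (real^2 \<Rightarrow> complex) \<Rightarrow> ennreal" where
  "samp \<eta> \<sigma> F = (\<integral>\<^sup>+\<theta>\<in>{0<..<1}. (\<Sum>k. ennreal (node \<eta> \<sigma> (Suc k) \<theta> *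
     (norm (F (node \<eta> \<sigma> (Suc k) \<theta> *\<^sub>R dirv \<theta>)))\<^sup>2)) \<partial>lborel)"

lemma suminf_shift_le:
  fixes f :: "nat \<Rightarrow> ennreal"
  shows "(\<Sum>j. f (j + m)) \<le> (\<Sum>j. f j)"
proof (rule suminf_le_const)
  fix n
  have "(\<Sum>j<n. f (j + m)) = (\<Sum>j\<in>{m..<n+m}. f j)"
    by (rule sum.reindex_bij_witness[of _ "\<lambda>j. j - m" "\<lambda>j. j + m"]) auto
  also have "\<dots> \<le> (\<Sum>j. f j)" by (rule sum_le_suminf) auto
  finally show "(\<Sum>j<n. f (j + m)) \<le> (\<Sum>j. f j)" .
qed auto

lemma nn_integral_intervals_sum:
  fixes h :: "real \<Rightarrow> ennreal"
  assumes [measurable]: "h \<in> borel_measurable borel" and \<eta>: "0 < \<eta>"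
  shows "(\<Sum>k. \<integral>\<^sup>+r\<in>{a + real k * \<eta>..a + real k * \<eta> + \<eta>}. h r \<partial>lborel) = (\<integral>\<^sup>+r\<in>{a..}. h r \<partial>lborel)"
proof -
  define J where "J k = {a + real k * \<eta>..<a + real (Suc k) * \<eta>}" for k
  have "(\<integral>\<^sup>+r\<in>{a + real k * \<eta>..a + real k * \<eta> + \<eta>}. h r \<partial>lborel) = (\<integral>\<^sup>+r\<in>J k. h r \<partial>lborel)" for k
  proof (rule nn_integral_cong_AE)
    have "AE r in lborel. r \<noteq> a + real k * \<eta> + \<eta>" by (rule AE_lborel_singleton)
    then show "AE r in lborel. h r * indicator {a + real k * \<eta>..a + real k * \<eta> + \<eta>} r = h r * indicator (J k) r"
      by eventually_elim (auto simp: J_def indicator_def algebra_simps)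
  qed
  then have "(\<Sum>k. \<integral>\<^sup>+r\<in>{a + real k * \<eta>..a + real k * \<eta> + \<eta>}. h r \<partial>lborel) = (\<Sum>k. \<integral>\<^sup>+r\<in>J k. h r \<partial>lborel)"
    by simp
  also have "\<dots> = (\<integral>\<^sup>+r. (\<Sum>k. h r * indicator (J k) r) \<partial>lborel)"
    by (rule nn_integral_suminf[symmetric]) (simp add: J_def)
  also have "\<dots> = (\<integral>\<^sup>+r\<in>{a..}. h r \<partial>lborel)"
  proof (rule nn_integral_cong)
    fix r
    have uniq: "k = nat \<lfloor>(r - a) / \<eta>\<rfloor>" if "r \<in> J k" for k r
    proof -
      have "real k \<le> (r - a) / \<eta>" "(r - a) / \<eta> < real k + 1"
        using that \<eta> by (auto simp: J_def field_simps)
      then have "\<lfloor>(r - a) / \<eta>\<rfloor> = int k" by (intro floor_unique) auto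
      then show ?thesis by simp
    qed
    have "disjoint_family J"
      unfolding disjoint_family_on_def using uniq by (metis disjoint_iff)
    then have "(\<Sum>k. indicator (J k) r :: ennreal) = indicator (\<Union>k. J k) r" by (rule suminf_indicator)
    moreover have "(\<Union>k. J k) = {a..}"
    proof (intro equalityI subsetI)
      fix x assume "x \<in> (\<Union>k. J k)"
      then obtain k where "x \<in> J k" by blast
      moreover have "0 \<le> real k * \<eta>" using \<eta> by simp
      ultimately show "x \<in> {a..}" by (auto simp: J_def)
    next
      fix x assume "x \<in> {a..}"
      then have q: "0 \<le> (x - a) / \<eta>" using \<eta> by simp
      define k where "k = nat \<lfloor>(x - a) / \<eta>\<rfloor>"
      have "real k \<le> (x - a) / \<eta>" "(x - a) / \<eta> < real k + 1" using q by (auto simp: k_def)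
      then have "x \<in> J k" using \<eta> by (auto simp: J_def field_simps)
      then show "x \<in> (\<Union>k. J k)" by blast
    qed
    ultimately show "(\<Sum>k. h r * indicator (J k) r) = h r * indicator {a..} r"
      by (simp add: ennreal_suminf_cmult)
  qed
  finally show ?thesis .
qed

lemma node_Suc: "node \<eta> \<sigma> (k + m) \<theta> = node \<eta> \<sigma> m \<theta> + real k * \<eta>"
  by (simp add: node_def algebra_simps)

lemma measurable_node [measurable]: "node \<eta> \<sigma> k \<in> borel_measurable borel"
  unfolding node_def by measurable

locale polar_sampling =
  fixes \<eta> \<sigma> R :: real
  assumes \<eta>: "0 < \<eta>" and \<sigma>: "0 \<le> \<sigma>" "\<sigma> \<le> 1" and R: "0 \<le> R"
begin

abbreviation nd :: "nat \<Rightarrow> real \<Rightarrow> real" where "nd \<equiv> node \<eta> \<sigma>"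

lemma nd_bounds:
  assumes "0 \<le> \<theta>" "\<theta> \<le> 1"
  shows "\<eta> * real k \<le> nd k \<theta>" "nd k \<theta> \<le> \<eta> * (real k + 1)"
proof -
  have "0 \<le> \<sigma> * \<theta>" "\<sigma> * \<theta> \<le> 1" using \<sigma> assms by (auto simp: mult_le_one)
  then show "\<eta> * real k \<le> nd k \<theta>" "nd k \<theta> \<le> \<eta> * (real k + 1)"
    using \<eta> by (auto simp: node_def intro!: mult_left_mono)
qed

lemma polar_total:
  fixes h :: "real^2 \<Rightarrow> real"
  assumes hm: "h \<in> borel_measurable borel" and hi: "integrable lborel h" and h0: "\<And>x. 0 \<le> h x"
  shows "(\<integral>\<^sup>+\<theta>\<in>{0<..<1}. (\<integral>\<^sup>+r\<in>{0<..}. ennreal (r * h (r *\<^sub>R dirv \<theta>)) \<partial>lborel) \<partial>lborel)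
     = ennreal ((LINT x|lborel. h x) / (2 * pi))"
proof -
  note [measurable] = hm
  define I where "I = (\<integral>\<^sup>+\<theta>\<in>{0<..<1}. (\<integral>\<^sup>+r\<in>{0<..}. ennreal (r * h (r *\<^sub>R dirv \<theta>)) \<partial>lborel) \<partial>lborel)"
  have "ennreal (LINT x|lborel. h x) = (\<integral>\<^sup>+x. ennreal (h x) \<partial>lborel)"
    using hi h0 by (simp add: nn_integral_eq_integral)
  also have "\<dots> = (\<integral>\<^sup>+\<theta>\<in>{0<..<1}. (\<integral>\<^sup>+r\<in>{0<..}. ennreal (2 * pi * r * h (r *\<^sub>R dirv \<theta>)) \<partial>lborel) \<partial>lborel)"
    by (rule polar_integral[OF assms])
  also have "\<dots> = (\<integral>\<^sup>+\<theta>\<in>{0<..<1}. (ennreal (2 * pi) * (\<integral>\<^sup>+r\<in>{0<..}. ennreal (r * h (r *\<^sub>R dirv \<theta>)) \<partial>lborel)) \<partial>lborel)"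
  proof (rule nn_integral_cong)
    fix \<theta> :: real
    have "(\<integral>\<^sup>+r\<in>{0<..}. ennreal (2 * pi * r * h (r *\<^sub>R dirv \<theta>)) \<partial>lborel)
      = (\<integral>\<^sup>+r. ennreal (2 * pi) * (ennreal (r * h (r *\<^sub>R dirv \<theta>)) * indicator {0<..} r) \<partial>lborel)"
      by (intro nn_integral_cong) (auto simp: indicator_def ennreal_mult[symmetric] h0 mult.assoc)
    also have "\<dots> = ennreal (2 * pi) * (\<integral>\<^sup>+r\<in>{0<..}. ennreal (r * h (r *\<^sub>R dirv \<theta>)) \<partial>lborel)"
      by (rule nn_integral_cmult) measurable
    finally show "(\<integral>\<^sup>+r\<in>{0<..}. ennreal (2 * pi * r * h (r *\<^sub>R dirv \<theta>)) \<partial>lborel) * indicator {0<..<1} \<theta>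
      = (ennreal (2 * pi) * (\<integral>\<^sup>+r\<in>{0<..}. ennreal (r * h (r *\<^sub>R dirv \<theta>)) \<partial>lborel)) * indicator {0<..<1} \<theta>" by simp
  qed
  also have "\<dots> = ennreal (2 * pi) * I"
    unfolding I_def mult.assoc by (rule nn_integral_cmult) measurable
  finally have eq: "ennreal (LINT x|lborel. h x) = ennreal (2 * pi) * I" .
  have "I = ennreal (1 / (2 * pi)) * (ennreal (2 * pi) * I)"
    unfolding mult.assoc[symmetric] by (simp add: ennreal_mult[symmetric])
  also have "\<dots> = ennreal (1 / (2 * pi) * (LINT x|lborel. h x))"
    unfolding eq[symmetric] using h0 by (subst ennreal_mult) (auto intro: integral_nonneg_AE)
  finally show ?thesis unfolding I_def by simp
qed

definition ray_samp :: "(real^2 \<Rightarrow> complex) \<Rightarrow> real \<Rightarrow> ennreal" where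
  "ray_samp F \<theta> = (\<Sum>k. ennreal (nd (Suc k) \<theta> * (norm (F (nd (Suc k) \<theta> *\<^sub>R dirv \<theta>)))\<^sup>2))"

lemma samp_eq: "samp \<eta> \<sigma> F = (\<integral>\<^sup>+\<theta>\<in>{0<..<1}. ray_samp F \<theta> \<partial>lborel)"
  by (simp add: samp_def ray_samp_def)

lemma continuous_ray: "continuous_on UNIV g \<Longrightarrow> continuous_on UNIV (\<lambda>r :: real. g (r *\<^sub>R dirv \<theta>) :: real)"
  by (rule continuous_on_compose2[of UNIV g]) (auto intro!: continuous_intros)

text \<open>Each node is charged, by \<open>trace_interval\<close>, to the interval of length \<eta>
  that follows it. These intervals tile the ray beyond the first node, and polar integration
  together with Bernstein's inequality bounds the total.\<close>

lemma samp_upper: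
  assumes f: "bandlimited R f"
  shows "samp \<eta> \<sigma> (fourier_transform f) \<le> ennreal (((1 + 1 / \<eta>) + (2 * pi * R)\<^sup>2) / (2 * pi) * energy f)"
proof -
  define F where "F = fourier_transform f"
  define Q where "Q = grad_square f"
  define h where "h x = (1 + 1 / \<eta>) * (norm (F x))\<^sup>2 + Q x" for x
  have Fc: "continuous_on UNIV F"
    unfolding F_def by (rule continuous_fourier_transform[OF bandlimited_integrable[OF f]])
  have Qc: "continuous_on UNIV Q" unfolding Q_def by (rule continuous_grad_square[OF f])
  have [measurable]: "F \<in> borel_measurable borel" "Q \<in> borel_measurable borel"
    using Fc Qc by (auto intro: borel_measurable_continuous_onI)
  have [measurable]: "h \<in> borel_measurable borel" unfolding h_def by measurable
  have Q0: "0 \<le> Q x" for x by (simp add: Q_def grad_square_def)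
  have h0: "0 \<le> h x" for x using Q0[of x] \<eta> by (simp add: h_def)
  have hi: "integrable lborel h"
    unfolding h_def F_def Q_def
    by (intro Bochner_Integration.integrable_add integrable_mult_right plancherel_integral(1)[OF f] grad_square_energy(1)[OF f R])
  have hE: "(LINT x|lborel. h x) \<le> ((1 + 1 / \<eta>) + (2 * pi * R)\<^sup>2) * energy f"
  proof -
    have "(LINT x|lborel. h x) = (1 + 1 / \<eta>) * energy f + (LINT x|lborel. Q x)"
      unfolding h_def F_def Q_def using plancherel_integral[OF f] grad_square_energy(1)[OF f R]
      by (subst Bochner_Integration.integral_add) auto
    also have "\<dots> \<le> (1 + 1 / \<eta>) * energy f + (2 * pi * R)\<^sup>2 * energy f"
      unfolding Q_def using grad_square_energy(2)[OF f R] by simp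
    finally show ?thesis by (simp add: distrib_right)
  qed
  have ray: "ray_samp F \<theta> \<le> (\<integral>\<^sup>+r\<in>{0<..}. ennreal (r * h (r *\<^sub>R dirv \<theta>)) \<partial>lborel)" if \<theta>: "0 < \<theta>" "\<theta> < 1" for \<theta>
  proof -
    have "ray_samp F \<theta> \<le> (\<Sum>k. \<integral>\<^sup>+r\<in>{nd 1 \<theta> + real k * \<eta>..nd 1 \<theta> + real k * \<eta> + \<eta>}. ennreal (r * h (r *\<^sub>R dirv \<theta>)) \<partial>lborel)"
      unfolding ray_samp_def
    proof (intro suminf_le allI)
      fix k
      have nS: "nd (Suc k) \<theta> = nd 1 \<theta> + real k * \<eta>" using node_Suc[of \<eta> \<sigma> k 1 \<theta>] by simp
      have "ennreal (nd (Suc k) \<theta> * (norm (F (nd (Suc k) \<theta> *\<^sub>R dirv \<theta>)))\<^sup>2) \<le>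
        (\<integral>\<^sup>+r\<in>{nd (Suc k) \<theta>..nd (Suc k) \<theta> + \<eta>}. ennreal (r * ((1 + 1 / \<eta>) * (norm (F (r *\<^sub>R dirv \<theta>)))\<^sup>2 + Q (r *\<^sub>R dirv \<theta>))) \<partial>lborel)"
      proof (rule trace_interval[OF \<eta>])
        show "((\<lambda>r. F (r *\<^sub>R dirv \<theta>)) has_vector_derivative
          of_real (dirv \<theta>$1) * coordinate_derivative 1 f (r *\<^sub>R dirv \<theta>) + of_real (dirv \<theta>$2) * coordinate_derivative 2 f (r *\<^sub>R dirv \<theta>)) (at r)" for r
          unfolding F_def by (rule ray_derivative[OF f])
        show "continuous_on UNIV (\<lambda>r. Q (r *\<^sub>R dirv \<theta>))" by (rule continuous_ray[OF Qc])
        show "(norm (of_real (dirv \<theta>$1) * coordinate_derivative 1 f (r *\<^sub>R dirv \<theta>) + of_real (dirv \<theta>$2) * coordinate_derivative 2 f (r *\<^sub>R dirv \<theta>)))\<^sup>2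
           \<le> Q (r *\<^sub>R dirv \<theta>)" for r
          unfolding Q_def by (rule ray_derivative_bound) simp
        have "0 \<le> \<eta> * real (Suc k)" using \<eta> by simp
        also have "\<dots> \<le> nd (Suc k) \<theta>" using nd_bounds(1)[of \<theta> "Suc k"] \<theta> by simp
        finally show "0 \<le> nd (Suc k) \<theta>" .
      qed
      then show "ennreal (nd (Suc k) \<theta> * (norm (F (nd (Suc k) \<theta> *\<^sub>R dirv \<theta>)))\<^sup>2) \<le>
        (\<integral>\<^sup>+r\<in>{nd 1 \<theta> + real k * \<eta>..nd 1 \<theta> + real k * \<eta> + \<eta>}. ennreal (r * h (r *\<^sub>R dirv \<theta>)) \<partial>lborel)"
        unfolding nS h_def .
    qed auto
    also have "\<dots> = (\<integral>\<^sup>+r\<in>{nd 1 \<theta>..}. ennreal (r * h (r *\<^sub>R dirv \<theta>)) \<partial>lborel)"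
      by (rule nn_integral_intervals_sum[OF _ \<eta>]) measurable
    also have "\<dots> \<le> (\<integral>\<^sup>+r\<in>{0<..}. ennreal (r * h (r *\<^sub>R dirv \<theta>)) \<partial>lborel)"
    proof (intro nn_integral_mono mult_left_mono)
      have "0 < nd 1 \<theta>" using nd_bounds(1)[of \<theta> 1] \<theta> \<eta> by simp
      then show "indicator {nd 1 \<theta>..} r \<le> (indicator {0<..} r :: ennreal)" for r
        by (auto simp: indicator_def)
    qed auto
    finally show ?thesis .
  qed
  have "samp \<eta> \<sigma> F \<le> (\<integral>\<^sup>+\<theta>\<in>{0<..<1}. (\<integral>\<^sup>+r\<in>{0<..}. ennreal (r * h (r *\<^sub>R dirv \<theta>)) \<partial>lborel) \<partial>lborel)"
    unfolding samp_eq using ray by (intro nn_integral_mono) (auto simp: indicator_def)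
  also have "\<dots> = ennreal ((LINT x|lborel. h x) / (2 * pi))"
    by (rule polar_total[OF _ hi h0]) measurable
  also have "\<dots> \<le> ennreal (((1 + 1 / \<eta>) + (2 * pi * R)\<^sup>2) * energy f / (2 * pi))"
    using hE by (intro ennreal_leI divide_right_mono) auto
  finally show ?thesis unfolding F_def by simp
qed

lemma samp_lower:
  assumes R\<eta>: "2 * R * \<eta> < 1"
  shows "\<exists>A>0. \<forall>f. bandlimited R f \<longrightarrow> ennreal (A * energy f) \<le> samp \<eta> \<sigma> (fourier_transform f)"
proof -
  define B where "B = 2 * pi * R"
  have B0: "0 \<le> B" using R by (simp add: B_def)
  have B\<eta>: "B * \<eta> < pi" using mult_strict_left_mono[OF R\<eta>, of pi] by (simp add: B_def mult_ac)
  \<comment> \<open>With this \<open>e\<close> the product \<open>\<kappa> \<eta> = pi - 2 e\<close>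
    is the midpoint between \<open>B \<eta>\<close> and \<open>pi\<close>.\<close>
  define e where "e = (pi - B * \<eta>) / 4"
  have e: "0 < e" "e < pi / 2"
  proof -
    show "0 < e" using B\<eta> by (simp add: e_def)
    have "0 \<le> B * \<eta>" using B0 \<eta> by simp
    then have "pi - B * \<eta> \<le> pi" by simp
    then have "e \<le> pi / 4" unfolding e_def by (rule divide_right_mono) simp
    also have "\<dots> < pi / 2" by simp
    finally show "e < pi / 2" .
  qed
  define \<kappa> where "\<kappa> = (pi - 2 * e) / \<eta>"
  have B\<kappa>: "B < \<kappa>"
  proof -
    have "B * \<eta> < pi - 2 * e" using B\<eta> by (simp add: e_def field_simps)
    then show ?thesis using \<eta> by (simp add: \<kappa>_def field_simps)
  qed
  have B2: "B\<^sup>2 < \<kappa>\<^sup>2" using B\<kappa> B0 by (intro power_strict_mono) auto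
  \<comment> \<open>The midpoint again: the gap up to \<open>\<kappa>^2\<close> absorbs the boundary
    weight \<open>Wm\<close> far from the origin, and the gap down to \<open>B^2\<close> is what
    remains after Bernstein's inequality.\<close>
  define \<mu> where "\<mu> = (B\<^sup>2 + \<kappa>\<^sup>2) / 2"
  have \<mu>: "B\<^sup>2 < \<mu>" "\<mu> < \<kappa>\<^sup>2" using B2 by (auto simp: \<mu>_def)
  have \<mu>0: "0 < \<mu>" using \<mu>(1) by (rule le_less_trans[OF zero_le_power2])
  define Wm where "Wm = \<kappa> * cot e"
  have Wm0: "0 \<le> Wm"
  proof -
    have "0 < cot e" unfolding cot_def using e by (intro divide_pos_pos cos_gt_zero sin_gt_zero) auto
    then show ?thesis using B\<kappa> B0 by (simp add: Wm_def)
  qed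
  \<comment> \<open>The radius beyond which \<open>\<mu> r <= \<kappa>^2 r - Wm\<close>.\<close>
  define r0 where "r0 = Wm / (\<kappa>\<^sup>2 - \<mu>)"
  have low: "\<mu> * r \<le> \<kappa>\<^sup>2 * r - Wm" if "r0 \<le> r" for r
  proof -
    have "Wm \<le> r * (\<kappa>\<^sup>2 - \<mu>)" using that \<mu>(2) by (simp add: r0_def field_simps)
    then show ?thesis by (simp add: algebra_simps)
  qed
  obtain k1 :: nat where k1: "r0 / \<eta> \<le> real k1" using real_arch_simple by blast
  \<comment> \<open>Taken positive, so that the intervals start at a node that is counted in
    \<open>ray_samp\<close>, whose terms begin at index 1. The index \<open>k1\<close> itself
    reappears as the corresponding shift.\<close>
  define K0 where "K0 = Suc k1"
  have K0: "r0 \<le> \<eta> * real K0"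
  proof -
    have "r0 \<le> \<eta> * real k1" using k1 \<eta> by (simp add: field_simps)
    also have "\<dots> \<le> \<eta> * real K0" using \<eta> by (simp add: K0_def)
    finally show ?thesis .
  qed
  define \<rho> where "\<rho> = \<eta> * (real K0 + 1)"
  have \<rho>: "0 < \<rho>" using \<eta> by (simp add: \<rho>_def)
  \<comment> \<open>The error from the disc then costs half of the available gain
    \<open>(\<mu> - B^2) / (2 pi)\<close> times the energy.\<close>
  define \<epsilon> where "\<epsilon> = (\<mu> - B\<^sup>2) / (4 * pi * \<mu> * \<rho>\<^sup>2)"
  have \<epsilon>: "0 < \<epsilon>" using \<mu>(1) \<mu>0 \<rho> by (simp add: \<epsilon>_def)
  have \<epsilon>': "\<mu> * \<rho>\<^sup>2 * \<epsilon> = (\<mu> - B\<^sup>2) / (4 * pi)" using \<mu>0 \<rho> by (simp add: \<epsilon>_def)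
  obtain K C where C: "0 \<le> C" and near: "\<And>f \<omega> \<beta> r. bandlimited R f \<Longrightarrow> norm \<omega> = 1 \<Longrightarrow> 0 \<le> \<beta> \<Longrightarrow> \<beta> \<le> \<eta> \<Longrightarrow> 0 \<le> r \<Longrightarrow> r \<le> \<rho> \<Longrightarrow>
     (norm (fourier_transform f (r *\<^sub>R \<omega>)))\<^sup>2 \<le> \<epsilon> * energy f +
       C * (\<Sum>k=1..K. (norm (fourier_transform f ((\<beta> + \<eta> * real k) *\<^sub>R \<omega>)))\<^sup>2)"
    using fourier_transform_near_bound[OF R \<eta> R\<eta> \<epsilon>, of \<rho>] by blast
  \<comment> \<open>Twice \<open>Wm\<close>, because a node may be an end point of two intervals;
    the second term is the price of the disc, and the 1 makes the constant positive.\<close>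
  define C1 where "C1 = 2 * Wm + \<mu> * \<rho>\<^sup>2 * C / \<eta> + 1"
  have C1: "0 < C1" using Wm0 \<mu>0 \<rho> C \<eta> by (simp add: C1_def add_nonneg_pos)
  have "ennreal ((\<mu> - B\<^sup>2) / (4 * pi) / C1 * energy f) \<le> samp \<eta> \<sigma> (fourier_transform f)" if f: "bandlimited R f" for f
  proof -
    define F where "F = fourier_transform f"
    define Q where "Q = grad_square f"
    have Fc: "continuous_on UNIV F"
      unfolding F_def by (rule continuous_fourier_transform[OF bandlimited_integrable[OF f]])
    have Qc: "continuous_on UNIV Q" unfolding Q_def by (rule continuous_grad_square[OF f])
    have [measurable]: "F \<in> borel_measurable borel" "Q \<in> borel_measurable borel"
      using Fc Qc by (auto intro: borel_measurable_continuous_onI)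
    have Q0: "0 \<le> Q x" for x by (simp add: Q_def grad_square_def)
    define a where "a \<theta> k = ennreal (nd k \<theta> * (norm (F (nd k \<theta> *\<^sub>R dirv \<theta>)))\<^sup>2)" for \<theta> k
    have rs: "ray_samp F \<theta> = (\<Sum>k. a \<theta> (Suc k))" for \<theta> by (simp add: ray_samp_def a_def)
    have ray: "ennreal \<mu> * (\<integral>\<^sup>+r\<in>{0<..}. ennreal (r * (norm (F (r *\<^sub>R dirv \<theta>)))\<^sup>2) \<partial>lborel) \<le>
       (\<integral>\<^sup>+r\<in>{0<..}. ennreal (r * Q (r *\<^sub>R dirv \<theta>)) \<partial>lborel) + ennreal C1 * ray_samp F \<theta> + ennreal ((\<mu> - B\<^sup>2) / (4 * pi) * energy f)"
      if \<theta>: "0 < \<theta>" "\<theta> < 1" for \<theta>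
    proof -
      define u where "u r = F (r *\<^sub>R dirv \<theta>)" for r
      define q where "q r = Q (r *\<^sub>R dirv \<theta>)" for r
      define b where "b = nd K0 \<theta>"
      have [measurable]: "u \<in> borel_measurable borel" "q \<in> borel_measurable borel" unfolding u_def q_def by measurable
      have ndpos: "0 \<le> nd k \<theta>" for k
        using nd_bounds(1)[of \<theta> k] \<theta> \<eta> by (smt (verit) mult_nonneg_nonneg of_nat_0_le_iff)
      have bK: "\<eta> * real K0 \<le> b" "b \<le> \<rho>" using nd_bounds[of \<theta> K0] \<theta> by (auto simp: b_def \<rho>_def)
      have b0: "0 < b" using bK(1) \<eta> by (smt (verit) K0_def mult_pos_pos of_nat_0_less_iff zero_less_Suc)
      have nk: "nd (k + K0) \<theta> = b + real k * \<eta>" for k unfolding b_def by (rule node_Suc)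
      have step: "ennreal \<mu> * (\<integral>\<^sup>+r\<in>{b + real k * \<eta>..b + real k * \<eta> + \<eta>}. ennreal (r * (norm (u r))\<^sup>2) \<partial>lborel) \<le>
         (\<integral>\<^sup>+r\<in>{b + real k * \<eta>..b + real k * \<eta> + \<eta>}. ennreal (r * q r) \<partial>lborel) +
         (ennreal Wm * a \<theta> (Suc k + K0) + ennreal Wm * a \<theta> (k + K0))" for k
      proof -
        have kb: "b \<le> b + real k * \<eta>" using \<eta> by simp
        have "ennreal \<mu> * (\<integral>\<^sup>+r\<in>{b + real k * \<eta>..b + real k * \<eta> + \<eta>}. ennreal (r * (norm (u r))\<^sup>2) \<partial>lborel) \<le>
         (\<integral>\<^sup>+r\<in>{b + real k * \<eta>..b + real k * \<eta> + \<eta>}. ennreal (r * q r) \<partial>lborel) +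
          ennreal (\<kappa> * cot e * ((b + real k * \<eta> + \<eta>) * (norm (u (b + real k * \<eta> + \<eta>)))\<^sup>2 + (b + real k * \<eta>) * (norm (u (b + real k * \<eta>)))\<^sup>2))"
        proof (rule wirtinger_interval[OF \<eta> e \<kappa>_def])
          show "(u has_vector_derivative of_real (dirv \<theta>$1) * coordinate_derivative 1 f (r *\<^sub>R dirv \<theta>) + of_real (dirv \<theta>$2) * coordinate_derivative 2 f (r *\<^sub>R dirv \<theta>)) (at r)" for r
            unfolding u_def F_def by (rule ray_derivative[OF f])
          show "continuous_on UNIV q" unfolding q_def by (rule continuous_ray[OF Qc])
          show "(norm (of_real (dirv \<theta>$1) * coordinate_derivative 1 f (r *\<^sub>R dirv \<theta>) + of_real (dirv \<theta>$2) * coordinate_derivative 2 f (r *\<^sub>R dirv \<theta>)))\<^sup>2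
             \<le> q r" for r
            unfolding Q_def q_def by (rule ray_derivative_bound) simp
          show "0 \<le> b + real k * \<eta>" using b0 kb by simp
          show "\<mu> * r \<le> \<kappa>\<^sup>2 * r - \<kappa> * cot e" if "b + real k * \<eta> \<le> r" for r
            using low[of r] that kb bK K0 by (simp add: Wm_def)
          show "0 \<le> \<mu>" using \<mu>0 by simp
        qed
        also have "ennreal (\<kappa> * cot e * ((b + real k * \<eta> + \<eta>) * (norm (u (b + real k * \<eta> + \<eta>)))\<^sup>2 + (b + real k * \<eta>) * (norm (u (b + real k * \<eta>)))\<^sup>2))
           = ennreal Wm * a \<theta> (Suc k + K0) + ennreal Wm * a \<theta> (k + K0)"
        proof -
          have n1: "nd (Suc k + K0) \<theta> = b + real k * \<eta> + \<eta>" unfolding nk by (simp add: algebra_simps)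
          have p1: "0 \<le> b + real k * \<eta>" "0 \<le> b + real k * \<eta> + \<eta>" using ndpos[of "k + K0"] nk \<eta> by auto
          show ?thesis unfolding a_def n1 unfolding nk using Wm0 p1
            by (simp only: u_def[symmetric] Wm_def[symmetric] ennreal_mult[symmetric] ennreal_plus[symmetric] distrib_left
                mult_nonneg_nonneg zero_le_power2)
        qed
        finally show ?thesis .
      qed
      have "ennreal \<mu> * (\<integral>\<^sup>+r\<in>{b..}. ennreal (r * (norm (u r))\<^sup>2) \<partial>lborel)
        = (\<Sum>k. ennreal \<mu> * (\<integral>\<^sup>+r\<in>{b + real k * \<eta>..b + real k * \<eta> + \<eta>}. ennreal (r * (norm (u r))\<^sup>2) \<partial>lborel))"
        by (subst nn_integral_intervals_sum[OF _ \<eta>, symmetric]) (simp_all add: ennreal_suminf_cmult)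
      also have "\<dots> \<le> (\<Sum>k. (\<integral>\<^sup>+r\<in>{b + real k * \<eta>..b + real k * \<eta> + \<eta>}. ennreal (r * q r) \<partial>lborel) +
         (ennreal Wm * a \<theta> (Suc k + K0) + ennreal Wm * a \<theta> (k + K0)))"
        by (intro suminf_le allI step) auto
      also have "\<dots> = (\<Sum>k. \<integral>\<^sup>+r\<in>{b + real k * \<eta>..b + real k * \<eta> + \<eta>}. ennreal (r * q r) \<partial>lborel) +
         (ennreal Wm * (\<Sum>k. a \<theta> (Suc k + K0)) + ennreal Wm * (\<Sum>k. a \<theta> (k + K0)))"
        by (simp add: suminf_add[symmetric] ennreal_suminf_cmult del: add_Suc)
      also have "\<dots> \<le> (\<integral>\<^sup>+r\<in>{0<..}. ennreal (r * q r) \<partial>lborel) +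
         (ennreal Wm * ray_samp F \<theta> + ennreal Wm * ray_samp F \<theta>)"
      proof (intro add_mono mult_left_mono)
        have "(\<Sum>k. \<integral>\<^sup>+r\<in>{b + real k * \<eta>..b + real k * \<eta> + \<eta>}. ennreal (r * q r) \<partial>lborel) = (\<integral>\<^sup>+r\<in>{b..}. ennreal (r * q r) \<partial>lborel)"
          by (rule nn_integral_intervals_sum[OF _ \<eta>]) measurable
        also have "\<dots> \<le> (\<integral>\<^sup>+r\<in>{0<..}. ennreal (r * q r) \<partial>lborel)"
          using b0 by (intro nn_integral_mono mult_left_mono) (auto simp: indicator_def)
        finally show "(\<Sum>k. \<integral>\<^sup>+r\<in>{b + real k * \<eta>..b + real k * \<eta> + \<eta>}. ennreal (r * q r) \<partial>lborel) \<le> (\<integral>\<^sup>+r\<in>{0<..}. ennreal (r * q r) \<partial>lborel)" .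
        show "(\<Sum>k. a \<theta> (Suc k + K0)) \<le> ray_samp F \<theta>"
          using suminf_shift_le[of "\<lambda>j. a \<theta> (Suc j)" K0] by (simp add: rs)
        show "(\<Sum>k. a \<theta> (k + K0)) \<le> ray_samp F \<theta>"
          using suminf_shift_le[of "\<lambda>j. a \<theta> (Suc j)" k1] by (simp add: rs K0_def)
      qed auto
      finally have far: "ennreal \<mu> * (\<integral>\<^sup>+r\<in>{b..}. ennreal (r * (norm (u r))\<^sup>2) \<partial>lborel) \<le>
        (\<integral>\<^sup>+r\<in>{0<..}. ennreal (r * q r) \<partial>lborel) + ennreal (2 * Wm) * ray_samp F \<theta>"
        using Wm0 by (simp add: distrib_right[symmetric] ennreal_plus[symmetric] del: ennreal_plus)
      \<comment> \<open>Unweighted values at the nodes; since nodes of index at least 1 have radius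
        at least \<eta>, \<open>\<eta> X\<close> is bounded by the weighted sum.\<close>
      define X where "X = (\<Sum>k=1..K. (norm (F (nd k \<theta> *\<^sub>R dirv \<theta>)))\<^sup>2)"
      have X0: "0 \<le> X" by (simp add: X_def sum_nonneg)
      have X: "ennreal (\<eta> * X) \<le> ray_samp F \<theta>"
      proof -
        have "\<eta> * X \<le> (\<Sum>k=1..K. nd k \<theta> * (norm (F (nd k \<theta> *\<^sub>R dirv \<theta>)))\<^sup>2)"
          unfolding X_def sum_distrib_left
        proof (intro sum_mono mult_right_mono)
          fix k assume "k \<in> {1..K}"
          then have "\<eta> * 1 \<le> \<eta> * real k" using \<eta> by (intro mult_left_mono) auto
          also have "\<dots> \<le> nd k \<theta>" using nd_bounds(1)[of \<theta> k] \<theta> by simp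
          finally show "\<eta> \<le> nd k \<theta>" by simp
        qed simp
        then have "ennreal (\<eta> * X) \<le> ennreal (\<Sum>k=1..K. nd k \<theta> * (norm (F (nd k \<theta> *\<^sub>R dirv \<theta>)))\<^sup>2)" by (rule ennreal_leI)
        also have "\<dots> = (\<Sum>k=1..K. a \<theta> k)" unfolding a_def using ndpos by (intro sum_ennreal[symmetric]) simp
        also have "\<dots> = (\<Sum>k<K. a \<theta> (Suc k))"
          by (rule sum.reindex_bij_witness[of _ Suc "\<lambda>j. j - 1"]) auto
        also have "\<dots> \<le> ray_samp F \<theta>" unfolding rs by (rule sum_le_suminf) auto
        finally show ?thesis .
      qed
      have nearp: "(norm (u r))\<^sup>2 \<le> \<epsilon> * energy f + C * X" if r: "0 < r" "r \<le> \<rho>" for r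
      proof -
        have st: "0 \<le> \<sigma> * \<theta>" "\<sigma> * \<theta> \<le> 1" using \<sigma> \<theta> by (auto simp: mult_le_one)
        have "(norm (u r))\<^sup>2 \<le> \<epsilon> * energy f + C * (\<Sum>k=1..K. (norm (F ((\<eta> * (\<sigma> * \<theta>) + \<eta> * real k) *\<^sub>R dirv \<theta>)))\<^sup>2)"
          unfolding u_def F_def using r st \<eta> by (intro near f) auto
        moreover have "\<eta> * (\<sigma> * \<theta>) + \<eta> * real k = nd k \<theta>" for k by (simp add: node_def algebra_simps)
        ultimately show ?thesis by (simp add: X_def)
      qed
      \<comment> \<open>A crude bound is enough here: both the weight \<open>r\<close> and the
        length of the interval are at most \<rho>, which explains the square of \<rho> in the choice
        of \<epsilon>.\<close>
      have "ennreal \<mu> * (\<integral>\<^sup>+r\<in>{0<..<b}. ennreal (r * (norm (u r))\<^sup>2) \<partial>lborel) \<le>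
          ennreal \<mu> * (\<integral>\<^sup>+r\<in>{0..\<rho>}. ennreal (\<rho> * (\<epsilon> * energy f + C * X)) \<partial>lborel)"
      proof (intro mult_left_mono nn_integral_mono)
        fix r
        show "ennreal (r * (norm (u r))\<^sup>2) * indicator {0<..<b} r \<le> ennreal (\<rho> * (\<epsilon> * energy f + C * X)) * indicator {0..\<rho>} r"
        proof (cases "r \<in> {0<..<b}")
          case True
          then have r: "0 < r" "r \<le> \<rho>" using bK by auto
          have "r * (norm (u r))\<^sup>2 \<le> \<rho> * (\<epsilon> * energy f + C * X)"
            using r nearp[OF r] by (intro mult_mono) auto
          then show ?thesis using True r by (simp add: ennreal_leI)
        qed simp
      qed simp
      also have "\<dots> = ennreal (\<mu> * \<rho>\<^sup>2 * \<epsilon> * energy f + \<mu> * \<rho>\<^sup>2 * C * X)"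
      proof -
        have y: "0 \<le> \<epsilon> * energy f + C * X" using \<epsilon> C X0 by simp
        have "ennreal \<mu> * (\<integral>\<^sup>+r\<in>{0..\<rho>}. ennreal (\<rho> * (\<epsilon> * energy f + C * X)) \<partial>lborel)
          = ennreal (\<mu> * (\<rho> * (\<epsilon> * energy f + C * X) * \<rho>))"
          using y \<mu>0 \<rho> by (simp add: nn_integral_cmult_indicator ennreal_mult[symmetric])
        also have "\<mu> * (\<rho> * (\<epsilon> * energy f + C * X) * \<rho>) = \<mu> * \<rho>\<^sup>2 * \<epsilon> * energy f + \<mu> * \<rho>\<^sup>2 * C * X"
          by (simp add: power2_eq_square algebra_simps)
        finally show ?thesis .
      qed
      also have "\<dots> = ennreal ((\<mu> - B\<^sup>2) / (4 * pi) * energy f) + ennreal (\<mu> * \<rho>\<^sup>2 * C / \<eta>) * ennreal (\<eta> * X)"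
      proof -
        have "\<mu> * \<rho>\<^sup>2 * C * X = (\<mu> * \<rho>\<^sup>2 * C / \<eta>) * (\<eta> * X)" using \<eta> by simp
        moreover have "0 \<le> (\<mu> - B\<^sup>2) / (4 * pi) * energy f" "0 \<le> \<mu> * \<rho>\<^sup>2 * C / \<eta>" "0 \<le> \<eta> * X"
          using \<mu> \<mu>0 C X0 \<eta> by auto
        ultimately show ?thesis unfolding \<epsilon>' by (metis ennreal_mult ennreal_plus mult_nonneg_nonneg)
      qed
      also have "\<dots> \<le> ennreal ((\<mu> - B\<^sup>2) / (4 * pi) * energy f) + ennreal (\<mu> * \<rho>\<^sup>2 * C / \<eta>) * ray_samp F \<theta>"
        using X by (intro add_left_mono mult_left_mono) auto
      finally have nr: "ennreal \<mu> * (\<integral>\<^sup>+r\<in>{0<..<b}. ennreal (r * (norm (u r))\<^sup>2) \<partial>lborel) \<le>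
        ennreal ((\<mu> - B\<^sup>2) / (4 * pi) * energy f) + ennreal (\<mu> * \<rho>\<^sup>2 * C / \<eta>) * ray_samp F \<theta>" .
      have "(\<integral>\<^sup>+r\<in>{0<..}. ennreal (r * (norm (u r))\<^sup>2) \<partial>lborel) =
         (\<integral>\<^sup>+r. (ennreal (r * (norm (u r))\<^sup>2) * indicator {0<..<b} r + ennreal (r * (norm (u r))\<^sup>2) * indicator {b..} r) \<partial>lborel)"
        using b0 by (intro nn_integral_cong) (auto simp: indicator_def)
      also have "\<dots> = (\<integral>\<^sup>+r\<in>{0<..<b}. ennreal (r * (norm (u r))\<^sup>2) \<partial>lborel) + (\<integral>\<^sup>+r\<in>{b..}. ennreal (r * (norm (u r))\<^sup>2) \<partial>lborel)"
        by (rule nn_integral_add) measurable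
      finally have "ennreal \<mu> * (\<integral>\<^sup>+r\<in>{0<..}. ennreal (r * (norm (u r))\<^sup>2) \<partial>lborel) =
        ennreal \<mu> * (\<integral>\<^sup>+r\<in>{0<..<b}. ennreal (r * (norm (u r))\<^sup>2) \<partial>lborel) + ennreal \<mu> * (\<integral>\<^sup>+r\<in>{b..}. ennreal (r * (norm (u r))\<^sup>2) \<partial>lborel)"
        by (simp add: distrib_left)
      also have "\<dots> \<le> (ennreal ((\<mu> - B\<^sup>2) / (4 * pi) * energy f) + ennreal (\<mu> * \<rho>\<^sup>2 * C / \<eta>) * ray_samp F \<theta>) +
         ((\<integral>\<^sup>+r\<in>{0<..}. ennreal (r * q r) \<partial>lborel) + ennreal (2 * Wm) * ray_samp F \<theta>)"
        by (rule add_mono[OF nr far])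
      also have "\<dots> = (\<integral>\<^sup>+r\<in>{0<..}. ennreal (r * q r) \<partial>lborel) + (ennreal (\<mu> * \<rho>\<^sup>2 * C / \<eta>) + ennreal (2 * Wm)) * ray_samp F \<theta>
          + ennreal ((\<mu> - B\<^sup>2) / (4 * pi) * energy f)"
        by (simp add: distrib_right add_ac)
      also have "\<dots> \<le> (\<integral>\<^sup>+r\<in>{0<..}. ennreal (r * q r) \<partial>lborel) + ennreal C1 * ray_samp F \<theta>
          + ennreal ((\<mu> - B\<^sup>2) / (4 * pi) * energy f)"
      proof (intro add_mono mult_right_mono order_refl)
        have "0 \<le> \<mu> * \<rho>\<^sup>2 * C / \<eta>" using \<mu>0 C \<eta> by simp
        then show "ennreal (\<mu> * \<rho>\<^sup>2 * C / \<eta>) + ennreal (2 * Wm) \<le> ennreal C1"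
          using Wm0 by (subst ennreal_plus[symmetric]) (auto simp: C1_def intro!: ennreal_leI)
      qed auto
      finally show ?thesis unfolding u_def q_def .
    qed
    have [measurable]: "ray_samp F \<in> borel_measurable borel" unfolding ray_samp_def by measurable
    define I1 where "I1 \<theta> = (\<integral>\<^sup>+r\<in>{0<..}. ennreal (r * (norm (F (r *\<^sub>R dirv \<theta>)))\<^sup>2) \<partial>lborel)" for \<theta>
    define I2 where "I2 \<theta> = (\<integral>\<^sup>+r\<in>{0<..}. ennreal (r * Q (r *\<^sub>R dirv \<theta>)) \<partial>lborel)" for \<theta>
    have [measurable]: "I1 \<in> borel_measurable borel" "I2 \<in> borel_measurable borel"
      unfolding I1_def I2_def by measurable
    have T1: "(\<integral>\<^sup>+\<theta>\<in>{0<..<1}. I1 \<theta> \<partial>lborel) = ennreal (energy f / (2 * pi))"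
      unfolding I1_def using polar_total[of "\<lambda>x. (norm (F x))\<^sup>2"] plancherel_integral[OF f] by (simp add: F_def)
    have T2: "(\<integral>\<^sup>+\<theta>\<in>{0<..<1}. I2 \<theta> \<partial>lborel) \<le> ennreal (B\<^sup>2 * energy f / (2 * pi))"
    proof -
      have "(\<integral>\<^sup>+\<theta>\<in>{0<..<1}. I2 \<theta> \<partial>lborel) = ennreal ((LINT x|lborel. Q x) / (2 * pi))"
        unfolding I2_def
      proof (rule polar_total)
        show "integrable lborel Q" unfolding Q_def by (rule grad_square_energy(1)[OF f R])
      qed (use Q0 in auto)
      also have "\<dots> \<le> ennreal (B\<^sup>2 * energy f / (2 * pi))"
        unfolding Q_def B_def by (intro ennreal_leI divide_right_mono grad_square_energy(2)[OF f R]) simp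
      finally show ?thesis .
    qed
    have "ennreal (\<mu> * energy f / (2 * pi)) = ennreal \<mu> * (\<integral>\<^sup>+\<theta>\<in>{0<..<1}. I1 \<theta> \<partial>lborel)"
      unfolding T1 using \<mu>0 by (simp add: ennreal_mult[symmetric])
    also have "\<dots> = (\<integral>\<^sup>+\<theta>\<in>{0<..<1}. ennreal \<mu> * I1 \<theta> \<partial>lborel)"
      unfolding mult.assoc by (rule nn_integral_cmult[symmetric]) measurable
    also have "\<dots> \<le> (\<integral>\<^sup>+\<theta>. (I2 \<theta> * indicator {0<..<1} \<theta> + ennreal C1 * (ray_samp F \<theta> * indicator {0<..<1} \<theta>)
         + ennreal ((\<mu> - B\<^sup>2) / (4 * pi) * energy f) * indicator {0<..<1} \<theta>) \<partial>lborel)"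
      using ray by (intro nn_integral_mono) (auto simp: indicator_def I1_def I2_def)
    also have "\<dots> = (\<integral>\<^sup>+\<theta>\<in>{0<..<1}. I2 \<theta> \<partial>lborel) + ennreal C1 * samp \<eta> \<sigma> F + ennreal ((\<mu> - B\<^sup>2) / (4 * pi) * energy f)"
      unfolding samp_eq by (simp add: nn_integral_add nn_integral_cmult)
    also have "\<dots> \<le> ennreal (B\<^sup>2 * energy f / (2 * pi)) + ennreal C1 * samp \<eta> \<sigma> F + ennreal ((\<mu> - B\<^sup>2) / (4 * pi) * energy f)"
      using T2 by (intro add_right_mono)
    finally have main: "ennreal (\<mu> * energy f / (2 * pi)) \<le> ennreal (B\<^sup>2 * energy f / (2 * pi)) + ennreal C1 * samp \<eta> \<sigma> F + ennreal ((\<mu> - B\<^sup>2) / (4 * pi) * energy f)" .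
    show ?thesis
    \<comment> \<open>Cancelling the Bernstein term is possible only among finite quantities; an
      infinite sample sum satisfies the claim trivially.\<close>
    proof (cases "samp \<eta> \<sigma> F = top")
      case False
      then obtain s where s: "samp \<eta> \<sigma> F = ennreal s" "0 \<le> s" by (cases "samp \<eta> \<sigma> F") auto
      have nn: "0 \<le> B\<^sup>2 * energy f / (2 * pi)" "0 \<le> C1 * s" "0 \<le> (\<mu> - B\<^sup>2) / (4 * pi) * energy f"
        using \<mu> C1 s by auto
      have "ennreal (\<mu> * energy f / (2 * pi)) \<le> ennreal (B\<^sup>2 * energy f / (2 * pi) + C1 * s + (\<mu> - B\<^sup>2) / (4 * pi) * energy f)"
        using main nn C1 s by (simp add: ennreal_mult ennreal_plus)
      then have "\<mu> * energy f / (2 * pi) \<le> B\<^sup>2 * energy f / (2 * pi) + C1 * s + (\<mu> - B\<^sup>2) / (4 * pi) * energy f"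
        using nn by (subst (asm) ennreal_le_iff) auto
      moreover have "(\<mu> - B\<^sup>2) / (4 * pi) * energy f = \<mu> * energy f / (2 * pi) - B\<^sup>2 * energy f / (2 * pi) - (\<mu> - B\<^sup>2) / (4 * pi) * energy f"
        by (simp add: field_simps)
      ultimately have "(\<mu> - B\<^sup>2) / (4 * pi) * energy f \<le> C1 * s" by linarith
      then have "(\<mu> - B\<^sup>2) / (4 * pi) / C1 * energy f \<le> s" using C1 by (simp add: field_simps)
      then show ?thesis using s by (simp add: F_def ennreal_leI)
    qed (simp add: F_def)
  qed
  moreover have "0 < (\<mu> - B\<^sup>2) / (4 * pi) / C1" using \<mu> C1 by simp
  ultimately show ?thesis by blast
qed

end

subsection \<open>Hausdorff measure on the turns\<close>

text \<open>A half-open interval is a countable union of compact ones, and continuous images of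
  compact sets are closed.\<close>

lemma borel_image_interval:
  fixes \<gamma> :: "real \<Rightarrow> 'a::metric_space"
  assumes \<gamma>: "continuous_on UNIV \<gamma>"
  shows "\<gamma> ` {a..<b} \<in> sets borel"
proof -
  have "{a..<b} = (\<Union>n :: nat. {a..b - 1 / real (Suc n)})"
  proof (intro equalityI subsetI)
    fix x assume x: "x \<in> {a..<b}"
    then obtain n where "1 / real (Suc n) < b - x" using nat_approx_posE[of "b - x"] by auto
    then have "x \<in> {a..b - 1 / real (Suc n)}" using x by simp
    then show "x \<in> (\<Union>n :: nat. {a..b - 1 / real (Suc n)})" by blast
  next
    fix x assume "x \<in> (\<Union>n :: nat. {a..b - 1 / real (Suc n)})"
    then obtain n :: nat where "x \<in> {a..b - 1 / real (Suc n)}" by blast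
    moreover have "0 < 1 / real (Suc n)" by simp
    ultimately show "x \<in> {a..<b}" unfolding atLeastLessThan_iff atLeastAtMost_iff by linarith
  qed
  then have "\<gamma> ` {a..<b} = (\<Union>n :: nat. \<gamma> ` {a..b - 1 / real (Suc n)})" by (simp only: image_UN)
  moreover have "\<gamma> ` {a..b - 1 / real (Suc n)} \<in> sets borel" for n
    by (intro borel_closed compact_imp_closed compact_continuous_image continuous_on_subset[OF \<gamma>]) auto
  ultimately show ?thesis by (auto intro!: sets.countable_UN)
qed

text \<open>Hausdorff measure restricted to \<Gamma> and to the Borel sets. It thus lives on the
  same \<sigma>-algebra as the image of Lebesgue measure under a curve, so the two can be compared
  as measures.\<close>

definition hausdorff1_on :: "'a::metric_space set \<Rightarrow> 'a measure" where
  "hausdorff1_on \<Gamma> = distr (density hausdorff1 (indicator \<Gamma>)) borel (\<lambda>x. x)"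

lemma measurable_id_hausdorff1: "(\<lambda>x. x) \<in> borel_measurable (hausdorff1 :: 'a::metric_space measure)"
  by (rule measurable_hausdorff1_borel) simp

lemma emeasure_hausdorff1_on:
  fixes \<Gamma> :: "'a::metric_space set"
  assumes \<Gamma>: "\<Gamma> \<in> sets borel" and B: "B \<in> sets borel"
  shows "emeasure (hausdorff1_on \<Gamma>) B = hausdorff1_outer (\<Gamma> \<inter> B)"
proof -
  have S: "\<Gamma> \<in> sets hausdorff1" "B \<in> sets hausdorff1" "\<Gamma> \<inter> B \<in> sets hausdorff1"
    using \<Gamma> B sets_borel_subset_hausdorff1 by blast+
  have "emeasure (hausdorff1_on \<Gamma>) B = emeasure (density hausdorff1 (indicator \<Gamma>)) B"
    unfolding hausdorff1_on_def using B measurable_id_hausdorff1 by (subst emeasure_distr) auto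
  also have "\<dots> = (\<integral>\<^sup>+x. indicator \<Gamma> x * indicator B x \<partial>hausdorff1)"
    using S by (intro emeasure_density) auto
  also have "\<dots> = (\<integral>\<^sup>+x. indicator (\<Gamma> \<inter> B) x \<partial>hausdorff1)"
    by (intro nn_integral_cong) (auto simp: indicator_def)
  also have "\<dots> = hausdorff1_outer (\<Gamma> \<inter> B)"
    using S by (simp add: emeasure_hausdorff1)
  finally show ?thesis .
qed

lemma nn_integral_hausdorff1_on:
  fixes \<Gamma> :: "'a::metric_space set" and f :: "'a \<Rightarrow> ennreal"
  assumes \<Gamma>: "\<Gamma> \<in> sets borel" and f: "f \<in> borel_measurable borel"
  shows "(\<integral>\<^sup>+x. f x \<partial>hausdorff1_on \<Gamma>) = (\<integral>\<^sup>+x\<in>\<Gamma>. f x \<partial>hausdorff1)"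
proof -
  have S: "\<Gamma> \<in> sets hausdorff1" using \<Gamma> sets_borel_subset_hausdorff1 by blast
  have fm: "f \<in> borel_measurable hausdorff1" by (rule measurable_hausdorff1_borel[OF f])
  have "(\<integral>\<^sup>+x. f x \<partial>hausdorff1_on \<Gamma>) = (\<integral>\<^sup>+x. f x \<partial>density hausdorff1 (indicator \<Gamma>))"
    unfolding hausdorff1_on_def using f measurable_id_hausdorff1 by (subst nn_integral_distr) auto
  also have "\<dots> = (\<integral>\<^sup>+x. indicator \<Gamma> x * f x \<partial>hausdorff1)"
    using S fm by (intro nn_integral_density) auto
  finally show ?thesis by (simp add: mult.commute)
qed

lemma hausdorff1_curve_compare:
  fixes \<gamma> :: "real \<Rightarrow> 'a::metric_space"
  assumes \<gamma>: "continuous_on UNIV \<gamma>" and B: "B \<in> sets borel"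
  shows "emeasure (distr (density lborel (\<lambda>t. ennreal c * indicator {a..<b} t)) borel \<gamma>) B
      = ennreal c * emeasure lborel ({a..<b} \<inter> \<gamma> -` B)"
    and "{a..<b} \<inter> \<gamma> -` B \<in> sets borel"
    and "\<gamma> ` ({a..<b} \<inter> \<gamma> -` B) = \<gamma> ` {a..<b} \<inter> B"
proof -
  have m: "\<gamma> \<in> borel_measurable borel" using \<gamma> by (rule borel_measurable_continuous_onI)
  then have pB: "\<gamma> -` B \<in> sets borel" using measurable_sets[OF m B] by simp
  then show E: "{a..<b} \<inter> \<gamma> -` B \<in> sets borel" by auto
  have "emeasure (distr (density lborel (\<lambda>t. ennreal c * indicator {a..<b} t)) borel \<gamma>) B
     = emeasure (density lborel (\<lambda>t. ennreal c * indicator {a..<b} t)) (\<gamma> -` B)"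
    using m B by (subst emeasure_distr) auto
  also have "\<dots> = (\<integral>\<^sup>+t. ennreal c * indicator {a..<b} t * indicator (\<gamma> -` B) t \<partial>lborel)"
    using pB by (intro emeasure_density) auto
  also have "\<dots> = (\<integral>\<^sup>+t. ennreal c * indicator ({a..<b} \<inter> \<gamma> -` B) t \<partial>lborel)"
    by (intro nn_integral_cong) (auto simp: indicator_def)
  also have "\<dots> = ennreal c * emeasure lborel ({a..<b} \<inter> \<gamma> -` B)"
    using E by (subst nn_integral_cmult_indicator) auto
  finally show "emeasure (distr (density lborel (\<lambda>t. ennreal c * indicator {a..<b} t)) borel \<gamma>) B
      = ennreal c * emeasure lborel ({a..<b} \<inter> \<gamma> -` B)" .
qed auto

lemma nn_integral_curve_distr:
  fixes \<gamma> :: "real \<Rightarrow> 'a::metric_space" and f :: "'a \<Rightarrow> ennreal"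
  assumes \<gamma>: "continuous_on UNIV \<gamma>" and f: "f \<in> borel_measurable borel"
  shows "(\<integral>\<^sup>+x. f x \<partial>distr (density lborel (\<lambda>t. ennreal c * indicator {a..<b} t)) borel \<gamma>)
     = ennreal c * (\<integral>\<^sup>+t\<in>{a..<b}. f (\<gamma> t) \<partial>lborel)"
proof -
  have [measurable]: "\<gamma> \<in> borel_measurable borel" using \<gamma> by (rule borel_measurable_continuous_onI)
  note [measurable] = f
  have "(\<integral>\<^sup>+x. f x \<partial>distr (density lborel (\<lambda>t. ennreal c * indicator {a..<b} t)) borel \<gamma>)
     = (\<integral>\<^sup>+t. ennreal c * indicator {a..<b} t * f (\<gamma> t) \<partial>lborel)"
    by (subst nn_integral_distr) (auto simp: nn_integral_density)
  also have "\<dots> = (\<integral>\<^sup>+t. ennreal c * (f (\<gamma> t) * indicator {a..<b} t) \<partial>lborel)"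
    by (simp add: mult_ac)
  also have "\<dots> = ennreal c * (\<integral>\<^sup>+t\<in>{a..<b}. f (\<gamma> t) \<partial>lborel)"
    by (rule nn_integral_cmult) measurable
  finally show ?thesis .
qed

text \<open>An inequality of measures on Borel sets passes to integrals, so it is enough to compare,
  for each Borel set, the length of its parameter set with the Hausdorff measure of the
  corresponding piece of the curve.\<close>

lemma nn_integral_hausdorff1_curve_ge:
  fixes \<gamma> :: "real \<Rightarrow> 'a::metric_space" and f :: "'a \<Rightarrow> ennreal"
  assumes \<gamma>: "continuous_on UNIV \<gamma>" and f: "f \<in> borel_measurable borel" and c: "0 < c"
    and exp: "\<And>s t. s \<in> {a..<b} \<Longrightarrow> t \<in> {a..<b} \<Longrightarrow> c * \<bar>s - t\<bar> \<le> dist (\<gamma> s) (\<gamma> t)"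
  shows "ennreal c * (\<integral>\<^sup>+t\<in>{a..<b}. f (\<gamma> t) \<partial>lborel) \<le> (\<integral>\<^sup>+x\<in>\<gamma> ` {a..<b}. f x \<partial>hausdorff1)"
  unfolding nn_integral_curve_distr[OF \<gamma> f, symmetric]
    nn_integral_hausdorff1_on[OF borel_image_interval[OF \<gamma>] f, symmetric]
proof (rule nn_integral_mono_measure)
  show s: "sets (distr (density lborel (\<lambda>t. ennreal c * indicator {a..<b} t)) borel \<gamma>) = sets (hausdorff1_on (\<gamma> ` {a..<b}))"
    by (simp add: hausdorff1_on_def)
  show "distr (density lborel (\<lambda>t. ennreal c * indicator {a..<b} t)) borel \<gamma> \<le> hausdorff1_on (\<gamma> ` {a..<b})"
    unfolding le_measure[OF s]
  proof
    fix B assume "B \<in> sets (distr (density lborel (\<lambda>t. ennreal c * indicator {a..<b} t)) borel \<gamma>)"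
    then have B: "B \<in> sets borel" by simp
    note C1 = hausdorff1_curve_compare(1)[OF \<gamma> B, of c a b]
    note C2 = hausdorff1_curve_compare(2)[OF \<gamma> B, of a b]
    note C3 = hausdorff1_curve_compare(3)[OF \<gamma> B, of a b]
    show "emeasure (distr (density lborel (\<lambda>t. ennreal c * indicator {a..<b} t)) borel \<gamma>) B \<le> emeasure (hausdorff1_on (\<gamma> ` {a..<b})) B"
      unfolding C1 emeasure_hausdorff1_on[OF borel_image_interval[OF \<gamma>] B] C3[symmetric]
      by (rule hausdorff1_outer_image_ge[OF C2 c]) (use exp in auto)
  qed
qed

lemma nn_integral_hausdorff1_curve_le:
  fixes \<gamma> :: "real \<Rightarrow> 'a::metric_space" and f :: "'a \<Rightarrow> ennreal"
  assumes \<gamma>: "continuous_on UNIV \<gamma>" and f: "f \<in> borel_measurable borel" and c: "0 < c"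
    and lip: "\<And>s t. s \<in> {a..b} \<Longrightarrow> t \<in> {a..b} \<Longrightarrow> dist (\<gamma> s) (\<gamma> t) \<le> c * \<bar>s - t\<bar>"
  shows "(\<integral>\<^sup>+x\<in>\<gamma> ` {a..<b}. f x \<partial>hausdorff1) \<le> ennreal c * (\<integral>\<^sup>+t\<in>{a..<b}. f (\<gamma> t) \<partial>lborel)"
  unfolding nn_integral_curve_distr[OF \<gamma> f, symmetric]
    nn_integral_hausdorff1_on[OF borel_image_interval[OF \<gamma>] f, symmetric]
proof (rule nn_integral_mono_measure)
  show s: "sets (hausdorff1_on (\<gamma> ` {a..<b})) = sets (distr (density lborel (\<lambda>t. ennreal c * indicator {a..<b} t)) borel \<gamma>)"
    by (simp add: hausdorff1_on_def)
  show "hausdorff1_on (\<gamma> ` {a..<b}) \<le> distr (density lborel (\<lambda>t. ennreal c * indicator {a..<b} t)) borel \<gamma>"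
    unfolding le_measure[OF s]
  proof
    fix B assume "B \<in> sets (hausdorff1_on (\<gamma> ` {a..<b}))"
    then have B: "B \<in> sets borel" by (simp add: hausdorff1_on_def)
    note C1 = hausdorff1_curve_compare(1)[OF \<gamma> B, of c a b]
    note C2 = hausdorff1_curve_compare(2)[OF \<gamma> B, of a b]
    note C3 = hausdorff1_curve_compare(3)[OF \<gamma> B, of a b]
    show "emeasure (hausdorff1_on (\<gamma> ` {a..<b})) B \<le> emeasure (distr (density lborel (\<lambda>t. ennreal c * indicator {a..<b} t)) borel \<gamma>) B"
      unfolding C1 emeasure_hausdorff1_on[OF borel_image_interval[OF \<gamma>] B] C3[symmetric]
      by (rule hausdorff1_outer_image_le[OF C2 _ c lip]) auto
  qed
qed

section \<open>Geometry of a single turn\<close>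

lemma norm_dirv_diff: "norm (dirv s - dirv t) = norm (fchar s - fchar t)"
proof -
  have "(norm (dirv s - dirv t))\<^sup>2 = (norm (fchar s - fchar t))\<^sup>2"
    by (simp add: norm_real2 cmod_power2 dirv_def fchar_cis power2_commute[of "sin (2 * pi * t)"])
  then show ?thesis by (simp add: power2_eq_iff_nonneg)
qed

lemma half_le_sin:
  assumes "0 \<le> x" "x \<le> pi / 3"
  shows "x / 2 \<le> sin x"
proof -
  have "sin 0 - 0 / 2 \<le> sin x - x / 2"
  proof (rule DERIV_nonneg_imp_nondecreasing[OF assms(1)])
    fix y assume y: "0 \<le> y" "y \<le> x"
    have "cos (pi / 3) \<le> cos y" using y assms by (intro cos_monotone_0_pi_le) auto
    then have "0 \<le> cos y - 1 / 2" by (simp add: cos_60)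
    moreover have "((\<lambda>x. sin x - x / 2) has_real_derivative cos y - 1 / 2) (at y)"
      by (auto intro!: derivative_eq_intros)
    ultimately show "\<exists>z. ((\<lambda>x. sin x - x / 2) has_real_derivative z) (at y) \<and> 0 \<le> z" by blast
  qed
  then show ?thesis by simp
qed

lemma norm_fchar_diff_sin: "norm (fchar s - fchar t) = 2 * \<bar>sin (pi * (s - t))\<bar>"
proof -
  have "(norm (fchar s - fchar t))\<^sup>2 = (cos (2 * pi * s) - cos (2 * pi * t))\<^sup>2 + (sin (2 * pi * s) - sin (2 * pi * t))\<^sup>2"
    by (simp add: cmod_power2 fchar_cis power2_commute)
  also have "\<dots> = ((sin (2 * pi * s))\<^sup>2 + (cos (2 * pi * s))\<^sup>2) + ((sin (2 * pi * t))\<^sup>2 + (cos (2 * pi * t))\<^sup>2)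
     - 2 * (cos (2 * pi * s) * cos (2 * pi * t) + sin (2 * pi * s) * sin (2 * pi * t))"
    by (simp add: power2_diff del: sin_cos_squared_add sin_cos_squared_add2)
  also have "\<dots> = 2 - 2 * cos (2 * (pi * (s - t)))"
    by (simp add: cos_diff[symmetric] right_diff_distrib mult.assoc)
  also have "\<dots> = (2 * \<bar>sin (pi * (s - t))\<bar>)\<^sup>2"
    unfolding cos_double_sin by (simp add: power2_eq_square)
  finally show ?thesis by (rule power2_eq_imp_eq) auto
qed

text \<open>The chord of an arc of at most half a turn. The angle \<open>pi |s - t|\<close> may
  reach \<open>pi / 2\<close>, beyond the range of \<open>half_le_sin\<close>, so it is halved first
  and recovered by the double angle formula.\<close>

lemma norm_fchar_diff_ge:
  assumes "\<bar>s - t\<bar> \<le> 1 / 2"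
  shows "\<bar>s - t\<bar> \<le> norm (fchar s - fchar t)"
proof -
  define x where "x = pi * \<bar>s - t\<bar> / 2"
  have x: "0 \<le> x" "x \<le> pi / 4"
    using assms mult_left_mono[OF assms, of pi] by (auto simp: x_def)
  have x3: "x \<le> pi / 3" using x(2) pi_gt_zero by linarith
  have c: "1 / 2 \<le> cos x"
    using cos_monotone_0_pi_le[of x "pi / 3"] x x3 by (simp add: cos_60)
  have s: "x / 2 \<le> sin x" by (rule half_le_sin[OF x(1) x3])
  have "x / 2 \<le> 2 * sin x * cos x"
  proof -
    have "x / 2 * (1 / 2) \<le> sin x * cos x" using s c x by (intro mult_mono) auto
    then show ?thesis by simp
  qed
  also have "2 * sin x * cos x = sin (2 * x)" by (simp add: sin_double)
  also have "sin (2 * x) \<le> \<bar>sin (pi * (s - t))\<bar>"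
  proof (cases "t \<le> s")
    case False
    then have "\<bar>s - t\<bar> = - (s - t)" by simp
    moreover have "2 * x = pi * \<bar>s - t\<bar>" by (simp add: x_def)
    ultimately have "2 * x = - (pi * (s - t))" by (simp only: mult_minus_right)
    then show ?thesis by (simp only: sin_minus)
  qed (simp add: x_def)
  finally have "x \<le> norm (fchar s - fchar t)" unfolding norm_fchar_diff_sin by simp
  moreover have "\<bar>s - t\<bar> \<le> x"
  proof -
    have "2 * \<bar>s - t\<bar> \<le> pi * \<bar>s - t\<bar>" using pi_ge_two by (intro mult_right_mono) auto
    then show ?thesis by (simp add: x_def)
  qed
  ultimately show ?thesis by simp
qed

context polar_sampling
begin

definition turn :: "nat \<Rightarrow> real \<Rightarrow> real^2" where
  "turn k \<theta> = nd k \<theta> *\<^sub>R dirv \<theta>"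

lemma continuous_turn: "continuous_on UNIV (turn k)"
  unfolding turn_def node_def by (intro continuous_intros)

lemma turn_lipschitz:
  assumes "s \<in> {0..1}" "t \<in> {0..1}"
  shows "dist (turn k s) (turn k t) \<le> \<eta> * (1 + 2 * pi * (real k + 1)) * \<bar>s - t\<bar>"
proof -
  have "turn k s - turn k t = (nd k s - nd k t) *\<^sub>R dirv s + nd k t *\<^sub>R (dirv s - dirv t)"
    by (simp add: turn_def algebra_simps)
  then have "dist (turn k s) (turn k t) \<le> \<bar>nd k s - nd k t\<bar> + \<bar>nd k t\<bar> * norm (dirv s - dirv t)"
    unfolding dist_norm using norm_triangle_ineq[of "(nd k s - nd k t) *\<^sub>R dirv s" "nd k t *\<^sub>R (dirv s - dirv t)"] by simp
  also have "\<dots> \<le> \<eta> * \<bar>s - t\<bar> + \<eta> * (real k + 1) * (2 * pi * \<bar>s - t\<bar>)"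
  proof (intro add_mono mult_mono)
    have "nd k s - nd k t = \<eta> * (\<sigma> * (s - t))" by (simp add: node_def algebra_simps)
    then show "\<bar>nd k s - nd k t\<bar> \<le> \<eta> * \<bar>s - t\<bar>"
      using \<eta> \<sigma> by (simp add: abs_mult mult_left_le_one_le)
    show "\<bar>nd k t\<bar> \<le> \<eta> * (real k + 1)"
    proof -
      have "0 \<le> \<eta> * real k" using \<eta> by simp
      then show ?thesis using nd_bounds[of t k] assms by auto
    qed
    show "norm (dirv s - dirv t) \<le> 2 * pi * \<bar>s - t\<bar>" unfolding norm_dirv_diff by (rule fchar_lipschitz)
  qed (use \<eta> in auto)
  finally show ?thesis by (simp add: algebra_simps)
qed

text \<open>By the law of cosines the squared distance is
  \<open>(a - b)^2 + a b |dirv s - dirv t|^2\<close>, so a change of radius only helps. Beyond half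
  a turn the chord shrinks again, hence the restriction.\<close>

lemma turn_expand:
  assumes st: "s \<in> {0..1}" "t \<in> {0..1}" "\<bar>s - t\<bar> \<le> 1 / 2"
  shows "\<eta> * real k * \<bar>s - t\<bar> \<le> dist (turn k s) (turn k t)"
proof -
  define a b where "a = nd k s" and "b = nd k t"
  have ab: "\<eta> * real k \<le> a" "\<eta> * real k \<le> b" using nd_bounds(1) st by (auto simp: a_def b_def)
  have k0: "0 \<le> \<eta> * real k" using \<eta> by simp
  have n1: "dirv s \<bullet> dirv s = 1" "dirv t \<bullet> dirv t = 1" by (simp_all flip: power2_norm_eq_inner)
  have "(dist (turn k s) (turn k t))\<^sup>2 = (a - b)\<^sup>2 + a * b * (norm (dirv s - dirv t))\<^sup>2"
    unfolding dist_norm power2_norm_eq_inner turn_def a_def[symmetric] b_def[symmetric]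
    by (simp add: inner_diff_left inner_diff_right inner_commute n1 power2_eq_square algebra_simps)
  moreover have "(\<eta> * real k)\<^sup>2 * (norm (dirv s - dirv t))\<^sup>2 \<le> a * b * (norm (dirv s - dirv t))\<^sup>2"
    unfolding power2_eq_square[of "\<eta> * real k"] using ab k0 by (intro mult_right_mono mult_mono) auto
  ultimately have "(\<eta> * real k * norm (dirv s - dirv t))\<^sup>2 \<le> (dist (turn k s) (turn k t))\<^sup>2"
    by (simp add: power_mult_distrib) (smt (verit) zero_le_power2)
  then have "\<eta> * real k * norm (dirv s - dirv t) \<le> dist (turn k s) (turn k t)"
    by (rule power2_le_imp_le) simp
  moreover have "\<eta> * real k * \<bar>s - t\<bar> \<le> \<eta> * real k * norm (dirv s - dirv t)"
    unfolding norm_dirv_diff by (rule mult_left_mono[OF norm_fchar_diff_ge[OF st(3)] k0])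
  ultimately show ?thesis by linarith
qed

text \<open>The turn is cut into two half turns, on which \<open>turn_expand\<close> holds. The node
  is at most twice \<eta> \<open>k\<close> since \<open>k >= 1\<close>, which with the two halves
  makes the constant 4.\<close>

lemma turn_integral_ge:
  fixes g :: "real^2 \<Rightarrow> real"
  assumes g: "g \<in> borel_measurable borel" and g0: "\<And>x. 0 \<le> g x" and k: "1 \<le> k"
  shows "(\<integral>\<^sup>+\<theta>\<in>{0<..<1}. ennreal (nd k \<theta> * g (turn k \<theta>)) \<partial>lborel) \<le> 4 * (\<integral>\<^sup>+x\<in>turn k ` {0..<1}. ennreal (g x) \<partial>hausdorff1)"
proof -
  note [measurable] = g
  have gm: "(\<lambda>x. ennreal (g x)) \<in> borel_measurable borel" by measurable
  have [measurable]: "turn k \<in> borel_measurable borel" by (rule borel_measurable_continuous_onI[OF continuous_turn])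
  have half: "ennreal (\<eta> * real k) * (\<integral>\<^sup>+\<theta>\<in>{a..<a + 1/2}. ennreal (g (turn k \<theta>)) \<partial>lborel)
     \<le> (\<integral>\<^sup>+x\<in>turn k ` {0..<1}. ennreal (g x) \<partial>hausdorff1)" if a: "0 \<le> a" "a \<le> 1 / 2" for a
  proof -
    have "ennreal (\<eta> * real k) * (\<integral>\<^sup>+\<theta>\<in>{a..<a + 1/2}. ennreal (g (turn k \<theta>)) \<partial>lborel)
       \<le> (\<integral>\<^sup>+x\<in>turn k ` {a..<a + 1/2}. ennreal (g x) \<partial>hausdorff1)"
    proof (rule nn_integral_hausdorff1_curve_ge[OF continuous_turn gm])
      show "0 < \<eta> * real k" using \<eta> k by simp
      fix s t assume "s \<in> {a..<a + 1/2}" "t \<in> {a..<a + 1/2}"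
      then show "\<eta> * real k * \<bar>s - t\<bar> \<le> dist (turn k s) (turn k t)"
        using a by (intro turn_expand) (auto simp: abs_if)
    qed
    also have "\<dots> \<le> (\<integral>\<^sup>+x\<in>turn k ` {0..<1}. ennreal (g x) \<partial>hausdorff1)"
      using a by (intro nn_integral_mono mult_left_mono) (auto simp: indicator_def split: if_splits)
    finally show ?thesis .
  qed
  have "(\<integral>\<^sup>+\<theta>\<in>{0<..<1}. ennreal (nd k \<theta> * g (turn k \<theta>)) \<partial>lborel) \<le>
    (\<integral>\<^sup>+\<theta>. (2 * (ennreal (\<eta> * real k) * (ennreal (g (turn k \<theta>)) * indicator {0..<0 + 1/2} \<theta>)) +
       2 * (ennreal (\<eta> * real k) * (ennreal (g (turn k \<theta>)) * indicator {1/2..<1/2 + 1/2} \<theta>))) \<partial>lborel)"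
  proof (rule nn_integral_mono)
    fix \<theta> :: real
    show "ennreal (nd k \<theta> * g (turn k \<theta>)) * indicator {0<..<1} \<theta> \<le>
      2 * (ennreal (\<eta> * real k) * (ennreal (g (turn k \<theta>)) * indicator {0..<0 + 1/2} \<theta>)) +
       2 * (ennreal (\<eta> * real k) * (ennreal (g (turn k \<theta>)) * indicator {1/2..<1/2 + 1/2} \<theta>))"
    proof (cases "\<theta> \<in> {0<..<1}")
      case True
      have "nd k \<theta> \<le> \<eta> * (real k + 1)" using nd_bounds(2)[of \<theta> k] True by auto
      also have "\<dots> \<le> \<eta> * (2 * real k)" using k \<eta> by (intro mult_left_mono) auto
      finally have "nd k \<theta> * g (turn k \<theta>) \<le> \<eta> * (2 * real k) * g (turn k \<theta>)" by (rule mult_right_mono) (rule g0)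
      then have "ennreal (nd k \<theta> * g (turn k \<theta>)) \<le> ennreal (2 * (\<eta> * real k * g (turn k \<theta>)))" by (intro ennreal_leI) simp
      also have "\<dots> = 2 * (ennreal (\<eta> * real k) * ennreal (g (turn k \<theta>)))"
        using \<eta> g0 by (simp add: ennreal_mult)
      finally show ?thesis using True by (auto simp: indicator_def)
    qed simp
  qed
  also have "\<dots> = 2 * (ennreal (\<eta> * real k) * (\<integral>\<^sup>+\<theta>\<in>{0..<0 + 1/2}. ennreal (g (turn k \<theta>)) \<partial>lborel)) +
      2 * (ennreal (\<eta> * real k) * (\<integral>\<^sup>+\<theta>\<in>{1/2..<1/2 + 1/2}. ennreal (g (turn k \<theta>)) \<partial>lborel))"
    by (subst nn_integral_add) (simp_all add: nn_integral_cmult)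
  also have "\<dots> \<le> 2 * (\<integral>\<^sup>+x\<in>turn k ` {0..<1}. ennreal (g x) \<partial>hausdorff1) + 2 * (\<integral>\<^sup>+x\<in>turn k ` {0..<1}. ennreal (g x) \<partial>hausdorff1)"
    by (intro add_mono mult_left_mono half) auto
  also have "\<dots> = 4 * (\<integral>\<^sup>+x\<in>turn k ` {0..<1}. ennreal (g x) \<partial>hausdorff1)"
    by (simp flip: distrib_right)
  finally show ?thesis .
qed

lemma turn_integral_le:
  fixes g :: "real^2 \<Rightarrow> real"
  assumes g: "g \<in> borel_measurable borel"
  shows "(\<integral>\<^sup>+x\<in>turn k ` {0..<1}. ennreal (g x) \<partial>hausdorff1) \<le>
    ennreal (\<eta> * (1 + 2 * pi * (real k + 1))) * (\<integral>\<^sup>+\<theta>\<in>{0..<1}. ennreal (g (turn k \<theta>)) \<partial>lborel)"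
proof (rule nn_integral_hausdorff1_curve_le[OF continuous_turn])
  show "(\<lambda>x. ennreal (g x)) \<in> borel_measurable borel" using g by measurable
  show "0 < \<eta> * (1 + 2 * pi * (real k + 1))" using \<eta> by (simp add: add_pos_nonneg)
qed (rule turn_lipschitz)

lemma turn_integral_le_node:
  fixes g :: "real^2 \<Rightarrow> real"
  assumes g: "g \<in> borel_measurable borel" and g0: "\<And>x. 0 \<le> g x" and k: "1 \<le> k"
  shows "(\<integral>\<^sup>+x\<in>turn k ` {0..<1}. ennreal (g x) \<partial>hausdorff1) \<le>
    ennreal 17 * (\<integral>\<^sup>+\<theta>\<in>{0<..<1}. ennreal (nd k \<theta> * g (turn k \<theta>)) \<partial>lborel)"
proof -
  note [measurable] = g
  have [measurable]: "turn k \<in> borel_measurable borel" by (rule borel_measurable_continuous_onI[OF continuous_turn])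
  define L where "L = \<eta> * (1 + 2 * pi * (real k + 1))"
  have L0: "0 \<le> L" using \<eta> by (simp add: L_def)
  have L: "L \<le> 17 * (\<eta> * real k)"
  proof -
    \<comment> \<open>From \<open>pi < 4\<close> and \<open>k + 1 <= 2 k\<close>: the speed is at
      most \<eta> times \<open>1 + 16 k\<close>, hence the constant 17.\<close>
    have "pi * (real k + 1) \<le> 4 * (2 * real k)" using k pi_less_4 by (intro mult_mono) auto
    then have "1 + 2 * pi * (real k + 1) \<le> 17 * real k" using k by simp
    then have "L \<le> \<eta> * (17 * real k)" unfolding L_def using \<eta> by (intro mult_left_mono) auto
    then show ?thesis by simp
  qed
  have "(\<integral>\<^sup>+x\<in>turn k ` {0..<1}. ennreal (g x) \<partial>hausdorff1) \<le> ennreal L * (\<integral>\<^sup>+\<theta>\<in>{0..<1}. ennreal (g (turn k \<theta>)) \<partial>lborel)"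
    unfolding L_def by (rule turn_integral_le[OF g])
  also have "\<dots> = (\<integral>\<^sup>+\<theta>. ennreal L * (ennreal (g (turn k \<theta>)) * indicator {0..<1} \<theta>) \<partial>lborel)"
    by (rule nn_integral_cmult[symmetric]) measurable
  also have "\<dots> \<le> (\<integral>\<^sup>+\<theta>. ennreal 17 * (ennreal (nd k \<theta> * g (turn k \<theta>)) * indicator {0<..<1} \<theta>) \<partial>lborel)"
  proof (rule nn_integral_mono_AE)
    have "AE \<theta> in lborel. \<theta> \<noteq> (0::real)" by (rule AE_lborel_singleton)
    then show "AE \<theta> in lborel. ennreal L * (ennreal (g (turn k \<theta>)) * indicator {0..<1} \<theta>) \<le>
      ennreal 17 * (ennreal (nd k \<theta> * g (turn k \<theta>)) * indicator {0<..<1} \<theta>)"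
    proof eventually_elim
      case (elim \<theta>)
      show ?case
      proof (cases "\<theta> \<in> {0<..<1}")
        case True
        have nn: "0 \<le> nd k \<theta>" using nd_bounds(1)[of \<theta> k] True \<eta> by (smt (verit) greaterThanLessThan_iff mult_nonneg_nonneg of_nat_0_le_iff)
        have "L \<le> 17 * nd k \<theta>" using L nd_bounds(1)[of \<theta> k] True by auto
        then have "L * g (turn k \<theta>) \<le> 17 * nd k \<theta> * g (turn k \<theta>)" by (rule mult_right_mono) (rule g0)
        then have "ennreal (L * g (turn k \<theta>)) \<le> ennreal (17 * (nd k \<theta> * g (turn k \<theta>)))" by (intro ennreal_leI) simp
        then show ?thesis using True L0 g0 nn by (simp add: ennreal_mult)
      next
        case False
        then show ?thesis using elim by (auto simp: indicator_def)
      qed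
    qed
  qed
  also have "\<dots> = ennreal 17 * (\<integral>\<^sup>+\<theta>\<in>{0<..<1}. ennreal (nd k \<theta> * g (turn k \<theta>)) \<partial>lborel)"
    by (rule nn_integral_cmult) measurable
  finally show ?thesis .
qed

section \<open>From single turns to the whole set\<close>

text \<open>The index of the turn can be read off from the norm as the integer part of
  \<open>norm x / \<eta>\<close>, since \<open>\<sigma> \<theta> < 1\<close> on the half-open
  turn.\<close>

lemma disjoint_turns:
  assumes \<sigma>1: "\<sigma> = 0 \<or> \<sigma> = 1"
    and x: "x \<in> turn k ` {0..<1}" "x \<in> turn l ` {0..<1}"
  shows "k = l"
proof -
  have fl: "m = nat \<lfloor>norm x / \<eta>\<rfloor>" if "x \<in> turn m ` {0..<1}" for m
  proof -
    from that obtain \<theta> where \<theta>: "0 \<le> \<theta>" "\<theta> < 1" "x = turn m \<theta>" by auto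
    have "0 \<le> nd m \<theta>" using nd_bounds(1)[of \<theta> m] \<theta> \<eta> by (smt (verit) mult_nonneg_nonneg of_nat_0_le_iff)
    then have "norm x / \<eta> = \<sigma> * \<theta> + real m" using \<theta>(3) \<eta> by (simp add: turn_def node_def)
    moreover have "0 \<le> \<sigma> * \<theta>" "\<sigma> * \<theta> < 1" using \<sigma>1 \<theta> by auto
    ultimately have "\<lfloor>norm x / \<eta>\<rfloor> = int m" by (intro floor_unique) auto
    then show ?thesis by simp
  qed
  show ?thesis using fl[OF x(1)] fl[OF x(2)] by simp
qed

lemma nn_integral_turns:
  fixes g :: "real^2 \<Rightarrow> real"
  assumes \<sigma>1: "\<sigma> = 0 \<or> \<sigma> = 1" and g: "g \<in> borel_measurable borel"
  shows "(\<integral>\<^sup>+x\<in>(\<Union>k. turn (k + m) ` {0..<1}). ennreal (g x) \<partial>hausdorff1) =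
    (\<Sum>k. \<integral>\<^sup>+x\<in>turn (k + m) ` {0..<1}. ennreal (g x) \<partial>hausdorff1)"
proof -
  have S: "turn k ` {0..<1} \<in> sets hausdorff1" for k
    using borel_image_interval[OF continuous_turn] sets_borel_subset_hausdorff1 by blast
  have gm: "(\<lambda>x. ennreal (g x)) \<in> borel_measurable hausdorff1"
    by (rule measurable_hausdorff1_borel) (use g in measurable)
  have dj: "disjoint_family (\<lambda>k. turn (k + m) ` {0..<1})"
    unfolding disjoint_family_on_def using disjoint_turns[OF \<sigma>1] by (metis add_right_cancel disjoint_iff)
  have "(\<Sum>k. \<integral>\<^sup>+x\<in>turn (k + m) ` {0..<1}. ennreal (g x) \<partial>hausdorff1)
    = (\<integral>\<^sup>+x. (\<Sum>k. ennreal (g x) * indicator (turn (k + m) ` {0..<1}) x) \<partial>hausdorff1)"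
    by (rule nn_integral_suminf[symmetric]) (use S gm in measurable)
  also have "\<dots> = (\<integral>\<^sup>+x\<in>(\<Union>k. turn (k + m) ` {0..<1}). ennreal (g x) \<partial>hausdorff1)"
    by (intro nn_integral_cong) (simp add: ennreal_suminf_cmult suminf_indicator[OF dj])
  finally show ?thesis by simp
qed

lemma samp_eq_suminf:
  assumes "F \<in> borel_measurable borel"
  shows "samp \<eta> \<sigma> F = (\<Sum>k. \<integral>\<^sup>+\<theta>\<in>{0<..<1}. ennreal (nd (Suc k) \<theta> * (norm (F (turn (Suc k) \<theta>)))\<^sup>2) \<partial>lborel)"
proof -
  note [measurable] = assms
  have [measurable]: "turn k \<in> borel_measurable borel" for k by (rule borel_measurable_continuous_onI[OF continuous_turn])
  have "samp \<eta> \<sigma> F = (\<integral>\<^sup>+\<theta>. (\<Sum>k. ennreal (nd (Suc k) \<theta> * (norm (F (turn (Suc k) \<theta>)))\<^sup>2) * indicator {0<..<1} \<theta>) \<partial>lborel)"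
    unfolding samp_def turn_def[symmetric] by simp
  also have "\<dots> = (\<Sum>k. \<integral>\<^sup>+\<theta>\<in>{0<..<1}. ennreal (nd (Suc k) \<theta> * (norm (F (turn (Suc k) \<theta>)))\<^sup>2) \<partial>lborel)"
    by (rule nn_integral_suminf) measurable
  finally show ?thesis .
qed

text \<open>The index \<open>m\<close> of the first turn is \<open>0\<close> for the spiral and \<open>1\<close> for the circles.\<close>

theorem turns_sampling:
  assumes \<sigma>1: "\<sigma> = 0 \<or> \<sigma> = 1" and m: "m \<le> 1" and R\<eta>: "2 * R * \<eta> < 1"
  shows "\<exists>A>0. \<exists>B>0. \<forall>f. bandlimited R f \<longrightarrow>
    ennreal (A * energy f) \<le> (\<integral>\<^sup>+x\<in>(\<Union>k. turn (k + m) ` {0..<1}). ennreal ((norm (fourier_transform f x))\<^sup>2) \<partial>hausdorff1) \<and>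
    (\<integral>\<^sup>+x\<in>(\<Union>k. turn (k + m) ` {0..<1}). ennreal ((norm (fourier_transform f x))\<^sup>2) \<partial>hausdorff1) \<le> ennreal (B * energy f)"
proof -
  obtain A where A: "0 < A" "\<And>f. bandlimited R f \<Longrightarrow> ennreal (A * energy f) \<le> samp \<eta> \<sigma> (fourier_transform f)"
    using samp_lower[OF R\<eta>] by blast
  define B1 where "B1 = ((1 + 1 / \<eta>) + (2 * pi * R)\<^sup>2) / (2 * pi)"
  define V where "V = measure lborel (cball (0::real^2) R) + 1"
  define L where "L = \<eta> * (1 + 2 * pi)"
  have B1: "0 \<le> B1" using \<eta> by (simp add: B1_def)
  have V: "0 < V" by (simp add: V_def add_nonneg_pos)
  have L: "0 < L" using \<eta> by (simp add: L_def add_pos_pos)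
  have low: "ennreal (A / 4 * energy f) \<le> (\<integral>\<^sup>+x\<in>(\<Union>k. turn (k + m) ` {0..<1}). ennreal ((norm (fourier_transform f x))\<^sup>2) \<partial>hausdorff1)"
    and up: "(\<integral>\<^sup>+x\<in>(\<Union>k. turn (k + m) ` {0..<1}). ennreal ((norm (fourier_transform f x))\<^sup>2) \<partial>hausdorff1) \<le> ennreal ((L * V + 17 * B1) * energy f)"
    if f: "bandlimited R f" for f
  proof -
    define F where "F = fourier_transform f"
    define g where "g x = (norm (F x))\<^sup>2" for x
    have Fm: "F \<in> borel_measurable borel" unfolding F_def
      using continuous_fourier_transform[OF bandlimited_integrable[OF f]] by (rule borel_measurable_continuous_onI)
    then have gm: "g \<in> borel_measurable borel" unfolding g_def by measurable
    have g0: "0 \<le> g x" for x by (simp add: g_def)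
    define H where "H k = (\<integral>\<^sup>+x\<in>turn k ` {0..<1}. ennreal (g x) \<partial>hausdorff1)" for k
    define S where "S k = (\<integral>\<^sup>+\<theta>\<in>{0<..<1}. ennreal (nd k \<theta> * g (turn k \<theta>)) \<partial>lborel)" for k
    have SH: "S (Suc k) \<le> 4 * H (Suc k)" for k
      unfolding S_def H_def by (rule turn_integral_ge[OF gm g0]) simp
    have HS: "H (Suc k) \<le> ennreal 17 * S (Suc k)" for k
      unfolding S_def H_def by (rule turn_integral_le_node[OF gm g0]) simp
    have sS: "samp \<eta> \<sigma> F = (\<Sum>k. S (Suc k))" unfolding samp_eq_suminf[OF Fm] S_def g_def ..
    have I: "(\<integral>\<^sup>+x\<in>(\<Union>k. turn (k + m) ` {0..<1}). ennreal (g x) \<partial>hausdorff1) = (\<Sum>k. H (k + m))"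
      unfolding H_def by (rule nn_integral_turns[OF \<sigma>1 gm])
    have "ennreal (A * energy f) \<le> (\<Sum>k. S (Suc k))" using A(2)[OF f] sS by (simp add: F_def)
    also have "\<dots> \<le> (\<Sum>k. 4 * H (Suc k))" by (intro suminf_le allI SH) auto
    also have "\<dots> = 4 * (\<Sum>k. H (Suc k))" by (rule ennreal_suminf_cmult)
    \<comment> \<open>The two sums agree for \<open>m = 1\<close>; for \<open>m = 0\<close> the turn
      of index 0 is added, which only helps.\<close>
    also have "(\<Sum>k. H (Suc k)) \<le> (\<Sum>k. H (k + m))"
      using suminf_shift_le[of "\<lambda>k. H (k + m)" "1 - m"] m by simp
    finally have 4: "ennreal (A * energy f) \<le> 4 * (\<Sum>k. H (k + m))" by (simp add: mult_left_mono)
    have "ennreal (A / 4 * energy f) = ennreal (1/4) * ennreal (A * energy f)"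
      using A by (simp add: ennreal_mult[symmetric])
    also have "\<dots> \<le> ennreal (1/4) * (4 * (\<Sum>k. H (k + m)))" using 4 by (rule mult_left_mono) simp
    also have "\<dots> = (\<Sum>k. H (k + m))"
    proof -
      have "ennreal (1/4) * 4 = 1"
        using ennreal_mult[of "1/4" 4] by simp
      then show ?thesis by (simp only: mult.assoc[symmetric] mult_1)
    qed
    finally show "ennreal (A / 4 * energy f) \<le> (\<integral>\<^sup>+x\<in>(\<Union>k. turn (k + m) ` {0..<1}). ennreal ((norm (fourier_transform f x))\<^sup>2) \<partial>hausdorff1)"
      using I by (simp add: g_def F_def)
    \<comment> \<open>The turn of index 0 does not occur in \<open>samp\<close>. It has bounded
      length, so the supremum bound of the transform by the energy suffices.\<close>
    have H0: "H 0 \<le> ennreal (L * (V * energy f))"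
    proof -
      have gV: "g x \<le> V * energy f" for x
      proof -
        have "g x \<le> (LINT x|lborel. norm (f x))\<^sup>2"
          unfolding g_def F_def by (intro power_mono norm_fourier_transform_le) simp
        also have "\<dots> \<le> V * energy f" unfolding V_def by (rule norm_L1_le_energy[OF f])
        finally show ?thesis .
      qed
      have "H 0 \<le> ennreal (\<eta> * (1 + 2 * pi * (real 0 + 1))) * (\<integral>\<^sup>+\<theta>\<in>{0..<1}. ennreal (g (turn 0 \<theta>)) \<partial>lborel)"
        unfolding H_def by (rule turn_integral_le[OF gm])
      also have "\<dots> \<le> ennreal L * (\<integral>\<^sup>+\<theta>. ennreal (V * energy f) * indicator {0..<1::real} \<theta> \<partial>lborel)"
        using gV by (intro mult_mono nn_integral_mono) (auto simp: L_def indicator_def ennreal_leI)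
      also have "\<dots> = ennreal (L * (V * energy f))"
        using L V by (simp add: nn_integral_cmult_indicator ennreal_mult)
      finally show ?thesis .
    qed
    have "(\<Sum>k. H (k + m)) \<le> (\<Sum>k. H k)" by (rule suminf_shift_le)
    also have "\<dots> = H 0 + (\<Sum>k. H (Suc k))"
      using suminf_offset[of H 1] by (simp add: add.commute)
    also have "\<dots> \<le> ennreal (L * (V * energy f)) + (\<Sum>k. ennreal 17 * S (Suc k))"
      by (intro add_mono H0 suminf_le allI HS) auto
    also have "(\<Sum>k. ennreal 17 * S (Suc k)) = ennreal 17 * samp \<eta> \<sigma> F"
      unfolding sS by (rule ennreal_suminf_cmult)
    also have "\<dots> \<le> ennreal 17 * ennreal (B1 * energy f)"
      unfolding F_def B1_def by (intro mult_left_mono samp_upper[OF f]) simp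
    also have "ennreal (L * (V * energy f)) + ennreal 17 * ennreal (B1 * energy f) = ennreal ((L * V + 17 * B1) * energy f)"
    proof -
      have "ennreal 17 * ennreal (B1 * energy f) = ennreal (17 * (B1 * energy f))"
        using B1 by (intro ennreal_mult[symmetric]) auto
      then show ?thesis using L V B1 by (simp only:) (subst ennreal_plus[symmetric], auto simp: algebra_simps)
    qed
    finally show "(\<integral>\<^sup>+x\<in>(\<Union>k. turn (k + m) ` {0..<1}). ennreal ((norm (fourier_transform f x))\<^sup>2) \<partial>hausdorff1) \<le> ennreal ((L * V + 17 * B1) * energy f)"
      using I by (simp add: g_def F_def add_left_mono)
  qed
  have "0 < A / 4" "0 < L * V + 17 * B1" using A L V B1 by (auto simp: add_pos_nonneg)
  then show ?thesis using low up by blast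
qed

end

lemma spiral_eq_turns:
  assumes "0 < \<eta>"
  shows "spiral \<eta> = (\<Union>k. polar_sampling.turn \<eta> 1 (k + 0) ` {0..<1})"
proof -
  interpret polar_sampling \<eta> 1 0 by unfold_locales (use assms in auto)
  have sp: "vector [\<eta> * \<theta> * cos (2 * pi * \<theta>), \<eta> * \<theta> * sin (2 * pi * \<theta>)] = (\<eta> * \<theta>) *\<^sub>R dirv \<theta>" for \<theta>
    by (simp add: vec_eq_iff forall_2 dirv_def)
  \<comment> \<open>By periodicity of the direction, the point \<theta> of turn \<open>k\<close> is
    the point of parameter \<open>\<theta> + k\<close> on the spiral.\<close>
  have tn: "turn k \<theta> = (\<eta> * (\<theta> + real k)) *\<^sub>R dirv (\<theta> + real k)" for k \<theta>
    by (simp add: turn_def node_def)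
  show ?thesis
    unfolding spiral_def sp
  proof (intro equalityI subsetI)
    fix x assume "x \<in> {(\<eta> * \<theta>) *\<^sub>R dirv \<theta> |\<theta>. 0 \<le> \<theta>}"
    then obtain \<theta> where \<theta>: "0 \<le> \<theta>" "x = (\<eta> * \<theta>) *\<^sub>R dirv \<theta>" by blast
    define k where "k = nat \<lfloor>\<theta>\<rfloor>"
    have "frac \<theta> + real k = \<theta>" using \<theta>(1) by (simp add: k_def frac_def)
    then have "x = turn k (frac \<theta>)" using \<theta>(2) by (simp only: tn)
    then show "x \<in> (\<Union>k. turn (k + 0) ` {0..<1})" by (auto simp: frac_lt_1 intro!: exI[of _ k])
  next
    fix x assume "x \<in> (\<Union>k. turn (k + 0) ` {0..<1})"
    then obtain k \<theta> where "0 \<le> \<theta>" "x = turn k \<theta>" by auto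
    then show "x \<in> {(\<eta> * \<theta>) *\<^sub>R dirv \<theta> |\<theta>. 0 \<le> \<theta>}" unfolding tn by (intro CollectI exI[of _ "\<theta> + real k"]) auto
  qed
qed

lemma concentric_circles_eq_turns:
  assumes "0 < \<eta>"
  shows "concentric_circles \<eta> = (\<Union>k. polar_sampling.turn \<eta> 0 (k + 1) ` {0..<1})"
proof -
  interpret polar_sampling \<eta> 0 0 by unfold_locales (use assms in auto)
  show ?thesis
  proof (intro equalityI subsetI)
    fix x assume "x \<in> concentric_circles \<eta>"
    then obtain k :: nat where k: "1 \<le> k" "(norm x)\<^sup>2 = (\<eta> * real k)\<^sup>2"
      by (auto simp: concentric_circles_def norm_real2 power_mult_distrib)
    then have n: "norm x = \<eta> * real k" using assms by (simp add: power2_eq_iff_nonneg)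
    obtain \<theta> where \<theta>: "0 \<le> \<theta>" "\<theta> < 1" "x = norm x *\<^sub>R dirv \<theta>" using polar_exists by blast
    then have "x = turn ((k - 1) + 1) \<theta>" using n k(1) by (simp add: turn_def node_def)
    then have "x \<in> turn ((k - 1) + 1) ` {0..<1}" by (rule image_eqI) (use \<theta> in simp)
    then show "x \<in> (\<Union>k. turn (k + 1) ` {0..<1})" by blast
  next
    fix x assume "x \<in> (\<Union>k. turn (k + 1) ` {0..<1})"
    then obtain k \<theta> where "x = turn (k + 1) \<theta>" by auto
    then have "norm x = \<eta> * real (k + 1)" using assms by (simp add: turn_def node_def)
    then have "(norm x)\<^sup>2 = \<eta>\<^sup>2 * (real (k + 1))\<^sup>2" by (simp only: power_mult_distrib)
    then show "x \<in> concentric_circles \<eta>"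
      unfolding concentric_circles_def norm_real2 by (intro CollectI exI[of _ "k + 1"]) auto
  qed
qed

subsection \<open>Sharpness\<close>

text \<open>The square makes the function and its first derivative vanish at both ends, so two
  integrations by parts leave no boundary terms.\<close>

definition bump :: "real \<Rightarrow> real \<Rightarrow> complex" where
  "bump a t = of_real (indicator {- a..a} t * (a\<^sup>2 - t\<^sup>2)\<^sup>2)"

definition bump'' :: "real \<Rightarrow> real \<Rightarrow> complex" where
  "bump'' a t = of_real (indicator {- a..a} t * (12 * t\<^sup>2 - 4 * a\<^sup>2))"

lemma integrable_bump: "integrable lborel (bump a)"
proof -
  have "set_integrable lborel {- a..a} (\<lambda>t. (a\<^sup>2 - t\<^sup>2)\<^sup>2)"
    by (rule borel_integrable_atLeastAtMost') (intro continuous_intros)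
  then show ?thesis unfolding bump_def by (intro integrable_of_real) (simp add: set_integrable_def)
qed

lemma integrable_bump'': "integrable lborel (bump'' a)"
proof -
  have "set_integrable lborel {- a..a} (\<lambda>t. 12 * t\<^sup>2 - 4 * a\<^sup>2)"
    by (rule borel_integrable_atLeastAtMost') (intro continuous_intros)
  then show ?thesis unfolding bump''_def by (intro integrable_of_real) (simp add: set_integrable_def)
qed

lemma fourier_transform_real:
  fixes f :: "real \<Rightarrow> complex"
  shows "fourier_transform f \<xi> = (LINT t|lborel. fchar (\<xi> * t) * f t)"
  by (simp add: fourier_transform_fchar)

lemma fchar_has_vector_derivative:
  "((\<lambda>t. fchar (\<xi> * t)) has_vector_derivative - (2 * of_real pi * \<i> * of_real \<xi>) * fchar (\<xi> * t)) (at t within S)"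
proof -
  have "((\<lambda>t. exp (- (2 * of_real pi * \<i> * of_real \<xi>) * of_real t)) has_vector_derivative
      - (2 * of_real pi * \<i> * of_real \<xi>) * exp (- (2 * of_real pi * \<i> * of_real \<xi>) * of_real t)) (at t within S)"
    by (rule has_vector_derivative_real_field) (auto intro!: derivative_eq_intros)
  then show ?thesis by (simp add: fchar_def mult_ac)
qed

text \<open>Both integrations by parts are done at once: the character times \<open>P' + w P\<close>
  is a primitive of the character times \<open>P'' - w^2 P\<close>, and it vanishes at both
  ends.\<close>

lemma fourier_transform_bump'':
  assumes a: "0 < a"
  shows "fourier_transform (bump'' a) \<xi> = - (of_real (4 * pi\<^sup>2 * \<xi>\<^sup>2)) * fourier_transform (bump a) \<xi>"
proof -
  define P P' P'' where "P t = complex_of_real ((a\<^sup>2 - t\<^sup>2)\<^sup>2)" and "P' t = complex_of_real (- 4 * t * (a\<^sup>2 - t\<^sup>2))"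
    and "P'' t = complex_of_real (12 * t\<^sup>2 - 4 * a\<^sup>2)" for t
  define w where "w = 2 * of_real pi * \<i> * complex_of_real \<xi>"
  have w2: "w\<^sup>2 = - of_real (4 * pi\<^sup>2 * \<xi>\<^sup>2)" by (simp add: w_def power_mult_distrib)
  have dP: "(P has_vector_derivative P' t) (at t within S)" for t S
    unfolding P_def P'_def
    by (rule has_vector_derivative_of_real) (auto intro!: derivative_eq_intros simp: has_real_derivative_iff_has_vector_derivative[symmetric] algebra_simps)
  have dP': "(P' has_vector_derivative P'' t) (at t within S)" for t S
    unfolding P'_def P''_def
    by (rule has_vector_derivative_of_real) (auto intro!: derivative_eq_intros simp: has_real_derivative_iff_has_vector_derivative[symmetric] algebra_simps power2_eq_square)
  define G where "G t = fchar (\<xi> * t) * (P' t + w * P t)" for t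
  define g where "g t = fchar (\<xi> * t) * (P'' t - w\<^sup>2 * P t)" for t
  have dG: "(G has_vector_derivative g t) (at t within {- a..a})" for t
  proof -
    have "(G has_vector_derivative (fchar (\<xi> * t) * (P'' t + w * P' t) + (- w * fchar (\<xi> * t)) * (P' t + w * P t))) (at t within {- a..a})"
      unfolding G_def w_def
      by (intro has_vector_derivative_mult has_vector_derivative_add has_vector_derivative_mult_right dP dP' fchar_has_vector_derivative)
    also have "fchar (\<xi> * t) * (P'' t + w * P' t) + (- w * fchar (\<xi> * t)) * (P' t + w * P t) = g t"
      by (simp add: g_def algebra_simps power2_eq_square)
    finally show ?thesis .
  qed
  have gc: "continuous_on {- a..a} g"
    unfolding g_def P_def P''_def by (intro continuous_intros)
  have "(LINT t|lborel. indicator {- a..a} t *\<^sub>R g t) = G a - G (- a)"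
    by (rule integral_FTC_atLeastAtMost) (use a gc dG in auto)
  also have "\<dots> = 0" by (simp add: G_def P_def P'_def)
  also have "(\<lambda>t. indicator {- a..a} t *\<^sub>R g t) = (\<lambda>t. fchar (\<xi> * t) * bump'' a t - w\<^sup>2 * (fchar (\<xi> * t) * bump a t))"
    by (auto simp: g_def P_def P''_def bump_def bump''_def indicator_def algebra_simps)
  also have "(LINT t|lborel. fchar (\<xi> * t) * bump'' a t - w\<^sup>2 * (fchar (\<xi> * t) * bump a t)) =
    fourier_transform (bump'' a) \<xi> - w\<^sup>2 * fourier_transform (bump a) \<xi>"
    using integrable_fchar_mult[OF integrable_bump, of \<xi> a] integrable_fchar_mult[OF integrable_bump'', of \<xi> a]
    unfolding fourier_transform_real by (subst Bochner_Integration.integral_diff) auto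
  finally show ?thesis by (simp add: w2 eq_neg_iff_add_eq_0)
qed

definition tensor :: "(real \<Rightarrow> complex) \<Rightarrow> (real \<Rightarrow> complex) \<Rightarrow> real^2 \<Rightarrow> complex" where
  "tensor f g x = f (x$1) * g (x$2)"

lemma integrable_tensor:
  assumes "integrable lborel f" "integrable lborel g"
  shows "integrable lborel (tensor f g)"
  unfolding tensor_def by (rule real2_integral_prod(1)[OF assms])

lemma fourier_transform_tensor:
  assumes f: "integrable lborel f" and g: "integrable lborel g"
  shows "fourier_transform (tensor f g) \<xi> = fourier_transform f (\<xi>$1) * fourier_transform g (\<xi>$2)"
proof -
  have "fourier_transform (tensor f g) \<xi> = (LINT x|lborel. (fchar (\<xi>$1 * (x::real^2)$1) * f (x$1)) * (fchar (\<xi>$2 * x$2) * g (x$2)))"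
    unfolding fourier_transform_fchar tensor_def by (simp add: inner_real2 fchar_add mult_ac)
  also have "\<dots> = (LINT s|lborel. fchar (\<xi>$1 * s) * f s) * (LINT t|lborel. fchar (\<xi>$2 * t) * g t)"
    by (rule real2_integral_prod(2)) (use integrable_fchar_mult[OF f] integrable_fchar_mult[OF g] in auto)
  finally show ?thesis by (simp add: fourier_transform_real)
qed

definition bump0 :: "real \<Rightarrow> real^2 \<Rightarrow> complex" where
  "bump0 a = tensor (bump a) (bump a)"

text \<open>\<open>bump1\<close> is \<open>1 - \<Delta> / (4 pi\<^sup>2)\<close> applied to \<open>bump0\<close>.\<close>

definition bump1 :: "real \<Rightarrow> real^2 \<Rightarrow> complex" where
  "bump1 a x = bump0 a x - of_real (1 / (4 * pi\<^sup>2)) * (tensor (bump'' a) (bump a) x + tensor (bump a) (bump'' a) x)"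

lemma integrable_bump0: "integrable lborel (bump0 a)"
  unfolding bump0_def by (intro integrable_tensor integrable_bump)

lemma fourier_transform_bump1:
  assumes a: "0 < a"
  shows "fourier_transform (bump1 a) \<xi> = of_real (1 + (norm \<xi>)\<^sup>2) * fourier_transform (bump0 a) \<xi>"
proof -
  note I = integrable_tensor[OF integrable_bump'' integrable_bump] integrable_tensor[OF integrable_bump integrable_bump'']
  have "fourier_transform (bump1 a) \<xi> = fourier_transform (bump0 a) \<xi> - of_real (1 / (4 * pi\<^sup>2)) *
     (fourier_transform (tensor (bump'' a) (bump a)) \<xi> + fourier_transform (tensor (bump a) (bump'' a)) \<xi>)"
    unfolding bump1_def[abs_def]
    by (subst fourier_transform_diff[OF integrable_bump0], intro integrable_mult_right Bochner_Integration.integrable_add I)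
      (simp only: fourier_transform_cmult fourier_transform_add[OF I])
  also have "fourier_transform (tensor (bump'' a) (bump a)) \<xi> = - of_real (4 * pi\<^sup>2 * (\<xi>$1)\<^sup>2) * fourier_transform (bump0 a) \<xi>"
    unfolding bump0_def fourier_transform_tensor[OF integrable_bump'' integrable_bump] fourier_transform_tensor[OF integrable_bump integrable_bump]
      fourier_transform_bump''[OF a] by simp
  also have "fourier_transform (tensor (bump a) (bump'' a)) \<xi> = - of_real (4 * pi\<^sup>2 * (\<xi>$2)\<^sup>2) * fourier_transform (bump0 a) \<xi>"
    unfolding bump0_def fourier_transform_tensor[OF integrable_bump integrable_bump''] fourier_transform_tensor[OF integrable_bump integrable_bump]
      fourier_transform_bump''[OF a] by simp
  also have "fourier_transform (bump0 a) \<xi> - of_real (1 / (4 * pi\<^sup>2)) *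
     (- of_real (4 * pi\<^sup>2 * (\<xi>$1)\<^sup>2) * fourier_transform (bump0 a) \<xi> + - of_real (4 * pi\<^sup>2 * (\<xi>$2)\<^sup>2) * fourier_transform (bump0 a) \<xi>)
     = of_real (1 + (norm \<xi>)\<^sup>2) * fourier_transform (bump0 a) \<xi>"
  proof -
    have "1 / (4 * pi\<^sup>2) * (4 * pi\<^sup>2 * (\<xi>$1)\<^sup>2) = (\<xi>$1)\<^sup>2" "1 / (4 * pi\<^sup>2) * (4 * pi\<^sup>2 * (\<xi>$2)\<^sup>2) = (\<xi>$2)\<^sup>2" by simp_all
    then have "complex_of_real (1 / (4 * pi\<^sup>2)) * of_real (4 * pi\<^sup>2 * (\<xi>$1)\<^sup>2) = of_real ((\<xi>$1)\<^sup>2)"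
      "complex_of_real (1 / (4 * pi\<^sup>2)) * of_real (4 * pi\<^sup>2 * (\<xi>$2)\<^sup>2) = of_real ((\<xi>$2)\<^sup>2)"
      by (simp_all only: of_real_mult[symmetric])
    then show ?thesis
      unfolding norm_real2 by (simp only: distrib_left mult_minus_left mult_minus_right mult.assoc[symmetric] of_real_add of_real_1) (simp add: algebra_simps)
  qed
  finally show ?thesis .
qed

lemma bump_support:
  assumes "2 * a < norm x"
  shows "bump0 a x = 0" "bump1 a x = 0"
proof -
  have "norm x \<le> \<bar>x$1\<bar> + \<bar>x$2\<bar>" using norm_le_l1_cart[of x] by (simp add: sum_2)
  then have "a < \<bar>x$1\<bar> \<or> a < \<bar>x$2\<bar>" using assms by linarith
  then show "bump0 a x = 0" "bump1 a x = 0"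
    by (auto simp: bump0_def bump1_def tensor_def bump_def bump''_def indicator_def)
qed

lemma measurable_bump [measurable]: "bump a \<in> borel_measurable borel" "bump'' a \<in> borel_measurable borel"
  unfolding bump_def bump''_def by measurable

lemma measurable_bump2 [measurable]: "bump0 a \<in> borel_measurable borel" "bump1 a \<in> borel_measurable borel"
  unfolding bump1_def[abs_def] bump0_def tensor_def[abs_def] by measurable

lemma norm_bump_le: "norm (bump a t) \<le> a ^ 4" "norm (bump'' a t) \<le> 16 * a\<^sup>2"
proof -
  have "\<bar>t\<bar> \<le> a \<Longrightarrow> t\<^sup>2 \<le> a\<^sup>2" using power_mono[of "\<bar>t\<bar>" a 2] by simp
  moreover have "t \<in> {- a..a} \<Longrightarrow> \<bar>t\<bar> \<le> a" by auto
  ultimately have t: "t \<in> {- a..a} \<Longrightarrow> t\<^sup>2 \<le> a\<^sup>2" by blast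
  show "norm (bump a t) \<le> a ^ 4"
  proof (cases "t \<in> {- a..a}")
    case True
    then have "(a\<^sup>2 - t\<^sup>2)\<^sup>2 \<le> (a\<^sup>2)\<^sup>2" using t by (intro power_mono) auto
    then show ?thesis using True unfolding bump_def norm_of_real by simp
  qed (simp add: bump_def)
  show "norm (bump'' a t) \<le> 16 * a\<^sup>2"
  proof (cases "t \<in> {- a..a}")
    case True
    have "\<bar>12 * t\<^sup>2 - 4 * a\<^sup>2\<bar> \<le> 16 * a\<^sup>2" using t[OF True] zero_le_power2[of t] by (simp only: abs_le_iff) linarith
    then show ?thesis using True unfolding bump''_def norm_of_real by simp
  qed (simp add: bump''_def)
qed

lemma bounded_support_bandlimited:
  assumes m: "f \<in> borel_measurable borel" and s: "\<And>x. R < norm x \<Longrightarrow> f x = 0" and b: "\<And>x. norm (f x) \<le> M"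
  shows "bandlimited R f"
  unfolding bandlimited_def
proof (intro conjI m)
  show "AE x in lborel. R < norm x \<longrightarrow> f x = 0" using s by auto
  show "integrable lborel (\<lambda>x. (norm (f x))\<^sup>2)"
  proof (rule Bochner_Integration.integrable_bound)
    show "integrable lborel (\<lambda>x. M\<^sup>2 * indicat_real (cball (0::real^2) R) x)"
      by (intro integrable_mult_right integrable_indicator_cball)
    show "(\<lambda>x. (norm (f x))\<^sup>2) \<in> borel_measurable lborel" using m by measurable
    have "(norm (f x))\<^sup>2 \<le> M\<^sup>2" for x using b[of x] by (intro power_mono) auto
    then show "AE x in lborel. norm ((norm (f x))\<^sup>2) \<le> norm (M\<^sup>2 * indicat_real (cball 0 R) x)"
      using s by (intro AE_I2) (auto simp: indicator_def)
  qed
qed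

lemma bump1_bounded: "norm (bump1 a x) \<le> a ^ 4 * a ^ 4 + 1 / (4 * pi\<^sup>2) * (16 * a\<^sup>2 * a ^ 4 + a ^ 4 * (16 * a\<^sup>2))"
proof -
  have "norm (bump1 a x) \<le> norm (bump0 a x) + norm (of_real (1 / (4 * pi\<^sup>2)) * (tensor (bump'' a) (bump a) x + tensor (bump a) (bump'' a) x))"
    unfolding bump1_def by (rule norm_triangle_ineq4)
  also have "\<dots> \<le> a ^ 4 * a ^ 4 + 1 / (4 * pi\<^sup>2) * (16 * a\<^sup>2 * a ^ 4 + a ^ 4 * (16 * a\<^sup>2))"
  proof (intro add_mono)
    have a4: "0 \<le> a ^ 4" "0 \<le> 16 * a\<^sup>2" using zero_le_power_eq[of a 4] by auto
    show "norm (bump0 a x) \<le> a ^ 4 * a ^ 4"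
      unfolding bump0_def tensor_def norm_mult using a4 by (intro mult_mono norm_bump_le) auto
    have "norm (tensor (bump'' a) (bump a) x + tensor (bump a) (bump'' a) x) \<le> 16 * a\<^sup>2 * a ^ 4 + a ^ 4 * (16 * a\<^sup>2)"
      by (rule order_trans[OF norm_triangle_ineq]) (unfold tensor_def norm_mult, use a4 in \<open>intro add_mono mult_mono norm_bump_le; simp\<close>)
    then have "1 / (4 * pi\<^sup>2) * norm (tensor (bump'' a) (bump a) x + tensor (bump a) (bump'' a) x) \<le> 1 / (4 * pi\<^sup>2) * (16 * a\<^sup>2 * a ^ 4 + a ^ 4 * (16 * a\<^sup>2))"
      by (intro mult_left_mono) auto
    then show "norm (of_real (1 / (4 * pi\<^sup>2)) * (tensor (bump'' a) (bump a) x + tensor (bump a) (bump'' a) x))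
       \<le> 1 / (4 * pi\<^sup>2) * (16 * a\<^sup>2 * a ^ 4 + a ^ 4 * (16 * a\<^sup>2))"
      unfolding norm_mult norm_of_real by (simp del: of_real_divide)
  qed
  finally show ?thesis .
qed

lemma bump0_bounded: "norm (bump0 a x) \<le> a ^ 4 * a ^ 4"
proof -
  have "0 \<le> a ^ 4" using zero_le_power_eq[of a 4] by auto
  then show ?thesis unfolding bump0_def tensor_def norm_mult by (intro mult_mono norm_bump_le) auto
qed

section \<open>Wave packets and the failure of sampling\<close>

text \<open>Translation of the spectrum by \<open>v\<close> and modulation by \<open>p\<close>: the
  transform is moved to the point \<open>p\<close> of the plane and acquires the frequency
  \<open>v\<close>.\<close>

definition shift :: "real^2 \<Rightarrow> real^2 \<Rightarrow> (real^2 \<Rightarrow> complex) \<Rightarrow> real^2 \<Rightarrow> complex" where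
  "shift v p f x = fchar (- (p \<bullet> x)) * f (x - v)"

lemma measurable_shift [measurable]:
  assumes [measurable]: "f \<in> borel_measurable borel"
  shows "shift v p f \<in> borel_measurable borel"
  unfolding shift_def[abs_def] by measurable

lemma integral_translate:
  fixes f :: "real^2 \<Rightarrow> complex"
  assumes "f \<in> borel_measurable borel"
  shows "(LINT x|lborel. f (x - v)) = (LINT x|lborel. f x)"
  using integral_lborel_affine[OF assms, of 1 "- v"] by (simp add: add.commute)

lemma fourier_transform_shift:
  assumes [measurable]: "f \<in> borel_measurable borel"
  shows "fourier_transform (shift v p f) \<xi> = fchar ((\<xi> - p) \<bullet> v) * fourier_transform f (\<xi> - p)"
proof -
  define g where "g x = fchar ((\<xi> - p) \<bullet> x) * f x" for x
  have [measurable]: "g \<in> borel_measurable borel" unfolding g_def by measurable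
  have "fchar (\<xi> \<bullet> x) * shift v p f x = fchar ((\<xi> - p) \<bullet> v) * g (x - v)" for x
  proof -
    have e: "\<xi> \<bullet> x + - (p \<bullet> x) = (\<xi> - p) \<bullet> v + (\<xi> - p) \<bullet> (x - v)"
      by (simp add: inner_diff_left inner_diff_right)
    have "fchar (\<xi> \<bullet> x) * fchar (- (p \<bullet> x)) = fchar ((\<xi> - p) \<bullet> v) * fchar ((\<xi> - p) \<bullet> (x - v))"
      unfolding fchar_add[symmetric] e ..
    then show ?thesis by (simp add: shift_def g_def mult.assoc[symmetric])
  qed
  then have "fourier_transform (shift v p f) \<xi> = fchar ((\<xi> - p) \<bullet> v) * (LINT x|lborel. g (x - v))"
    by (simp add: fourier_transform_fchar)
  also have "(LINT x|lborel. g (x - v)) = fourier_transform f (\<xi> - p)"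
    by (subst integral_translate) (simp_all add: g_def[abs_def] fourier_transform_fchar)
  finally show ?thesis .
qed

lemma PW2_I:
  assumes "bandlimited R f" "\<And>x. x \<notin> \<Omega> \<Longrightarrow> f x = 0"
  shows "fourier_transform f \<in> PW2 \<Omega>"
  unfolding PW2_def using assms by (intro CollectI exI[of _ f]) (auto simp: bandlimited_def)

lemma fchar_of_int [simp]: "fchar (of_int m) = 1"
proof -
  have "fchar (of_int m) = of_real (cos (2 * pi * of_int m)) - \<i> * of_real (sin (2 * pi * of_int m))"
    by (rule fchar_cis)
  then show ?thesis using cos_int_2pin[of m] sin_int_2pin[of m] by (simp add: mult.commute)
qed

lemma continuous_bump: "0 < a \<Longrightarrow> continuous_on UNIV (bump a)"
proof -
  assume a: "0 < a"
  have "bump a t = of_real ((max 0 (a\<^sup>2 - t\<^sup>2))\<^sup>2)" for t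
  proof (cases "t \<in> {- a..a}")
    case True
    then have "t\<^sup>2 \<le> a\<^sup>2" by (intro power2_le_iff_abs_le[THEN iffD2]) auto
    then show ?thesis using True by (simp add: bump_def max_def)
  next
    case False
    then have "a \<le> \<bar>t\<bar>" by auto
    then have "a\<^sup>2 \<le> t\<^sup>2" using a power_mono[of a "\<bar>t\<bar>" 2] by simp
    then show ?thesis using False by (simp add: bump_def max_def)
  qed
  then have "bump a = (\<lambda>t. of_real ((max 0 (a\<^sup>2 - t\<^sup>2))\<^sup>2))" by blast
  then show ?thesis by (simp only:) (intro continuous_intros)
qed

text \<open>The set where a continuous function is nonzero is open, and a nonempty open set is not
  negligible.\<close>

lemma energy_pos:
  assumes f: "bandlimited R f" and c: "continuous_on UNIV f" and x: "f x \<noteq> 0"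
  shows "0 < energy f"
proof (rule ccontr)
  assume "\<not> 0 < energy f"
  then have "energy f = 0" using energy_nonneg[of f] by linarith
  then have "AE x in lborel. (norm (f x))\<^sup>2 = 0"
    unfolding energy_def using f
    by (subst (asm) integral_nonneg_eq_0_iff_AE) (auto simp: bandlimited_def)
  then have "AE x in lborel. f x = 0" by simp
  then have "AE x in lebesgue. f x = 0" by (rule AE_completion)
  moreover have op: "open {x. f x \<noteq> 0}" by (intro open_Collect_neq c continuous_intros)
  ultimately have "{x. f x \<noteq> 0} \<in> null_sets lebesgue"
    by (subst (asm) AE_iff_null) auto
  then have "negligible {x. f x \<noteq> 0}" by (simp add: negligible_iff_null_sets)
  then show False using open_not_negligible[OF op] x by blast
qed

text \<open>On \<open>\<Gamma>\<close> near \<open>n \<eta> u\<close> the phase \<open>\<xi> \<bullet> u / \<eta> - \<tau>\<close> is nearly an integer, so a function with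
  the two frequencies \<open>\<plusminus> u / (2 \<eta>)\<close> is nearly annihilated there. The weight \<open>1 + |\<xi>|\<^sup>2\<close> is absorbed by the
  transform of \<open>bump1\<close>, to which the upper sampling inequality applies.\<close>

lemma not_sampling_trajectory:
  fixes u :: "real^2"
  assumes \<eta>: "0 < \<eta>" and u: "norm u = 1" and \<delta>: "0 < \<delta>"
    and \<Omega>: "cball 0 \<delta> \<subseteq> \<Omega>" "cball (u /\<^sub>R (2 * \<eta>)) \<delta> \<subseteq> \<Omega>" "cball (- (u /\<^sub>R (2 * \<eta>))) \<delta> \<subseteq> \<Omega>"
    and phase: "\<And>\<xi> n. \<xi> \<in> \<Gamma> \<Longrightarrow> 1 \<le> n \<Longrightarrow>
      \<exists>m :: int. \<bar>\<xi> \<bullet> u / \<eta> - \<tau> - of_int m\<bar> \<le> C / real n * (1 + (norm (\<xi> - (\<eta> * real n) *\<^sub>R u))\<^sup>2)"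
  shows "\<not> sampling_trajectory \<Omega> \<Gamma>"
proof
  assume "sampling_trajectory \<Omega> \<Gamma>"
  then obtain A B where A: "0 < A" and B: "0 < B" and
    low: "\<And>F. F \<in> PW2 \<Omega> \<Longrightarrow> ennreal A * (\<integral>\<^sup>+ \<xi>. ennreal ((norm (F \<xi>))\<^sup>2) \<partial>lborel) \<le> (\<integral>\<^sup>+ \<xi> \<in> \<Gamma>. ennreal ((norm (F \<xi>))\<^sup>2) \<partial>hausdorff1)" and
    up: "\<And>F. F \<in> PW2 \<Omega> \<Longrightarrow> (\<integral>\<^sup>+ \<xi> \<in> \<Gamma>. ennreal ((norm (F \<xi>))\<^sup>2) \<partial>hausdorff1) \<le> ennreal B * (\<integral>\<^sup>+ \<xi>. ennreal ((norm (F \<xi>))\<^sup>2) \<partial>lborel)"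
    unfolding sampling_trajectory_def by blast
  define v where "v = u /\<^sub>R (2 * \<eta>)"
  have nv: "norm v = 1 / (2 * \<eta>)" using u \<eta> by (simp add: v_def inverse_eq_divide)
  \<comment> \<open>The bumps have support radius \<open>2 a\<close>: at most \<delta>, so that they
    fit into the three balls, and less than the distance \<open>1 / \<eta>\<close> of the two
    frequencies.\<close>
  define a where "a = min \<delta> (1 / (2 * \<eta>)) / 2"
  have a: "0 < a" "2 * a \<le> \<delta>" "2 * a \<le> 1 / (2 * \<eta>)" using \<delta> \<eta> by (auto simp: a_def)
  \<comment> \<open>A packet around \<open>n \<eta> u\<close> with frequencies \<open>- v\<close>
    and \<open>v\<close>, the relative factor being chosen so that its transform vanishes where
    \<open>\<xi> \<bullet> u / \<eta> - \<tau>\<close> is an integer. The functions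
    \<open>f n\<close> differ from \<open>fs\<close> by a unimodular factor only, so their energies
    do not depend on \<open>n\<close>.\<close>
  define f where "f n = (\<lambda>x. shift (- v) ((\<eta> * real n) *\<^sub>R u) (bump0 a) x - fchar (- \<tau>) * shift v ((\<eta> * real n) *\<^sub>R u) (bump0 a) x)" for n :: nat
  define fs where "fs x = bump0 a (x + v) - fchar (- \<tau>) * bump0 a (x - v)" for x
  have f_eq: "f n x = fchar (- (((\<eta> * real n) *\<^sub>R u) \<bullet> x)) * fs x" for n x
    by (simp add: f_def fs_def shift_def algebra_simps)
  have fs0: "fs x = 0" if "x \<notin> \<Omega>" for x
  proof -
    have "x \<notin> cball v \<delta>" "x \<notin> cball (- v) \<delta>" using that \<Omega>(2,3) unfolding v_def by blast+
    moreover have "norm (v - x) = norm (x - v)" by (rule norm_minus_commute)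
    moreover have "norm (- v - x) = norm (x + v)"
    proof -
      have "- v - x = - (x + v)" by simp
      then show ?thesis by (simp only: norm_minus_cancel)
    qed
    ultimately have "\<delta> < norm (x - v)" "\<delta> < norm (x + v)" by (simp_all add: dist_norm)
    then show ?thesis using a by (simp add: fs_def bump_support)
  qed
  have fs1: "fs x = 0" if "norm v + 2 * a < norm x" for x
  proof -
    have "2 * a < norm (x - v)" "2 * a < norm (x + v)"
      using that norm_triangle_ineq2[of x v] norm_diff_ineq[of x v] by linarith+
    then show ?thesis by (simp add: fs_def bump_support)
  qed
  have fsb: "norm (fs x) \<le> 2 * (a ^ 4 * a ^ 4)" for x
  proof -
    have "norm (fs x) \<le> norm (bump0 a (x + v)) + norm (fchar (- \<tau>) * bump0 a (x - v))"
      unfolding fs_def by (rule norm_triangle_ineq4)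
    also have "\<dots> \<le> a ^ 4 * a ^ 4 + a ^ 4 * a ^ 4"
      unfolding norm_mult norm_fchar mult_1 by (intro add_mono bump0_bounded)
    finally show ?thesis by simp
  qed
  have [measurable]: "fs \<in> borel_measurable borel" unfolding fs_def[abs_def] by measurable
  have fsB: "bandlimited (norm v + 2 * a) fs"
    by (rule bounded_support_bandlimited[OF _ fs1 fsb]) measurable
  have fnB: "bandlimited (norm v + 2 * a) (f n)" for n
    unfolding f_eq by (rule bounded_support_bandlimited[where M = "2 * (a ^ 4 * a ^ 4)"]) (use fs1 fsb in \<open>auto simp: norm_mult\<close>)
  have fnE: "energy (f n) = energy fs" for n
    unfolding energy_def f_eq by (simp add: norm_mult)
  have fsc: "continuous_on UNIV fs"
    unfolding fs_def[abs_def] bump0_def tensor_def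
    by (intro continuous_intros continuous_on_compose2[OF continuous_bump[OF a(1)]]) auto
  \<comment> \<open>At \<open>- v\<close> one bump is at its centre and the other one has already
    vanished.\<close>
  have "fs (- v) \<noteq> 0"
  proof -
    have "norm (- v - v) = 1 / \<eta>"
    proof -
      have "- v - v = (- 2) *\<^sub>R v" by (simp add: scaleR_2)
      then show ?thesis using nv \<eta> by simp
    qed
    moreover have "2 * a < 1 / \<eta>"
    proof -
      have "1 / (2 * \<eta>) < 1 / \<eta>" using \<eta> by (simp add: field_simps)
      then show ?thesis using a(3) by linarith
    qed
    ultimately have "bump0 a (- v - v) = 0" by (intro bump_support) simp
    moreover have "bump0 a 0 \<noteq> 0" using a by (simp add: bump0_def tensor_def bump_def)
    ultimately show ?thesis by (simp add: fs_def)
  qed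
  then have Epos: "0 < energy fs" by (rule energy_pos[OF fsB fsc])
  define E1 where "E1 = energy (bump1 a)"
  have bB: "bandlimited (2 * a) (bump1 a)"
    by (rule bounded_support_bandlimited[OF _ _ bump1_bounded]) (auto simp: bump_support)
  have main: "A * energy fs \<le> B * ((2 * pi * C / real n)\<^sup>2 * E1)" if n: "1 \<le> n" for n
  proof -
    define p where "p = (\<eta> * real n) *\<^sub>R u"
    define c where "c = complex_of_real (2 * pi * C / real n)"
    \<comment> \<open>The comparison function: the same packet with the single frequency 0,
      multiplied by \<open>1 + |\<xi> - p|^2\<close> and by a constant of order
      \<open>1 / n\<close>.\<close>
    define h where "h x = c * shift 0 p (bump1 a) x" for x
    have hB: "bandlimited (2 * a) h"
      unfolding h_def
    proof (rule bounded_support_bandlimited)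
      show "(\<lambda>x. c * shift 0 p (bump1 a) x) \<in> borel_measurable borel" by measurable
      show "c * shift 0 p (bump1 a) x = 0" if "2 * a < norm x" for x using that by (simp add: shift_def bump_support)
      show "norm (c * shift 0 p (bump1 a) x) \<le> norm c * (a ^ 4 * a ^ 4 + 1 / (4 * pi\<^sup>2) * (16 * a\<^sup>2 * a ^ 4 + a ^ 4 * (16 * a\<^sup>2)))" for x
        unfolding norm_mult shift_def norm_fchar mult_1 by (intro mult_left_mono bump1_bounded) auto
    qed
    have hE: "energy h = (2 * pi * C / real n)\<^sup>2 * E1"
    proof -
      have "(norm c)\<^sup>2 = (2 * pi * C / real n)\<^sup>2" unfolding c_def norm_of_real by (rule power2_abs)
      then show ?thesis
        unfolding energy_def E1_def h_def shift_def by (simp add: norm_mult power_mult_distrib)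
    qed
    have hP: "fourier_transform h \<in> PW2 \<Omega>"
    proof (rule PW2_I[OF hB])
      fix x assume "x \<notin> \<Omega>"
      then have "\<delta> < norm x" using \<Omega>(1) by (auto simp: subset_eq not_le[symmetric])
      then show "h x = 0" using a by (simp add: h_def shift_def bump_support)
    qed
    have fP: "fourier_transform (f n) \<in> PW2 \<Omega>"
      by (rule PW2_I[OF fnB]) (simp add: f_eq fs0)
    have hF: "fourier_transform h \<xi> = c * (of_real (1 + (norm (\<xi> - p))\<^sup>2) * fourier_transform (bump0 a) (\<xi> - p))" for \<xi>
      unfolding h_def fourier_transform_cmult fourier_transform_shift[OF measurable_bump2(2)] fourier_transform_bump1[OF a(1)] by simp
    have fF: "fourier_transform (f n) \<xi> = (fchar ((\<xi> - p) \<bullet> (- v)) - fchar (- \<tau>) * fchar ((\<xi> - p) \<bullet> v)) * fourier_transform (bump0 a) (\<xi> - p)" for \<xi>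
    proof -
      have I: "integrable lborel (shift w p (bump0 a))" for w
      proof (rule bandlimited_integrable[of "2 * a + norm w"], rule bounded_support_bandlimited)
        show "shift w p (bump0 a) \<in> borel_measurable borel" by measurable
        show "shift w p (bump0 a) x = 0" if "2 * a + norm w < norm x" for x
          using that norm_triangle_ineq2[of x w] by (simp add: shift_def bump_support)
        show "norm (shift w p (bump0 a) x) \<le> a ^ 4 * a ^ 4" for x
          unfolding shift_def norm_mult norm_fchar mult_1 by (rule bump0_bounded)
      qed
      have "fourier_transform (f n) \<xi> = fourier_transform (shift (- v) p (bump0 a)) \<xi> - fchar (- \<tau>) * fourier_transform (shift v p (bump0 a)) \<xi>"
        unfolding f_def p_def[symmetric] by (subst fourier_transform_diff) (auto intro: I simp: fourier_transform_cmult)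
      then show ?thesis unfolding fourier_transform_shift[OF measurable_bump2(1)] by (simp add: algebra_simps)
    qed
    have point: "norm (fourier_transform (f n) \<xi>) \<le> norm (fourier_transform h \<xi>)" if \<xi>: "\<xi> \<in> \<Gamma>" for \<xi>
    proof -
      obtain m :: int where m: "\<bar>\<xi> \<bullet> u / \<eta> - \<tau> - of_int m\<bar> \<le> C / real n * (1 + (norm (\<xi> - p))\<^sup>2)"
        using phase[OF \<xi> n] unfolding p_def by blast
      define y where "y = (\<xi> - p) \<bullet> v"
      have y: "2 * y = \<xi> \<bullet> u / \<eta> - real n"
      proof -
        have uu: "u \<bullet> u = 1" using u by (simp flip: power2_norm_eq_inner)
        have "2 * y = (\<xi> \<bullet> u - (\<eta> * real n) * (u \<bullet> u)) / \<eta>"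
          using \<eta> by (simp add: y_def v_def p_def inner_diff_left field_simps)
        then show ?thesis using \<eta> uu by (simp add: diff_divide_distrib)
      qed
      \<comment> \<open>Since \<open>fchar\<close> is 1 at the integer \<open>m - n\<close>, the
        factor becomes a difference of two values of \<open>fchar\<close>, and its Lipschitz bound
        measures the distance of the phase from an integer.\<close>
      have "fchar ((\<xi> - p) \<bullet> (- v)) - fchar (- \<tau>) * fchar ((\<xi> - p) \<bullet> v) = fchar (- y) * (fchar (of_int (m - int n)) - fchar (2 * y - \<tau>))"
      proof -
        have "fchar (- y) * fchar (2 * y - \<tau>) = fchar (- \<tau>) * fchar y"
          by (simp flip: fchar_add)
        then show ?thesis by (simp add: y_def right_diff_distrib del: of_int_diff)
      qed
      then have "norm (fchar ((\<xi> - p) \<bullet> (- v)) - fchar (- \<tau>) * fchar ((\<xi> - p) \<bullet> v)) = norm (fchar (of_int (m - int n)) - fchar (2 * y - \<tau>))"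
        by (simp only: norm_mult norm_fchar mult_1)
      also have "\<dots> \<le> 2 * pi * \<bar>of_int (m - int n) - (2 * y - \<tau>)\<bar>" by (rule fchar_lipschitz)
      also have "\<bar>of_int (m - int n) - (2 * y - \<tau>)\<bar> = \<bar>\<xi> \<bullet> u / \<eta> - \<tau> - of_int m\<bar>"
        unfolding y by (simp add: abs_minus_commute algebra_simps)
      also have "2 * pi * \<dots> \<le> 2 * pi * (C / real n * (1 + (norm (\<xi> - p))\<^sup>2))" using m by (intro mult_left_mono) auto
      also have "\<dots> \<le> norm (c * of_real (1 + (norm (\<xi> - p))\<^sup>2))"
        unfolding c_def of_real_mult[symmetric] norm_of_real by (rule order_trans[OF _ abs_ge_self]) simp
      finally have "norm (fchar ((\<xi> - p) \<bullet> (- v)) - fchar (- \<tau>) * fchar ((\<xi> - p) \<bullet> v)) * norm (fourier_transform (bump0 a) (\<xi> - p))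
         \<le> norm (c * of_real (1 + (norm (\<xi> - p))\<^sup>2)) * norm (fourier_transform (bump0 a) (\<xi> - p))"
        by (rule mult_right_mono) simp
      then show ?thesis unfolding fF hF norm_mult[symmetric] mult.assoc .
    qed
    have "ennreal (A * energy fs) = ennreal A * (\<integral>\<^sup>+ \<xi>. ennreal ((norm (fourier_transform (f n) \<xi>))\<^sup>2) \<partial>lborel)"
      unfolding plancherel[OF fnB] fnE using A by (simp add: ennreal_mult)
    also have "\<dots> \<le> (\<integral>\<^sup>+ \<xi> \<in> \<Gamma>. ennreal ((norm (fourier_transform (f n) \<xi>))\<^sup>2) \<partial>hausdorff1)" by (rule low[OF fP])
    also have "\<dots> \<le> (\<integral>\<^sup>+ \<xi> \<in> \<Gamma>. ennreal ((norm (fourier_transform h \<xi>))\<^sup>2) \<partial>hausdorff1)"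
      using point by (intro nn_integral_mono) (auto simp: indicator_def intro!: ennreal_leI power_mono)
    also have "\<dots> \<le> ennreal B * (\<integral>\<^sup>+ \<xi>. ennreal ((norm (fourier_transform h \<xi>))\<^sup>2) \<partial>lborel)" by (rule up[OF hP])
    also have "\<dots> = ennreal (B * energy h)" unfolding plancherel[OF hB] using B by (simp add: ennreal_mult)
    finally show ?thesis unfolding hE using B by (subst (asm) ennreal_le_iff) (auto simp: E1_def)
  qed
  have "(\<lambda>n. B * ((2 * pi * C / real n)\<^sup>2 * E1)) \<longlonglongrightarrow> B * (0\<^sup>2 * E1)"
    by (intro tendsto_intros lim_const_over_n)
  then have "A * energy fs \<le> B * (0\<^sup>2 * E1)"
    by (rule LIMSEQ_le_const) (use main in blast)
  then show False using A Epos by (simp add: mult_le_0_iff)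
qed

section \<open>The phase on the two sets\<close>

text \<open>Close to \<open>P u\<close>, the difference of squares
  \<open>|\<xi>|^2 - (\<xi> \<bullet> u)^2\<close> is at most \<open>d^2\<close> and is divided by a
  sum that is at least \<open>P\<close>. Far away the gap is at most
  \<open>2 |\<xi>| <= 6 d\<close>, and \<open>P < 2 d\<close> turns this into
  \<open>12 d^2 / P\<close>; this is the origin of the 12.\<close>

lemma radial_gap:
  fixes \<xi> u :: "real^2"
  assumes u: "norm u = 1" and P: "0 < P"
  shows "0 \<le> norm \<xi> - \<xi> \<bullet> u" "norm \<xi> - \<xi> \<bullet> u \<le> 12 * (norm (\<xi> - P *\<^sub>R u))\<^sup>2 / P"
proof -
  define d where "d = norm (\<xi> - P *\<^sub>R u)"
  have uu: "u \<bullet> u = 1" using u by (simp flip: power2_norm_eq_inner)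
  have cs: "\<bar>\<xi> \<bullet> u\<bar> \<le> norm \<xi>" using Cauchy_Schwarz_ineq2[of \<xi> u] u by simp
  then show g0: "0 \<le> norm \<xi> - \<xi> \<bullet> u" by linarith
  have d2: "d\<^sup>2 = (norm \<xi>)\<^sup>2 - 2 * P * (\<xi> \<bullet> u) + P\<^sup>2"
    unfolding d_def power2_norm_eq_inner using uu
    by (simp add: inner_diff_left inner_diff_right inner_commute power2_eq_square algebra_simps)
  have d0: "0 \<le> d" by (simp add: d_def)
  show "norm \<xi> - \<xi> \<bullet> u \<le> 12 * (norm (\<xi> - P *\<^sub>R u))\<^sup>2 / P"
  proof (cases "d \<le> P / 2")
    case True
    have "\<bar>(\<xi> - P *\<^sub>R u) \<bullet> u\<bar> \<le> d" unfolding d_def using Cauchy_Schwarz_ineq2[of "\<xi> - P *\<^sub>R u" u] u by simp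
    then have xu: "P / 2 \<le> \<xi> \<bullet> u" using True uu by (simp add: inner_diff_left abs_le_iff)
    then have s: "P \<le> norm \<xi> + \<xi> \<bullet> u" using cs by linarith
    have "(norm \<xi> - \<xi> \<bullet> u) * P \<le> (norm \<xi> - \<xi> \<bullet> u) * (norm \<xi> + \<xi> \<bullet> u)" by (rule mult_left_mono[OF s g0])
    also have "\<dots> = (norm \<xi>)\<^sup>2 - (\<xi> \<bullet> u)\<^sup>2" by (simp add: power2_eq_square algebra_simps)
    also have "\<dots> \<le> d\<^sup>2" unfolding d2 using zero_le_power2[of "\<xi> \<bullet> u - P"] by (simp add: power2_diff algebra_simps)
    also have "\<dots> \<le> 12 * d\<^sup>2" by simp
    finally show ?thesis using P by (simp add: d_def field_simps)
  next
    case False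
    then have dp: "P < 2 * d" by simp
    have "norm \<xi> \<le> d + P" unfolding d_def using norm_triangle_ineq[of "\<xi> - P *\<^sub>R u" "P *\<^sub>R u"] u P by simp
    then have "norm \<xi> - \<xi> \<bullet> u \<le> 6 * d" using cs dp by linarith
    then have "(norm \<xi> - \<xi> \<bullet> u) * P \<le> 6 * d * (2 * d)" using dp P d0 by (intro mult_mono) auto
    then show ?thesis using P by (simp add: d_def field_simps power2_eq_square)
  qed
qed

lemma circles_phase:
  assumes \<eta>: "0 < \<eta>" and u: "norm u = 1" and \<xi>: "\<xi> \<in> concentric_circles \<eta>" and n: "1 \<le> n"
  shows "\<exists>m :: int. \<bar>\<xi> \<bullet> u / \<eta> - 0 - of_int m\<bar> \<le> (12 / \<eta>\<^sup>2) / real n * (1 + (norm (\<xi> - (\<eta> * real n) *\<^sub>R u))\<^sup>2)"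
proof -
  obtain k :: nat where k: "(norm \<xi>)\<^sup>2 = (\<eta> * real k)\<^sup>2"
    using \<xi> by (auto simp: concentric_circles_def norm_real2 power_mult_distrib)
  then have nk: "norm \<xi> = \<eta> * real k" using \<eta> by (simp add: power2_eq_iff_nonneg)
  define d where "d = norm (\<xi> - (\<eta> * real n) *\<^sub>R u)"
  have P: "0 < \<eta> * real n" using \<eta> n by simp
  note g = radial_gap[OF u P, of \<xi>]
  have "\<bar>\<xi> \<bullet> u / \<eta> - 0 - of_int (int k)\<bar> = (norm \<xi> - \<xi> \<bullet> u) / \<eta>"
  proof -
    have "\<xi> \<bullet> u / \<eta> - real k = - ((norm \<xi> - \<xi> \<bullet> u) / \<eta>)" using \<eta> by (simp add: nk field_simps)
    moreover have "0 \<le> (norm \<xi> - \<xi> \<bullet> u) / \<eta>" using g(1) \<eta> by simp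
    ultimately show ?thesis by (simp only: diff_zero of_int_of_nat_eq abs_minus_cancel abs_of_nonneg)
  qed
  also have "\<dots> \<le> (12 * d\<^sup>2 / (\<eta> * real n)) / \<eta>" unfolding d_def using g(2) \<eta> by (intro divide_right_mono) auto
  also have "\<dots> = (12 / \<eta>\<^sup>2) / real n * d\<^sup>2" by (simp add: power2_eq_square)
  also have "\<dots> \<le> (12 / \<eta>\<^sup>2) / real n * (1 + d\<^sup>2)" by (intro mult_left_mono) auto
  finally show ?thesis unfolding d_def by blast
qed

text \<open>On the spiral \<open>norm \<xi> / \<eta>\<close> is the parameter \<theta>, which modulo
  1 is the angle of \<xi>. Near the ray of angle \<tau> it is therefore close to \<tau> modulo 1,
  which is why \<tau> is the offset.\<close>

lemma spiral_phase:
  assumes \<eta>: "0 < \<eta>" and \<xi>: "\<xi> \<in> spiral \<eta>" and n: "1 \<le> n"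
  shows "\<exists>m :: int. \<bar>\<xi> \<bullet> dirv \<tau> / \<eta> - \<tau> - of_int m\<bar> \<le> (12 / \<eta>\<^sup>2 + 4 / \<eta>) / real n * (1 + (norm (\<xi> - (\<eta> * real n) *\<^sub>R dirv \<tau>))\<^sup>2)"
proof -
  define u where "u = dirv \<tau>"
  have u: "norm u = 1" by (simp add: u_def)
  obtain \<theta> where \<theta>: "0 \<le> \<theta>" "\<xi> = (\<eta> * \<theta>) *\<^sub>R dirv \<theta>"
    using \<xi> by (auto simp: spiral_def vec_eq_iff forall_2 dirv_def)
  have n\<xi>: "norm \<xi> = \<eta> * \<theta>" using \<theta> \<eta> by simp
  define P where "P = \<eta> * real n"
  have P: "0 < P" using \<eta> n by (simp add: P_def)
  define d where "d = norm (\<xi> - P *\<^sub>R u)"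
  have d0: "0 \<le> d" by (simp add: d_def)
  note g = radial_gap[OF u P, of \<xi>]
  define m where "m = round (\<theta> - \<tau>)"
  define \<psi> where "\<psi> = \<theta> - \<tau> - of_int m"
  have \<psi>: "\<bar>\<psi>\<bar> \<le> 1 / 2" using of_int_round_abs_le[of "\<theta> - \<tau>"] by (simp add: \<psi>_def m_def abs_minus_commute)
  \<comment> \<open>Near \<open>P u\<close> the angular error is the tangential displacement, at
    most \<open>2 d\<close>, divided by a radius of at least \<open>P / 2\<close>. Far away the
    trivial bound 1/2 is already below \<open>4 d / P\<close>.\<close>
  have \<psi>d: "\<bar>\<psi>\<bar> \<le> 4 * d / P"
  proof (cases "d \<le> P / 2")
    case True
    have "fchar \<theta> = fchar (\<tau> + \<psi>)"
    proof -
      have "\<theta> = (\<tau> + \<psi>) + of_int m" by (simp add: \<psi>_def)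
      then show ?thesis using fchar_add[of "\<tau> + \<psi>" "of_int m"] by simp
    qed
    then have "norm (dirv \<theta> - u) = norm (fchar (\<tau> + \<psi>) - fchar \<tau>)" by (simp add: u_def norm_dirv_diff)
    moreover have "\<bar>\<tau> + \<psi> - \<tau>\<bar> \<le> norm (fchar (\<tau> + \<psi>) - fchar \<tau>)" by (rule norm_fchar_diff_ge) (use \<psi> in simp)
    ultimately have 1: "\<bar>\<psi>\<bar> \<le> norm (dirv \<theta> - u)" by simp
    have "norm \<xi> * norm (dirv \<theta> - u) = norm (\<xi> - norm \<xi> *\<^sub>R u)"
    proof -
      have "\<xi> - norm \<xi> *\<^sub>R u = norm \<xi> *\<^sub>R (dirv \<theta> - u)" using \<theta>(2) n\<xi> by (simp add: scaleR_right_diff_distrib)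
      then show ?thesis by simp
    qed
    also have "\<dots> \<le> d + norm (P *\<^sub>R u - norm \<xi> *\<^sub>R u)"
      unfolding d_def using norm_triangle_ineq[of "\<xi> - P *\<^sub>R u" "P *\<^sub>R u - norm \<xi> *\<^sub>R u"] by simp
    also have "norm (P *\<^sub>R u - norm \<xi> *\<^sub>R u) = \<bar>norm (P *\<^sub>R u) - norm \<xi>\<bar>"
      using u P by (simp flip: scaleR_left_diff_distrib)
    also have "\<dots> \<le> d" unfolding d_def using norm_triangle_ineq3[of "P *\<^sub>R u" \<xi>] by (simp add: norm_minus_commute)
    finally have 2: "norm \<xi> * norm (dirv \<theta> - u) \<le> 2 * d" by simp
    have "P / 2 \<le> norm \<xi>"
      using True norm_triangle_ineq2[of "P *\<^sub>R u" \<xi>] u P unfolding d_def by (simp add: norm_minus_commute)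
    then have "P / 2 * \<bar>\<psi>\<bar> \<le> norm \<xi> * norm (dirv \<theta> - u)" using 1 P by (intro mult_mono) auto
    with 2 have "P / 2 * \<bar>\<psi>\<bar> \<le> 2 * d" by linarith
    then show ?thesis using P by (simp add: field_simps)
  next
    case False
    then have "1 / 2 \<le> 4 * d / P" using P d0 by (simp add: field_simps)
    then show ?thesis using \<psi> by linarith
  qed
  have "\<xi> \<bullet> u / \<eta> - \<tau> - of_int m = \<psi> - (norm \<xi> - \<xi> \<bullet> u) / \<eta>"
    using \<eta> by (simp add: n\<xi> \<psi>_def field_simps)
  then have "\<bar>\<xi> \<bullet> u / \<eta> - \<tau> - of_int m\<bar> \<le> \<bar>\<psi>\<bar> + (norm \<xi> - \<xi> \<bullet> u) / \<eta>"
    using abs_triangle_ineq4[of \<psi> "(norm \<xi> - \<xi> \<bullet> u) / \<eta>"] g(1) \<eta> by simp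
  also have "\<dots> \<le> 4 * (1 + d\<^sup>2) / P + (12 * (1 + d\<^sup>2) / P) / \<eta>"
  proof (intro add_mono)
    \<comment> \<open>The angular error is linear in \<open>d\<close>; this bounds it by the weight
      \<open>1 + d^2\<close>.\<close>
    have "d \<le> 1 + d\<^sup>2" using sum_squares_bound[of 1 d] d0 by (simp add: power2_eq_square)
    then have "4 * d / P \<le> 4 * (1 + d\<^sup>2) / P" using P by (intro divide_right_mono) auto
    then show "\<bar>\<psi>\<bar> \<le> 4 * (1 + d\<^sup>2) / P" using \<psi>d by linarith
    have "12 * d\<^sup>2 / P \<le> 12 * (1 + d\<^sup>2) / P" using P by (intro divide_right_mono) auto
    then have "norm \<xi> - \<xi> \<bullet> u \<le> 12 * (1 + d\<^sup>2) / P" using g(2) unfolding d_def by linarith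
    then show "(norm \<xi> - \<xi> \<bullet> u) / \<eta> \<le> (12 * (1 + d\<^sup>2) / P) / \<eta>" using \<eta> by (intro divide_right_mono) auto
  qed
  also have "\<dots> = (12 / \<eta>\<^sup>2 + 4 / \<eta>) / real n * (1 + d\<^sup>2)"
    using \<eta> n by (simp add: P_def field_simps power2_eq_square)
  finally show ?thesis unfolding d_def u_def P_def by blast
qed

subsection \<open>The critical spacing\<close>

lemma sampling_trajectory_I:
  assumes \<Omega>: "\<Omega> \<subseteq> cball 0 R"
    and AB: "\<exists>A>0. \<exists>B>0. \<forall>f. bandlimited R f \<longrightarrow>
      ennreal (A * energy f) \<le> (\<integral>\<^sup>+x\<in>\<Gamma>. ennreal ((norm (fourier_transform f x))\<^sup>2) \<partial>hausdorff1) \<and>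
      (\<integral>\<^sup>+x\<in>\<Gamma>. ennreal ((norm (fourier_transform f x))\<^sup>2) \<partial>hausdorff1) \<le> ennreal (B * energy f)"
  shows "sampling_trajectory \<Omega> \<Gamma>"
proof -
  obtain A B :: real where A: "0 < A" and B: "0 < B" and
    low: "\<And>f. bandlimited R f \<Longrightarrow> ennreal (A * energy f) \<le> (\<integral>\<^sup>+x\<in>\<Gamma>. ennreal ((norm (fourier_transform f x))\<^sup>2) \<partial>hausdorff1)" and
    up: "\<And>f. bandlimited R f \<Longrightarrow> (\<integral>\<^sup>+x\<in>\<Gamma>. ennreal ((norm (fourier_transform f x))\<^sup>2) \<partial>hausdorff1) \<le> ennreal (B * energy f)"
    using AB by blast
  show ?thesis
    unfolding sampling_trajectory_def
  proof (rule exI[of _ A], rule exI[of _ B], intro conjI A B ballI)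
    fix F assume "F \<in> PW2 \<Omega>"
    then obtain f where F: "F = fourier_transform f" and f: "f \<in> borel_measurable lborel"
      "integrable lborel (\<lambda>x. (norm (f x))\<^sup>2)" "AE x in lborel. x \<notin> \<Omega> \<longrightarrow> f x = 0"
      unfolding PW2_def by blast
    have "AE x in lborel. R < norm x \<longrightarrow> f x = 0"
      using f(3)
    proof eventually_elim
      case (elim x)
      then show ?case using \<Omega> by (auto simp: subset_eq not_le[symmetric])
    qed
    then have b: "bandlimited R f" using f by (simp add: bandlimited_def)
    show "ennreal A * (\<integral>\<^sup>+ \<xi>. ennreal ((norm (F \<xi>))\<^sup>2) \<partial>lborel) \<le> (\<integral>\<^sup>+ \<xi> \<in> \<Gamma>. ennreal ((norm (F \<xi>))\<^sup>2) \<partial>hausdorff1)"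
      using low[OF b] A unfolding F plancherel[OF b] by (simp add: ennreal_mult)
    show "(\<integral>\<^sup>+ \<xi> \<in> \<Gamma>. ennreal ((norm (F \<xi>))\<^sup>2) \<partial>hausdorff1) \<le> ennreal B * (\<integral>\<^sup>+ \<xi>. ennreal ((norm (F \<xi>))\<^sup>2) \<partial>lborel)"
      using up[OF b] B unfolding F plancherel[OF b] by (simp add: ennreal_mult)
  qed
qed

text \<open>A point of the small ball is the convex combination of \<open>z\<close> and a point of
  the ball around 0, with weights \<open>t\<close> and \<open>1 - t\<close>.\<close>

lemma cball_subset_shrink:
  fixes z :: "'a::real_normed_vector"
  assumes c: "convex \<Omega>" and b: "cball 0 \<rho> \<subseteq> \<Omega>" and z: "z \<in> \<Omega>" and t: "0 \<le> t" "t < 1"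
  shows "cball (t *\<^sub>R z) ((1 - t) * \<rho>) \<subseteq> \<Omega>"
proof
  fix y assume "y \<in> cball (t *\<^sub>R z) ((1 - t) * \<rho>)"
  then have y: "norm (y - t *\<^sub>R z) \<le> (1 - t) * \<rho>" by (simp add: dist_norm norm_minus_commute)
  define w where "w = (y - t *\<^sub>R z) /\<^sub>R (1 - t)"
  have "norm w = norm (y - t *\<^sub>R z) / (1 - t)"
    unfolding w_def norm_scaleR using t by (simp add: divide_inverse mult.commute)
  then have "norm w \<le> \<rho>" using y t by (simp add: pos_divide_le_eq mult.commute)
  then have "w \<in> \<Omega>" using b by (auto simp: subset_eq)
  then have "t *\<^sub>R z + (1 - t) *\<^sub>R w \<in> \<Omega>" using c z t by (intro convexD) auto
  moreover have "t *\<^sub>R z + (1 - t) *\<^sub>R w = y" using t by (simp add: w_def)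
  ultimately show "y \<in> \<Omega>" by simp
qed

theorem theoremA:
  fixes \<Omega> :: "(real ^ 2) set" and \<eta> :: real
  assumes "convex_body \<Omega>" and "centered \<Omega>" and "symmetric \<Omega>" and "\<eta> > 0"
  shows "(diameter \<Omega> * \<eta> < 1 \<longrightarrow>
            sampling_trajectory \<Omega> (spiral \<eta>) \<and> sampling_trajectory \<Omega> (concentric_circles \<eta>)) \<and>
         (diameter \<Omega> * \<eta> > 1 \<longrightarrow>
            \<not> sampling_trajectory \<Omega> (spiral \<eta>) \<and> \<not> sampling_trajectory \<Omega> (concentric_circles \<eta>))"
proof (intro conjI impI)
  have conv: "convex \<Omega>" and comp: "compact \<Omega>" using assms(1) by (auto simp: convex_body_def)
  have bdd: "bounded \<Omega>" using comp by (rule compact_imp_bounded)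
  have "\<Omega> = uminus ` \<Omega>" using assms(3) by (simp add: symmetric_def)
  then have sym: "- x \<in> \<Omega>" if "x \<in> \<Omega>" for x using that by blast
  define D where "D = diameter \<Omega>"
  have D0: "0 \<le> D" unfolding D_def by (rule diameter_ge_0[OF bdd])
  have ball: "\<Omega> \<subseteq> cball 0 (D / 2)"
  proof
    fix x assume x: "x \<in> \<Omega>"
    \<comment> \<open>By symmetry the antipode belongs to the body, so the norm is at most half the
      diameter and the body lies in the disc of radius \<open>D / 2\<close>.\<close>
    have "dist x (- x) \<le> D" unfolding D_def by (rule diameter_bounded_bound[OF bdd x sym[OF x]])
    moreover have "dist x (- x) = 2 * norm x"
    proof -
      have "x - - x = 2 *\<^sub>R x" by (simp add: scaleR_2)
      then show ?thesis by (simp add: dist_norm)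
    qed
    ultimately show "x \<in> cball 0 (D / 2)" by simp
  qed
  show "sampling_trajectory \<Omega> (spiral \<eta>)" if d: "diameter \<Omega> * \<eta> < 1"
  proof -
    interpret polar_sampling \<eta> 1 "D / 2" by unfold_locales (use assms(4) D0 in auto)
    show ?thesis
      unfolding spiral_eq_turns[OF assms(4)]
      by (rule sampling_trajectory_I[OF ball turns_sampling]) (use d in \<open>auto simp: D_def\<close>)
  qed
  show "sampling_trajectory \<Omega> (concentric_circles \<eta>)" if d: "diameter \<Omega> * \<eta> < 1"
  proof -
    interpret polar_sampling \<eta> 0 "D / 2" by unfold_locales (use assms(4) D0 in auto)
    show ?thesis
      unfolding concentric_circles_eq_turns[OF assms(4)]
      by (rule sampling_trajectory_I[OF ball turns_sampling]) (use d in \<open>auto simp: D_def\<close>)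
  qed
  have "0 \<in> interior \<Omega>" using assms(2) by (simp add: centered_def)
  then obtain \<rho> where \<rho>: "0 < \<rho>" "cball 0 \<rho> \<subseteq> \<Omega>" by (auto simp: mem_interior_cball)
  then have "\<Omega> \<noteq> {}" by auto
  then obtain x y where xy: "x \<in> \<Omega>" "y \<in> \<Omega>" "dist x y = D"
    using diameter_compact_attained[OF comp] by (auto simp: D_def)
  \<comment> \<open>Symmetry and convexity move a diameter from \<open>x\<close> to \<open>y\<close>
    to the parallel one through the origin, with end points \<open>z\<close> and
    \<open>- z\<close>.\<close>
  define z where "z = (1 / 2) *\<^sub>R x + (1 / 2) *\<^sub>R (- y)"
  have z: "z \<in> \<Omega>" unfolding z_def by (rule convexD[OF conv xy(1) sym[OF xy(2)]]) auto
  have nz: "norm z = D / 2"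
  proof -
    have "z = (1 / 2) *\<^sub>R (x - y)" by (simp add: z_def scaleR_right_diff_distrib)
    then show ?thesis using xy(3) by (simp add: dist_norm)
  qed
  have sharp: "\<exists>u \<delta>. norm u = 1 \<and> 0 < \<delta> \<and> cball 0 \<delta> \<subseteq> \<Omega> \<and>
      cball (u /\<^sub>R (2 * \<eta>)) \<delta> \<subseteq> \<Omega> \<and> cball (- (u /\<^sub>R (2 * \<eta>))) \<delta> \<subseteq> \<Omega>"
    if d: "1 < diameter \<Omega> * \<eta>"
  proof -
    have De: "1 < D * \<eta>" using d by (simp add: D_def)
    then have Dp: "0 < D" using assms(4) D0 by (cases "D = 0") auto
    \<comment> \<open>The contraction that takes \<open>z\<close>, of norm \<open>D / 2\<close>, to
      the frequency \<open>u / (2 \<eta>)\<close>; it is strict exactly because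
      \<open>D \<eta> > 1\<close>, which leaves room for a ball.\<close>
    define t where "t = 1 / (D * \<eta>)"
    have t: "0 \<le> t" "t < 1" using De by (auto simp: t_def)
    define u where "u = z /\<^sub>R (D / 2)"
    have u: "norm u = 1" using nz Dp by (simp add: u_def)
    have ut: "u /\<^sub>R (2 * \<eta>) = t *\<^sub>R z" using Dp assms(4) by (simp add: u_def t_def field_simps)
    define \<delta> where "\<delta> = (1 - t) * \<rho>"
    have \<delta>: "0 < \<delta>" "\<delta> \<le> \<rho>" using t \<rho> by (auto simp: \<delta>_def mult_left_le_one_le)
    have "cball 0 \<delta> \<subseteq> \<Omega>" using \<rho>(2) \<delta>(2) by (auto simp: subset_eq)
    moreover have "cball (u /\<^sub>R (2 * \<eta>)) \<delta> \<subseteq> \<Omega>"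
      unfolding ut \<delta>_def by (rule cball_subset_shrink[OF conv \<rho>(2) z t])
    moreover have "cball (- (u /\<^sub>R (2 * \<eta>))) \<delta> \<subseteq> \<Omega>"
      unfolding ut \<delta>_def using cball_subset_shrink[OF conv \<rho>(2) sym[OF z] t] by simp
    ultimately show ?thesis using u \<delta> by blast
  qed
  show "\<not> sampling_trajectory \<Omega> (spiral \<eta>)" if d: "1 < diameter \<Omega> * \<eta>"
  proof -
    obtain u \<delta> where u: "norm u = 1" "0 < \<delta>" "cball 0 \<delta> \<subseteq> \<Omega>"
      "cball (u /\<^sub>R (2 * \<eta>)) \<delta> \<subseteq> \<Omega>" "cball (- (u /\<^sub>R (2 * \<eta>))) \<delta> \<subseteq> \<Omega>" using sharp[OF d] by blast
    \<comment> \<open>For the spiral the phase offset is the angle of the extremal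
      direction.\<close>
    obtain \<tau> where "u = norm u *\<^sub>R dirv \<tau>" using polar_exists by blast
    then have \<tau>: "u = dirv \<tau>" using u(1) by simp
    show ?thesis
      by (rule not_sampling_trajectory[OF assms(4) u spiral_phase[OF assms(4), of _ _ \<tau>, folded \<tau>]])
  qed
  show "\<not> sampling_trajectory \<Omega> (concentric_circles \<eta>)" if d: "1 < diameter \<Omega> * \<eta>"
  proof -
    obtain u \<delta> where u: "norm u = 1" "0 < \<delta>" "cball 0 \<delta> \<subseteq> \<Omega>"
      "cball (u /\<^sub>R (2 * \<eta>)) \<delta> \<subseteq> \<Omega>" "cball (- (u /\<^sub>R (2 * \<eta>))) \<delta> \<subseteq> \<Omega>" using sharp[OF d] by blast
    show ?thesis
      by (rule not_sampling_trajectory[OF assms(4) u circles_phase[OF assms(4) u(1)]])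
  qed
qed

end
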